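(* Let $k$ be a field of arbitrary characteristic, let $V$ be a finite dimensional $k$-vector space, let $R'\subseteq V\otimes V$ be a subspace, and suppose $S=T_k(V)/\langle R'\rangle$ is a Koszul algebra over $k$ (graded with $V$ in degree 1). Let $G$ be a finite group acting on $S$ by graded automorphisms. Let $U=V\otimes kG$, viewed as a $kG$-bimodule via $g(v\otimes h)l={}^gv\otimes ghl$ for $g,h,l\in G$, $v\in V$, and let $T=T_{kG}(U)$. Let $P\subseteq F^2(T)$ be a $kG$-subbimodule, put $R=\pi(P)$, and suppose the homogeneous quadratic algebra $T/\langle R\rangle$ determined by $P$ is isomorphic, as a graded algebra, to the skew group algebra $S\# G$. Then the filtered quadratic algebra $A'=T/\langle P\rangle$ over $kG$ is of PBW type (with respect to $P$) if and only if the following hold: (I) $P\cap F^1(T)=\{0\}$; and, with $\alpha:R\to U$ and $\beta:R\to kG$ the maps (which exist and are unique when (I) holds) such that $P=\{x-\alpha(x)-\beta(x)\mid x\in R\}$, (i) $\operatorname{Im}(\alpha\otimes_{kG}\mathrm{id}-\mathrm{id}\otimes_{kG}\alpha)\subseteq R$; (ii) $\alpha\circ(\alpha\otimes_{kG}\mathrm{id}-\mathrm{id}\otimes_{kG}\alpha)=-(\beta\otimes_{kG}\mathrm{id}-\mathrm{id}\otimes_{kG}\beta)$; (iii) $\beta\circ(\alpha\otimes_{kG}\mathrm{id}-\mathrm{id}\otimes_{kG}\alpha)=0$; where the maps $\alpha\otimes_{kG}\mathrm{id}-\mathrm{id}\otimes_{kG}\alpha$ and $\beta\otimes_{kG}\mathrm{id}-\mathrm{id}\otimes_{kG}\beta$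 are defined on the subspace $(R\otimes_{kG}U)\cap(U\otimes_{kG}R)$ of $U^{\otimes_{kG}3}$.
   Context: Unadorned $\otimes$ means $\otimes_k$. The characteristic of $k$ may divide $|G|$. Koszul algebra: for $S=T_k(V)/\langle R'\rangle$ with $R'\subseteq V\otimes V$, put $K^0=k$, $K^1=V$, $K^n=\bigcap_{j=0}^{n-2}V^{\otimes j}\otimes R'\otimes V^{\otimes(n-2-j)}$ for $n\ge2$. The spaces $S\otimes K^n\otimes S$ form a subcomplex of the bar resolution $S^{\otimes(\bullet+2)}$ of $S$ (the Koszul complex), and $S$ is Koszul if the complex $S\otimes K^n\cong(S\otimes K^n\otimes S)\otimes_S k$ is a resolution of the $S$-module $k$ on which $V$ acts as 0 (equivalently, $S\otimes K^\bullet\otimes S$ is a resolution of the $S$-bimodule $S$). Skew group algebra: $S\# G$ is $S\otimes kG$ with multiplication $(r\otimes g)(s\otimes h)=r({}^gs)\otimes gh$; it is graded with $G$ in degree 0. Tensor algebra and filtration: for a $k$-algebra $B$ and a $B$-bimodule $U$, $T=T_B(U)=B\oplus U\oplus(U\otimes_BU)\oplus\cdots$ with $T^i=U^{\otimes_Bi}$, $T^0=B$, and $F^i(T)=T^0\oplus\cdots\oplus T^i$. The map $\pi:F^2(T)\to T^2=U\otimes_BU$ is projection onto the degree 2 component. A $B$-subbimodule $P\subseteq F^2(T)$ is a set of filtered quadratic relations over $B$; $T/\langle P\rangle$ is the corresponding filtered quadratic algebra over $B$, filtered by the images of the $F^m(T)$, and $T/\langle\pi(P)\rangle$ is the homogeneous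 quadratic algebra determined by $P$. PBW type: $T/\langle P\rangle$ is of PBW type (with respect to $P$) if the natural surjection of graded algebras $T/\langle\pi(P)\rangle\to\operatorname{gr}(T/\langle P\rangle)$ is an isomorphism; equivalently $\langle\pi(P)\rangle=\langle \mathrm{LH}(\langle P\rangle)\rangle$, where $\mathrm{LH}(f)$ is the nonzero homogeneous component of $f$ of highest degree ($\mathrm{LH}(0)=0$). Since $U$ is free as a left and as a right $kG$-module, $R\otimes_{kG}U$ and $U\otimes_{kG}R$ are identified with subspaces of $U^{\otimes_{kG}3}$. The maps $\alpha,\beta$ are $kG$-bimodule homomorphisms; $\alpha\otimes_{kG}\mathrm{id}$ and $\mathrm{id}\otimes_{kG}\alpha$ take values in $U\otimes_{kG}U$, and $\beta\otimes_{kG}\mathrm{id}$ and $\mathrm{id}\otimes_{kG}\beta$ take values in $U$ (via $kG\otimes_{kG}U\cong U\cong U\otimes_{kG}kG$). *)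

theory Defs
  imports Complex_Main "HOL-Algebra.Module" "HOL-Algebra.QuotRing" "HOL-Algebra.Free_Abelian_Groups"
begin

text \<open>
  Conventions. The field \<open>k\<close> and the finite group \<open>G\<close> are types (the group is written additively,
  as in class \<^class>\<open>group_add\<close>, which is not commutative), and the group algebra \<open>kG\<close> is the
  library's convolution ring \<open>'g \<Rightarrow>\<^sub>0 'k\<close>. Everything built from them by quotients or tensor
  products is a record over a carrier set, in the style of HOL-Algebra.
\<close>

section \<open>Graded algebras\<close>

record ('k, 'a) graded_algebra = "('k, 'a) module" +
  component :: "nat \<Rightarrow> 'a set"

definition graded_algebra_iso ::
  "('k, 'a, 'm) graded_algebra_scheme \<Rightarrow> ('k, 'b, 'n) graded_algebra_scheme \<Rightarrow> ('a \<Rightarrow> 'b) set" where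
  "graded_algebra_iso A B = {h \<in> ring_iso A B.
     (\<forall>c. \<forall>x \<in> carrier A. h (c \<odot>\<^bsub>A\<^esub> x) = c \<odot>\<^bsub>B\<^esub> h x) \<and>
     (\<forall>n. h ` component A n = component B n)}"

text \<open>The homogeneous component of degree \<open>n\<close> of an element.\<close>

definition hom_part :: "('k, 'a, 'm) graded_algebra_scheme \<Rightarrow> nat \<Rightarrow> 'a \<Rightarrow> 'a" where
  "hom_part A n x = (THE y. \<exists>f. (\<forall>i. f i \<in> component A i) \<and> finite {i. f i \<noteq> \<zero>\<^bsub>A\<^esub>} \<and>
     x = (\<Oplus>\<^bsub>A\<^esub>i \<in> {i. f i \<noteq> \<zero>\<^bsub>A\<^esub>}. f i) \<and> y = f n)"

definition filtration :: "('k, 'a, 'm) graded_algebra_scheme \<Rightarrow> nat \<Rightarrow> 'a set" where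
  "filtration A m = {(\<Oplus>\<^bsub>A\<^esub>i \<in> {..m}. f i) | f. \<forall>i \<le> m. f i \<in> component A i}"

text \<open>For a homogeneous ideal \<open>I\<close> the components below are the induced grading on \<open>A/I\<close>. For
  inhomogeneous \<open>I\<close> they are only the images of the components of \<open>A\<close> and are never used.\<close>

definition quotient_algebra ::
  "('k, 'a, 'm) graded_algebra_scheme \<Rightarrow> 'a set \<Rightarrow> ('k, 'a set) graded_algebra" where
  "quotient_algebra A I =
     \<lparr>carrier = carrier (A Quot I), monoid.mult = monoid.mult (A Quot I),
      one = monoid.one (A Quot I), ring.zero = ring.zero (A Quot I), ring.add = ring.add (A Quot I),
      smult = (\<lambda>c X. \<Union>x\<in>X. I +>\<^bsub>A\<^esub> (c \<odot>\<^bsub>A\<^esub> x)),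
      component = (\<lambda>n. (\<lambda>x. I +>\<^bsub>A\<^esub> x) ` component A n)\<rparr>"

text \<open>The associated graded algebra \<open>\<Oplus>\<^sub>n F\<^sup>n/F\<^sup>n\<^sup>-\<^sup>1\<close> of a filtration \<open>F\<close>, with \<open>F\<^sup>-\<^sup>1 = 0\<close>. Its
  elements are finitely supported sequences whose \<open>n\<close>-th entry is a coset of \<open>F\<^sup>n\<^sup>-\<^sup>1\<close> in \<open>F\<^sup>n\<close>.\<close>

definition previous ::
  "('k, 'a, 'm) module_scheme \<Rightarrow> (nat \<Rightarrow> 'a set) \<Rightarrow> nat \<Rightarrow> 'a set" where
  "previous A F n = (case n of 0 \<Rightarrow> {\<zero>\<^bsub>A\<^esub>} | Suc m \<Rightarrow> F m)"

definition associated_graded ::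
  "('k, 'a, 'm) module_scheme \<Rightarrow> (nat \<Rightarrow> 'a set) \<Rightarrow> ('k, nat \<Rightarrow> 'a set) graded_algebra" where
  "associated_graded A F =
    (let C = {f. (\<forall>n. f n \<in> (\<lambda>x. previous A F n +>\<^bsub>A\<^esub> x) ` F n) \<and>
                 finite {n. f n \<noteq> previous A F n}}
     in \<lparr>carrier = C,
         monoid.mult = (\<lambda>f g n. \<Union>x\<in>Pi UNIV f. \<Union>y\<in>Pi UNIV g.
                   previous A F n +>\<^bsub>A\<^esub> (\<Oplus>\<^bsub>A\<^esub>i \<in> {..n}. x i \<otimes>\<^bsub>A\<^esub> y (n - i))),
         one = (\<lambda>n. if n = 0 then previous A F 0 +>\<^bsub>A\<^esub> \<one>\<^bsub>A\<^esub> else previous A F n),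
         ring.zero = previous A F,
         ring.add = (\<lambda>f g n. f n <+>\<^bsub>A\<^esub> g n),
         smult = (\<lambda>c f n. \<Union>x\<in>f n. previous A F n +>\<^bsub>A\<^esub> (c \<odot>\<^bsub>A\<^esub> x)),
         component = (\<lambda>n. {f \<in> C. \<forall>m. m \<noteq> n \<longrightarrow> f m = previous A F m})\<rparr>)"


section \<open>Tensor algebras\<close>

text \<open>Bimodules over a ring \<open>B\<close> given as a type; \<open>smult\<close> is the left action. As for
  HOL-Algebra modules, the fields \<open>mult\<close> and \<open>one\<close> are irrelevant.\<close>

record ('b, 'u) bimodule = "('b, 'u) module" +
  rsmult :: "'u \<Rightarrow> 'b \<Rightarrow> 'u"

text \<open>For \<open>n > 0\<close>, the tensor power \<open>U\<^sup>n = U \<otimes>\<^sub>B \<cdots> \<otimes>\<^sub>B U\<close> is the free abelian group on words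
  \<open>[u\<^sub>1, \<dots>, u\<^sub>n]\<close> modulo additivity in each letter and balancing over \<open>B\<close>. All \<open>n > 0\<close> are
  treated at once, the relations being homogeneous in the length.\<close>

definition tensor_words :: "('b, 'u, 'm) bimodule_scheme \<Rightarrow> 'u list set" where
  "tensor_words U = {w. w \<noteq> [] \<and> set w \<subseteq> carrier U}"

definition tensor_relators :: "('b, 'u, 'm) bimodule_scheme \<Rightarrow> ('u list \<Rightarrow>\<^sub>0 int) set" where
  "tensor_relators U =
     {frag_of (p @ [u \<oplus>\<^bsub>U\<^esub> v] @ q) - frag_of (p @ [u] @ q) - frag_of (p @ [v] @ q) | p q u v.
        set p \<subseteq> carrier U \<and> set q \<subseteq> carrier U \<and> u \<in> carrier U \<and> v \<in> carrier U} \<union>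
     {frag_of (p @ [rsmult U u b, v] @ q) - frag_of (p @ [u, b \<odot>\<^bsub>U\<^esub> v] @ q) | p q u v b.
        set p \<subseteq> carrier U \<and> set q \<subseteq> carrier U \<and> u \<in> carrier U \<and> v \<in> carrier U}"

definition tensor_null :: "('b, 'u, 'm) bimodule_scheme \<Rightarrow> ('u list \<Rightarrow>\<^sub>0 int) set" where
  "tensor_null U = generate (free_Abelian_group (tensor_words U)) (tensor_relators U)"

definition tensor_class ::
  "('b, 'u, 'm) bimodule_scheme \<Rightarrow> ('u list \<Rightarrow>\<^sub>0 int) \<Rightarrow> ('u list \<Rightarrow>\<^sub>0 int) set" where
  "tensor_class U x = tensor_null U #>\<^bsub>free_Abelian_group (tensor_words U)\<^esub> x"

definition tensor_powers :: "('b, 'u, 'm) bimodule_scheme \<Rightarrow> ('u list \<Rightarrow>\<^sub>0 int) set monoid" where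
  "tensor_powers U = free_Abelian_group (tensor_words U) Mod tensor_null U"

definition word_mult :: "('u list \<Rightarrow>\<^sub>0 int) \<Rightarrow> ('u list \<Rightarrow>\<^sub>0 int) \<Rightarrow> ('u list \<Rightarrow>\<^sub>0 int)" where
  "word_mult x y = frag_extend (\<lambda>p. frag_extend (\<lambda>q. frag_of (p @ q)) y) x"

definition word_left ::
  "('b, 'u, 'm) bimodule_scheme \<Rightarrow> 'b \<Rightarrow> ('u list \<Rightarrow>\<^sub>0 int) \<Rightarrow> ('u list \<Rightarrow>\<^sub>0 int)" where
  "word_left U b = frag_extend (\<lambda>w. frag_of ((b \<odot>\<^bsub>U\<^esub> hd w) # tl w))"

definition word_right ::
  "('b, 'u, 'm) bimodule_scheme \<Rightarrow> ('u list \<Rightarrow>\<^sub>0 int) \<Rightarrow> 'b \<Rightarrow> ('u list \<Rightarrow>\<^sub>0 int)" where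
  "word_right U x b = frag_extend (\<lambda>w. frag_of (butlast w @ [rsmult U (last w) b])) x"

text \<open>\<open>T\<^sub>B(U) = B \<oplus> U \<oplus> (U \<otimes>\<^sub>B U) \<oplus> \<cdots>\<close>, an element being a pair of its component in \<open>B\<close> and the
  sum of its components of positive degree. The map \<open>\<eta>\<close> is the structure map \<open>k \<rightarrow> B\<close>.\<close>

definition tensor_algebra ::
  "('k \<Rightarrow> 'b::ring_1) \<Rightarrow> ('b, 'u, 'm) bimodule_scheme
    \<Rightarrow> ('k, 'b \<times> ('u list \<Rightarrow>\<^sub>0 int) set) graded_algebra" where
  "tensor_algebra \<eta> U =
     \<lparr>carrier = UNIV \<times> carrier (tensor_powers U),
      monoid.mult = (\<lambda>(b, X) (c, Y). (b * c, \<Union>x\<in>X. \<Union>y\<in>Y.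
                tensor_class U (word_left U b y + word_right U x c + word_mult x y))),
      one = (1, \<one>\<^bsub>tensor_powers U\<^esub>),
      ring.zero = (0, \<one>\<^bsub>tensor_powers U\<^esub>),
      ring.add = (\<lambda>(b, X) (c, Y). (b + c, X \<otimes>\<^bsub>tensor_powers U\<^esub> Y)),
      smult = (\<lambda>a (b, X). (\<eta> a * b, \<Union>x\<in>X. tensor_class U (word_left U (\<eta> a) x))),
      component = (\<lambda>n. if n = 0 then UNIV \<times> {\<one>\<^bsub>tensor_powers U\<^esub>}
        else {0} \<times> tensor_class U `
               {x. Poly_Mapping.keys x \<subseteq> {w \<in> tensor_words U. length w = n}})\<rparr>"

definition tensor_generator ::
  "('b::ring_1, 'u, 'm) bimodule_scheme \<Rightarrow> 'u \<Rightarrow> 'b \<times> ('u list \<Rightarrow>\<^sub>0 int) set" where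
  "tensor_generator U u = (0, tensor_class U (frag_of [u]))"

text \<open>The functoriality of \<open>T\<^sub>B\<close> in a bimodule map \<open>f\<close> into \<open>U'\<close>.\<close>

definition tensor_map ::
  "('b, 'w, 'm) bimodule_scheme \<Rightarrow> ('u \<Rightarrow> 'w)
    \<Rightarrow> 'b \<times> ('u list \<Rightarrow>\<^sub>0 int) set \<Rightarrow> 'b \<times> ('w list \<Rightarrow>\<^sub>0 int) set" where
  "tensor_map U' f = (\<lambda>(b, X).
     (b, \<Union>x\<in>X. tensor_class U' (frag_extend (\<lambda>w. frag_of (map f w)) x)))"

text \<open>For subbimodules \<open>X \<subseteq> U\<^sup>i\<close> and \<open>Y \<subseteq> U\<^sup>j\<close>, the image of \<open>X \<otimes>\<^sub>B Y\<close> in \<open>U\<^sup>i\<^sup>+\<^sup>j\<close>. The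
  multiplication of \<open>T\<^sub>B(U)\<close> is the tensor product.\<close>

definition tensor_sub ::
  "('k, 'a, 'm) module_scheme \<Rightarrow> 'a set \<Rightarrow> 'a set \<Rightarrow> 'a set" where
  "tensor_sub T X Y = {(\<Oplus>\<^bsub>T\<^esub>i \<in> {..<n}. x i \<otimes>\<^bsub>T\<^esub> y i) | (n::nat) x y.
     \<forall>i < n. x i \<in> X \<and> y i \<in> Y}"

text \<open>The map \<open>\<phi> \<otimes>\<^sub>B \<psi>\<close> on \<open>X \<otimes>\<^sub>B Y\<close>, for bimodule maps \<open>\<phi>\<close> and \<open>\<psi>\<close> on \<open>X\<close> and \<open>Y\<close> with values
  in tensor powers. Values in \<open>B\<close> are absorbed, as in \<open>B \<otimes>\<^sub>B U \<cong> U\<close>. The description is definite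
  as soon as \<open>X \<otimes>\<^sub>B Y\<close> embeds in the tensor algebra.\<close>

definition tensor_hom ::
  "('k, 'a, 'm) module_scheme \<Rightarrow> 'a set \<Rightarrow> 'a set \<Rightarrow> ('a \<Rightarrow> 'a) \<Rightarrow> ('a \<Rightarrow> 'a) \<Rightarrow> 'a \<Rightarrow> 'a" where
  "tensor_hom T X Y \<phi> \<psi> z = (THE t. \<exists>(n::nat) x y. (\<forall>i < n. x i \<in> X \<and> y i \<in> Y) \<and>
     z = (\<Oplus>\<^bsub>T\<^esub>i \<in> {..<n}. x i \<otimes>\<^bsub>T\<^esub> y i) \<and>
     t = (\<Oplus>\<^bsub>T\<^esub>i \<in> {..<n}. \<phi> (x i) \<otimes>\<^bsub>T\<^esub> \<psi> (y i)))"

text \<open>\<open>B\<close>-subbimodules of \<open>T\<^sub>B(U)\<close>, the ring \<open>B\<close> being the component of degree \<open>0\<close>, and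
  \<open>B\<close>-bimodule homomorphisms between them.\<close>

definition subbimodule :: "('k, 'a, 'm) graded_algebra_scheme \<Rightarrow> 'a set \<Rightarrow> bool" where
  "subbimodule T P \<longleftrightarrow> subgroup P (add_monoid T) \<and>
     (\<forall>b \<in> component T 0. \<forall>x \<in> P. b \<otimes>\<^bsub>T\<^esub> x \<in> P \<and> x \<otimes>\<^bsub>T\<^esub> b \<in> P)"

definition bimodule_hom ::
  "('k, 'a, 'm) graded_algebra_scheme \<Rightarrow> 'a set \<Rightarrow> 'a set \<Rightarrow> ('a \<Rightarrow> 'a) set" where
  "bimodule_hom T X Y = {\<phi> \<in> X \<rightarrow> Y.
     (\<forall>x \<in> X. \<forall>y \<in> X. \<phi> (x \<oplus>\<^bsub>T\<^esub> y) = \<phi> x \<oplus>\<^bsub>T\<^esub> \<phi> y) \<and>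
     (\<forall>b \<in> component T 0. \<forall>x \<in> X.
        \<phi> (b \<otimes>\<^bsub>T\<^esub> x) = b \<otimes>\<^bsub>T\<^esub> \<phi> x \<and> \<phi> (x \<otimes>\<^bsub>T\<^esub> b) = \<phi> x \<otimes>\<^bsub>T\<^esub> b)}"


section \<open>PBW type\<close>

definition filtered_quotient_filtration ::
  "('k, 'a, 'm) graded_algebra_scheme \<Rightarrow> 'a set \<Rightarrow> nat \<Rightarrow> 'a set set" where
  "filtered_quotient_filtration T P m =
     (\<lambda>t. genideal T P +>\<^bsub>T\<^esub> t) ` filtration T m"

definition filtered_quotient_gr ::
  "('k, 'a, 'm) graded_algebra_scheme \<Rightarrow> 'a set \<Rightarrow> ('k, nat \<Rightarrow> 'a set set) graded_algebra" where
  "filtered_quotient_gr T P =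
     associated_graded (quotient_algebra T (genideal T P)) (filtered_quotient_filtration T P)"

text \<open>The natural map \<open>T/\<langle>\<pi>(P)\<rangle> \<rightarrow> gr(T/\<langle>P\<rangle>)\<close>, sending the class of \<open>t \<in> T\<^sup>n\<close> to the class of
  \<open>t + \<langle>P\<rangle>\<close> in \<open>F\<^sup>n/F\<^sup>n\<^sup>-\<^sup>1\<close>.\<close>

definition natural_map ::
  "('k, 'a, 'm) graded_algebra_scheme \<Rightarrow> 'a set \<Rightarrow> 'a set \<Rightarrow> nat \<Rightarrow> 'a set set" where
  "natural_map T P X n = (\<Union>t\<in>X.
     previous (quotient_algebra T (genideal T P)) (filtered_quotient_filtration T P) n
       +>\<^bsub>quotient_algebra T (genideal T P)\<^esub> (genideal T P +>\<^bsub>T\<^esub> hom_part T n t))"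

definition PBW_type :: "('k, 'a, 'm) graded_algebra_scheme \<Rightarrow> 'a set \<Rightarrow> bool" where
  "PBW_type T P \<longleftrightarrow> natural_map T P \<in>
     graded_algebra_iso (quotient_algebra T (genideal T (hom_part T 2 ` P)))
       (filtered_quotient_gr T P)"


section \<open>Koszul algebras\<close>

definition vector_bimodule :: "('k \<Rightarrow> 'v \<Rightarrow> 'v) \<Rightarrow> ('k, 'v::ab_group_add) bimodule" where
  "vector_bimodule scale = \<lparr>carrier = UNIV, monoid.mult = undefined, one = undefined, ring.zero = 0,
     ring.add = (+), smult = scale, rsmult = (\<lambda>v c. scale c v)\<rparr>"

definition algebra_bimodule :: "('k, 'a, 'm) module_scheme \<Rightarrow> ('k, 'a) bimodule" where
  "algebra_bimodule S = \<lparr>carrier = carrier S, monoid.mult = undefined, one = undefined, ring.zero = \<zero>\<^bsub>S\<^esub>,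
     ring.add = ring.add S, smult = smult S, rsmult = (\<lambda>s c. c \<odot>\<^bsub>S\<^esub> s)\<rparr>"

abbreviation tensor_algebra_field ::
  "('k::field \<Rightarrow> 'v \<Rightarrow> 'v) \<Rightarrow> ('k, 'k \<times> ('v::ab_group_add list \<Rightarrow>\<^sub>0 int) set) graded_algebra" where
  "tensor_algebra_field scale \<equiv> tensor_algebra id (vector_bimodule scale)"

definition quadratic_algebra where
  "quadratic_algebra scale R' =
     quotient_algebra (tensor_algebra_field scale) (genideal (tensor_algebra_field scale) R')"

definition quadratic_generator where
  "quadratic_generator scale R' v =
     genideal (tensor_algebra_field scale) R' +>\<^bsub>tensor_algebra_field scale\<^esub>
       tensor_generator (vector_bimodule scale) v"

text \<open>The augmentation \<open>S \<rightarrow> k\<close> with kernel the elements of positive degree: the component in \<open>k\<close>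
  of any representative in \<open>T\<^sub>k(V)\<close>.\<close>

definition augmentation :: "('k \<times> 'x) set \<Rightarrow> 'k" where
  "augmentation s = the_elem (fst ` s)"

definition koszul_space where
  "koszul_space scale R' n =
    (let T = tensor_algebra_field scale in
     if n < 2 then component T n
     else \<Inter>j \<in> {..n - 2}. tensor_sub T (tensor_sub T (component T j) R') (component T (n - 2 - j)))"

text \<open>The bar resolution of \<open>S\<close>, tensored over \<open>S\<close> with \<open>k\<close>, has the terms
  \<open>S\<^sup>n\<^sup>+\<^sup>2 \<otimes>\<^sub>S k \<cong> S\<^sup>n\<^sup>+\<^sup>1\<close> for \<open>n \<ge> 0\<close> and the differential
  \<open>s\<^sub>0 \<otimes> \<cdots> \<otimes> s\<^sub>n \<mapsto> (\<Sum>i<n. (-1)\<^sup>i s\<^sub>0 \<otimes> \<cdots> \<otimes> s\<^sub>i s\<^sub>i\<^sub>+\<^sub>1 \<otimes> \<cdots> \<otimes> s\<^sub>n) + (-1)\<^sup>n \<epsilon>(s\<^sub>n) s\<^sub>0 \<otimes> \<cdots> \<otimes> s\<^sub>n\<^sub>-\<^sub>1\<close>,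
  which for \<open>n = 0\<close> is the augmentation to \<open>k\<close>. It is regarded as one map on \<open>T\<^sub>k(S)\<close>, lowering the
  tensor degree by one.\<close>

definition bar_word ::
  "('k, 'a, 'm) module_scheme \<Rightarrow> ('a \<Rightarrow> 'k) \<Rightarrow> 'a list \<Rightarrow> ('a list \<Rightarrow>\<^sub>0 int)" where
  "bar_word S \<epsilon> w = (let n = length w - 1 in
     if n = 0 then 0
     else (\<Sum>i<n. frag_cmul ((-1) ^ i)
            (frag_of (take i w @ [w ! i \<otimes>\<^bsub>S\<^esub> w ! Suc i] @ drop (i + 2) w)))
        + frag_cmul ((-1) ^ n) (frag_of ((\<epsilon> (last w) \<odot>\<^bsub>S\<^esub> hd w) # tl (butlast w))))"

definition bar_augmentation :: "('a \<Rightarrow> 'k::ring_1) \<Rightarrow> ('a list \<Rightarrow>\<^sub>0 int) \<Rightarrow> 'k" where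
  "bar_augmentation \<epsilon> x = (\<Sum>w \<in> {w \<in> Poly_Mapping.keys x. length w = 1}.
     of_int (Poly_Mapping.lookup x w) * \<epsilon> (hd w))"

definition bar_differential ::
  "('k::ring_1, 'a, 'm) module_scheme \<Rightarrow> ('a \<Rightarrow> 'k)
    \<Rightarrow> 'k \<times> ('a list \<Rightarrow>\<^sub>0 int) set \<Rightarrow> 'k \<times> ('a list \<Rightarrow>\<^sub>0 int) set" where
  "bar_differential S \<epsilon> = (\<lambda>(c, X).
     (the_elem (bar_augmentation \<epsilon> ` X),
      \<Union>x\<in>X. tensor_class (algebra_bimodule S) (frag_extend (bar_word S \<epsilon>) x)))"

text \<open>\<open>S \<otimes> K\<^sup>n\<close> as a subspace of \<open>S\<^sup>n\<^sup>+\<^sup>1\<close>, via \<open>K\<^sup>n \<subseteq> V\<^sup>n \<subseteq> S\<^sup>n\<close>.\<close>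

definition koszul_complex where
  "koszul_complex scale R' n =
    (let S = quadratic_algebra scale R';
         TS = tensor_algebra id (algebra_bimodule S) in
     tensor_sub TS (component TS 1)
       (tensor_map (algebra_bimodule S) (quadratic_generator scale R') ` koszul_space scale R' n))"

definition koszul where
  "koszul scale R' \<longleftrightarrow>
    (let S = quadratic_algebra scale R';
         TS = tensor_algebra id (algebra_bimodule S);
         d = bar_differential S augmentation;
         C = koszul_complex scale R' in
     d ` C 0 = component TS 0 \<and>
     (\<forall>n. {z \<in> C n. d z = \<zero>\<^bsub>TS\<^esub>} = d ` C (Suc n)))"


section \<open>Group actions and skew group algebras\<close>

definition graded_action ::
  "('g::group_add \<Rightarrow> 'a \<Rightarrow> 'a) \<Rightarrow> ('k, 'a, 'm) graded_algebra_scheme \<Rightarrow> bool" where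
  "graded_action act S \<longleftrightarrow> (\<forall>g. act g \<in> graded_algebra_iso S S) \<and>
     (\<forall>x \<in> carrier S. act 0 x = x) \<and>
     (\<forall>g h. \<forall>x \<in> carrier S. act (g + h) x = act g (act h x))"

text \<open>The action on \<open>V\<close> induced by an action on \<open>S = T\<^sub>k(V)/\<langle>R'\<rangle>\<close>, through \<open>V \<cong> S\<^sub>1\<close>.\<close>

definition generator_action where
  "generator_action scale R' act g v =
     (THE w. quadratic_generator scale R' w = act g (quadratic_generator scale R' v))"

text \<open>For a vector space \<open>M\<close>, the space \<open>M \<otimes> kG\<close> consists of the functions \<open>'g \<Rightarrow> M\<close>, where \<open>f\<close>
  stands for \<open>\<Sum>g. f g \<otimes> g\<close>.\<close>

definition skew_group_algebra ::
  "('k, 'a, 'm) graded_algebra_scheme \<Rightarrow> ('g::{group_add,finite} \<Rightarrow> 'a \<Rightarrow> 'a)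
    \<Rightarrow> ('k, 'g \<Rightarrow> 'a) graded_algebra" where
  "skew_group_algebra S act =
     \<lparr>carrier = {f. \<forall>g. f g \<in> carrier S},
      monoid.mult = (\<lambda>f f' x. \<Oplus>\<^bsub>S\<^esub>g \<in> UNIV. f g \<otimes>\<^bsub>S\<^esub> act g (f' (- g + x))),
      one = (\<lambda>g. if g = 0 then \<one>\<^bsub>S\<^esub> else \<zero>\<^bsub>S\<^esub>),
      ring.zero = (\<lambda>g. \<zero>\<^bsub>S\<^esub>),
      ring.add = (\<lambda>f f' g. f g \<oplus>\<^bsub>S\<^esub> f' g),
      smult = (\<lambda>c f g. c \<odot>\<^bsub>S\<^esub> f g),
      component = (\<lambda>n. {f. \<forall>g. f g \<in> component S n})\<rparr>"

definition group_bimodule ::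
  "('k::field \<Rightarrow> 'v \<Rightarrow> 'v) \<Rightarrow> ('g::{group_add,finite} \<Rightarrow> 'v \<Rightarrow> 'v)
    \<Rightarrow> ('g \<Rightarrow>\<^sub>0 'k, 'g \<Rightarrow> 'v::ab_group_add) bimodule" where
  "group_bimodule scale \<rho> =
     \<lparr>carrier = UNIV, monoid.mult = undefined, one = undefined,
      ring.zero = (\<lambda>x. 0),
      ring.add = (\<lambda>u u' x. u x + u' x),
      smult = (\<lambda>a u x. \<Sum>g\<in>UNIV. scale (Poly_Mapping.lookup a g) (\<rho> g (u (- g + x)))),
      rsmult = (\<lambda>u a x. \<Sum>h\<in>UNIV. scale (Poly_Mapping.lookup a (- h + x)) (u h))\<rparr>"

lemma sum_lookup_single:
  fixes f :: "'k::zero \<Rightarrow> 'g::finite \<Rightarrow> 'v::comm_monoid_add"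
  assumes "\<And>g. f 0 g = 0"
  shows "(\<Sum>g\<in>UNIV. f (Poly_Mapping.lookup (Poly_Mapping.single a c) g) g) = f c a"
  by (subst sum.remove[of _ a]) (auto simp: lookup_single assms when_def intro!: sum.neutral)

text \<open>On pure tensors the actions are \<open>g (v \<otimes> h) l = \<^sup>gv \<otimes> ghl\<close>.\<close>

lemma group_bimodule_pure_tensor:
  fixes \<rho> :: "'g::{group_add,finite} \<Rightarrow> 'v::ab_group_add \<Rightarrow> 'v" and g h l :: 'g
  assumes "vector_space scale" "\<And>g. \<rho> g 0 = 0"
  shows "Poly_Mapping.single g 1 \<odot>\<^bsub>group_bimodule scale \<rho>\<^esub>
      rsmult (group_bimodule scale \<rho>) (\<lambda>x. if x = h then v else 0) (Poly_Mapping.single l 1) =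
    (\<lambda>x. if x = g + h + l then \<rho> g v else 0)"
proof -
  interpret vector_space scale by fact
  have eq: "- a + x = b \<longleftrightarrow> x = a + b" "b = - a + x \<longleftrightarrow> x = a + b" for a x b :: 'g
    by (metis add.assoc add.left_inverse add.right_inverse add_0)+
  have right: "rsmult (group_bimodule scale \<rho>) (\<lambda>x. if x = h then v else 0)
      (Poly_Mapping.single l 1) = (\<lambda>x. if x = h + l then v else 0)"
  proof
    fix x
    have "(\<Sum>g\<in>UNIV. scale (1 when l = - g + x) (if g = h then v else 0)) =
        (\<Sum>g\<in>UNIV. if g = h then scale (1 when x = h + l) v else 0)"
      by (rule sum.cong) (auto simp: eq)
    then show "rsmult (group_bimodule scale \<rho>) (\<lambda>x. if x = h then v else 0)
        (Poly_Mapping.single l 1) x = (if x = h + l then v else 0)"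
      by (simp add: group_bimodule_def lookup_single)
  qed
  show ?thesis
    unfolding right
  proof
    fix x
    show "(Poly_Mapping.single g 1 \<odot>\<^bsub>group_bimodule scale \<rho>\<^esub>
        (\<lambda>x. if x = h + l then v else 0)) x = (if x = g + h + l then \<rho> g v else 0)"
      using sum_lookup_single[of "\<lambda>c g. scale c (\<rho> g (if - g + x = h + l then v else 0))" g 1]
      by (simp only: group_bimodule_def bimodule.simps module.simps scale_one)
        (simp add: assms eq add.assoc)
  qed
qed

text \<open>\<open>T\<^bsub>kG\<^esub>(V \<otimes> kG)\<close>, for an action \<open>\<rho>\<close> of \<open>G\<close> on \<open>V\<close>.\<close>

definition group_tensor_algebra where
  "group_tensor_algebra scale \<rho> =
     tensor_algebra (Poly_Mapping.single 0) (group_bimodule scale \<rho>)"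

end

theory Submission
  imports Defs
begin

text \<open>For \<open>T/\<langle>P\<rangle>\<close> to be of PBW type it suffices that overlaps of relations do not produce new relations
  of lower degree. By the conditions (i)--(iii) the overlaps in \<open>(R \<otimes> U) \<inter> (U \<otimes> R)\<close> are harmless, and
  Koszulness reduces all others to these: an element of \<open>T\<^sup>m\<^sup>+\<^sup>1 \<otimes> R\<close> that also lies in \<open>\<langle>R\<rangle> \<otimes> U\<close> is a
  sum of an element of \<open>T\<^sup>m \<otimes> ((R \<otimes> U) \<inter> (U \<otimes> R))\<close> and one of \<open>\<langle>R\<rangle> \<otimes> R\<close>. For \<open>T\<^sub>k(V)\<close> and \<open>R'\<close> this is
  exactness of the Koszul complex at \<open>S \<otimes> K\<^sup>2\<close>. It passes to \<open>T\<close>, because the isomorphism with \<open>S # G\<close> in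
  degrees \<open>0\<close> and \<open>1\<close> yields \<open>T = \<Oplus>\<^sub>g T\<^sub>k(V) \<gamma>\<^sub>g\<close> and correspondingly \<open>R = \<Oplus>\<^sub>g R' \<gamma>\<^sub>g\<close>; no averaging over \<open>G\<close>
  is involved, so the characteristic may divide the order of \<open>G\<close>.\<close>

section \<open>The tensor algebra is a ring\<close>

text \<open>The isomorphism with \<open>S # G\<close> is an arbitrary graded one and need not be the
  identity on kG or V. So the elements \<gamma>_g, and the copy of V next to them, are chosen as
  preimages of 1 # g and v # 1, and the argument is carried out for T_B(U) over an abstract ring B.
  As \<langle>R\<rangle> is zero in degrees 0 and 1, these preimages are unique and identities
  between them can be tested in S # G. No monomial order is chosen. Its place in the diamond
  argument is taken by an induction on degree: the Koszul step turns a derivation of zero that ends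
  in a relation into one that ends in a letter, and coordinates with respect to a basis of U strip
  off that letter. Exactness concerns S \<otimes> V \<otimes> V, so the return to T_k(V) needs that
  an element of T_k(V) \<otimes> R' lying in J \<otimes> V \<otimes> V, with J =
  \<langle>R'\<rangle>, lies in J \<otimes> R'. This is elimination over a field, which is why the
  Koszul step is done over k; kG need not be semisimple. Maps such as id \<otimes> \<alpha> are
  handled as relations until flatness shows that they are functions.\<close>

locale bimod = abelian_group U for U :: "('b::ring_1, 'u, 'm) bimodule_scheme" (structure) +
  fixes eta :: "'k::field \<Rightarrow> 'b"
  assumes lact_closed [simp]: "u \<in> carrier U \<Longrightarrow> b \<odot> u \<in> carrier U"
    and ract_closed [simp]: "u \<in> carrier U \<Longrightarrow> rsmult U u b \<in> carrier U"
    and lact_add: "u \<in> carrier U \<Longrightarrow> v \<in> carrier U \<Longrightarrow> b \<odot> (u \<oplus> v) = b \<odot> u \<oplus> b \<odot> v"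
    and lact_plus: "u \<in> carrier U \<Longrightarrow> (b + c) \<odot> u = b \<odot> u \<oplus> c \<odot> u"
    and lact_mult: "u \<in> carrier U \<Longrightarrow> (b * c) \<odot> u = b \<odot> (c \<odot> u)"
    and lact_one [simp]: "u \<in> carrier U \<Longrightarrow> 1 \<odot> u = u"
    and ract_add: "u \<in> carrier U \<Longrightarrow> v \<in> carrier U \<Longrightarrow>
      rsmult U (u \<oplus> v) b = rsmult U u b \<oplus> rsmult U v b"
    and ract_plus: "u \<in> carrier U \<Longrightarrow> rsmult U u (b + c) = rsmult U u b \<oplus> rsmult U u c"
    and ract_mult: "u \<in> carrier U \<Longrightarrow> rsmult U u (b * c) = rsmult U (rsmult U u b) c"
    and ract_one [simp]: "u \<in> carrier U \<Longrightarrow> rsmult U u 1 = u"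
    and act_assoc: "u \<in> carrier U \<Longrightarrow> b \<odot> rsmult U u c = rsmult U (b \<odot> u) c"
    and eta_add: "eta (a + a') = eta a + eta a'"
    and eta_mult: "eta (a * a') = eta a * eta a'"
    and eta_one [simp]: "eta 1 = 1"
    and eta_comm: "eta a * b = b * eta a"
    and eta_act: "u \<in> carrier U \<Longrightarrow> rsmult U u (eta a) = eta a \<odot> u"
begin

abbreviation FA where "FA \<equiv> free_Abelian_group (tensor_words U)"
abbreviation null where "null \<equiv> tensor_null U"
abbreviation cls where "cls \<equiv> tensor_class U"
abbreviation tp where "tp \<equiv> tensor_powers U"
abbreviation words where "words \<equiv> tensor_words U"

lemma words_append: "p \<in> words \<Longrightarrow> q \<in> words \<Longrightarrow> p @ q \<in> words"
  by (auto simp: tensor_words_def)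

lemma add_relator: "set p \<subseteq> carrier U \<Longrightarrow> set q \<subseteq> carrier U \<Longrightarrow> u \<in> carrier U \<Longrightarrow> v \<in> carrier U \<Longrightarrow>
    frag_of (p @ [u \<oplus> v] @ q) - frag_of (p @ [u] @ q) - frag_of (p @ [v] @ q) \<in> tensor_relators U"
  unfolding tensor_relators_def by blast

lemma bal_relator: "set p \<subseteq> carrier U \<Longrightarrow> set q \<subseteq> carrier U \<Longrightarrow> u \<in> carrier U \<Longrightarrow> v \<in> carrier U \<Longrightarrow>
    frag_of (p @ [rsmult U u b, v] @ q) - frag_of (p @ [u, b \<odot> v] @ q) \<in> tensor_relators U"
  unfolding tensor_relators_def by blast

lemma relator_cases:
  assumes "r \<in> tensor_relators U"
  obtains (add) p q u v where "set p \<subseteq> carrier U" "set q \<subseteq> carrier U" "u \<in> carrier U" "v \<in> carrier U"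
      "r = frag_of (p @ [u \<oplus> v] @ q) - frag_of (p @ [u] @ q) - frag_of (p @ [v] @ q)"
  | (bal) p q u v b where "set p \<subseteq> carrier U" "set q \<subseteq> carrier U" "u \<in> carrier U" "v \<in> carrier U"
      "r = frag_of (p @ [rsmult U u b, v] @ q) - frag_of (p @ [u, b \<odot> v] @ q)"
  using assms unfolding tensor_relators_def
  by (elim UnE CollectE exE conjE) ((rule add; assumption) | (rule bal; assumption))+

lemma keys_diff_sub: "Poly_Mapping.keys x \<subseteq> A \<Longrightarrow> Poly_Mapping.keys y \<subseteq> A \<Longrightarrow> Poly_Mapping.keys (x - y :: 'x \<Rightarrow>\<^sub>0 int) \<subseteq> A"
  by (rule order_trans[OF keys_diff]) simp

lemma keys_add_sub: "Poly_Mapping.keys x \<subseteq> A \<Longrightarrow> Poly_Mapping.keys y \<subseteq> A \<Longrightarrow> Poly_Mapping.keys (x + y :: 'x \<Rightarrow>\<^sub>0 int) \<subseteq> A"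
  by (rule order_trans[OF keys_add]) simp

lemma relators_carrier: "tensor_relators U \<subseteq> carrier FA"
proof
  fix r assume "r \<in> tensor_relators U"
  then show "r \<in> carrier FA"
  proof (cases rule: relator_cases)
    case (add p q u v)
    then show ?thesis unfolding carrier_free_Abelian_group_iff add
      by (intro keys_diff_sub) (auto simp: tensor_words_def)
  next
    case (bal p q u v b)
    then show ?thesis unfolding carrier_free_Abelian_group_iff bal
      by (intro keys_diff_sub) (auto simp: tensor_words_def)
  qed
qed

lemma null_subgroup: "subgroup null FA"
  unfolding tensor_null_def
  by (rule group.generate_is_subgroup[OF group_free_Abelian_group relators_carrier])

lemma null_normal: "null \<lhd> FA"
  by (rule comm_group.subgroup_imp_normal[OF abelian_free_Abelian_group null_subgroup])

lemma null_carrier: "x \<in> null \<Longrightarrow> Poly_Mapping.keys x \<subseteq> words"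
  using subgroup.mem_carrier[OF null_subgroup] by force

lemma null_zero [simp]: "0 \<in> null"
  using subgroup.one_closed[OF null_subgroup] by simp

lemma null_add: "x \<in> null \<Longrightarrow> y \<in> null \<Longrightarrow> x + y \<in> null"
  using subgroup.m_closed[OF null_subgroup] by simp

lemma null_minus: "x \<in> null \<Longrightarrow> - x \<in> null"
  using subgroup.m_inv_closed[OF null_subgroup] null_carrier by simp

lemma null_diff: "x \<in> null \<Longrightarrow> y \<in> null \<Longrightarrow> x - y \<in> null"
  using null_add[OF _ null_minus] by fastforce

lemma relator_null: "r \<in> tensor_relators U \<Longrightarrow> r \<in> null"
  unfolding tensor_null_def by (rule generate.incl)

text \<open>Differences alone generate the subgroup: \<open>- h\<close> is \<open>0 - h\<close>, and
  a sum is \<open>h1 - (0 - h2)\<close>. This leaves a single closure case, which matches the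
  additivity of the word operations in the form of differences.\<close>

lemma null_induct [consumes 1, case_names zero rel diff]:
  assumes "x \<in> null" "P 0" "\<And>r. r \<in> tensor_relators U \<Longrightarrow> P r"
    "\<And>x y. x \<in> null \<Longrightarrow> y \<in> null \<Longrightarrow> P x \<Longrightarrow> P y \<Longrightarrow> P (x - y)"
  shows "P x"
  using assms(1) unfolding tensor_null_def
proof (induction rule: generate.induct)
  case one
  then show ?case using assms(2) by simp
next
  case (incl h)
  then show ?case using assms(3) by simp
next
  case (inv h)
  then have "inv\<^bsub>FA\<^esub> h = 0 - h"
    using subsetD[OF relators_carrier inv] by (subst inv_free_Abelian_group) simp_all
  then show ?case
    using assms(4)[of 0 h] assms(2,3) inv relator_null by simp
next
  case (eng h1 h2)
  then have n: "h1 \<in> null" "h2 \<in> null" by (simp_all add: tensor_null_def)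
  have "P (0 - h2)" using assms(4)[of 0 h2] assms(2) eng n by simp
  then have "P (h1 - (0 - h2))" using assms(4)[of h1 "0 - h2"] eng n null_minus by simp
  then show ?case by simp
qed

lemma cls_mem: "z \<in> cls x \<longleftrightarrow> z - x \<in> null"
proof -
  have "z - x \<in> null \<Longrightarrow> \<exists>h\<in>null. z = h + x" by (rule bexI[of _ "z - x"]) auto
  then show ?thesis by (auto simp: tensor_class_def r_coset_def)
qed

lemma cls_self [simp]: "x \<in> cls x"
  by (simp add: cls_mem)

lemma cls_eq: "cls x = cls y \<longleftrightarrow> x - y \<in> null"
proof
  assume "cls x = cls y"
  then show "x - y \<in> null" using cls_self[of x] by (simp add: cls_mem)
next
  assume n: "x - y \<in> null"
  show "cls x = cls y"
  proof (auto simp: cls_mem)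
    fix z assume "z - x \<in> null"
    then show "z - y \<in> null" using null_add[OF _ n] by fastforce
  next
    fix z assume "z - y \<in> null"
    then show "z - x \<in> null" using null_diff[OF _ n] by fastforce
  qed
qed

section \<open>The group of tensor powers and maps out of it\<close>

lemma tp_carrier: "carrier tp = cls ` carrier FA"
  by (auto simp: tensor_powers_def FactGroup_def RCOSETS_def tensor_class_def)

lemma cls_in_tp [simp]: "Poly_Mapping.keys x \<subseteq> words \<Longrightarrow> cls x \<in> carrier tp"
  by (auto simp: tp_carrier)

lemma tp_cases:
  assumes "X \<in> carrier tp" obtains x where "Poly_Mapping.keys x \<subseteq> words" "X = cls x"
  using assms by (auto simp: tp_carrier)

lemma tp_mult: "Poly_Mapping.keys x \<subseteq> words \<Longrightarrow> Poly_Mapping.keys y \<subseteq> words \<Longrightarrow>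
    cls x \<otimes>\<^bsub>tp\<^esub> cls y = cls (x + y)"
  using normal.rcos_sum[OF null_normal, of x y]
  by (simp add: tensor_powers_def FactGroup_def tensor_class_def)

lemma tp_one: "\<one>\<^bsub>tp\<^esub> = cls 0"
  using group.coset_mult_one[OF group_free_Abelian_group subgroup.subset[OF null_subgroup]]
  by (simp add: tensor_powers_def FactGroup_def tensor_class_def)

lemma tp_comm_group: "comm_group tp"
  unfolding tensor_powers_def
  by (rule comm_group.abelian_FactGroup[OF abelian_free_Abelian_group null_subgroup])

text \<open>Additivity and balancing of \<open>F\<close> say exactly that its extension
  \<open>h\<close> to the free abelian group is trivial on the relators, hence on all of
  \<open>null\<close>; so \<open>h\<close> may be evaluated on any representative of a class. The
  target is written multiplicatively because it will be the additive group of a ring or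
  module.\<close>

lemma tp_lift:
  assumes H: "comm_group H"
    and F: "\<And>w. w \<in> words \<Longrightarrow> F w \<in> carrier H"
    and add: "\<And>p q u v. set p \<subseteq> carrier U \<Longrightarrow> set q \<subseteq> carrier U \<Longrightarrow> u \<in> carrier U \<Longrightarrow> v \<in> carrier U \<Longrightarrow>
      F (p @ (u \<oplus> v) # q) = F (p @ u # q) \<otimes>\<^bsub>H\<^esub> F (p @ v # q)"
    and bal: "\<And>p q u v b. set p \<subseteq> carrier U \<Longrightarrow> set q \<subseteq> carrier U \<Longrightarrow> u \<in> carrier U \<Longrightarrow> v \<in> carrier U \<Longrightarrow>
      F (p @ rsmult U u b # v # q) = F (p @ u # (b \<odot> v) # q)"
  obtains L where "L \<in> hom tp H" "\<And>w. w \<in> words \<Longrightarrow> L (cls (frag_of w)) = F w"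
proof -
  interpret H: comm_group H by fact
  obtain h where h: "h \<in> hom FA H" "\<And>w. w \<in> words \<Longrightarrow> h (frag_of w) = F w"
    using H.free_Abelian_group_universal[of F words] F by auto
  interpret h: group_hom FA H h
    using h(1) by (auto simp: group_hom_def group_hom_axioms_def)
  have hd: "h (x - y) = h x \<otimes>\<^bsub>H\<^esub> inv\<^bsub>H\<^esub> (h y)" if "Poly_Mapping.keys x \<subseteq> words" "Poly_Mapping.keys y \<subseteq> words" for x y
    using h.hom_mult[of x "- y"] h.hom_inv[of y] that by simp
  have hc: "h x \<in> carrier H" if "Poly_Mapping.keys x \<subseteq> words" for x
    using h.hom_closed that by simp
  have hn: "h x = \<one>\<^bsub>H\<^esub>" if "x \<in> null" for x
    using that
  proof (induction rule: null_induct)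
    case zero
    then show ?case using h.hom_one by simp
  next
    case (rel r)
    then show ?case
    proof (cases rule: relator_cases)
      case (add p q u v)
      then have w: "p @ [u \<oplus> v] @ q \<in> words" "p @ [u] @ q \<in> words" "p @ [v] @ q \<in> words"
        by (auto simp: tensor_words_def)
      have "h r = F (p @ [u \<oplus> v] @ q) \<otimes>\<^bsub>H\<^esub> inv\<^bsub>H\<^esub> F (p @ [u] @ q) \<otimes>\<^bsub>H\<^esub> inv\<^bsub>H\<^esub> F (p @ [v] @ q)"
        using w unfolding add by (simp only: hd h(2) keys_diff_sub keys_frag_of singleton_iff insert_subset empty_subsetI)
      moreover have "F (p @ [u \<oplus> v] @ q) = F (p @ [u] @ q) \<otimes>\<^bsub>H\<^esub> F (p @ [v] @ q)"
        using assms(3)[of p q u v] add by simp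
      moreover have "F (p @ [u] @ q) \<in> carrier H" "F (p @ [v] @ q) \<in> carrier H" using w F by auto
      moreover have "a \<otimes>\<^bsub>H\<^esub> b \<otimes>\<^bsub>H\<^esub> inv\<^bsub>H\<^esub> a \<otimes>\<^bsub>H\<^esub> inv\<^bsub>H\<^esub> b = \<one>\<^bsub>H\<^esub>"
        if "a \<in> carrier H" "b \<in> carrier H" for a b
      proof -
        have "a \<otimes>\<^bsub>H\<^esub> b \<otimes>\<^bsub>H\<^esub> inv\<^bsub>H\<^esub> a \<otimes>\<^bsub>H\<^esub> inv\<^bsub>H\<^esub> b = (b \<otimes>\<^bsub>H\<^esub> a) \<otimes>\<^bsub>H\<^esub> (inv\<^bsub>H\<^esub> a \<otimes>\<^bsub>H\<^esub> inv\<^bsub>H\<^esub> b)"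
          unfolding H.m_comm[OF that] by (rule H.m_assoc) (use that in simp_all)
        also have "inv\<^bsub>H\<^esub> a \<otimes>\<^bsub>H\<^esub> inv\<^bsub>H\<^esub> b = inv\<^bsub>H\<^esub> (b \<otimes>\<^bsub>H\<^esub> a)" using that by (simp add: H.inv_mult_group)
        also have "b \<otimes>\<^bsub>H\<^esub> a \<otimes>\<^bsub>H\<^esub> \<dots> = \<one>\<^bsub>H\<^esub>" using that by (intro H.r_inv H.m_closed)
        finally show ?thesis .
      qed
      ultimately show ?thesis by simp
    next
      case (bal p q u v b)
      then have w: "p @ [rsmult U u b, v] @ q \<in> words" "p @ [u, b \<odot> v] @ q \<in> words"
        by (auto simp: tensor_words_def)
      have "h r = F (p @ [rsmult U u b, v] @ q) \<otimes>\<^bsub>H\<^esub> inv\<^bsub>H\<^esub> F (p @ [u, b \<odot> v] @ q)"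
        using w unfolding bal by (simp only: hd h(2) keys_diff_sub keys_frag_of singleton_iff insert_subset empty_subsetI)
      moreover have "F (p @ [rsmult U u b, v] @ q) = F (p @ [u, b \<odot> v] @ q)"
        using assms(4)[of p q u v b] bal by simp
      moreover have "F (p @ [u, b \<odot> v] @ q) \<in> carrier H" using w F by auto
      ultimately show ?thesis by simp
    qed
  next
    case (diff x y)
    then show ?case by (simp add: hd null_carrier)
  qed
  \<comment> \<open>A representative is chosen once; \<open>Lc\<close> shows that the choice is
    immaterial, as representatives of one class differ by \<open>null\<close>.\<close>
  define L where "L X = h (SOME x. Poly_Mapping.keys x \<subseteq> words \<and> X = cls x)" for X
  have Lc: "L (cls x) = h x" if "Poly_Mapping.keys x \<subseteq> words" for x
  proof -
    define y where "y = (SOME y. Poly_Mapping.keys y \<subseteq> words \<and> cls x = cls y)"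
    have y: "Poly_Mapping.keys y \<subseteq> words \<and> cls x = cls y"
      unfolding y_def by (rule someI[of _ x]) (use that in simp)
    then have "h (x - y) = \<one>\<^bsub>H\<^esub>" using hn by (simp add: cls_eq)
    then have "h x = h y" using y that hc by (simp add: hd H.inv_solve_right')
    then show ?thesis by (simp add: L_def y_def)
  qed
  show ?thesis
  proof
    show "L \<in> hom tp H"
    proof (rule homI)
      fix X assume "X \<in> carrier tp"
      then show "L X \<in> carrier H" by (elim tp_cases) (simp add: Lc hc)
    next
      fix X Y assume "X \<in> carrier tp" "Y \<in> carrier tp"
      then show "L (X \<otimes>\<^bsub>tp\<^esub> Y) = L X \<otimes>\<^bsub>H\<^esub> L Y"
        apply (elim tp_cases)
        subgoal for x y using h.hom_mult[of x y] by (simp add: tp_mult Lc keys_add_sub)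
        done
    qed
    show "L (cls (frag_of w)) = F w" if "w \<in> words" for w
      using that by (simp add: Lc h)
  qed
qed

text \<open>The descent test for the operations on words that follow: only the splitting of one
  letter into a sum and one move of a scalar across a tensor sign have to be checked. The target is
  the null group of a second bimodule \<open>U'\<close>, so that functoriality of the tensor algebra
  is covered as well.\<close>

lemma frag_extend_null:
  assumes add: "\<And>p q u v. set p \<subseteq> carrier U \<Longrightarrow> set q \<subseteq> carrier U \<Longrightarrow> u \<in> carrier U \<Longrightarrow> v \<in> carrier U \<Longrightarrow>
      F (p @ (u \<oplus> v) # q) - F (p @ u # q) - F (p @ v # q) \<in> tensor_null U'"
    and bal: "\<And>p q u v b. set p \<subseteq> carrier U \<Longrightarrow> set q \<subseteq> carrier U \<Longrightarrow> u \<in> carrier U \<Longrightarrow> v \<in> carrier U \<Longrightarrow>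
      F (p @ rsmult U u b # v # q) - F (p @ u # (b \<odot> v) # q) \<in> tensor_null U'"
    and U': "bimod U' eta'" and x: "x \<in> null"
  shows "frag_extend F x \<in> tensor_null U'"
  using x
proof (induction rule: null_induct)
  case zero
  then show ?case using bimod.null_zero[OF U'] by simp
next
  case (rel r)
  then show ?case
    by (cases rule: relator_cases) (use add bal in \<open>simp_all add: frag_extend_diff\<close>)
next
  case (diff x y)
  then show ?case using bimod.null_diff[OF U'] by (simp add: frag_extend_diff)
qed

lemma bimod: "bimod U eta" ..

text \<open>Zero is not a separate case: the word with the single letter \<zero> exists, and its
  difference with itself is the zero combination.\<close>

lemma frag_eqv_induct [consumes 1, case_names word diff]:
  assumes "Poly_Mapping.keys x \<subseteq> words" "\<And>w. w \<in> words \<Longrightarrow> P (frag_of w)"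
    "\<And>x y. Poly_Mapping.keys x \<subseteq> words \<Longrightarrow> Poly_Mapping.keys y \<subseteq> words \<Longrightarrow> P x \<Longrightarrow> P y \<Longrightarrow> P (x - y)"
  shows "P (x :: 'u list \<Rightarrow>\<^sub>0 int)"
proof -
  have "[\<zero>] \<in> words" by (simp add: tensor_words_def)
  then have "P (frag_of [\<zero>] - frag_of [\<zero>])" by (intro assms(3)) (auto intro: assms(2))
  then have "P 0" by simp
  then show ?thesis using free_Abelian_group_induct[of x words P] assms by blast
qed

lemma keys_frag_extend_sub:
  assumes "\<And>w. w \<in> A \<Longrightarrow> Poly_Mapping.keys (F w) \<subseteq> B" "Poly_Mapping.keys x \<subseteq> A"
  shows "Poly_Mapping.keys (frag_extend F x) \<subseteq> B"
  using keys_frag_extend[of F x] assms by blast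

section \<open>Word operations and the multiplication of the tensor algebra\<close>

abbreviation "wl \<equiv> word_left U"
abbreviation "wr \<equiv> word_right U"

lemma wl_of [simp]: "wl b (frag_of w) = frag_of ((b \<odot> hd w) # tl w)"
  by (simp add: word_left_def)
lemma wl_diff: "wl b (x - y) = wl b x - wl b y" by (simp add: word_left_def frag_extend_diff)
lemma wl_add: "wl b (x + y) = wl b x + wl b y" by (simp add: word_left_def frag_extend_add)
lemma wl_zero [simp]: "wl b 0 = 0" by (simp add: word_left_def)
lemma wr_of [simp]: "wr (frag_of w) b = frag_of (butlast w @ [rsmult U (last w) b])"
  by (simp add: word_right_def)
lemma wr_diff: "wr (x - y) b = wr x b - wr y b" by (simp add: word_right_def frag_extend_diff)
lemma wr_add: "wr (x + y) b = wr x b + wr y b" by (simp add: word_right_def frag_extend_add)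
lemma wr_zero [simp]: "wr 0 b = 0" by (simp add: word_right_def)
lemma wm_of [simp]: "word_mult (frag_of p) (frag_of q) = frag_of (p @ q)"
  by (simp add: word_mult_def)
lemma wm_diff_l: "word_mult (x - x') y = word_mult x y - word_mult x' y"
  by (simp add: word_mult_def frag_extend_diff)
lemma wm_add_l: "word_mult (x + x') y = word_mult x y + word_mult x' y"
  by (simp add: word_mult_def frag_extend_add)
lemma frag_extend_diff_fun: "frag_extend (\<lambda>p. f p - g p) x = frag_extend f x - frag_extend g x"
  by (rule frag_induction[of x UNIV]) (auto simp: frag_extend_diff)
lemma frag_extend_add_fun: "frag_extend (\<lambda>p. f p + g p) x = frag_extend f x + frag_extend g x"
  by (rule frag_induction[of x UNIV]) (auto simp: frag_extend_diff)
lemma wm_diff_r: "word_mult x (y - y') = word_mult x y - word_mult x y'"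
  by (simp add: word_mult_def frag_extend_diff frag_extend_diff_fun)
lemma wm_add_r: "word_mult x (y + y') = word_mult x y + word_mult x y'"
  by (simp add: word_mult_def frag_extend_add frag_extend_add_fun)
lemma wm_zero [simp]: "word_mult 0 y = 0" "word_mult x 0 = 0"
  using wm_diff_l[of 0 0 y] wm_diff_r[of x 0 0] by simp_all

lemma word_cases:
  assumes "w \<in> words" obtains u w' where "w = u # w'" "u \<in> carrier U" "set w' \<subseteq> carrier U"
  using assms by (cases w) (auto simp: tensor_words_def)

lemma word_cases_rev:
  assumes "w \<in> words" obtains u w' where "w = w' @ [u]" "u \<in> carrier U" "set w' \<subseteq> carrier U"
  using assms by (cases w rule: rev_cases) (auto simp: tensor_words_def)

lemma wl_closed [simp]: "Poly_Mapping.keys x \<subseteq> words \<Longrightarrow> Poly_Mapping.keys (wl b x) \<subseteq> words"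
  unfolding word_left_def
  by (rule keys_frag_extend_sub[where A = words], erule word_cases) (simp_all add: tensor_words_def)

lemma wr_closed [simp]: "Poly_Mapping.keys x \<subseteq> words \<Longrightarrow> Poly_Mapping.keys (wr x b) \<subseteq> words"
  unfolding word_right_def
  by (rule keys_frag_extend_sub[where A = words], erule word_cases_rev) (simp_all add: tensor_words_def)

lemma wm_closed [simp]: "Poly_Mapping.keys x \<subseteq> words \<Longrightarrow> Poly_Mapping.keys y \<subseteq> words \<Longrightarrow> Poly_Mapping.keys (word_mult x y) \<subseteq> words"
  unfolding word_mult_def
  by (rule keys_frag_extend_sub[where A = words], rule keys_frag_extend_sub[where A = words])
    (auto simp: words_append)

text \<open>The left action touches only the first letter. Either the relator sits there, and left
  additivity or \<open>act_assoc\<close> applies, or it sits in the tail, which the action leaves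
  alone.\<close>

lemma wl_null: "x \<in> null \<Longrightarrow> wl b x \<in> null"
  unfolding word_left_def
proof (rule frag_extend_null[OF _ _ bimod])
  fix p q u v assume a: "set p \<subseteq> carrier U" "set q \<subseteq> carrier U" "u \<in> carrier U" "v \<in> carrier U"
  show "frag_of ((b \<odot> hd (p @ (u \<oplus> v) # q)) # tl (p @ (u \<oplus> v) # q)) - frag_of ((b \<odot> hd (p @ u # q)) # tl (p @ u # q)) -
       frag_of ((b \<odot> hd (p @ v # q)) # tl (p @ v # q)) \<in> null"
    using a add_relator[of "[]" q "b \<odot> u" "b \<odot> v"] add_relator[of "(b \<odot> hd p) # tl p" q u v]
    by (cases p) (auto intro!: relator_null simp: lact_add)
  fix c
  show "frag_of ((b \<odot> hd (p @ rsmult U u c # v # q)) # tl (p @ rsmult U u c # v # q)) -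
      frag_of ((b \<odot> hd (p @ u # c \<odot> v # q)) # tl (p @ u # c \<odot> v # q)) \<in> null"
    using a bal_relator[of "[]" q "b \<odot> u" v c] bal_relator[of "(b \<odot> hd p) # tl p" q u v c]
    by (cases p) (auto intro!: relator_null simp: act_assoc)
qed

lemma wr_null: "x \<in> null \<Longrightarrow> wr x b \<in> null"
  unfolding word_right_def
proof (rule frag_extend_null[OF _ _ bimod])
  fix p q u v assume a: "set p \<subseteq> carrier U" "set q \<subseteq> carrier U" "u \<in> carrier U" "v \<in> carrier U"
  show "frag_of (butlast (p @ (u \<oplus> v) # q) @ [rsmult U (last (p @ (u \<oplus> v) # q)) b]) -
       frag_of (butlast (p @ u # q) @ [rsmult U (last (p @ u # q)) b]) -
       frag_of (butlast (p @ v # q) @ [rsmult U (last (p @ v # q)) b]) \<in> null"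
    using a add_relator[of p "[]" "rsmult U u b" "rsmult U v b"]
      add_relator[of p "butlast q @ [rsmult U (last q) b]" u v]
    by (cases q rule: rev_cases) (auto intro!: relator_null simp: ract_add butlast_append)
  fix c
  show "frag_of (butlast (p @ rsmult U u c # v # q) @ [rsmult U (last (p @ rsmult U u c # v # q)) b]) -
       frag_of (butlast (p @ u # c \<odot> v # q) @ [rsmult U (last (p @ u # c \<odot> v # q)) b]) \<in> null"
    using a bal_relator[of p "[]" u "rsmult U v b" c] bal_relator[of p "butlast q @ [rsmult U (last q) b]" u v c]
    by (cases q rule: rev_cases) (auto intro!: relator_null simp: act_assoc butlast_append)
qed

lemma wm_null_l:
  assumes "Poly_Mapping.keys y \<subseteq> words" "x \<in> null" shows "word_mult x y \<in> null"
  using assms(1)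
proof (induction rule: frag_eqv_induct)
  case (word w)
  have w: "set w \<subseteq> carrier U" using word by (simp add: tensor_words_def)
  show ?case unfolding word_mult_def
  proof (rule frag_extend_null[OF _ _ bimod assms(2)])
    fix p q u v assume a: "set p \<subseteq> carrier U" "set q \<subseteq> carrier U" "u \<in> carrier U" "v \<in> carrier U"
    show "frag_extend (\<lambda>qa. frag_of ((p @ (u \<oplus> v) # q) @ qa)) (frag_of w) -
       frag_extend (\<lambda>qa. frag_of ((p @ u # q) @ qa)) (frag_of w) - frag_extend (\<lambda>qa. frag_of ((p @ v # q) @ qa)) (frag_of w) \<in> null"
      using add_relator[of p "q @ w" u v] a w by (auto intro!: relator_null)
    fix c
    show "frag_extend (\<lambda>qa. frag_of ((p @ rsmult U u c # v # q) @ qa)) (frag_of w) -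
       frag_extend (\<lambda>qa. frag_of ((p @ u # c \<odot> v # q) @ qa)) (frag_of w) \<in> null"
      using bal_relator[of p "q @ w" u v c] a w by (auto intro!: relator_null)
  qed
next
  case (diff x y)
  then show ?case by (simp add: wm_diff_r null_diff)
qed

lemma wm_null_r:
  assumes "Poly_Mapping.keys y \<subseteq> words" "x \<in> null" shows "word_mult y x \<in> null"
  using assms(1)
proof (induction rule: frag_eqv_induct)
  case (word w)
  have w: "set w \<subseteq> carrier U" using word by (simp add: tensor_words_def)
  show ?case unfolding word_mult_def frag_extend_of
  proof (rule frag_extend_null[OF _ _ bimod assms(2)])
    fix p q u v assume a: "set p \<subseteq> carrier U" "set q \<subseteq> carrier U" "u \<in> carrier U" "v \<in> carrier U"
    show "frag_of (w @ (p @ (u \<oplus> v) # q)) - frag_of (w @ (p @ u # q)) - frag_of (w @ (p @ v # q)) \<in> null"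
      using add_relator[of "w @ p" "q" u v] a w by (auto intro!: relator_null)
    fix c
    show "frag_of (w @ (p @ rsmult U u c # v # q)) - frag_of (w @ (p @ u # c \<odot> v # q)) \<in> null"
      using bal_relator[of "w @ p" "q" u v c] a w by (auto intro!: relator_null)
  qed
next
  case (diff x y)
  then show ?case by (simp add: wm_diff_l null_diff)
qed

lemma wl_plus: "Poly_Mapping.keys x \<subseteq> words \<Longrightarrow> wl (b + c) x - (wl b x + wl c x) \<in> null"
proof (induction rule: frag_eqv_induct)
  case (word w)
  then show ?case
  proof (cases rule: word_cases)
    case (1 u w')
    then show ?thesis using add_relator[of "[]" w' "b \<odot> u" "c \<odot> u"]
      by (auto intro!: relator_null simp: lact_plus diff_diff_eq)
  qed
next
  case (diff x y)
  then show ?case using null_diff[OF diff(3,4)] by (simp add: wl_diff algebra_simps)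
qed

lemma wr_plus: "Poly_Mapping.keys x \<subseteq> words \<Longrightarrow> wr x (b + c) - (wr x b + wr x c) \<in> null"
proof (induction rule: frag_eqv_induct)
  case (word w)
  then show ?case
  proof (cases rule: word_cases_rev)
    case (1 u w')
    then show ?thesis using add_relator[of w' "[]" "rsmult U u b" "rsmult U u c"]
      by (auto intro!: relator_null simp: ract_plus diff_diff_eq)
  qed
next
  case (diff x y)
  then show ?case using null_diff[OF diff(3,4)] by (simp add: wr_diff algebra_simps)
qed

lemma wl_one: "Poly_Mapping.keys x \<subseteq> words \<Longrightarrow> wl 1 x = x"
  by (induction rule: frag_eqv_induct) (auto simp: wl_diff elim!: word_cases)

lemma wr_one: "Poly_Mapping.keys x \<subseteq> words \<Longrightarrow> wr x 1 = x"
  by (induction rule: frag_eqv_induct) (auto simp: wr_diff elim!: word_cases_rev)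

lemma wl_mult: "Poly_Mapping.keys x \<subseteq> words \<Longrightarrow> wl (b * c) x = wl b (wl c x)"
  by (induction rule: frag_eqv_induct) (auto simp: wl_diff lact_mult elim!: word_cases)

lemma wr_mult: "Poly_Mapping.keys x \<subseteq> words \<Longrightarrow> wr x (b * c) = wr (wr x b) c"
  by (induction rule: frag_eqv_induct) (auto simp: wr_diff ract_mult elim!: word_cases_rev)

lemma wl_wr: "Poly_Mapping.keys x \<subseteq> words \<Longrightarrow> wl b (wr x c) = wr (wl b x) c"
proof (induction rule: frag_eqv_induct)
  case (word w)
  then show ?case by (cases "tl w = []") (auto simp: act_assoc hd_append elim!: word_cases)
qed (auto simp: wr_diff wl_diff)

lemma wm_wl: "Poly_Mapping.keys x \<subseteq> words \<Longrightarrow> Poly_Mapping.keys y \<subseteq> words \<Longrightarrow>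
    word_mult (wl b x) y = wl b (word_mult x y)"
proof (induction rule: frag_eqv_induct)
  case (word w)
  from word(2) show ?case
    by (induction rule: frag_eqv_induct) (use word in \<open>auto simp: wl_diff wm_diff_r elim!: word_cases\<close>)
qed (auto simp: wm_diff_l wl_diff)

lemma wm_wr: "Poly_Mapping.keys x \<subseteq> words \<Longrightarrow> Poly_Mapping.keys y \<subseteq> words \<Longrightarrow>
    word_mult x (wr y b) = wr (word_mult x y) b"
proof (induction rule: frag_eqv_induct)
  case (word w)
  from word(2) show ?case
    by (induction rule: frag_eqv_induct) (use word in \<open>auto simp: wr_diff wm_diff_r butlast_append elim!: word_cases_rev\<close>)
qed (auto simp: wm_diff_l wr_diff)

text \<open>Juxtaposition of words does not see scalars between them, so (x b) y and x (b y) are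
  different combinations; they agree modulo one balancing relator for each pair of words. This is
  the only correction term in the associativity of \<open>T\<close>.\<close>

lemma wm_bal: "Poly_Mapping.keys x \<subseteq> words \<Longrightarrow> Poly_Mapping.keys y \<subseteq> words \<Longrightarrow>
    word_mult (wr x b) y - word_mult x (wl b y) \<in> null"
proof (induction rule: frag_eqv_induct)
  case (word w)
  from word(2) show ?case
  proof (induction rule: frag_eqv_induct)
    case (word w')
    obtain u p where p: "w = p @ [u]" "u \<in> carrier U" "set p \<subseteq> carrier U"
      using \<open>w \<in> words\<close> by (rule word_cases_rev)
    obtain v q where q: "w' = v # q" "v \<in> carrier U" "set q \<subseteq> carrier U"
      using \<open>w' \<in> words\<close> by (rule word_cases)
    show ?case using bal_relator[of p q u v b] p q by (auto intro!: relator_null)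
  next
    case (diff x y)
    then show ?case using null_diff[OF diff(3,4)] by (simp add: wm_diff_r wl_diff algebra_simps)
  qed
next
  case (diff x x')
  then show ?case using null_diff[OF diff(3,4)] by (simp add: wm_diff_l wr_diff algebra_simps)
qed

lemma wm_assoc: "Poly_Mapping.keys x \<subseteq> words \<Longrightarrow> Poly_Mapping.keys y \<subseteq> words \<Longrightarrow> Poly_Mapping.keys z \<subseteq> words \<Longrightarrow>
    word_mult (word_mult x y) z = word_mult x (word_mult y z)"
proof (induction rule: frag_eqv_induct)
  case (word w)
  from word(2) word(3) show ?case
  proof (induction rule: frag_eqv_induct)
    case (word w')
    from word(2) show ?case
      by (induction rule: frag_eqv_induct) (auto simp: wm_diff_r)
  qed (auto simp: wm_diff_l wm_diff_r)
qed (auto simp: wm_diff_l)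

abbreviation T where "T \<equiv> tensor_algebra eta U"

lemma cls_UN:
  assumes "\<And>y. y - x \<in> null \<Longrightarrow> h y - h x \<in> null"
  shows "(\<Union>y\<in>cls x. cls (h y)) = cls (h x)"
proof -
  have "cls (h y) = cls (h x)" if "y \<in> cls x" for y
    using that assms by (simp add: cls_eq cls_mem)
  moreover have "x \<in> cls x" by simp
  ultimately show ?thesis by blast
qed

text \<open>All pairs of representatives give the same class, so the double union in the definition
  collapses. Representatives are changed in one factor at a time: x' - x is multiplied by the new
  y', and y' - y by the old x, which gives four null terms in all.\<close>

lemma T_mult:
  assumes x: "Poly_Mapping.keys x \<subseteq> words" and y: "Poly_Mapping.keys y \<subseteq> words"
  shows "(b, cls x) \<otimes>\<^bsub>T\<^esub> (c, cls y) = (b * c, cls (wl b y + wr x c + word_mult x y))"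
proof -
  have "cls (wl b y' + wr x' c + word_mult x' y') = cls (wl b y + wr x c + word_mult x y)"
    if "x' \<in> cls x" "y' \<in> cls y" for x' y'
  proof -
    have n: "x' - x \<in> null" "y' - y \<in> null" using that by (simp_all add: cls_mem)
    have y': "Poly_Mapping.keys y' \<subseteq> words"
      using keys_add_sub[OF null_carrier[OF n(2)] y] by simp
    have "wl b (y' - y) + wr (x' - x) c + (word_mult (x' - x) y' + word_mult x (y' - y)) \<in> null"
      by (intro null_add wl_null wr_null wm_null_l wm_null_r n x y')
    then show ?thesis by (simp add: cls_eq wl_diff wr_diff wm_diff_l wm_diff_r algebra_simps)
  qed
  moreover have "x \<in> cls x" "y \<in> cls y" by auto
  ultimately have "(\<Union>x'\<in>cls x. \<Union>y'\<in>cls y. cls (wl b y' + wr x' c + word_mult x' y')) =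
      cls (wl b y + wr x c + word_mult x y)" by blast
  then show ?thesis by (simp add: tensor_algebra_def)
qed

lemma T_add: "Poly_Mapping.keys x \<subseteq> words \<Longrightarrow> Poly_Mapping.keys y \<subseteq> words \<Longrightarrow>
  (b, cls x) \<oplus>\<^bsub>T\<^esub> (c, cls y) = (b + c, cls (x + y))"
  by (simp add: tensor_algebra_def tp_mult)

lemma T_zero: "\<zero>\<^bsub>T\<^esub> = (0, cls 0)" by (simp add: tensor_algebra_def tp_one)
lemma T_one: "\<one>\<^bsub>T\<^esub> = (1, cls 0)" by (simp add: tensor_algebra_def tp_one)

lemma T_carrier: "(b, X) \<in> carrier T \<longleftrightarrow> X \<in> carrier tp" by (simp add: tensor_algebra_def)

lemma T_cases:
  assumes "t \<in> carrier T" obtains b x where "Poly_Mapping.keys x \<subseteq> words" "t = (b, cls x)"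
  using assms by (cases t) (auto simp: T_carrier elim!: tp_cases)

lemma T_smult:
  assumes "Poly_Mapping.keys x \<subseteq> words"
  shows "a \<odot>\<^bsub>T\<^esub> (b, cls x) = (eta a * b, cls (wl (eta a) x))"
  using cls_UN[of x "wl (eta a)"] by (simp add: tensor_algebra_def wl_diff[symmetric] wl_null)

lemma T_abelian_group: "abelian_group T"
proof (rule abelian_groupI)
  fix x assume "x \<in> carrier T"
  then obtain b y where y: "Poly_Mapping.keys y \<subseteq> words" "x = (b, cls y)" by (rule T_cases)
  show "\<exists>y\<in>carrier T. y \<oplus>\<^bsub>T\<^esub> x = \<zero>\<^bsub>T\<^esub>"
    by (rule bexI[of _ "(- b, cls (- y))"]) (simp_all add: y T_add T_zero T_carrier)
qed ((elim T_cases)?, simp add: T_add T_carrier T_zero keys_add_sub algebra_simps)+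

lemma T_ring: "ring T"
proof (rule ringI)
  show "abelian_group T" by (rule T_abelian_group)
  show "monoid T"
  proof (rule monoidI)
    fix x y z assume "x \<in> carrier T" "y \<in> carrier T" "z \<in> carrier T"
    then show "x \<otimes>\<^bsub>T\<^esub> y \<otimes>\<^bsub>T\<^esub> z = x \<otimes>\<^bsub>T\<^esub> (y \<otimes>\<^bsub>T\<^esub> z)"
    proof (elim T_cases)
      fix b x' c y' d z'
      assume a: "Poly_Mapping.keys x' \<subseteq> words" "x = (b, cls x')" "Poly_Mapping.keys y' \<subseteq> words"
        "y = (c, cls y')" "Poly_Mapping.keys z' \<subseteq> words" "z = (d, cls z')"
      have k: "Poly_Mapping.keys (wl b y' + wr x' c + word_mult x' y') \<subseteq> words"
        "Poly_Mapping.keys (wl c z' + wr y' d + word_mult y' z') \<subseteq> words"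
        by (intro keys_add_sub wl_closed wr_closed wm_closed a)+
      have "word_mult (wr x' c) z' - word_mult x' (wl c z') \<in> null" by (intro wm_bal a)
      then show ?thesis using a k
        by (simp add: T_mult wl_add wr_add wm_add_l wm_add_r wl_mult wr_mult wl_wr wm_wl wm_wr wm_assoc
            cls_eq mult.assoc algebra_simps)
    qed
  qed ((elim T_cases)?, simp add: T_mult T_carrier T_one wl_one wr_one keys_add_sub)+
next
  fix x y z assume "x \<in> carrier T" "y \<in> carrier T" "z \<in> carrier T"
  then show "(x \<oplus>\<^bsub>T\<^esub> y) \<otimes>\<^bsub>T\<^esub> z = x \<otimes>\<^bsub>T\<^esub> z \<oplus>\<^bsub>T\<^esub> y \<otimes>\<^bsub>T\<^esub> z"
  proof (elim T_cases)
    fix b x' c y' d z'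
    assume a: "Poly_Mapping.keys x' \<subseteq> words" "x = (b, cls x')" "Poly_Mapping.keys y' \<subseteq> words"
      "y = (c, cls y')" "Poly_Mapping.keys z' \<subseteq> words" "z = (d, cls z')"
    have "wl (b + c) z' - (wl b z' + wl c z') \<in> null" by (intro wl_plus a)
    then show ?thesis using a
      by (simp add: T_mult T_add keys_add_sub cls_eq wr_add wm_add_l algebra_simps)
  qed
next
  fix x y z assume "x \<in> carrier T" "y \<in> carrier T" "z \<in> carrier T"
  then show "z \<otimes>\<^bsub>T\<^esub> (x \<oplus>\<^bsub>T\<^esub> y) = z \<otimes>\<^bsub>T\<^esub> x \<oplus>\<^bsub>T\<^esub> z \<otimes>\<^bsub>T\<^esub> y"
  proof (elim T_cases)
    fix b x' c y' d z'
    assume a: "Poly_Mapping.keys x' \<subseteq> words" "x = (b, cls x')" "Poly_Mapping.keys y' \<subseteq> words"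
      "y = (c, cls y')" "Poly_Mapping.keys z' \<subseteq> words" "z = (d, cls z')"
    have "wr z' (b + c) - (wr z' b + wr z' c) \<in> null" by (intro wr_plus a)
    then show ?thesis using a
      by (simp add: T_mult T_add keys_add_sub cls_eq wl_add wm_add_r algebra_simps)
  qed
qed

end

section \<open>Graded algebras and PBW type\<close>

text \<open>Directness of the sum of components is stated as the existence of additive maps that are
  the identity on one component and zero on the others: for a tensor algebra these come straight
  from its universal property. Scalars act through the central elements
  \<open>c \<odot> \<one>\<close> of degree 0, so that ideals are automatically subspaces.\<close>

locale galg = ring A for A :: "('k::field, 'a, 'm) graded_algebra_scheme" (structure) +
  assumes comp_subgroup: "subgroup (component A n) (add_monoid A)"
    and comp_one: "\<one> \<in> component A 0"
    and comp_mult: "x \<in> component A m \<Longrightarrow> y \<in> component A n \<Longrightarrow> x \<otimes> y \<in> component A (m + n)"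
    and projection: "\<exists>p. (\<forall>n. \<forall>x \<in> carrier A. \<forall>y \<in> carrier A. p n (x \<oplus> y) = p n x \<oplus> p n y) \<and>
      (\<forall>n m. \<forall>x \<in> component A m. p n x = (if n = m then x else \<zero>))"
    and decomposition: "x \<in> carrier A \<Longrightarrow> \<exists>f N. (\<forall>i. f i \<in> component A i) \<and> x = (\<Oplus>i\<in>{..N::nat}. f i)"
    and smult_eq: "x \<in> carrier A \<Longrightarrow> c \<odot> x = (c \<odot> \<one>) \<otimes> x"
    and smult_comm: "x \<in> carrier A \<Longrightarrow> x \<otimes> (c \<odot> \<one>) = (c \<odot> \<one>) \<otimes> x"
    and smult_one_comp: "c \<odot> \<one> \<in> component A 0"
    and smult_one_add: "(c + d) \<odot> \<one> = c \<odot> \<one> \<oplus> d \<odot> \<one>"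
    and smult_one_mult: "(c * d) \<odot> \<one> = (c \<odot> \<one>) \<otimes> (d \<odot> \<one>)"
    and smult_one_one: "1 \<odot> \<one> = \<one>"
begin

abbreviation comp where "comp \<equiv> component A"
abbreviation hp where "hp \<equiv> hom_part A"

lemma comp_carrier [simp]: "x \<in> comp n \<Longrightarrow> x \<in> carrier A"
  using subgroup.mem_carrier[OF comp_subgroup] by force

lemma comp_zero [simp]: "\<zero> \<in> comp n"
  using subgroup.one_closed[OF comp_subgroup] by simp

lemma comp_add: "x \<in> comp n \<Longrightarrow> y \<in> comp n \<Longrightarrow> x \<oplus> y \<in> comp n"
  using subgroup.m_closed[OF comp_subgroup] by simp

lemma comp_uminus: "x \<in> comp n \<Longrightarrow> \<ominus> x \<in> comp n"
  using subgroup.m_inv_closed[OF comp_subgroup] by (simp add: a_inv_def)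

lemma comp_minus: "x \<in> comp n \<Longrightarrow> y \<in> comp n \<Longrightarrow> x \<ominus> y \<in> comp n"
  by (simp add: minus_eq comp_add comp_uminus)

lemma smult_closed [simp]: "x \<in> carrier A \<Longrightarrow> c \<odot> x \<in> carrier A"
  using comp_carrier[OF smult_one_comp] by (subst smult_eq) simp_all

lemma diff_eq_0: "x \<in> carrier A \<Longrightarrow> y \<in> carrier A \<Longrightarrow> x \<ominus> y = \<zero> \<Longrightarrow> x = y"
  using add.inv_solve_right[of \<zero> x y] by (simp add: minus_eq)

lemma diff_self [simp]: "x \<in> carrier A \<Longrightarrow> x \<ominus> x = \<zero>"
  by (simp add: minus_eq r_neg)

text \<open>\<open>hom_part\<close> is a definite description over all finitely supported
  decompositions. Any family \<open>p\<close> of additive projections reads the n-th term off every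
  such decomposition, which gives uniqueness; existence comes from
  \<open>decomposition\<close>.\<close>

lemma hom_part_eq:
  assumes add: "\<And>n x y. x \<in> carrier A \<Longrightarrow> y \<in> carrier A \<Longrightarrow> p n (x \<oplus> y) = p n x \<oplus> p n y"
    and hom: "\<And>n m x. x \<in> comp m \<Longrightarrow> p n x = (if n = m then x else \<zero>)"
    and x: "x \<in> carrier A"
  shows "hp n x = p n x"
proof -
  have sum: "p n (\<Oplus>i\<in>F. f i) = (if n \<in> F then f n else \<zero>)" if "finite F" "\<And>i. f i \<in> comp i" for f F
    using that
  proof (induction F rule: finite_induct)
    case empty
    then show ?case using hom[of \<zero> 0 n] by simp
  next
    case (insert a F)
    have c: "f \<in> F \<rightarrow> carrier A" "f a \<in> carrier A" using insert by (auto intro: comp_carrier)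
    moreover have "p n (f a) = (if n = a then f a else \<zero>)" by (rule hom) (rule insert)
    ultimately show ?case using insert comp_carrier[OF insert(4)] by (auto simp: add)
  qed
  obtain f N where f: "\<And>i. f i \<in> comp i" "x = (\<Oplus>i\<in>{..N::nat}. f i)"
    using decomposition[OF x] by blast
  \<comment> \<open>\<open>f\<close> may be nonzero above \<open>N\<close>; cutting it off gives the
    finite support over which \<open>hom_part\<close> sums.\<close>
  define g where "g i = (if i \<le> N then f i else \<zero>)" for i
  have g: "\<And>i. g i \<in> comp i" "finite {i. g i \<noteq> \<zero>}"
    using f finite_subset[of "{i. g i \<noteq> \<zero>}" "{..N}"] by (auto simp: g_def split: if_splits)
  have xg: "x = (\<Oplus>i\<in>{i. g i \<noteq> \<zero>}. g i)"
  proof -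
    have "(\<Oplus>i\<in>{i. g i \<noteq> \<zero>}. g i) = (\<Oplus>i\<in>{..N}. g i)"
      using g by (intro add.finprod_mono_neutral_cong_left) (auto simp: g_def f intro: comp_carrier split: if_splits)
    also have "\<dots> = x" unfolding f(2)
      by (intro add.finprod_cong') (auto simp: g_def intro: comp_carrier[OF f(1)])
    finally show ?thesis by simp
  qed
  have pg: "p n x = g n"
  proof -
    have "p n x = (if n \<in> {i. g i \<noteq> \<zero>} then g n else \<zero>)"
      by (subst xg) (rule sum[OF g(2,1)])
    then show ?thesis by (simp split: if_splits)
  qed
  show ?thesis unfolding hom_part_def
  proof (rule the_equality)
    show "\<exists>f. (\<forall>i. f i \<in> comp i) \<and> finite {i. f i \<noteq> \<zero>} \<and> x = (\<Oplus>i\<in>{i. f i \<noteq> \<zero>}. f i) \<and> p n x = f n"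
      using g xg pg by blast
  next
    fix y assume "\<exists>f. (\<forall>i. f i \<in> comp i) \<and> finite {i. f i \<noteq> \<zero>} \<and> x = (\<Oplus>i\<in>{i. f i \<noteq> \<zero>}. f i) \<and> y = f n"
    then obtain f where f: "\<forall>i. f i \<in> comp i" "finite {i. f i \<noteq> \<zero>}" "x = (\<Oplus>i\<in>{i. f i \<noteq> \<zero>}. f i)" "y = f n"
      by blast
    have "p n x = (if n \<in> {i. f i \<noteq> \<zero>} then f n else \<zero>)"
      by (subst f(3)) (rule sum, use f in auto)
    then show "y = p n x" using f by (simp split: if_splits)
  qed
qed

lemma hp_add: "x \<in> carrier A \<Longrightarrow> y \<in> carrier A \<Longrightarrow> hp n (x \<oplus> y) = hp n x \<oplus> hp n y"
  and hp_hom: "x \<in> comp m \<Longrightarrow> hp n x = (if n = m then x else \<zero>)"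
proof -
  obtain p where p: "\<And>n x y. x \<in> carrier A \<Longrightarrow> y \<in> carrier A \<Longrightarrow> p n (x \<oplus> y) = p n x \<oplus> p n y"
    "\<And>n m x. x \<in> comp m \<Longrightarrow> p n x = (if n = m then x else \<zero>)"
    using projection by blast
  have e: "hp n x = p n x" if "x \<in> carrier A" for n x
    by (rule hom_part_eq[of p]) (use p that in auto)
  show "x \<in> carrier A \<Longrightarrow> y \<in> carrier A \<Longrightarrow> hp n (x \<oplus> y) = hp n x \<oplus> hp n y"
    by (simp add: e p(1))
  show "x \<in> comp m \<Longrightarrow> hp n x = (if n = m then x else \<zero>)"
    by (simp add: e p(2))
qed

lemma hp_zero [simp]: "hp n \<zero> = \<zero>"
  using hp_hom[of \<zero> n n] by simp

lemma hp_finsum: "finite F \<Longrightarrow> (\<And>i. i \<in> F \<Longrightarrow> f i \<in> carrier A) \<Longrightarrow> hp n (\<Oplus>i\<in>F. f i) = (\<Oplus>i\<in>F. hp n (f i))"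
  if hpc: "\<And>x. x \<in> carrier A \<Longrightarrow> hp n x \<in> carrier A"
proof (induction F rule: finite_induct)
  case (insert a F)
  then have "f \<in> F \<rightarrow> carrier A" "(\<lambda>i. hp n (f i)) \<in> F \<rightarrow> carrier A" using hpc by auto
  then show ?case using insert by (simp add: hp_add hpc)
qed simp

lemma hp_comp: "x \<in> carrier A \<Longrightarrow> hp n x \<in> comp n"
  and graded_bound: "x \<in> carrier A \<Longrightarrow> \<exists>N. (\<forall>n>N. hp n x = \<zero>) \<and> x = (\<Oplus>i\<in>{..N}. hp i x)"
proof -
  assume x: "x \<in> carrier A"
  obtain f N where f: "\<And>i. f i \<in> comp i" "x = (\<Oplus>i\<in>{..N::nat}. f i)"
    using decomposition[OF x] by blast
  have sum: "hp n (\<Oplus>i\<in>F. f i) = (if n \<in> F then f n else \<zero>)" if "finite F" for n F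
    using that
  proof (induction F rule: finite_induct)
    case (insert a F)
    have c: "f \<in> F \<rightarrow> carrier A" "f a \<in> carrier A" using f by (auto intro: comp_carrier)
    moreover have "hp n (f a) = (if n = a then f a else \<zero>)" by (rule hp_hom) (rule f)
    ultimately show ?case using insert comp_carrier[OF f(1)] by (auto simp: hp_add)
  qed simp
  have h: "hp n x = (if n \<le> N then f n else \<zero>)" for n
    by (subst f(2)) (simp add: sum)
  show "hp n x \<in> comp n" unfolding h using f(1) by simp
  have "(\<Oplus>i\<in>{..N}. hp i x) = x"
    by (subst (2) f(2)) (intro add.finprod_cong', auto simp: h intro: comp_carrier[OF f(1)])
  then show "\<exists>N. (\<forall>n>N. hp n x = \<zero>) \<and> x = (\<Oplus>i\<in>{..N}. hp i x)"
    by (intro exI[of _ N]) (simp add: h)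
qed

lemma hp_closed [simp]: "x \<in> carrier A \<Longrightarrow> hp n x \<in> carrier A"
  using hp_comp comp_carrier by blast

lemma hp_uminus: "x \<in> carrier A \<Longrightarrow> hp n (\<ominus> x) = \<ominus> hp n x"
  by (rule minus_equality[symmetric]) (simp_all add: hp_add[symmetric] l_neg)

lemma hp_minus: "x \<in> carrier A \<Longrightarrow> y \<in> carrier A \<Longrightarrow> hp n (x \<ominus> y) = hp n x \<ominus> hp n y"
  by (simp add: minus_eq hp_add hp_uminus)

lemma graded_induct [consumes 1, case_names hom add]:
  assumes "x \<in> carrier A" and hom: "\<And>x n. x \<in> comp n \<Longrightarrow> P x"
    and add: "\<And>x y. x \<in> carrier A \<Longrightarrow> y \<in> carrier A \<Longrightarrow> P x \<Longrightarrow> P y \<Longrightarrow> P (x \<oplus> y)"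
  shows "P x"
proof -
  obtain N where N: "x = (\<Oplus>i\<in>{..N}. hp i x)" using graded_bound[OF assms(1)] by blast
  have "P (\<Oplus>i\<in>F. hp i x)" if "finite F" for F
    using that
  proof (induction F rule: finite_induct)
    case empty
    then show ?case using hom[of \<zero> 0] by simp
  next
    case (insert a F)
    have "(\<lambda>i. hp i x) \<in> F \<rightarrow> carrier A" using assms(1) by auto
    moreover have "P (hp a x)" by (rule hom[OF hp_comp[OF assms(1)]])
    ultimately show ?case using insert assms(1) add finsum_closed[of "\<lambda>i. hp i x" F] by simp
  qed
  from this[OF finite_atMost[of N]] show ?thesis by (simp only: N[symmetric])
qed

lemma eqI_hp:
  assumes "x \<in> carrier A" "y \<in> carrier A" "\<And>n. hp n x = hp n y" shows "x = y"
proof -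
  obtain N where N: "x \<ominus> y = (\<Oplus>i\<in>{..N}. hp i (x \<ominus> y))" using graded_bound[of "x \<ominus> y"] assms by auto
  have "hp i (x \<ominus> y) = \<zero>" for i using assms by (simp add: hp_minus)
  then have "x \<ominus> y = \<zero>" using N by (simp add: add.finprod_one_eqI)
  then show ?thesis using assms by (simp add: diff_eq_0)
qed

lemma hp_mult_l: "a \<in> comp i \<Longrightarrow> y \<in> carrier A \<Longrightarrow> hp n (a \<otimes> y) = (if i \<le> n then a \<otimes> hp (n - i) y else \<zero>)"
proof -
  assume a: "a \<in> comp i"
  assume "y \<in> carrier A"
  then show ?thesis
  proof (induction rule: graded_induct)
    case (hom x m)
    have "hp n (a \<otimes> x) = (if n = i + m then a \<otimes> x else \<zero>)" by (rule hp_hom[OF comp_mult[OF a hom]])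
    moreover have "n = i + m \<longleftrightarrow> i \<le> n \<and> n - i = m" by auto
    ultimately show ?case using a hom by (auto simp: hp_hom)
  qed (use a in \<open>auto simp: hp_add r_distr\<close>)
qed

lemma hp_mult_r: "a \<in> comp i \<Longrightarrow> y \<in> carrier A \<Longrightarrow> hp n (y \<otimes> a) = (if i \<le> n then hp (n - i) y \<otimes> a else \<zero>)"
proof -
  assume a: "a \<in> comp i"
  assume "y \<in> carrier A"
  then show ?thesis
  proof (induction rule: graded_induct)
    case (hom x m)
    have "hp n (x \<otimes> a) = (if n = m + i then x \<otimes> a else \<zero>)" by (rule hp_hom[OF comp_mult[OF hom a]])
    moreover have "n = m + i \<longleftrightarrow> i \<le> n \<and> n - i = m" by auto
    ultimately show ?case using a hom by (auto simp: hp_hom)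
  qed (use a in \<open>auto simp: hp_add l_distr\<close>)
qed

lemma hp_mult: "x \<in> carrier A \<Longrightarrow> y \<in> carrier A \<Longrightarrow> hp n (x \<otimes> y) = (\<Oplus>i\<in>{..n}. hp i x \<otimes> hp (n - i) y)"
proof (induction rule: graded_induct)
  case (hom x m)
  have "(\<Oplus>i\<in>{..n}. hp i x \<otimes> hp (n - i) y) = (\<Oplus>i\<in>{..n}. if m = i then x \<otimes> hp (n - i) y else \<zero>)"
    by (rule add.finprod_cong') (use hom in \<open>auto simp: hp_hom intro!: m_closed\<close>)
  also have "\<dots> = (if m \<le> n then x \<otimes> hp (n - m) y else \<zero>)"
  proof (cases "m \<le> n")
    case True
    have "(\<lambda>i. x \<otimes> hp (n - i) y) \<in> {..n} \<rightarrow> carrier A" using hom by auto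
    then show ?thesis using add.finprod_singleton[of m "{..n}" "\<lambda>i. x \<otimes> hp (n - i) y"] True hom by simp
  qed (auto intro: add.finprod_one_eqI)
  finally show ?case using hp_mult_l[of x m y n] hom by simp
next
  case (add u v)
  have "(\<Oplus>i\<in>{..n}. hp i (u \<oplus> v) \<otimes> hp (n - i) y) = (\<Oplus>i\<in>{..n}. hp i u \<otimes> hp (n - i) y \<oplus> hp i v \<otimes> hp (n - i) y)"
    by (rule add.finprod_cong') (use add in \<open>auto simp: hp_add l_distr\<close>)
  also have "\<dots> = (\<Oplus>i\<in>{..n}. hp i u \<otimes> hp (n - i) y) \<oplus> (\<Oplus>i\<in>{..n}. hp i v \<otimes> hp (n - i) y)"
    by (rule add.finprod_multf) (use add in auto)
  finally show ?case using add by (simp add: hp_add l_distr)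
qed

lemma filtration_iff: "x \<in> filtration A m \<longleftrightarrow> x \<in> carrier A \<and> (\<forall>n>m. hp n x = \<zero>)"
proof
  assume "x \<in> filtration A m"
  then obtain f where f: "x = (\<Oplus>i\<in>{..m}. f i)" "\<forall>i\<le>m. f i \<in> comp i" by (auto simp: filtration_def)
  have x: "x \<in> carrier A" unfolding f(1) using f(2) by (intro finsum_closed) auto
  have "hp n x = (\<Oplus>i\<in>{..m}. hp n (f i))" if "n > m" for n
    unfolding f(1) by (rule hp_finsum) (use f in auto)
  moreover have "hp n (f i) = \<zero>" if "n > m" "i \<le> m" for n i
    using hp_hom[of "f i" i n] f(2) that by simp
  ultimately show "x \<in> carrier A \<and> (\<forall>n>m. hp n x = \<zero>)" using x by (auto intro: add.finprod_one_eqI)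
next
  assume a: "x \<in> carrier A \<and> (\<forall>n>m. hp n x = \<zero>)"
  have "x = (\<Oplus>i\<in>{..m}. hp i x)"
  proof (rule eqI_hp)
    show "(\<Oplus>i\<in>{..m}. hp i x) \<in> carrier A" using a by (intro finsum_closed) auto
    fix n
    have "hp n (\<Oplus>i\<in>{..m}. hp i x) = (\<Oplus>i\<in>{..m}. hp n (hp i x))"
      by (rule hp_finsum) (use a in auto)
    also have "\<dots> = (\<Oplus>i\<in>{..m}. if n = i then hp i x else \<zero>)"
      by (rule add.finprod_cong') (use a in \<open>auto simp: hp_hom[OF hp_comp]\<close>)
    also have "\<dots> = hp n x"
    proof (cases "n \<le> m")
      case True
      then show ?thesis using add.finprod_singleton[of n "{..m}" "\<lambda>i. hp i x"] a by auto
    qed (use a in \<open>auto intro!: add.finprod_one_eqI\<close>)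
    finally show "hp n x = hp n (\<Oplus>i\<in>{..m}. hp i x)" by simp
  qed (use a in simp)
  then show "x \<in> filtration A m" unfolding filtration_def using a hp_comp by blast
qed

lemma filt_carrier [simp]: "x \<in> filtration A m \<Longrightarrow> x \<in> carrier A" by (simp add: filtration_iff)
lemma filt_add: "x \<in> filtration A m \<Longrightarrow> y \<in> filtration A m \<Longrightarrow> x \<oplus> y \<in> filtration A m"
  by (simp add: filtration_iff hp_add)
lemma filt_uminus: "x \<in> filtration A m \<Longrightarrow> \<ominus> x \<in> filtration A m"
  by (simp add: filtration_iff hp_uminus)
lemma filt_minus: "x \<in> filtration A m \<Longrightarrow> y \<in> filtration A m \<Longrightarrow> x \<ominus> y \<in> filtration A m"
  by (simp add: minus_eq filt_add filt_uminus)
lemma filt_zero [simp]: "\<zero> \<in> filtration A m" by (simp add: filtration_iff)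
lemma filt_comp: "x \<in> comp n \<Longrightarrow> n \<le> m \<Longrightarrow> x \<in> filtration A m"
  by (simp add: filtration_iff hp_hom)
lemma filt_mono: "x \<in> filtration A m \<Longrightarrow> m \<le> n \<Longrightarrow> x \<in> filtration A n"
  by (simp add: filtration_iff)
lemma filt_ex: "x \<in> carrier A \<Longrightarrow> \<exists>N. x \<in> filtration A N"
  using graded_bound[of x] by (auto simp: filtration_iff)

lemma filt_top:
  assumes "x \<in> filtration A (Suc m)" shows "x \<ominus> hp (Suc m) x \<in> filtration A m"
  unfolding filtration_iff
proof (intro conjI allI impI)
  fix n assume "m < n"
  then show "hp n (x \<ominus> hp (Suc m) x) = \<zero>"
    using assms by (cases "n = Suc m") (auto simp: hp_minus hp_hom[OF hp_comp] filtration_iff)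
qed (use assms in simp)

lemma filt_0: "x \<in> filtration A 0 \<longleftrightarrow> x \<in> comp 0"
proof
  assume x: "x \<in> filtration A 0"
  have "x = hp 0 x" by (rule eqI_hp) (use x in \<open>auto simp: hp_hom[OF hp_comp] filtration_iff\<close>)
  then show "x \<in> comp 0" using x hp_comp by (metis filt_carrier)
qed (simp add: filt_comp)

lemma filt_induct [consumes 1, case_names hom add]:
  assumes "x \<in> filtration A m" and hom: "\<And>x n. x \<in> comp n \<Longrightarrow> n \<le> m \<Longrightarrow> P x"
    and add: "\<And>x y. x \<in> filtration A m \<Longrightarrow> y \<in> filtration A m \<Longrightarrow> P x \<Longrightarrow> P y \<Longrightarrow> P (x \<oplus> y)"
  shows "P x"
  using assms
proof (induction m arbitrary: x)
  case 0
  then show ?case by (auto simp: filt_0)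
next
  case (Suc m)
  let ?t = "hp (Suc m) x"
  have c: "x \<in> carrier A" using Suc by simp
  have "P (x \<ominus> ?t)"
  proof (rule Suc.IH[OF filt_top[OF Suc.prems(1)]])
    fix x n assume "x \<in> comp n" "n \<le> m"
    then show "P x" using Suc.prems(2) by simp
  next
    fix x y assume "x \<in> filtration A m" "y \<in> filtration A m" "P x" "P y"
    then show "P (x \<oplus> y)" using Suc.prems(3) filt_mono[of _ m "Suc m"] by simp
  qed
  then have "P ((x \<ominus> ?t) \<oplus> ?t)"
    using Suc.prems(3)[of "x \<ominus> ?t" ?t] Suc.prems(2)[of ?t "Suc m"] filt_mono[OF filt_top[OF Suc.prems(1)]]
      filt_comp[OF hp_comp[OF c, of "Suc m"]] hp_comp[OF c] by simp
  moreover have "(x \<ominus> ?t) \<oplus> ?t = x" using c by (simp add: minus_eq a_assoc l_neg)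
  ultimately show ?case by simp
qed

lemma filt_mult:
  assumes "x \<in> filtration A m" "y \<in> filtration A n" shows "x \<otimes> y \<in> filtration A (m + n)"
  using assms(1)
proof (induction rule: filt_induct)
  case (hom x i)
  from assms(2) show ?case
  proof (induction rule: filt_induct)
    case (hom y j)
    then show ?case using \<open>x \<in> comp i\<close> \<open>i \<le> m\<close> by (auto intro!: filt_comp[OF comp_mult])
  next
    case (add y z)
    then show ?case using \<open>x \<in> comp i\<close> by (simp add: r_distr filt_add)
  qed
next
  case (add x z)
  then show ?case using assms(2) by (simp add: l_distr filt_add)
qed

end

section \<open>Generators, grading and universal properties of the tensor algebra\<close>

context bimod
begin

abbreviation TT_mult (infixl "\<otimes>\<^sub>T" 70) where "x \<otimes>\<^sub>T y \<equiv> x \<otimes>\<^bsub>T\<^esub> y"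
abbreviation TT_add (infixl "\<oplus>\<^sub>T" 65) where "x \<oplus>\<^sub>T y \<equiv> x \<oplus>\<^bsub>T\<^esub> y"
abbreviation TT_zero ("\<zero>\<^sub>T") where "\<zero>\<^sub>T \<equiv> \<zero>\<^bsub>T\<^esub>"

sublocale T: ring T by (rule T_ring)

definition inB :: "'b \<Rightarrow> 'b \<times> ('u list \<Rightarrow>\<^sub>0 int) set" where "inB b = (b, cls 0)"
abbreviation gen where "gen \<equiv> tensor_generator U"
definition W :: "'u list \<Rightarrow> 'b \<times> ('u list \<Rightarrow>\<^sub>0 int) set" where
  "W w = (if w = [] then \<one>\<^bsub>T\<^esub> else (0, cls (frag_of w)))"

lemma inB_closed [simp]: "inB b \<in> carrier T" by (simp add: inB_def T_carrier)
lemma inB_add: "inB (b + c) = inB b \<oplus>\<^sub>T inB c" by (simp add: inB_def T_add)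
lemma inB_mult: "inB (b * c) = inB b \<otimes>\<^sub>T inB c" by (simp add: inB_def T_mult)
lemma inB_zero: "inB 0 = \<zero>\<^sub>T" by (simp add: inB_def T_zero)
lemma inB_one: "inB 1 = \<one>\<^bsub>T\<^esub>" by (simp add: inB_def T_one)
lemma inB_inj: "inB b = inB c \<longleftrightarrow> b = c" by (simp add: inB_def)
lemma inB_uminus: "inB (- b) = \<ominus>\<^bsub>T\<^esub> inB b"
  by (rule T.minus_equality[symmetric]) (simp_all add: inB_add[symmetric] inB_zero)

lemma gen_eq: "gen u = (0, cls (frag_of [u]))" by (simp add: tensor_generator_def)

lemma word1 [simp]: "u \<in> carrier U \<Longrightarrow> [u] \<in> words" by (simp add: tensor_words_def)

lemma gen_closed [simp]: "u \<in> carrier U \<Longrightarrow> gen u \<in> carrier T"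
  by (simp add: gen_eq T_carrier)

lemma gen_add: "u \<in> carrier U \<Longrightarrow> v \<in> carrier U \<Longrightarrow> gen (u \<oplus> v) = gen u \<oplus>\<^sub>T gen v"
  using relator_null[OF add_relator[of "[]" "[]" u v]] by (simp add: gen_eq T_add cls_eq diff_diff_eq)

lemma gen_zero: "gen \<zero> = \<zero>\<^sub>T"
  using gen_add[of \<zero> \<zero>] T.add.r_cancel_one'[of "gen \<zero>" "gen \<zero>"] by simp

lemma gen_uminus: "u \<in> carrier U \<Longrightarrow> gen (\<ominus> u) = \<ominus>\<^bsub>T\<^esub> gen u"
  by (rule T.minus_equality[symmetric]) (simp_all add: gen_add[symmetric] l_neg gen_zero)

lemma inB_gen: "u \<in> carrier U \<Longrightarrow> inB b \<otimes>\<^sub>T gen u = gen (b \<odot> u)"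
  by (simp add: inB_def gen_eq T_mult)

lemma gen_inB: "u \<in> carrier U \<Longrightarrow> gen u \<otimes>\<^sub>T inB b = gen (rsmult U u b)"
  by (simp add: inB_def gen_eq T_mult)

lemma W_nil [simp]: "W [] = \<one>\<^bsub>T\<^esub>" by (simp add: W_def)
lemma W_word: "w \<in> words \<Longrightarrow> W w = (0, cls (frag_of w))" by (auto simp: W_def tensor_words_def)
lemma W_closed [simp]: "set w \<subseteq> carrier U \<Longrightarrow> W w \<in> carrier T"
  by (auto simp: W_def T_carrier tensor_words_def)
lemma W_one: "W [u] = gen u" by (simp add: W_def gen_eq)

text \<open>\<open>wl 0\<close> replaces a first letter u by 0 u and yields nonempty words, not the
  zero combination. The result is trivial only modulo \<open>null\<close>, by additivity in the
  scalar.\<close>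

lemma wl_0_null: "Poly_Mapping.keys x \<subseteq> words \<Longrightarrow> wl 0 x \<in> null"
  using wl_plus[of x 0 0] null_minus by force
lemma wr_0_null: "Poly_Mapping.keys x \<subseteq> words \<Longrightarrow> wr x 0 \<in> null"
  using wr_plus[of x 0 0] null_minus by force

lemma T_mult_00: "Poly_Mapping.keys x \<subseteq> words \<Longrightarrow> Poly_Mapping.keys y \<subseteq> words \<Longrightarrow>
  (0, cls x) \<otimes>\<^sub>T (0, cls y) = (0, cls (word_mult x y))"
  using null_add[OF wl_0_null wr_0_null, of y x] by (simp add: T_mult cls_eq)

lemma W_append: "set p \<subseteq> carrier U \<Longrightarrow> set q \<subseteq> carrier U \<Longrightarrow> W (p @ q) = W p \<otimes>\<^sub>T W q"
proof (cases "p = [] \<or> q = []")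
  case False
  assume "set p \<subseteq> carrier U" "set q \<subseteq> carrier U"
  with False show ?thesis by (simp add: W_def T_mult_00 tensor_words_def)
qed auto

lemma W_Cons: "u \<in> carrier U \<Longrightarrow> set q \<subseteq> carrier U \<Longrightarrow> W (u # q) = gen u \<otimes>\<^sub>T W q"
  using W_append[of "[u]" q] by (simp add: W_one)

lemma W_snoc: "u \<in> carrier U \<Longrightarrow> set q \<subseteq> carrier U \<Longrightarrow> W (q @ [u]) = W q \<otimes>\<^sub>T gen u"
  using W_append[of q "[u]"] by (simp add: W_one)

lemma T_smult_eq: "t \<in> carrier T \<Longrightarrow> a \<odot>\<^bsub>T\<^esub> t = inB (eta a) \<otimes>\<^sub>T t"
  by (elim T_cases) (simp add: T_smult inB_def T_mult)

lemma pos_split: "Poly_Mapping.keys x \<subseteq> words \<Longrightarrow> (b, cls x) = inB b \<oplus>\<^sub>T (0, cls x)"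
  by (simp add: inB_def T_add)

lemma pos_diff: "Poly_Mapping.keys x \<subseteq> words \<Longrightarrow> Poly_Mapping.keys y \<subseteq> words \<Longrightarrow>
  (0, cls (x - y)) = (0, cls x) \<ominus>\<^bsub>T\<^esub> (0, cls y)"
proof -
  assume a: "Poly_Mapping.keys x \<subseteq> words" "Poly_Mapping.keys y \<subseteq> words"
  have "(0, cls (x - y)) \<oplus>\<^sub>T (0, cls y) = (0, cls x)" using a by (simp add: T_add keys_diff_sub)
  then show ?thesis using a T.add.inv_solve_right[of "(0, cls (x - y))" "(0, cls x)" "(0, cls y)"]
    by (simp add: T.minus_eq T_carrier keys_diff_sub)
qed

lemma T_word_induct [consumes 1, case_names base word diff]:
  assumes t: "t \<in> carrier T" and B: "\<And>b. P (inB b)"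
    and W: "\<And>w. w \<in> words \<Longrightarrow> P (W w)"
    and D: "\<And>x y. x \<in> carrier T \<Longrightarrow> y \<in> carrier T \<Longrightarrow> P x \<Longrightarrow> P y \<Longrightarrow> P (x \<ominus>\<^bsub>T\<^esub> y)"
  shows "P t"
proof -
  obtain b x where x: "Poly_Mapping.keys x \<subseteq> words" "t = (b, cls x)" using t by (rule T_cases)
  have "P (0, cls x)" using x(1)
    by (induction rule: frag_eqv_induct) (use W D in \<open>auto simp: W_word pos_diff T_carrier\<close>)
  then have "P (inB b \<ominus>\<^bsub>T\<^esub> (inB 0 \<ominus>\<^bsub>T\<^esub> (0, cls x)))" using x by (intro D B) (auto simp: T_carrier)
  moreover have "inB b \<ominus>\<^bsub>T\<^esub> (inB 0 \<ominus>\<^bsub>T\<^esub> (0, cls x)) = t"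
    using x by (simp add: pos_split[of x b] inB_zero T.minus_eq T_carrier)
  ultimately show ?thesis by simp
qed

text \<open>The cases allow sums but no negatives. The assertion is therefore proved for t and its
  negative at once; the negative of a word is moved into its first letter.\<close>

lemma T_induct_left [consumes 1, case_names base add gen]:
  assumes t: "t \<in> carrier T" and B: "\<And>b. P (inB b)"
    and A: "\<And>x y. x \<in> carrier T \<Longrightarrow> y \<in> carrier T \<Longrightarrow> P x \<Longrightarrow> P y \<Longrightarrow> P (x \<oplus>\<^sub>T y)"
    and G: "\<And>u t. u \<in> carrier U \<Longrightarrow> t \<in> carrier T \<Longrightarrow> P t \<Longrightarrow> P (gen u \<otimes>\<^sub>T t)"
  shows "P t"
proof -
  have "P t \<and> P (\<ominus>\<^bsub>T\<^esub> t)" using t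
  proof (induction rule: T_word_induct)
    case (base b)
    then show ?case using B B[of "- b"] by (simp add: inB_uminus)
  next
    case (word w)
    have W: "set w \<subseteq> carrier U \<Longrightarrow> P (W w)" for w
      by (induction w) (use B[of 1] G in \<open>auto simp: W_Cons inB_one\<close>)
    show ?case using word
    proof (cases rule: word_cases)
      case (1 u w')
      have "P (gen (\<ominus> u) \<otimes>\<^sub>T W w')" using 1 W by (intro G) auto
      then show ?thesis using W[of w] 1 by (simp add: W_Cons gen_uminus T.l_minus)
    qed
  next
    case (diff x y)
    then show ?case using A[of x "\<ominus>\<^bsub>T\<^esub> y"] A[of "\<ominus>\<^bsub>T\<^esub> x" y] by (simp add: T.minus_eq T.minus_add)
  qed
  then show ?thesis by simp
qed

lemma T_induct_right [consumes 1, case_names base add gen]: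
  assumes t: "t \<in> carrier T" and B: "\<And>b. P (inB b)"
    and A: "\<And>x y. x \<in> carrier T \<Longrightarrow> y \<in> carrier T \<Longrightarrow> P x \<Longrightarrow> P y \<Longrightarrow> P (x \<oplus>\<^sub>T y)"
    and G: "\<And>u t. u \<in> carrier U \<Longrightarrow> t \<in> carrier T \<Longrightarrow> P t \<Longrightarrow> P (t \<otimes>\<^sub>T gen u)"
  shows "P t"
proof -
  have "P t \<and> P (\<ominus>\<^bsub>T\<^esub> t)" using t
  proof (induction rule: T_word_induct)
    case (base b)
    then show ?case using B B[of "- b"] by (simp add: inB_uminus)
  next
    case (word w)
    have W: "set w \<subseteq> carrier U \<Longrightarrow> P (W w)" for w
      by (induction w rule: rev_induct) (use B[of 1] G in \<open>auto simp: W_snoc inB_one\<close>)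
    show ?case using word
    proof (cases rule: word_cases_rev)
      case (1 u w')
      have "P (W w' \<otimes>\<^sub>T gen (\<ominus> u))" using 1 W by (intro G) auto
      then show ?thesis using W[of w] 1 by (simp add: W_snoc gen_uminus T.r_minus)
    qed
  next
    case (diff x y)
    then show ?case using A[of x "\<ominus>\<^bsub>T\<^esub> y"] A[of "\<ominus>\<^bsub>T\<^esub> x" y] by (simp add: T.minus_eq T.minus_add)
  qed
  then show ?thesis by simp
qed

section \<open>Homogeneous components and projections\<close>

lemma comp_0: "component T 0 = range inB"
  by (auto simp: tensor_algebra_def inB_def tp_one)

lemma comp_Suc: "component T (Suc n) =
    {(0, cls x) | x. Poly_Mapping.keys x \<subseteq> {w \<in> words. length w = Suc n}}"
  by (auto simp: tensor_algebra_def)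

lemma comp_word_induct [consumes 1, case_names word diff]:
  assumes t: "t \<in> component T (Suc n)"
    and W: "\<And>w. w \<in> words \<Longrightarrow> length w = Suc n \<Longrightarrow> P (W w)"
    and D: "\<And>x y. x \<in> carrier T \<Longrightarrow> y \<in> carrier T \<Longrightarrow> P x \<Longrightarrow> P y \<Longrightarrow> P (x \<ominus>\<^bsub>T\<^esub> y)"
  shows "P t"
proof -
  let ?S = "{w \<in> words. length w = Suc n}"
  obtain x where x: "Poly_Mapping.keys x \<subseteq> ?S" "t = (0, cls x)" using t by (auto simp: comp_Suc)
  have w: "replicate (Suc n) \<zero> \<in> words" by (auto simp: tensor_words_def)
  define X where "X = W (replicate (Suc n) \<zero>)"
  have X: "X \<in> carrier T" unfolding X_def by (rule W_closed) auto
  have "P X" unfolding X_def using w by (intro W) auto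
  then have "P (X \<ominus>\<^bsub>T\<^esub> X)" using X by (intro D)
  then have z: "P (0, cls 0)" using X by (simp add: T.minus_eq T.r_neg T_zero)
  have "P (0, cls x)" using x(1)
  proof (rule free_Abelian_group_induct)
    fix x y :: "'u list \<Rightarrow>\<^sub>0 int" assume a: "Poly_Mapping.keys x \<subseteq> ?S" "Poly_Mapping.keys y \<subseteq> ?S" "P (0, cls x)" "P (0, cls y)"
    then have k: "Poly_Mapping.keys x \<subseteq> words" "Poly_Mapping.keys y \<subseteq> words" by auto
    show "P (0, cls (x - y))" using a k D by (simp add: pos_diff T_carrier)
  next
    fix a assume "a \<in> ?S" then show "P (0, cls (frag_of a))" using W[of a] by (simp add: W_word)
  qed (rule z)
  then show ?thesis by (simp add: x)
qed

lemma comp_sub: "component T n \<subseteq> carrier T"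
proof (cases n)
  case 0 then show ?thesis by (auto simp: comp_0)
next
  case (Suc m)
  then show ?thesis by (auto simp: comp_Suc T_carrier intro!: cls_in_tp)
qed

lemma comp_diff: "x \<in> component T n \<Longrightarrow> y \<in> component T n \<Longrightarrow> x \<ominus>\<^bsub>T\<^esub> y \<in> component T n"
proof (cases n)
  case 0
  assume "x \<in> component T n" "y \<in> component T n"
  then obtain b c where "x = inB b" "y = inB c" using 0 by (auto simp: comp_0)
  then have "x \<ominus>\<^bsub>T\<^esub> y = inB (b - c)" using inB_add[of b "- c"] by (simp add: T.minus_eq inB_uminus)
  then show ?thesis using 0 by (simp add: comp_0)
next
  case (Suc m)
  let ?S = "{w \<in> words. length w = Suc m}"
  assume "x \<in> component T n" "y \<in> component T n"
  then obtain x' y' where a: "Poly_Mapping.keys x' \<subseteq> ?S" "x = (0, cls x')" "Poly_Mapping.keys y' \<subseteq> ?S" "y = (0, cls y')"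
    unfolding Suc comp_Suc by blast
  then have k: "Poly_Mapping.keys x' \<subseteq> words" "Poly_Mapping.keys y' \<subseteq> words" by auto
  have "x \<ominus>\<^bsub>T\<^esub> y = (0, cls (x' - y'))" by (simp add: a pos_diff k)
  moreover have "Poly_Mapping.keys (x' - y') \<subseteq> ?S" by (rule keys_diff_sub) (use a in auto)
  ultimately show ?thesis unfolding Suc comp_Suc by blast
qed

lemma comp_W: "set w \<subseteq> carrier U \<Longrightarrow> W w \<in> component T (length w)"
proof (cases w)
  case Nil
  then show ?thesis using inB_one by (metis comp_0 W_nil list.size(3) rangeI)
next
  case (Cons u w')
  assume s: "set w \<subseteq> carrier U"
  have "W w = (0, cls (frag_of w))" "Poly_Mapping.keys (frag_of w) \<subseteq> {v \<in> words. length v = Suc (length w')}"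
    using Cons s by (auto simp: W_def tensor_words_def)
  then show ?thesis using Cons comp_Suc[of "length w'"] by auto
qed

lemma comp_inB [simp]: "inB b \<in> component T 0" by (simp add: comp_0)

lemma comp_zero [simp]: "\<zero>\<^sub>T \<in> component T n"
proof -
  have "W (replicate n \<zero>) \<in> component T n" using comp_W[of "replicate n \<zero>"] by (simp add: set_replicate_conv_if)
  then show ?thesis using comp_diff[of "W (replicate n \<zero>)" n "W (replicate n \<zero>)"] comp_sub[of n]
    by (auto simp: T.minus_eq T.r_neg)
qed

lemma comp_uminus: "x \<in> component T n \<Longrightarrow> \<ominus>\<^bsub>T\<^esub> x \<in> component T n"
  using comp_diff[of "\<zero>\<^sub>T" n x] comp_sub[of n] by (auto simp: T.minus_eq)

lemma comp_add: "x \<in> component T n \<Longrightarrow> y \<in> component T n \<Longrightarrow> x \<oplus>\<^sub>T y \<in> component T n"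
  using comp_diff[of x n "\<ominus>\<^bsub>T\<^esub> y"] comp_uminus[of y n] comp_sub[of n] by (auto simp: T.minus_eq)

lemma comp_subgroup: "subgroup (component T n) (add_monoid T)"
  by (unfold_locales) (use comp_sub comp_add in \<open>auto simp: comp_uminus[unfolded a_inv_def]\<close>)

text \<open>An element of \<open>T\<close> is a pair, so an additive map is the sum of one on the
  base ring and one on the tensor powers; the latter is supplied by \<open>tp_lift\<close>. Only
  additivity is asked for, since projections, coordinates and contractions are all to be obtained in
  this way.\<close>

lemma T_lift:
  assumes H: "abelian_group H"
    and phi: "\<And>b. phi b \<in> carrier H" "\<And>b c. phi (b + c) = phi b \<oplus>\<^bsub>H\<^esub> phi c"
    and F: "\<And>w. w \<in> words \<Longrightarrow> F w \<in> carrier H"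
    and add: "\<And>p q u v. set p \<subseteq> carrier U \<Longrightarrow> set q \<subseteq> carrier U \<Longrightarrow> u \<in> carrier U \<Longrightarrow> v \<in> carrier U \<Longrightarrow>
      F (p @ (u \<oplus> v) # q) = F (p @ u # q) \<oplus>\<^bsub>H\<^esub> F (p @ v # q)"
    and bal: "\<And>p q u v b. set p \<subseteq> carrier U \<Longrightarrow> set q \<subseteq> carrier U \<Longrightarrow> u \<in> carrier U \<Longrightarrow> v \<in> carrier U \<Longrightarrow>
      F (p @ rsmult U u b # v # q) = F (p @ u # (b \<odot> v) # q)"
  shows "\<exists>L. (\<forall>t \<in> carrier T. L t \<in> carrier H) \<and>
    (\<forall>s \<in> carrier T. \<forall>t \<in> carrier T. L (s \<oplus>\<^sub>T t) = L s \<oplus>\<^bsub>H\<^esub> L t) \<and>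
    (\<forall>b. L (inB b) = phi b) \<and> (\<forall>w \<in> words. L (W w) = F w)"
proof -
  interpret H: abelian_group H by fact
  obtain M where M: "M \<in> hom tp (add_monoid H)" "\<And>w. w \<in> words \<Longrightarrow> M (cls (frag_of w)) = F w"
    using tp_lift[of "add_monoid H" F, OF H.a_comm_group] F add bal by auto
  interpret M: group_hom tp "add_monoid H" M
    using M(1) tp_comm_group by (simp add: group_hom_def group_hom_axioms_def comm_group_def H.a_group)
  have M1: "M (cls 0) = \<zero>\<^bsub>H\<^esub>" using M.hom_one by (simp add: tp_one)
  have phi0: "phi 0 = \<zero>\<^bsub>H\<^esub>" using phi(2)[of 0 0] phi(1)[of 0] by simp
  define L where "L = (\<lambda>(b, X). phi b \<oplus>\<^bsub>H\<^esub> M X)"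
  have Mc: "X \<in> carrier tp \<Longrightarrow> M X \<in> carrier H" for X using M.hom_closed by simp
  show ?thesis
  proof (intro exI[of _ L] conjI ballI allI)
    show "L t \<in> carrier H" if "t \<in> carrier T" for t
      using that phi Mc by (cases t) (auto simp: L_def T_carrier)
    show "L (s \<oplus>\<^sub>T t) = L s \<oplus>\<^bsub>H\<^esub> L t" if "s \<in> carrier T" "t \<in> carrier T" for s t
    proof -
      obtain b X c Y where e: "s = (b, X)" "t = (c, Y)" by (cases s, cases t)
      have X: "X \<in> carrier tp" "Y \<in> carrier tp" using that e by (auto simp: T_carrier)
      have "s \<oplus>\<^sub>T t = (b + c, X \<otimes>\<^bsub>tp\<^esub> Y)" by (simp add: e tensor_algebra_def)
      then show ?thesis using e X phi Mc M.hom_mult by (simp add: L_def H.a_ac)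
    qed
    show "L (inB b) = phi b" for b using phi by (simp add: L_def inB_def M1)
    show "L (W w) = F w" if "w \<in> words" for w
      using that M(2) F by (simp add: L_def W_word phi0)
  qed
qed

lemma W_app_Cons: "set p \<subseteq> carrier U \<Longrightarrow> set q \<subseteq> carrier U \<Longrightarrow> u \<in> carrier U \<Longrightarrow>
    W (p @ u # q) = W p \<otimes>\<^sub>T (gen u \<otimes>\<^sub>T W q)"
  using W_append[of p "u # q"] by (simp add: W_Cons)

lemma W_add: "set p \<subseteq> carrier U \<Longrightarrow> set q \<subseteq> carrier U \<Longrightarrow> u \<in> carrier U \<Longrightarrow> v \<in> carrier U \<Longrightarrow>
    W (p @ (u \<oplus> v) # q) = W (p @ u # q) \<oplus>\<^sub>T W (p @ v # q)"
  by (simp add: W_app_Cons gen_add T.l_distr T.r_distr)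

lemma gen_bal: "u \<in> carrier U \<Longrightarrow> v \<in> carrier U \<Longrightarrow> t \<in> carrier T \<Longrightarrow>
    gen (rsmult U u b) \<otimes>\<^sub>T (gen v \<otimes>\<^sub>T t) = gen u \<otimes>\<^sub>T (gen (b \<odot> v) \<otimes>\<^sub>T t)"
  by (simp add: gen_inB[symmetric] inB_gen[symmetric] T.m_assoc)

lemma W_bal: "set p \<subseteq> carrier U \<Longrightarrow> set q \<subseteq> carrier U \<Longrightarrow> u \<in> carrier U \<Longrightarrow> v \<in> carrier U \<Longrightarrow>
    W (p @ rsmult U u b # v # q) = W (p @ u # (b \<odot> v) # q)"
  by (simp add: W_app_Cons W_Cons gen_bal)

text \<open>The relators preserve word length, so the word function that keeps words of length n and
  sends the others to zero is additive and balanced. Its lift is the projection to degree n.\<close>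

lemma T_projection: "\<exists>p. (\<forall>n. \<forall>x \<in> carrier T. \<forall>y \<in> carrier T. p n (x \<oplus>\<^sub>T y) = p n x \<oplus>\<^sub>T p n y) \<and>
      (\<forall>n m. \<forall>x \<in> component T m. p n x = (if n = m then x else \<zero>\<^sub>T))"
proof -
  have "\<exists>L. (\<forall>x \<in> carrier T. \<forall>y \<in> carrier T. L (x \<oplus>\<^sub>T y) = L x \<oplus>\<^sub>T L y) \<and>
      (\<forall>m. \<forall>x \<in> component T m. L x = (if n = m then x else \<zero>\<^sub>T))" for n
  proof -
    let ?phi = "\<lambda>b. if n = 0 then inB b else \<zero>\<^sub>T"
    let ?F = "\<lambda>w. if length w = n then W w else \<zero>\<^sub>T"
    have "\<exists>L. (\<forall>t \<in> carrier T. L t \<in> carrier T) \<and>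
      (\<forall>s \<in> carrier T. \<forall>t \<in> carrier T. L (s \<oplus>\<^sub>T t) = L s \<oplus>\<^sub>T L t) \<and>
      (\<forall>b. L (inB b) = ?phi b) \<and> (\<forall>w \<in> words. L (W w) = ?F w)"
      by (rule T_lift) (simp_all add: T_abelian_group inB_add W_add W_bal tensor_words_def)
    then obtain L where L: "\<And>t. t \<in> carrier T \<Longrightarrow> L t \<in> carrier T"
      "\<And>s t. s \<in> carrier T \<Longrightarrow> t \<in> carrier T \<Longrightarrow> L (s \<oplus>\<^sub>T t) = L s \<oplus>\<^sub>T L t"
      "\<And>b. L (inB b) = ?phi b" "\<And>w. w \<in> words \<Longrightarrow> L (W w) = ?F w"
      by blast
    have L0: "L \<zero>\<^sub>T = \<zero>\<^sub>T" using L(3)[of 0] by (simp add: inB_zero split: if_splits)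
    have Lm: "L (\<ominus>\<^bsub>T\<^esub> x) = \<ominus>\<^bsub>T\<^esub> L x" if "x \<in> carrier T" for x
      by (rule T.minus_equality[symmetric]) (use that L in \<open>simp_all add: L(2)[symmetric] T.l_neg L0\<close>)
    have "L x = (if n = m then x else \<zero>\<^sub>T)" if "x \<in> component T m" for m x
    proof (cases m)
      case 0
      then show ?thesis using that by (auto simp: comp_0 L(3))
    next
      case (Suc k)
      from that[unfolded Suc] show ?thesis unfolding Suc
      proof (induction rule: comp_word_induct)
        case (word w)
        then show ?case by (simp add: L(4))
      next
        case (diff x y)
        then show ?case by (simp add: T.minus_eq L(2) Lm split: if_splits)
      qed
    qed
    then show ?thesis using L(2) by blast
  qed
  then have "\<exists>p. \<forall>n. (\<forall>x \<in> carrier T. \<forall>y \<in> carrier T. p n (x \<oplus>\<^sub>T y) = p n x \<oplus>\<^sub>T p n y) \<and>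
      (\<forall>m. \<forall>x \<in> component T m. p n x = (if n = m then x else \<zero>\<^sub>T))" by (intro choice allI)
  then show ?thesis by blast
qed

lemma comp_Suc_induct_left [consumes 1, case_names gen add]:
  assumes t: "t \<in> component T (Suc n)"
    and G: "\<And>u s. u \<in> carrier U \<Longrightarrow> s \<in> component T n \<Longrightarrow> P (gen u \<otimes>\<^sub>T s)"
    and A: "\<And>x y. x \<in> carrier T \<Longrightarrow> y \<in> carrier T \<Longrightarrow> P x \<Longrightarrow> P y \<Longrightarrow> P (x \<oplus>\<^sub>T y)"
  shows "P t"
proof -
  have "P t \<and> P (\<ominus>\<^bsub>T\<^esub> t)" using t
  proof (induction rule: comp_word_induct)
    case (word w)
    from word(1) show ?case
    proof (cases rule: word_cases)
      case (1 u w')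
      then have c: "W w' \<in> component T n" using word comp_W[of w'] by simp
      have "P (gen (\<ominus> u) \<otimes>\<^sub>T W w')" "P (gen u \<otimes>\<^sub>T W w')" using 1 G c by auto
      then show ?thesis using 1 by (simp add: W_Cons gen_uminus T.l_minus)
    qed
  next
    case (diff x y)
    then show ?case using A[of x "\<ominus>\<^bsub>T\<^esub> y"] A[of "\<ominus>\<^bsub>T\<^esub> x" y] by (simp add: T.minus_eq T.minus_add)
  qed
  then show ?thesis by simp
qed

lemma comp_Suc_induct_right [consumes 1, case_names gen add]:
  assumes t: "t \<in> component T (Suc n)"
    and G: "\<And>u s. u \<in> carrier U \<Longrightarrow> s \<in> component T n \<Longrightarrow> P (s \<otimes>\<^sub>T gen u)"
    and A: "\<And>x y. x \<in> carrier T \<Longrightarrow> y \<in> carrier T \<Longrightarrow> P x \<Longrightarrow> P y \<Longrightarrow> P (x \<oplus>\<^sub>T y)"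
  shows "P t"
proof -
  have "P t \<and> P (\<ominus>\<^bsub>T\<^esub> t)" using t
  proof (induction rule: comp_word_induct)
    case (word w)
    from word(1) show ?case
    proof (cases rule: word_cases_rev)
      case (1 u w')
      then have c: "W w' \<in> component T n" using word comp_W[of w'] by simp
      have "P (W w' \<otimes>\<^sub>T gen (\<ominus> u))" "P (W w' \<otimes>\<^sub>T gen u)" using 1 G c by auto
      then show ?thesis using 1 by (simp add: W_snoc gen_uminus T.r_minus)
    qed
  next
    case (diff x y)
    then show ?case using A[of x "\<ominus>\<^bsub>T\<^esub> y"] A[of "\<ominus>\<^bsub>T\<^esub> x" y] by (simp add: T.minus_eq T.minus_add)
  qed
  then show ?thesis by simp
qed

lemma inB_comp: "y \<in> component T n \<Longrightarrow> inB b \<otimes>\<^sub>T y \<in> component T n"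
proof (cases n)
  case 0
  assume "y \<in> component T n"
  then show ?thesis using 0 by (auto simp: comp_0 inB_mult[symmetric])
next
  case (Suc m)
  assume "y \<in> component T n"
  then show ?thesis unfolding Suc
  proof (induction rule: comp_word_induct)
    case (word w)
    from word(1) show ?case
    proof (cases rule: word_cases)
      case (1 u w')
      have "W ((b \<odot> u) # w') \<in> component T (Suc m)" using comp_W[of "(b \<odot> u) # w'"] 1 word by auto
      then show ?thesis using 1 by (simp add: W_Cons T.m_assoc[symmetric] inB_gen)
    qed
  next
    case (diff x y)
    then show ?case by (simp add: T.minus_eq T.r_distr T.r_minus) (metis T.minus_eq comp_diff T.m_closed inB_closed)
  qed
qed

lemma gen_comp: "u \<in> carrier U \<Longrightarrow> y \<in> component T n \<Longrightarrow> gen u \<otimes>\<^sub>T y \<in> component T (Suc n)"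
proof (cases n)
  case 0
  assume "u \<in> carrier U" "y \<in> component T n"
  then show ?thesis using 0 comp_W[of "[rsmult U u b]" for b] by (auto simp: comp_0 gen_inB W_one)
next
  case (Suc m)
  assume u: "u \<in> carrier U" and "y \<in> component T n"
  from this(2) show ?thesis unfolding Suc
  proof (induction rule: comp_word_induct)
    case (word w)
    then show ?case using u W_Cons[of u w, symmetric] comp_W[of "u # w"] by (auto simp: tensor_words_def)
  next
    case (diff x y)
    then show ?case using u by (simp add: T.minus_eq T.r_distr T.r_minus) (metis T.minus_eq comp_diff T.m_closed gen_closed)
  qed
qed

lemma comp_mult: "x \<in> component T m \<Longrightarrow> y \<in> component T n \<Longrightarrow> x \<otimes>\<^sub>T y \<in> component T (m + n)"
proof (induction m arbitrary: x)
  case 0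
  then show ?case by (auto simp: comp_0 inB_comp)
next
  case (Suc m)
  have y: "y \<in> carrier T" using Suc comp_sub by blast
  from Suc.prems(1) show ?case
  proof (induction rule: comp_Suc_induct_left)
    case (gen u s)
    have "s \<in> carrier T" using gen comp_sub by blast
    then show ?case using gen gen_comp[OF gen(1) Suc.IH[OF gen(2) Suc.prems(2)]] y by (simp add: T.m_assoc)
  next
    case (add x z)
    then show ?case using y by (simp add: T.l_distr comp_add)
  qed
qed

lemma gen_comp1 [simp]: "u \<in> carrier U \<Longrightarrow> gen u \<in> component T 1"
  using comp_W[of "[u]"] by (simp add: W_one)

declare gen_comp1[unfolded One_nat_def, simp]

lemma comp_1: "component T 1 = gen ` carrier U"
proof
  show "component T 1 \<subseteq> gen ` carrier U"
  proof
    fix t assume "t \<in> component T 1"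
    then have "t \<in> component T (Suc 0)" by simp
    then show "t \<in> gen ` carrier U"
    proof (induction rule: comp_word_induct)
      case (word w)
      then obtain u where "w = [u]" "u \<in> carrier U" by (cases w) (auto simp: tensor_words_def)
      then show ?case by (simp add: W_one)
    next
      case (diff x y)
      then obtain u v where "u \<in> carrier U" "v \<in> carrier U" "x = gen u" "y = gen v" by blast
      then have "x \<ominus>\<^bsub>T\<^esub> y = gen (u \<oplus> \<ominus> v)" "u \<oplus> \<ominus> v \<in> carrier U"
        by (simp_all add: T.minus_eq gen_add gen_uminus)
      then show ?case by blast
    qed
  qed
qed auto

lemma T_decomposition:
  assumes "x \<in> carrier T" shows "\<exists>f N. (\<forall>i. f i \<in> component T i) \<and> x = (\<Oplus>\<^bsub>T\<^esub>i\<in>{..N::nat}. f i)"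
  using assms
proof (induction rule: T_induct_left)
  case (base b)
  show ?case
    by (rule exI[of _ "\<lambda>i. if i = 0 then inB b else \<zero>\<^sub>T"], rule exI[of _ 0]) auto
next
  case (add x y)
  then obtain f N g M where f: "\<forall>i. f i \<in> component T i" "x = (\<Oplus>\<^bsub>T\<^esub>i\<in>{..N::nat}. f i)"
    "\<forall>i. g i \<in> component T i" "y = (\<Oplus>\<^bsub>T\<^esub>i\<in>{..M::nat}. g i)" by blast
  define h where "h i = (if i \<le> N then f i else \<zero>\<^sub>T) \<oplus>\<^sub>T (if i \<le> M then g i else \<zero>\<^sub>T)" for i
  have fc: "f i \<in> carrier T" "g i \<in> carrier T" for i using f comp_sub by blast+
  have "(\<Oplus>\<^bsub>T\<^esub>i\<in>{..max N M}. if i \<le> N then f i else \<zero>\<^sub>T) = x" unfolding f(2)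
    by (rule T.add.finprod_mono_neutral_cong_right) (use fc in auto)
  moreover have "(\<Oplus>\<^bsub>T\<^esub>i\<in>{..max N M}. if i \<le> M then g i else \<zero>\<^sub>T) = y" unfolding f(4)
    by (rule T.add.finprod_mono_neutral_cong_right) (use fc in auto)
  moreover have "(\<Oplus>\<^bsub>T\<^esub>i\<in>{..max N M}. h i) = (\<Oplus>\<^bsub>T\<^esub>i\<in>{..max N M}. if i \<le> N then f i else \<zero>\<^sub>T) \<oplus>\<^sub>T
      (\<Oplus>\<^bsub>T\<^esub>i\<in>{..max N M}. if i \<le> M then g i else \<zero>\<^sub>T)"
    unfolding h_def by (rule T.add.finprod_multf) (use fc in auto)
  moreover have "h i \<in> component T i" for i unfolding h_def using f by (auto intro: comp_add)
  ultimately show ?case by (intro exI[of _ h] exI[of _ "max N M"]) simp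
next
  case (gen u t)
  then obtain f N where f: "\<forall>i. f i \<in> component T i" "t = (\<Oplus>\<^bsub>T\<^esub>i\<in>{..N::nat}. f i)" by blast
  have fc: "f i \<in> carrier T" for i using f comp_sub by blast
  \<comment> \<open>Multiplication by a generator shifts degrees by one; the new part of degree 0 is
    zero.\<close>
  define h where "h i = (case i of 0 \<Rightarrow> \<zero>\<^sub>T | Suc j \<Rightarrow> gen u \<otimes>\<^sub>T f j)" for i
  have hc: "h i \<in> component T i" for i using f gen gen_comp by (auto simp: h_def split: nat.split)
  have hcc: "h i \<in> carrier T" for i using hc comp_sub by blast
  have "(\<Oplus>\<^bsub>T\<^esub>i\<in>{..n}. gen u \<otimes>\<^sub>T f i) = (\<Oplus>\<^bsub>T\<^esub>i\<in>{..Suc n}. h i)" for n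
  proof (induction n)
    case 0
    have "h 0 = \<zero>\<^sub>T" "h (Suc 0) = gen u \<otimes>\<^sub>T f 0" by (simp_all add: h_def)
    then show ?case using fc gen hcc by (subst T.finsum_Suc) auto
  next
    case (Suc n)
    have "(\<Oplus>\<^bsub>T\<^esub>i\<in>{..Suc (Suc n)}. h i) = h (Suc (Suc n)) \<oplus>\<^sub>T (\<Oplus>\<^bsub>T\<^esub>i\<in>{..Suc n}. h i)"
      using hcc by (intro T.finsum_Suc) auto
    moreover have "(\<Oplus>\<^bsub>T\<^esub>i\<in>{..Suc n}. gen u \<otimes>\<^sub>T f i) = gen u \<otimes>\<^sub>T f (Suc n) \<oplus>\<^sub>T (\<Oplus>\<^bsub>T\<^esub>i\<in>{..n}. gen u \<otimes>\<^sub>T f i)"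
      using fc gen by (intro T.finsum_Suc) auto
    ultimately show ?case using Suc by (simp add: h_def)
  qed
  moreover have "gen u \<otimes>\<^sub>T t = (\<Oplus>\<^bsub>T\<^esub>i\<in>{..N}. gen u \<otimes>\<^sub>T f i)"
    unfolding f(2) by (rule T.finsum_rdistr) (use gen fc in auto)
  ultimately show ?case using hc by (intro exI[of _ h] exI[of _ "Suc N"]) simp
qed

lemma eta_central: "t \<in> carrier T \<Longrightarrow> t \<otimes>\<^sub>T inB (eta c) = inB (eta c) \<otimes>\<^sub>T t"
proof (induction rule: T_induct_left)
  case (base b)
  then show ?case by (simp add: inB_mult[symmetric] eta_comm)
next
  case (add x y)
  then show ?case by (simp add: T.l_distr T.r_distr)
next
  case (gen u t)
  have "gen u \<otimes>\<^sub>T t \<otimes>\<^sub>T inB (eta c) = (gen u \<otimes>\<^sub>T inB (eta c)) \<otimes>\<^sub>T t" using gen by (simp add: T.m_assoc)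
  also have "gen u \<otimes>\<^sub>T inB (eta c) = inB (eta c) \<otimes>\<^sub>T gen u" using gen by (simp add: inB_gen gen_inB eta_act)
  finally show ?case using gen by (simp add: T.m_assoc)
qed

lemma T_galg: "galg T"
proof (rule galg.intro[OF T_ring], rule galg_axioms.intro)
  show "\<one>\<^bsub>T\<^esub> \<in> component T 0" using comp_inB[of 1] by (simp add: inB_one)
  show "\<exists>p. (\<forall>n. \<forall>x \<in> carrier T. \<forall>y \<in> carrier T. p n (x \<oplus>\<^sub>T y) = p n x \<oplus>\<^sub>T p n y) \<and>
      (\<forall>n m. \<forall>x \<in> component T m. p n x = (if n = m then x else \<zero>\<^sub>T))" by (rule T_projection)
qed (rule comp_subgroup | erule (1) comp_mult | erule T_decomposition | (simp add: T_smult_eq eta_add eta_mult inB_add inB_mult inB_one; fail) | simp add: T_smult_eq eta_central)+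

sublocale T: galg T by (rule T_galg)

section \<open>Maps on U \<otimes> T and T \<otimes> U\<close>

definition "lift_map H L \<longleftrightarrow> (\<forall>t \<in> carrier T. L t \<in> carrier H) \<and>
    (\<forall>s \<in> carrier T. \<forall>t \<in> carrier T. L (s \<oplus>\<^sub>T t) = L s \<oplus>\<^bsub>H\<^esub> L t) \<and>
    (\<forall>b. L (inB b) = \<zero>\<^bsub>H\<^esub>)"

lemma lift_mapD:
  "lift_map H L \<Longrightarrow> t \<in> carrier T \<Longrightarrow> L t \<in> carrier H"
  "lift_map H L \<Longrightarrow> s \<in> carrier T \<Longrightarrow> t \<in> carrier T \<Longrightarrow> L (s \<oplus>\<^sub>T t) = L s \<oplus>\<^bsub>H\<^esub> L t"
  "lift_map H L \<Longrightarrow> L (inB b) = \<zero>\<^bsub>H\<^esub>"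
  by (auto simp: lift_map_def)

text \<open>The universal property of U \<otimes> T over the base ring, transported along the
  identification of U \<otimes> T with the part of \<open>T\<close> of positive degree; on degree 0
  the lift is set to zero. On words the function splits off the first letter, and the induction over
  t extends the formula from words to all second factors.\<close>

lemma left_lift:
  assumes H: "abelian_group H"
    and f: "\<And>u t. u \<in> carrier U \<Longrightarrow> t \<in> carrier T \<Longrightarrow> f u t \<in> carrier H"
      "\<And>u v t. u \<in> carrier U \<Longrightarrow> v \<in> carrier U \<Longrightarrow> t \<in> carrier T \<Longrightarrow> f (u \<oplus> v) t = f u t \<oplus>\<^bsub>H\<^esub> f v t"
      "\<And>u s t. u \<in> carrier U \<Longrightarrow> s \<in> carrier T \<Longrightarrow> t \<in> carrier T \<Longrightarrow> f u (s \<oplus>\<^sub>T t) = f u s \<oplus>\<^bsub>H\<^esub> f u t"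
      "\<And>u t b. u \<in> carrier U \<Longrightarrow> t \<in> carrier T \<Longrightarrow> f (rsmult U u b) t = f u (inB b \<otimes>\<^sub>T t)"
  shows "\<exists>L. lift_map H L \<and> (\<forall>u \<in> carrier U. \<forall>t \<in> carrier T. L (gen u \<otimes>\<^sub>T t) = f u t)"
proof -
  interpret H: abelian_group H by fact
  let ?F = "\<lambda>w. f (hd w) (W (tl w))"
  have add: "?F (p @ (u \<oplus> v) # q) = ?F (p @ u # q) \<oplus>\<^bsub>H\<^esub> ?F (p @ v # q)"
    if "set p \<subseteq> carrier U" "set q \<subseteq> carrier U" "u \<in> carrier U" "v \<in> carrier U" for p q u v
    using that f by (cases p) (auto simp: W_add)
  have bal: "?F (p @ rsmult U u b # v # q) = ?F (p @ u # (b \<odot> v) # q)"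
    if "set p \<subseteq> carrier U" "set q \<subseteq> carrier U" "u \<in> carrier U" "v \<in> carrier U" for p q u v b
    using that f(4) by (cases p) (auto simp: W_bal W_Cons T.m_assoc inB_gen[symmetric])
  have "\<exists>D. (\<forall>t \<in> carrier T. D t \<in> carrier H) \<and>
    (\<forall>s \<in> carrier T. \<forall>t \<in> carrier T. D (s \<oplus>\<^sub>T t) = D s \<oplus>\<^bsub>H\<^esub> D t) \<and>
    (\<forall>b. D (inB b) = \<zero>\<^bsub>H\<^esub>) \<and> (\<forall>w \<in> words. D (W w) = ?F w)"
  proof (rule T_lift[OF H])
    fix w assume "w \<in> words"
    then show "?F w \<in> carrier H" by (elim word_cases) (simp add: f)
  qed (fact add | fact bal | simp)+
  then obtain D where D: "\<And>t. t \<in> carrier T \<Longrightarrow> D t \<in> carrier H"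
    "\<And>s t. s \<in> carrier T \<Longrightarrow> t \<in> carrier T \<Longrightarrow> D (s \<oplus>\<^sub>T t) = D s \<oplus>\<^bsub>H\<^esub> D t"
    "\<And>b. D (inB b) = \<zero>\<^bsub>H\<^esub>" "\<And>w. w \<in> words \<Longrightarrow> D (W w) = ?F w" by blast
  have "D (gen u \<otimes>\<^sub>T t) = f u t" if u: "u \<in> carrier U" and t: "t \<in> carrier T" for u t
    using t
  proof (induction rule: T_word_induct)
    case (base b)
    have "D (W [rsmult U u b]) = f u (inB b)" using u f(4)[of u "\<one>\<^bsub>T\<^esub>"] by (subst D(4)) auto
    then show ?case using u by (simp add: W_one gen_inB)
  next
    case (word w)
    then have "D (W (u # w)) = f u (W w)" using u by (subst D(4)) (auto simp: tensor_words_def)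
    then show ?case using u word by (simp add: W_Cons tensor_words_def)
  next
    case (diff x y)
    have "gen u \<otimes>\<^sub>T x = gen u \<otimes>\<^sub>T (x \<ominus>\<^bsub>T\<^esub> y) \<oplus>\<^sub>T gen u \<otimes>\<^sub>T y" "x = (x \<ominus>\<^bsub>T\<^esub> y) \<oplus>\<^sub>T y"
      using diff u by (simp_all add: T.minus_eq T.r_distr[symmetric] T.a_assoc T.l_neg)
    then have "D (gen u \<otimes>\<^sub>T (x \<ominus>\<^bsub>T\<^esub> y)) \<oplus>\<^bsub>H\<^esub> f u y = f u (x \<ominus>\<^bsub>T\<^esub> y) \<oplus>\<^bsub>H\<^esub> f u y"
      using diff u D(2)[of "gen u \<otimes>\<^sub>T (x \<ominus>\<^bsub>T\<^esub> y)" "gen u \<otimes>\<^sub>T y"] f(3)[of u "x \<ominus>\<^bsub>T\<^esub> y" y] by simp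
    then show ?case using diff u D f by (subst (asm) H.add.right_cancel) auto
  qed
  then show ?thesis using D unfolding lift_map_def by blast
qed

text \<open>The same for T \<otimes> U: the last letter is split off, and scalars cross from the
  left action on u to the right end of t.\<close>

lemma right_lift:
  assumes H: "abelian_group H"
    and f: "\<And>u t. u \<in> carrier U \<Longrightarrow> t \<in> carrier T \<Longrightarrow> f t u \<in> carrier H"
      "\<And>u v t. u \<in> carrier U \<Longrightarrow> v \<in> carrier U \<Longrightarrow> t \<in> carrier T \<Longrightarrow> f t (u \<oplus> v) = f t u \<oplus>\<^bsub>H\<^esub> f t v"
      "\<And>u s t. u \<in> carrier U \<Longrightarrow> s \<in> carrier T \<Longrightarrow> t \<in> carrier T \<Longrightarrow> f (s \<oplus>\<^sub>T t) u = f s u \<oplus>\<^bsub>H\<^esub> f t u"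
      "\<And>u t b. u \<in> carrier U \<Longrightarrow> t \<in> carrier T \<Longrightarrow> f t (b \<odot> u) = f (t \<otimes>\<^sub>T inB b) u"
  shows "\<exists>L. lift_map H L \<and> (\<forall>u \<in> carrier U. \<forall>t \<in> carrier T. L (t \<otimes>\<^sub>T gen u) = f t u)"
proof -
  interpret H: abelian_group H by fact
  let ?F = "\<lambda>w. f (W (butlast w)) (last w)"
  have add: "?F (p @ (u \<oplus> v) # q) = ?F (p @ u # q) \<oplus>\<^bsub>H\<^esub> ?F (p @ v # q)"
    if "set p \<subseteq> carrier U" "set q \<subseteq> carrier U" "u \<in> carrier U" "v \<in> carrier U" for p q u v
    using that f by (cases q rule: rev_cases) (auto simp: butlast_append W_add)
  have bal: "?F (p @ rsmult U u b # v # q) = ?F (p @ u # (b \<odot> v) # q)"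
    if "set p \<subseteq> carrier U" "set q \<subseteq> carrier U" "u \<in> carrier U" "v \<in> carrier U" for p q u v b
    using that f(4) W_bal[of p _ u v b]
    by (cases q rule: rev_cases) (auto simp: butlast_append W_snoc T.m_assoc gen_inB[symmetric])
  have "\<exists>D. (\<forall>t \<in> carrier T. D t \<in> carrier H) \<and>
    (\<forall>s \<in> carrier T. \<forall>t \<in> carrier T. D (s \<oplus>\<^sub>T t) = D s \<oplus>\<^bsub>H\<^esub> D t) \<and>
    (\<forall>b. D (inB b) = \<zero>\<^bsub>H\<^esub>) \<and> (\<forall>w \<in> words. D (W w) = ?F w)"
  proof (rule T_lift[OF H])
    fix w assume "w \<in> words"
    then show "?F w \<in> carrier H" by (elim word_cases_rev) (simp add: f)
  qed (fact add | fact bal | simp)+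
  then obtain D where D: "\<And>t. t \<in> carrier T \<Longrightarrow> D t \<in> carrier H"
    "\<And>s t. s \<in> carrier T \<Longrightarrow> t \<in> carrier T \<Longrightarrow> D (s \<oplus>\<^sub>T t) = D s \<oplus>\<^bsub>H\<^esub> D t"
    "\<And>b. D (inB b) = \<zero>\<^bsub>H\<^esub>" "\<And>w. w \<in> words \<Longrightarrow> D (W w) = ?F w" by blast
  have "D (t \<otimes>\<^sub>T gen u) = f t u" if u: "u \<in> carrier U" and t: "t \<in> carrier T" for u t
    using t
  proof (induction rule: T_word_induct)
    case (base b)
    have "D (W [b \<odot> u]) = f (inB b) u" using u f(4)[of u "\<one>\<^bsub>T\<^esub>"] by (subst D(4)) auto
    then show ?case using u by (simp add: W_one inB_gen)
  next
    case (word w)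
    then have "D (W (w @ [u])) = f (W w) u" using u by (subst D(4)) (auto simp: tensor_words_def)
    then show ?case using u word by (simp add: W_snoc tensor_words_def)
  next
    case (diff x y)
    have "x \<otimes>\<^sub>T gen u = (x \<ominus>\<^bsub>T\<^esub> y) \<otimes>\<^sub>T gen u \<oplus>\<^sub>T y \<otimes>\<^sub>T gen u" "x = (x \<ominus>\<^bsub>T\<^esub> y) \<oplus>\<^sub>T y"
      using diff u by (simp_all add: T.minus_eq T.l_distr[symmetric] T.a_assoc T.l_neg)
    then have "D ((x \<ominus>\<^bsub>T\<^esub> y) \<otimes>\<^sub>T gen u) \<oplus>\<^bsub>H\<^esub> f y u = f (x \<ominus>\<^bsub>T\<^esub> y) u \<oplus>\<^bsub>H\<^esub> f y u"
      using diff u D(2)[of "(x \<ominus>\<^bsub>T\<^esub> y) \<otimes>\<^sub>T gen u" "y \<otimes>\<^sub>T gen u"] f(3)[of u "x \<ominus>\<^bsub>T\<^esub> y" y] by simp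
    then show ?case using diff u D f by (subst (asm) H.add.right_cancel) auto
  qed
  then show ?thesis using D unfolding lift_map_def by blast
qed

text \<open>The lift that returns the letter of a word of length one, and zero otherwise, is a left
  inverse of \<open>gen\<close>.\<close>

lemma gen_eq_zero:
  assumes u: "u \<in> carrier U" and z: "gen u = \<zero>\<^sub>T" shows "u = \<zero>"
proof -
  have "\<exists>L. (\<forall>t \<in> carrier T. L t \<in> carrier U) \<and>
    (\<forall>s \<in> carrier T. \<forall>t \<in> carrier T. L (s \<oplus>\<^sub>T t) = L s \<oplus> L t) \<and>
    (\<forall>b. L (inB b) = \<zero>) \<and> (\<forall>w \<in> words. L (W w) = (if length w = 1 then hd w else \<zero>))"
  proof (rule T_lift[OF abelian_group_axioms])
    fix w assume "w \<in> words"
    then show "(if length w = 1 then hd w else \<zero>) \<in> carrier U" by (elim word_cases) simp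
  qed auto
  then obtain L where L: "\<And>b. L (inB b) = \<zero>" "\<And>w. w \<in> words \<Longrightarrow> L (W w) = (if length w = 1 then hd w else \<zero>)"
    by blast
  then have "L (W [u]) = u" using u by simp
  then show ?thesis using z L(1)[of 0] by (simp add: W_one inB_zero)
qed

end

text \<open>\<open>T_lift\<close> yields only an additive map. Multiplicativity is built up in the
  left factor: base elements, generators, and then everything by
  \<open>T_induct_left\<close>.\<close>

lemma (in bimod) universal_property:
  assumes A: "ring A"
    and phi: "\<And>b. phi b \<in> carrier A" "\<And>b c. phi (b + c) = phi b \<oplus>\<^bsub>A\<^esub> phi c"
      "\<And>b c. phi (b * c) = phi b \<otimes>\<^bsub>A\<^esub> phi c" "phi 1 = \<one>\<^bsub>A\<^esub>"
    and f: "\<And>u. u \<in> carrier U \<Longrightarrow> f u \<in> carrier A"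
      "\<And>u v. u \<in> carrier U \<Longrightarrow> v \<in> carrier U \<Longrightarrow> f (u \<oplus> v) = f u \<oplus>\<^bsub>A\<^esub> f v"
      "\<And>u b. u \<in> carrier U \<Longrightarrow> f (rsmult U u b) = f u \<otimes>\<^bsub>A\<^esub> phi b"
      "\<And>u b. u \<in> carrier U \<Longrightarrow> f (b \<odot> u) = phi b \<otimes>\<^bsub>A\<^esub> f u"
  obtains J where "J \<in> ring_hom T A" "\<And>b. J (inB b) = phi b" "\<And>u. u \<in> carrier U \<Longrightarrow> J (gen u) = f u"
proof -
  interpret A: ring A by fact
  let ?F = "\<lambda>w. foldr (\<lambda>u x. f u \<otimes>\<^bsub>A\<^esub> x) w \<one>\<^bsub>A\<^esub>"
  have Fc: "set w \<subseteq> carrier U \<Longrightarrow> ?F w \<in> carrier A" for w by (induction w) (auto simp: f)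
  have add: "?F (p @ (u \<oplus> v) # q) = ?F (p @ u # q) \<oplus>\<^bsub>A\<^esub> ?F (p @ v # q)"
    if "set p \<subseteq> carrier U" "set q \<subseteq> carrier U" "u \<in> carrier U" "v \<in> carrier U" for p q u v
    using that
  proof (induction p)
    case Nil
    then show ?case using f Fc by (simp add: A.l_distr)
  next
    case (Cons a p)
    have "?F (p @ u # q) \<in> carrier A" "?F (p @ v # q) \<in> carrier A" by (rule Fc; use Cons in auto)+
    then show ?case using Cons f by (simp add: A.r_distr)
  qed
  have bal: "?F (p @ rsmult U u b # v # q) = ?F (p @ u # (b \<odot> v) # q)"
    if "set p \<subseteq> carrier U" "set q \<subseteq> carrier U" "u \<in> carrier U" "v \<in> carrier U" for p q u v b
    using that f phi Fc by (induction p) (auto simp: A.m_assoc)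
  have "\<exists>J. (\<forall>t \<in> carrier T. J t \<in> carrier A) \<and>
    (\<forall>s \<in> carrier T. \<forall>t \<in> carrier T. J (s \<oplus>\<^sub>T t) = J s \<oplus>\<^bsub>A\<^esub> J t) \<and>
    (\<forall>b. J (inB b) = phi b) \<and> (\<forall>w \<in> words. J (W w) = ?F w)"
  proof (rule T_lift)
    fix w assume "w \<in> words"
    then show "?F w \<in> carrier A" by (simp add: Fc tensor_words_def)
  qed (fact add | fact bal | simp add: phi A.abelian_group_axioms)+
  then obtain J where J: "\<And>t. t \<in> carrier T \<Longrightarrow> J t \<in> carrier A"
    "\<And>s t. s \<in> carrier T \<Longrightarrow> t \<in> carrier T \<Longrightarrow> J (s \<oplus>\<^sub>T t) = J s \<oplus>\<^bsub>A\<^esub> J t"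
    "\<And>b. J (inB b) = phi b" "\<And>w. w \<in> words \<Longrightarrow> J (W w) = ?F w" by blast
  have J1: "J \<one>\<^bsub>T\<^esub> = \<one>\<^bsub>A\<^esub>" using J(3)[of 1] phi by (simp add: inB_one)
  have JW: "J (W w) = ?F w" if "set w \<subseteq> carrier U" for w
    using that J1 J(4) by (cases "w = []") (auto simp: tensor_words_def)
  have Jg: "J (gen u) = f u" if "u \<in> carrier U" for u using JW[of "[u]"] that f by (simp add: W_one)
  have J0: "J \<zero>\<^sub>T = \<zero>\<^bsub>A\<^esub>" using J(3)[of 0] phi(2)[of 0 0] phi(1)[of 0] by (simp add: inB_zero)
  have Jm: "J (\<ominus>\<^bsub>T\<^esub> x) = \<ominus>\<^bsub>A\<^esub> J x" if "x \<in> carrier T" for x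
    by (rule A.minus_equality[symmetric]) (use that J in \<open>simp_all add: J(2)[symmetric] T.l_neg J0\<close>)
  have Jb: "J (inB b \<otimes>\<^sub>T t) = phi b \<otimes>\<^bsub>A\<^esub> J t" if "t \<in> carrier T" for b t
    using that
  proof (induction rule: T_word_induct)
    case (base c)
    then show ?case by (simp add: inB_mult[symmetric] J(3) phi)
  next
    case (word w)
    then obtain u w' where w: "w = u # w'" "u \<in> carrier U" "set w' \<subseteq> carrier U" by (rule word_cases)
    then have "inB b \<otimes>\<^sub>T W w = W ((b \<odot> u) # w')" by (simp add: W_Cons inB_gen[symmetric] T.m_assoc)
    then show ?case using w f phi Fc by (simp add: JW A.m_assoc)
  next
    case (diff x y)
    then show ?case using phi J by (simp add: T.minus_eq T.r_distr T.r_minus Jm A.minus_eq A.r_distr A.r_minus)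
  qed
  have Jgt: "J (gen u \<otimes>\<^sub>T t) = f u \<otimes>\<^bsub>A\<^esub> J t" if "u \<in> carrier U" "t \<in> carrier T" for u t
    using that(2)
  proof (induction rule: T_word_induct)
    case (base c)
    then show ?case using that(1) by (simp add: gen_inB Jg J(3) f)
  next
    case (word w)
    then have w: "set w \<subseteq> carrier U" by (simp add: tensor_words_def)
    then have "gen u \<otimes>\<^sub>T W w = W (u # w)" using that by (simp add: W_Cons)
    then show ?case using w that by (simp add: JW)
  next
    case (diff x y)
    then show ?case using that f J by (simp add: T.minus_eq T.r_distr T.r_minus Jm A.minus_eq A.r_distr A.r_minus)
  qed
  have Jmult: "J (s \<otimes>\<^sub>T t) = J s \<otimes>\<^bsub>A\<^esub> J t" if "s \<in> carrier T" "t \<in> carrier T" for s t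
    using that(1)
  proof (induction rule: T_induct_left)
    case (base b)
    then show ?case using that by (simp add: Jb J(3))
  next
    case (add x y)
    then show ?case using that J by (simp add: T.l_distr A.l_distr)
  next
    case (gen u x)
    then show ?case using that J f by (simp add: T.m_assoc Jgt A.m_assoc)
  qed
  show ?thesis
    by (rule that[of J]) (use J J1 Jmult Jg in \<open>auto intro!: ring_hom_memI\<close>)
qed

lemma UN_const_eq:
  assumes "x \<in> A" "\<And>y. y \<in> A \<Longrightarrow> f y = c" shows "(\<Union>y\<in>A. f y) = c"
  using assms by blast

section \<open>Quotients by ideals\<close>

context galg
begin

lemma add_diff_cancel:
  assumes "x \<in> carrier A" "y \<in> carrier A"
  shows "x \<ominus> y \<oplus> y = x" "y \<oplus> (x \<ominus> y) = x" "x \<oplus> y \<ominus> y = x" "x \<oplus> y \<ominus> x = y" "x \<ominus> (x \<ominus> y) = y"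
  using assms by algebra+

lemma diff_diff_cancel:
  assumes "x \<in> carrier A" "y \<in> carrier A" "z \<in> carrier A"
  shows "(x \<ominus> z) \<oplus> (z \<ominus> y) = x \<ominus> y" "(x \<ominus> z) \<ominus> (y \<ominus> z) = x \<ominus> y"
    "x \<ominus> (y \<oplus> z) = x \<ominus> z \<ominus> y"
  using assms by algebra+

lemma diff_add_diff:
  assumes "x \<in> carrier A" "y \<in> carrier A" "u \<in> carrier A" "v \<in> carrier A"
  shows "(x \<oplus> y) \<ominus> (u \<oplus> v) = (x \<ominus> u) \<oplus> (y \<ominus> v)"
  using assms by algebra

lemma quotient_carrier: "carrier (quotient_algebra A I) = {I +> x | x. x \<in> carrier A}"
  by (auto simp: quotient_algebra_def FactRing_simps)

lemma quotient_zero: "\<zero>\<^bsub>quotient_algebra A I\<^esub> = I"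
  by (simp add: quotient_algebra_def FactRing_def)

lemma quotient_one: "\<one>\<^bsub>quotient_algebra A I\<^esub> = I +> \<one>"
  by (simp add: quotient_algebra_def FactRing_def)

lemma quotient_add: "ideal I A \<Longrightarrow> x \<in> carrier A \<Longrightarrow> y \<in> carrier A \<Longrightarrow>
    (I +> x) \<oplus>\<^bsub>quotient_algebra A I\<^esub> (I +> y) = I +> (x \<oplus> y)"
  by (simp add: quotient_algebra_def FactRing_def abelian_subgroup.a_rcos_sum
      ideal.axioms(1) abelian_subgroupI3 is_abelian_group)

lemma quotient_mult: "ideal I A \<Longrightarrow> x \<in> carrier A \<Longrightarrow> y \<in> carrier A \<Longrightarrow>
    (I +> x) \<otimes>\<^bsub>quotient_algebra A I\<^esub> (I +> y) = I +> (x \<otimes> y)"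
  by (simp add: quotient_algebra_def FactRing_def ideal.rcoset_mult_add)

lemma rcos_eq_iff:
  assumes "ideal I A" "x \<in> carrier A" "y \<in> carrier A" shows "I +> x = I +> y \<longleftrightarrow> x \<ominus> y \<in> I"
proof -
  interpret ideal I A by fact
  show ?thesis
  proof
    assume "I +> x = I +> y"
    then have "x \<in> I +> y" using a_rcos_self[OF assms(2)] by simp
    then show "x \<ominus> y \<in> I" using a_rcos_module_minus[OF ring_axioms assms(3,2)] by simp
  next
    assume "x \<ominus> y \<in> I"
    then have "x \<in> I +> y" using a_rcos_module_minus[OF ring_axioms assms(3,2)] by simp
    then show "I +> x = I +> y" using a_repr_independence'[OF _ assms(3)] by simp
  qed
qed

lemma rcos_mem_iff:
  assumes "ideal I A" "x \<in> carrier A" "y \<in> carrier A" shows "y \<in> I +> x \<longleftrightarrow> y \<ominus> x \<in> I"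
  using abelian_subgroup.a_rcos_module_minus[OF abelian_subgroupI3[OF ideal.axioms(1)[OF assms(1)] is_abelian_group] ring_axioms assms(2,3)]
  by simp

lemma rcos_carrier:
  assumes "ideal I A" "x \<in> carrier A" "y \<in> I +> x" shows "y \<in> carrier A"
  using a_r_coset_subset_G[OF additive_subgroup.a_subset[OF ideal.axioms(1)[OF assms(1)]] assms(2)] assms(3)
  by blast

lemma ideal_smult: "ideal I A \<Longrightarrow> x \<in> I \<Longrightarrow> c \<odot> x \<in> I"
proof -
  assume I: "ideal I A" and x: "x \<in> I"
  interpret ideal I A by fact
  show ?thesis using x smult_one_comp[of c] by (subst smult_eq) (auto intro!: I_l_closed comp_carrier)
qed

lemma smult_add: "x \<in> carrier A \<Longrightarrow> y \<in> carrier A \<Longrightarrow> c \<odot> (x \<oplus> y) = c \<odot> x \<oplus> c \<odot> y"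
  by (simp add: smult_eq[of x] smult_eq[of y] smult_eq[of "x \<oplus> y"] r_distr)

lemma smult_minus: "x \<in> carrier A \<Longrightarrow> y \<in> carrier A \<Longrightarrow> c \<odot> (x \<ominus> y) = c \<odot> x \<ominus> c \<odot> y"
  using smult_add[of x "\<ominus> y" c] smult_eq[of y c] smult_eq[of "\<ominus> y" c]
  by (simp add: minus_eq r_minus)

lemma quotient_smult:
  assumes I: "ideal I A" and x: "x \<in> carrier A"
  shows "c \<odot>\<^bsub>quotient_algebra A I\<^esub> (I +> x) = I +> (c \<odot> x)"
proof -
  have "(\<Union>y\<in>I +> x. I +> c \<odot> y) = I +> c \<odot> x"
  proof (rule UN_const_eq)
    show "x \<in> I +> x" using I x by (simp add: rcos_mem_iff additive_subgroup.zero_closed ideal.axioms(1))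
    fix y assume y: "y \<in> I +> x"
    have "c \<odot> (y \<ominus> x) \<in> I" using y rcos_carrier[OF I x y] I x by (simp add: rcos_mem_iff ideal_smult)
    then show "I +> c \<odot> y = I +> c \<odot> x" using y rcos_carrier[OF I x y] I x by (simp add: rcos_eq_iff smult_minus)
  qed
  then show ?thesis by (simp add: quotient_algebra_def)
qed

lemma quotient_component: "component (quotient_algebra A I) n = (\<lambda>x. I +> x) ` comp n"
  by (simp add: quotient_algebra_def)

lemma rcos_zero: "ideal I A \<Longrightarrow> I +> \<zero> = I"
  by (rule a_coset_add_zero, rule additive_subgroup.a_subset, rule ideal.axioms(1))

lemma quotient_ring:
  assumes I: "ideal I A" shows "ring (quotient_algebra A I)"
proof -
  note s = quotient_add[OF I] quotient_mult[OF I] quotient_one quotient_zero quotient_carrier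
  have z: "\<zero>\<^bsub>quotient_algebra A I\<^esub> = I +> \<zero>" using rcos_zero[OF I] by (simp add: quotient_zero)
  have carr: "I +> x \<in> carrier (quotient_algebra A I)" if "x \<in> carrier A" for x
    using that by (auto simp: quotient_carrier)
  have el: thesis if "X \<in> carrier (quotient_algebra A I)" "\<And>x. x \<in> carrier A \<Longrightarrow> X = I +> x \<Longrightarrow> thesis" for X thesis
    using that by (auto simp: quotient_carrier)
  note s = quotient_add[OF I] quotient_mult[OF I] quotient_one z carr
  show ?thesis
  proof (rule ringI)
    show "abelian_group (quotient_algebra A I)"
    proof (rule abelian_groupI)
      fix X assume "X \<in> carrier (quotient_algebra A I)"
      then obtain x where "x \<in> carrier A" "X = I +> x" by (rule el)
      then show "\<exists>Y\<in>carrier (quotient_algebra A I). Y \<oplus>\<^bsub>quotient_algebra A I\<^esub> X = \<zero>\<^bsub>quotient_algebra A I\<^esub>"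
        by (intro bexI[of _ "I +> (\<ominus> x)"]) (simp_all add: s l_neg)
    qed ((elim el)?, simp add: s a_ac)+
    show "monoid (quotient_algebra A I)"
      by (rule monoidI) ((elim el)?, simp add: s m_assoc)+
  qed ((elim el)?, simp add: s l_distr r_distr)+
qed

end

section \<open>The natural map to the associated graded algebra\<close>

locale filtered_quotient = galg +
  fixes P assumes P_filt: "P \<subseteq> filtration A 2"
begin

abbreviation I where "I \<equiv> Idl P"
abbreviation R where "R \<equiv> hp 2 ` P"
abbreviation IR where "IR \<equiv> Idl R"
abbreviation Q where "Q \<equiv> quotient_algebra A I"

definition prevF :: "nat \<Rightarrow> 'a set" where
  "prevF n = (case n of 0 \<Rightarrow> {\<zero>} | Suc m \<Rightarrow> filtration A m)"

text \<open>The preimage F^(n-1)(A) + I of the filtration step n - 1 of A/I, with F^(-1) = 0.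
  Elements of the associated graded algebra are families of cosets of cosets; \<open>K_eq\<close>
  turns every comparison of such entries into membership of a difference in
  \<open>M n\<close>.\<close>

definition M :: "nat \<Rightarrow> 'a set" where
  "M n = {x \<in> carrier A. \<exists>p\<in>prevF n. x \<ominus> p \<in> I}"

lemma P_carrier: "P \<subseteq> carrier A" using P_filt filt_carrier by blast
lemma R_comp: "R \<subseteq> comp 2" using P_carrier hp_comp by blast
lemma R_carrier: "R \<subseteq> carrier A" using R_comp comp_carrier by blast

sublocale I: ideal I A by (rule genideal_ideal[OF P_carrier])
sublocale IR: ideal IR A by (rule genideal_ideal[OF R_carrier])

lemma I_ideal: "ideal I A" ..
lemma IR_ideal: "ideal IR A" ..

lemma P_I: "p \<in> P \<Longrightarrow> p \<in> I" using genideal_self[OF P_carrier] by blast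
lemma R_IR: "r \<in> R \<Longrightarrow> r \<in> IR" using genideal_self[OF R_carrier] by blast

lemma prevF_carrier: "x \<in> prevF n \<Longrightarrow> x \<in> carrier A"
  by (auto simp: prevF_def split: nat.splits)
lemma prevF_zero [simp]: "\<zero> \<in> prevF n" by (simp add: prevF_def split: nat.split)
lemma prevF_add: "x \<in> prevF n \<Longrightarrow> y \<in> prevF n \<Longrightarrow> x \<oplus> y \<in> prevF n"
  by (auto simp: prevF_def filt_add split: nat.splits)
lemma prevF_uminus: "x \<in> prevF n \<Longrightarrow> \<ominus> x \<in> prevF n"
  by (auto simp: prevF_def filt_uminus split: nat.splits)
lemma prevF_filt: "x \<in> prevF n \<Longrightarrow> x \<in> filtration A n"
  by (auto simp: prevF_def intro: filt_mono split: nat.splits)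
lemma prevF_hp: "x \<in> prevF n \<Longrightarrow> hp n x = \<zero>"
  by (auto simp: prevF_def filtration_iff split: nat.splits)
lemma prevF_top: "x \<in> filtration A n \<Longrightarrow> x \<ominus> hp n x \<in> prevF n"
proof (cases n)
  case 0
  assume "x \<in> filtration A n"
  then show ?thesis using 0 by (simp add: filt_0 hp_hom[of x 0] prevF_def)
next
  case (Suc m)
  assume "x \<in> filtration A n"
  then show ?thesis using Suc filt_top by (simp add: prevF_def)
qed
lemma prevF_mult_l: "x \<in> prevF m \<Longrightarrow> y \<in> filtration A n \<Longrightarrow> x \<otimes> y \<in> prevF (m + n)"
proof (cases m)
  case 0
  assume "x \<in> prevF m" "y \<in> filtration A n"
  then show ?thesis using 0 by (simp add: prevF_def[of 0])
qed (auto simp: prevF_def intro: filt_mult)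
lemma prevF_mult_r: "x \<in> filtration A m \<Longrightarrow> y \<in> prevF n \<Longrightarrow> x \<otimes> y \<in> prevF (m + n)"
proof (cases n)
  case 0
  assume "x \<in> filtration A m" "y \<in> prevF n"
  then show ?thesis using 0 by (simp add: prevF_def[of 0])
qed (auto simp: prevF_def intro: filt_mult)
lemma prevF_smult: "x \<in> prevF n \<Longrightarrow> c \<odot> x \<in> prevF n"
  using prevF_mult_r[of "c \<odot> \<one>" 0 x n] filt_comp[OF smult_one_comp, of 0 c] smult_eq[of x c] prevF_carrier[of x n]
  by simp

lemma M_carrier: "x \<in> M n \<Longrightarrow> x \<in> carrier A" by (simp add: M_def)
lemma prevF_M: "x \<in> prevF n \<Longrightarrow> x \<in> M n"
  using prevF_carrier[of x n] by (auto simp: M_def intro!: bexI[of _ x])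
lemma I_M: "x \<in> I \<Longrightarrow> x \<in> M n"
  by (auto simp: M_def minus_eq intro!: bexI[of _ \<zero>])
lemma M_iff: "x \<in> M n \<longleftrightarrow> (\<exists>p\<in>prevF n. \<exists>i\<in>I. x = p \<oplus> i)"
proof
  assume "x \<in> M n"
  then obtain p where p: "x \<in> carrier A" "p \<in> prevF n" "x \<ominus> p \<in> I" by (auto simp: M_def)
  moreover have "x = p \<oplus> (x \<ominus> p)" using p prevF_carrier[of p n] by (simp add: add_diff_cancel)
  ultimately show "\<exists>p\<in>prevF n. \<exists>i\<in>I. x = p \<oplus> i" by blast
next
  assume "\<exists>p\<in>prevF n. \<exists>i\<in>I. x = p \<oplus> i"
  then obtain p i where p: "p \<in> prevF n" "i \<in> I" "x = p \<oplus> i" by blast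
  then have c: "p \<in> carrier A" "i \<in> carrier A" using prevF_carrier by auto
  then have "x \<ominus> p = i" using p by (simp add: add_diff_cancel)
  then show "x \<in> M n" using p c by (auto simp: M_def intro!: bexI[of _ p])
qed
lemma M_add: "x \<in> M n \<Longrightarrow> y \<in> M n \<Longrightarrow> x \<oplus> y \<in> M n"
proof -
  assume "x \<in> M n" "y \<in> M n"
  then obtain p i p' i' where p: "p \<in> prevF n" "i \<in> I" "x = p \<oplus> i" "p' \<in> prevF n" "i' \<in> I" "y = p' \<oplus> i'"
    by (auto simp: M_iff)
  then have c: "p \<in> carrier A" "i \<in> carrier A" "p' \<in> carrier A" "i' \<in> carrier A" using prevF_carrier by auto
  have "x \<oplus> y = (p \<oplus> p') \<oplus> (i \<oplus> i')" using p c by (simp add: a_ac)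
  then show ?thesis unfolding M_iff using p prevF_add I.a_closed by blast
qed
lemma M_uminus: "x \<in> M n \<Longrightarrow> \<ominus> x \<in> M n"
proof -
  assume "x \<in> M n"
  then obtain p i where p: "p \<in> prevF n" "i \<in> I" "x = p \<oplus> i" by (auto simp: M_iff)
  then have c: "p \<in> carrier A" "i \<in> carrier A" using prevF_carrier by auto
  have "\<ominus> x = \<ominus> p \<oplus> \<ominus> i" using p c by (simp add: minus_add)
  then show ?thesis unfolding M_iff using p prevF_uminus I.a_inv_closed by blast
qed
lemma M_minus: "x \<in> M n \<Longrightarrow> y \<in> M n \<Longrightarrow> x \<ominus> y \<in> M n"
  by (simp add: minus_eq M_add M_uminus)
lemma M_zero [simp]: "\<zero> \<in> M n" by (rule prevF_M) simp

text \<open>Since \<open>M (Suc n)\<close> is F^n + I, the claim is that (F^(m-1) + I)(F^n + I) lies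
  in F^(m+n-1) + I. It controls the error when the left factor of a product in the associated graded
  algebra is changed.\<close>

lemma M_mult_l: "x \<in> M m \<Longrightarrow> y \<in> M (Suc n) \<Longrightarrow> x \<otimes> y \<in> M (m + n)"
proof -
  assume "x \<in> M m" "y \<in> M (Suc n)"
  then obtain p i p' i' where p: "p \<in> prevF m" "i \<in> I" "x = p \<oplus> i" "p' \<in> filtration A n" "i' \<in> I" "y = p' \<oplus> i'"
    by (auto simp: M_iff prevF_def[of "Suc n"])
  then have c: "p \<in> carrier A" "i \<in> carrier A" "p' \<in> carrier A" "i' \<in> carrier A" using prevF_carrier by auto
  have "x \<otimes> y = p \<otimes> p' \<oplus> (p \<otimes> i' \<oplus> i \<otimes> (p' \<oplus> i'))" using p c by (simp add: l_distr r_distr a_ac)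
  moreover have "p \<otimes> i' \<oplus> i \<otimes> (p' \<oplus> i') \<in> I" using p c by (intro I.a_closed I.I_l_closed I.I_r_closed) auto
  ultimately show ?thesis unfolding M_iff using prevF_mult_l[OF p(1,4)] by blast
qed
lemma M_mult_r: "x \<in> M (Suc m) \<Longrightarrow> y \<in> M n \<Longrightarrow> x \<otimes> y \<in> M (m + n)"
proof -
  assume "x \<in> M (Suc m)" "y \<in> M n"
  then obtain p i p' i' where p: "p \<in> filtration A m" "i \<in> I" "x = p \<oplus> i" "p' \<in> prevF n" "i' \<in> I" "y = p' \<oplus> i'"
    by (auto simp: M_iff prevF_def[of "Suc m"])
  then have c: "p \<in> carrier A" "i \<in> carrier A" "p' \<in> carrier A" "i' \<in> carrier A" using prevF_carrier by auto
  have "x \<otimes> y = p \<otimes> p' \<oplus> (p \<otimes> i' \<oplus> i \<otimes> (p' \<oplus> i'))" using p c by (simp add: l_distr r_distr a_ac)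
  moreover have "p \<otimes> i' \<oplus> i \<otimes> (p' \<oplus> i') \<in> I" using p c by (intro I.a_closed I.I_l_closed I.I_r_closed) auto
  ultimately show ?thesis unfolding M_iff using prevF_mult_r[OF p(1,4)] by blast
qed
lemma M_smult: "x \<in> M n \<Longrightarrow> c \<odot> x \<in> M n"
proof -
  assume "x \<in> M n"
  then obtain p i where p: "p \<in> prevF n" "i \<in> I" "x = p \<oplus> i" by (auto simp: M_iff)
  then have "c \<odot> x = c \<odot> p \<oplus> c \<odot> i" using prevF_carrier by (simp add: smult_add)
  then show ?thesis unfolding M_iff using p prevF_smult ideal_smult[OF I_ideal] by blast
qed
lemma filt_M: "x \<in> filtration A n \<Longrightarrow> x \<in> M (Suc n)" by (rule prevF_M) (simp add: prevF_def)
lemma M_Suc: "x \<in> M n \<Longrightarrow> x \<in> M (Suc n)"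
  unfolding M_iff using prevF_filt[of _ n] by (fastforce simp: prevF_def[of "Suc n"])

text \<open>This makes the natural map well defined. The elements all of whose homogeneous parts
  satisfy the claim form an ideal, so the generators suffice: r = \<open>hp 2 p\<close> differs from
  p \<in> I by p - r \<in> F^1.\<close>

lemma IR_M:
  assumes "y \<in> IR" shows "hp n y \<in> M n"
proof -
  let ?Y = "{y \<in> carrier A. \<forall>n. hp n y \<in> M n}"
  have "ideal ?Y A"
  proof (rule idealI[OF ring_axioms])
    show "subgroup ?Y (add_monoid A)"
      by unfold_locales (auto simp: hp_add M_add hp_uminus M_uminus a_inv_def[symmetric])
    fix a x assume a: "a \<in> ?Y" and x: "x \<in> carrier A"
    from x have "\<forall>n. hp n (x \<otimes> a) \<in> M n"
    proof (induction rule: graded_induct)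
      case (hom x i)
      have "i \<le> n \<Longrightarrow> x \<otimes> hp (n - i) a \<in> M n" for n
        using M_mult_r[of x i "hp (n - i) a" "n - i"] a hom by (auto intro: filt_M filt_comp)
      then show ?case using a hom by (auto simp: hp_mult_l)
    next
      case (add x y)
      then show ?case using a by (simp add: hp_add l_distr M_add)
    qed
    then show "x \<otimes> a \<in> ?Y" using a x by simp
    from x have "\<forall>n. hp n (a \<otimes> x) \<in> M n"
    proof (induction rule: graded_induct)
      case (hom x i)
      have "i \<le> n \<Longrightarrow> hp (n - i) a \<otimes> x \<in> M n" for n
        using M_mult_l[of "hp (n - i) a" "n - i" x i] a hom by (auto intro: filt_M filt_comp)
      then show ?case using a hom by (auto simp: hp_mult_r)
    next
      case (add x y)
      then show ?case using a by (simp add: hp_add r_distr M_add)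
    qed
    then show "a \<otimes> x \<in> ?Y" using a x by simp
  qed
  moreover have "R \<subseteq> ?Y"
  proof
    fix r assume "r \<in> R"
    then obtain p where p: "p \<in> P" "r = hp 2 p" by blast
    then have pc: "p \<in> filtration A 2" "r \<in> comp 2" using P_filt R_comp by auto
    have "r \<in> M 2"
    proof -
      have "p \<ominus> r \<in> M 2" using prevF_top[OF pc(1)] p by (intro prevF_M) simp
      then have "p \<ominus> (p \<ominus> r) \<in> M 2" using M_minus[OF I_M[OF P_I[OF p(1)]]] by blast
      moreover have "p \<ominus> (p \<ominus> r) = r" using pc by (simp add: add_diff_cancel)
      ultimately show ?thesis by simp
    qed
    then show "r \<in> ?Y" using pc by (auto simp: hp_hom)
  qed
  ultimately have "IR \<subseteq> ?Y" by (rule genideal_minimal)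
  then show ?thesis using assms by blast
qed

text \<open>The ideal is homogeneous because its generators are; again the elements with the
  required homogeneous parts form an ideal.\<close>

lemma IR_hp: "x \<in> IR \<Longrightarrow> hp n x \<in> IR"
proof -
  let ?Y = "{y \<in> carrier A. \<forall>n. hp n y \<in> IR}"
  have "ideal ?Y A"
  proof (rule idealI[OF ring_axioms])
    show "subgroup ?Y (add_monoid A)"
      by unfold_locales (auto simp: hp_add hp_uminus a_inv_def[symmetric])
    fix a x assume a: "a \<in> ?Y" and x: "x \<in> carrier A"
    from x have "\<forall>n. hp n (x \<otimes> a) \<in> IR"
    proof (induction rule: graded_induct)
      case (hom x i)
      then show ?case using a by (auto simp: hp_mult_l intro: IR.I_l_closed)
    next
      case (add x y)
      then show ?case using a by (simp add: hp_add l_distr)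
    qed
    then show "x \<otimes> a \<in> ?Y" using a x by simp
    from x have "\<forall>n. hp n (a \<otimes> x) \<in> IR"
    proof (induction rule: graded_induct)
      case (hom x i)
      then show ?case using a by (auto simp: hp_mult_r intro: IR.I_r_closed)
    next
      case (add x y)
      then show ?case using a by (simp add: hp_add r_distr)
    qed
    then show "a \<otimes> x \<in> ?Y" using a x by simp
  qed
  moreover have "R \<subseteq> ?Y"
  proof
    fix r assume r: "r \<in> R"
    then show "r \<in> ?Y" using R_comp R_IR[OF r] by (auto simp: hp_hom[OF subsetD[OF R_comp r]])
  qed
  ultimately have "IR \<subseteq> ?Y" by (rule genideal_minimal)
  then show "x \<in> IR \<Longrightarrow> hp n x \<in> IR" by blast
qed

lemma IR_hpI:
  assumes "x \<in> carrier A" "\<And>n. hp n x \<in> IR" shows "x \<in> IR"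
proof -
  obtain N where N: "x = (\<Oplus>i\<in>{..N}. hp i x)" using graded_bound[OF assms(1)] by blast
  have "(\<Oplus>i\<in>F. hp i x) \<in> IR" if "finite F" for F
    using that by (induction F rule: finite_induct) (use assms in \<open>auto simp: Pi_def\<close>)
  from this[OF finite_atMost[of N]] show ?thesis by (simp only: N[symmetric])
qed

abbreviation pv where "pv \<equiv> previous Q (filtered_quotient_filtration A P)"
text \<open>The coset of F^(n-1)(A/I) through the class of x; for x in F^n(A) this is a typical n-th
  entry of an element of the associated graded algebra.\<close>

definition K where "K n x = pv n +>\<^bsub>Q\<^esub> (I +> x)"

lemma pv_eq: "pv n = (\<lambda>x. I +> x) ` prevF n"
  by (cases n) (simp_all add: previous_def prevF_def filtered_quotient_filtration_def quotient_zero rcos_zero[OF I_ideal])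

lemma K_mem: "x \<in> carrier A \<Longrightarrow> Z \<in> K n x \<longleftrightarrow> (\<exists>y\<in>carrier A. Z = I +> y \<and> y \<ominus> x \<in> M n)"
proof
  assume x: "x \<in> carrier A" and "Z \<in> K n x"
  then obtain p where p: "p \<in> prevF n" "Z = (I +> p) \<oplus>\<^bsub>Q\<^esub> (I +> x)"
    by (auto simp: K_def pv_eq a_r_coset_def r_coset_def)
  then have "Z = I +> (p \<oplus> x)" "p \<in> carrier A" using x prevF_carrier by (auto simp: quotient_add[OF I_ideal])
  moreover have "(p \<oplus> x) \<ominus> x = p" using x calculation by (simp add: add_diff_cancel)
  ultimately show "\<exists>y\<in>carrier A. Z = I +> y \<and> y \<ominus> x \<in> M n" using x p prevF_M by (intro bexI[of _ "p \<oplus> x"]) auto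
next
  assume x: "x \<in> carrier A" and "\<exists>y\<in>carrier A. Z = I +> y \<and> y \<ominus> x \<in> M n"
  then obtain y where y: "y \<in> carrier A" "Z = I +> y" "y \<ominus> x \<in> M n" by blast
  then obtain p where p: "p \<in> prevF n" "(y \<ominus> x) \<ominus> p \<in> I" by (auto simp: M_def)
  have c: "p \<in> carrier A" using p prevF_carrier by auto
  have "y \<ominus> (p \<oplus> x) = (y \<ominus> x) \<ominus> p" using y x c by (simp add: diff_diff_cancel)
  then have "Z = I +> (p \<oplus> x)" using y x c p by (simp add: rcos_eq_iff[OF I_ideal])
  then have "Z = (I +> p) \<oplus>\<^bsub>Q\<^esub> (I +> x)" using x c by (simp add: quotient_add[OF I_ideal])
  then show "Z \<in> K n x" using p by (auto simp: K_def pv_eq a_r_coset_def r_coset_def)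
qed

lemma K_self: "x \<in> carrier A \<Longrightarrow> I +> x \<in> K n x"
  by (auto simp: K_mem intro!: bexI[of _ x])

lemma K_eq: "x \<in> carrier A \<Longrightarrow> y \<in> carrier A \<Longrightarrow> K n x = K n y \<longleftrightarrow> x \<ominus> y \<in> M n"
proof
  assume c: "x \<in> carrier A" "y \<in> carrier A" and "K n x = K n y"
  then have "I +> x \<in> K n y" using K_self by blast
  then obtain z where z: "z \<in> carrier A" "I +> x = I +> z" "z \<ominus> y \<in> M n" using c by (auto simp: K_mem)
  then have "x \<ominus> z \<in> M n" using c by (intro I_M) (simp add: rcos_eq_iff[OF I_ideal])
  from M_add[OF this z(3)] have "(x \<ominus> z) \<oplus> (z \<ominus> y) \<in> M n" .
  moreover have "(x \<ominus> z) \<oplus> (z \<ominus> y) = x \<ominus> y" using c z by (simp add: diff_diff_cancel)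
  ultimately show "x \<ominus> y \<in> M n" by simp
next
  assume c: "x \<in> carrier A" "y \<in> carrier A" and d: "x \<ominus> y \<in> M n"
  have "z \<ominus> x \<in> M n \<longleftrightarrow> z \<ominus> y \<in> M n" if "z \<in> carrier A" for z
  proof
    assume "z \<ominus> x \<in> M n"
    from M_add[OF this d] have "(z \<ominus> x) \<oplus> (x \<ominus> y) \<in> M n" .
    moreover have "(z \<ominus> x) \<oplus> (x \<ominus> y) = z \<ominus> y" using c that by (simp add: diff_diff_cancel)
    ultimately show "z \<ominus> y \<in> M n" by simp
  next
    assume "z \<ominus> y \<in> M n"
    from M_minus[OF this d] have "(z \<ominus> y) \<ominus> (x \<ominus> y) \<in> M n" .
    moreover have "(z \<ominus> y) \<ominus> (x \<ominus> y) = z \<ominus> x" using c that by (simp add: diff_diff_cancel)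
    ultimately show "z \<ominus> x \<in> M n" by simp
  qed
  then show "K n x = K n y" using c by (auto simp: K_mem set_eq_iff)
qed

lemma pv_K: "pv n = K n \<zero>"
proof -
  interpret Q: ring Q by (rule quotient_ring[OF I_ideal])
  have "pv n \<subseteq> carrier Q" using prevF_carrier by (auto simp: pv_eq quotient_carrier)
  then have "pv n +>\<^bsub>Q\<^esub> \<zero>\<^bsub>Q\<^esub> = pv n" by (rule Q.a_coset_add_zero)
  then show ?thesis by (simp add: K_def quotient_zero rcos_zero[OF I_ideal])
qed

definition NM where "NM t n = K n (hp n t)"
abbreviation GR where "GR \<equiv> filtered_quotient_gr A P"
abbreviation QR where "QR \<equiv> quotient_algebra A IR"

lemma natural_map_eq: "t \<in> carrier A \<Longrightarrow> natural_map A P (IR +> t) = NM t"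
proof
  fix n assume t: "t \<in> carrier A"
  show "natural_map A P (IR +> t) n = NM t n"
    unfolding natural_map_def NM_def K_def[symmetric]
  proof (rule UN_const_eq)
    show "t \<in> IR +> t" using t by (simp add: rcos_mem_iff[OF IR_ideal])
    fix s assume "s \<in> IR +> t"
    moreover from this have s: "s \<in> carrier A" using rcos_carrier[OF IR_ideal t] by blast
    ultimately have "s \<ominus> t \<in> IR" using t by (simp add: rcos_mem_iff[OF IR_ideal])
    from IR_M[OF this, of n] show "K n (hp n s) = K n (hp n t)" using s t by (simp add: K_eq hp_minus)
  qed
qed

lemma GR_carrier: "f \<in> carrier GR \<longleftrightarrow> (\<forall>n. \<exists>x\<in>filtration A n. f n = K n x) \<and> finite {n. f n \<noteq> pv n}"
  by (auto simp: filtered_quotient_gr_def associated_graded_def Let_def filtered_quotient_filtration_def K_def image_iff)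

lemma GR_component: "f \<in> component GR n \<longleftrightarrow> f \<in> carrier GR \<and> (\<forall>m. m \<noteq> n \<longrightarrow> f m = pv m)"
  by (auto simp: filtered_quotient_gr_def associated_graded_def Let_def)

lemma NM_carrier: "t \<in> carrier A \<Longrightarrow> NM t \<in> carrier GR"
proof -
  assume t: "t \<in> carrier A"
  then obtain N where N: "\<forall>n>N. hp n t = \<zero>" using graded_bound by blast
  then have "{n. NM t n \<noteq> pv n} \<subseteq> {..N}" by (auto simp: NM_def pv_K not_le[symmetric])
  then have "finite {n. NM t n \<noteq> pv n}" by (rule finite_subset) simp
  moreover have "hp n t \<in> filtration A n" for n using hp_comp[OF t] filt_comp by blast
  ultimately show ?thesis by (auto simp: GR_carrier NM_def)
qed

lemma NM_add: "s \<in> carrier A \<Longrightarrow> t \<in> carrier A \<Longrightarrow> NM (s \<oplus> t) = NM s \<oplus>\<^bsub>GR\<^esub> NM t"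
proof
  fix n assume c: "s \<in> carrier A" "t \<in> carrier A"
  have "K n (x \<oplus> y) = K n x <+>\<^bsub>Q\<^esub> K n y" if x: "x \<in> carrier A" "y \<in> carrier A" for x y
  proof (intro Set.set_eqI iffI)
    fix Z assume "Z \<in> K n (x \<oplus> y)"
    then obtain z where z: "z \<in> carrier A" "Z = I +> z" "z \<ominus> (x \<oplus> y) \<in> M n" using x by (auto simp: K_mem)
    have "(z \<ominus> y) \<ominus> x = z \<ominus> (x \<oplus> y)" using x z by (simp add: diff_diff_cancel)
    then have "I +> (z \<ominus> y) \<in> K n x" using x z by (auto simp: K_mem)
    moreover have "I +> y \<in> K n y" using x by (intro K_self)
    moreover have "Z = (I +> (z \<ominus> y)) \<oplus>\<^bsub>Q\<^esub> (I +> y)" using x z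
      by (simp add: quotient_add[OF I_ideal] add_diff_cancel)
    ultimately show "Z \<in> K n x <+>\<^bsub>Q\<^esub> K n y" by (auto simp: set_add_def set_mult_def)
  next
    fix Z assume "Z \<in> K n x <+>\<^bsub>Q\<^esub> K n y"
    then obtain X Y where "X \<in> K n x" "Y \<in> K n y" "Z = X \<oplus>\<^bsub>Q\<^esub> Y" by (auto simp: set_add_def set_mult_def)
    then obtain u v where u: "u \<in> carrier A" "u \<ominus> x \<in> M n" "v \<in> carrier A" "v \<ominus> y \<in> M n" "Z = (I +> u) \<oplus>\<^bsub>Q\<^esub> (I +> v)"
      using x by (auto simp: K_mem)
    have "(u \<oplus> v) \<ominus> (x \<oplus> y) = (u \<ominus> x) \<oplus> (v \<ominus> y)" using x u by (simp add: diff_add_diff)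
    then show "Z \<in> K n (x \<oplus> y)" using u x M_add
      by (auto simp: K_mem quotient_add[OF I_ideal] intro!: bexI[of _ "u \<oplus> v"])
  qed
  then show "NM (s \<oplus> t) n = (NM s \<oplus>\<^bsub>GR\<^esub> NM t) n" using c
    by (simp add: NM_def hp_add filtered_quotient_gr_def associated_graded_def)
qed

lemma NM_one: "NM \<one> = \<one>\<^bsub>GR\<^esub>"
proof
  fix n
  show "NM \<one> n = \<one>\<^bsub>GR\<^esub> n"
  proof (cases n)
    case 0
    have "\<one>\<^bsub>GR\<^esub> 0 = pv 0 +>\<^bsub>Q\<^esub> \<one>\<^bsub>Q\<^esub>"
      by (simp add: filtered_quotient_gr_def associated_graded_def)
    then show ?thesis using 0 by (simp add: NM_def hp_hom[OF comp_one] quotient_one K_def)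
  next
    case (Suc m)
    then have "\<one>\<^bsub>GR\<^esub> n = pv n" by (simp add: filtered_quotient_gr_def associated_graded_def)
    then show ?thesis using Suc by (simp add: NM_def hp_hom[OF comp_one] pv_K)
  qed
qed

lemma NM_smult: "t \<in> carrier A \<Longrightarrow> NM (c \<odot> t) = c \<odot>\<^bsub>GR\<^esub> NM t"
proof
  fix n assume t: "t \<in> carrier A"
  have h: "hp n (c \<odot> t) = c \<odot> hp n t"
    using hp_mult_l[OF smult_one_comp t, of n c] t smult_eq[of t c] smult_eq[of "hp n t" c] by simp
  have "(\<Union>X\<in>NM t n. pv n +>\<^bsub>Q\<^esub> (c \<odot>\<^bsub>Q\<^esub> X)) = K n (c \<odot> hp n t)"
  proof (rule UN_const_eq)
    show "I +> hp n t \<in> NM t n" using t by (simp add: NM_def K_self)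
    fix X assume "X \<in> NM t n"
    then obtain x where x: "x \<in> carrier A" "X = I +> x" "x \<ominus> hp n t \<in> M n" using t by (auto simp: NM_def K_mem)
    have "pv n +>\<^bsub>Q\<^esub> (c \<odot>\<^bsub>Q\<^esub> X) = K n (c \<odot> x)" using x by (simp add: quotient_smult[OF I_ideal] K_def)
    also have "\<dots> = K n (c \<odot> hp n t)" using x t M_smult[OF x(3), of c] by (simp add: K_eq smult_minus)
    finally show "pv n +>\<^bsub>Q\<^esub> (c \<odot>\<^bsub>Q\<^esub> X) = K n (c \<odot> hp n t)" .
  qed
  then show "NM (c \<odot> t) n = (c \<odot>\<^bsub>GR\<^esub> NM t) n" using t h
    by (simp add: NM_def filtered_quotient_gr_def associated_graded_def)
qed

lemma Q_finsum:
  assumes "finite F" "\<And>i. i \<in> F \<Longrightarrow> f i \<in> carrier A"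
  shows "(\<Oplus>\<^bsub>Q\<^esub>i\<in>F. I +> f i) = I +> (\<Oplus>i\<in>F. f i)"
proof -
  interpret Q: ring Q by (rule quotient_ring[OF I_ideal])
  show ?thesis using assms
  proof (induction F rule: finite_induct)
    case empty
    then show ?case by (simp add: quotient_zero rcos_zero[OF I_ideal])
  next
    case (insert a F)
    then have "(\<lambda>i. I +> f i) \<in> F \<rightarrow> carrier Q" "f \<in> F \<rightarrow> carrier A" "I +> f a \<in> carrier Q" "f a \<in> carrier A"
      by (auto simp: quotient_carrier)
    then show ?case using insert by (simp add: quotient_add[OF I_ideal])
  qed
qed

lemma M_finsum: "finite F \<Longrightarrow> (\<And>i. i \<in> F \<Longrightarrow> f i \<in> M n) \<Longrightarrow> (\<Oplus>i\<in>F. f i) \<in> M n"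
proof (induction F rule: finite_induct)
  case (insert a F)
  then have "f \<in> F \<rightarrow> carrier A" "f a \<in> carrier A" using M_carrier by auto
  then show ?case using insert by (simp add: M_add)
qed simp

lemma finsum_minus: "finite F \<Longrightarrow> (\<And>i. i \<in> F \<Longrightarrow> f i \<in> carrier A) \<Longrightarrow> (\<And>i. i \<in> F \<Longrightarrow> g i \<in> carrier A) \<Longrightarrow>
   (\<Oplus>i\<in>F. f i) \<ominus> (\<Oplus>i\<in>F. g i) = (\<Oplus>i\<in>F. f i \<ominus> g i)"
proof (induction F rule: finite_induct)
  case (insert a F)
  then have p: "f \<in> F \<rightarrow> carrier A" "g \<in> F \<rightarrow> carrier A" "f a \<in> carrier A" "g a \<in> carrier A"
    "(\<lambda>i. f i \<ominus> g i) \<in> F \<rightarrow> carrier A" by auto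
  have "(f a \<oplus> finsum A f F) \<ominus> (g a \<oplus> finsum A g F) = (f a \<ominus> g a) \<oplus> (finsum A f F \<ominus> finsum A g F)"
    using p by (simp add: diff_add_diff)
  then show ?case using insert p by simp
qed simp

text \<open>The product of the associated graded algebra is a union over all choices of
  representatives, so each choice must give the class of the product. If u, v represent the entries
  of the forms a, b, then u v - a b = (u - a) v + a (v - b), and both terms lie in
  \<open>M n\<close>.\<close>

lemma NM_mult: "s \<in> carrier A \<Longrightarrow> t \<in> carrier A \<Longrightarrow> NM (s \<otimes> t) = NM s \<otimes>\<^bsub>GR\<^esub> NM t"
proof
  fix n assume c: "s \<in> carrier A" "t \<in> carrier A"
  let ?m = "\<lambda>x y. pv n +>\<^bsub>Q\<^esub> (\<Oplus>\<^bsub>Q\<^esub>i\<in>{..n}. x i \<otimes>\<^bsub>Q\<^esub> y (n - i))"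
  have key: "?m x y = K n (hp n (s \<otimes> t))" if x: "x \<in> Pi UNIV (NM s)" and y: "y \<in> Pi UNIV (NM t)" for x y
  proof -
    have "\<forall>i. \<exists>u. u \<in> carrier A \<and> x i = I +> u \<and> u \<ominus> hp i s \<in> M i" using x c by (auto simp: NM_def K_mem Pi_def)
    then obtain u where u: "\<And>i. u i \<in> carrier A" "\<And>i. x i = I +> u i" "\<And>i. u i \<ominus> hp i s \<in> M i" by metis
    have "\<forall>i. \<exists>v. v \<in> carrier A \<and> y i = I +> v \<and> v \<ominus> hp i t \<in> M i" using y c by (auto simp: NM_def K_mem Pi_def)
    then obtain v where v: "\<And>i. v i \<in> carrier A" "\<And>i. y i = I +> v i" "\<And>i. v i \<ominus> hp i t \<in> M i" by metis
    \<comment> \<open>\<open>v i\<close> agrees with a form of degree i modulo F^(i-1) + I, so it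
      lies in F^i + I, which is \<open>M (Suc i)\<close>.\<close>
    have vM: "v i \<in> M (Suc i)" for i
    proof -
      have "(v i \<ominus> hp i t) \<oplus> hp i t \<in> M (Suc i)"
        by (rule M_add[OF M_Suc[OF v(3)] filt_M[OF filt_comp[OF hp_comp[OF c(2)] order_refl]]])
      moreover have "(v i \<ominus> hp i t) \<oplus> hp i t = v i" using v c by (simp add: add_diff_cancel)
      ultimately show ?thesis by simp
    qed
    have d: "u i \<otimes> v (n - i) \<ominus> hp i s \<otimes> hp (n - i) t \<in> M n" if "i \<le> n" for i
    proof -
      have "(u i \<ominus> hp i s) \<otimes> v (n - i) \<in> M (i + (n - i))" by (rule M_mult_l[OF u(3) vM])
      moreover have "hp i s \<otimes> (v (n - i) \<ominus> hp (n - i) t) \<in> M (i + (n - i))"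
        by (rule M_mult_r[OF _ v(3)]) (use c in \<open>auto intro: filt_M filt_comp[OF hp_comp]\<close>)
      ultimately have "(u i \<ominus> hp i s) \<otimes> v (n - i) \<oplus> hp i s \<otimes> (v (n - i) \<ominus> hp (n - i) t) \<in> M n"
        using that M_add by simp
      moreover have "(u i \<ominus> hp i s) \<otimes> v (n - i) \<oplus> hp i s \<otimes> (v (n - i) \<ominus> hp (n - i) t) =
          u i \<otimes> v (n - i) \<ominus> hp i s \<otimes> hp (n - i) t"
        using u v c diff_diff_cancel(1)[of "u i \<otimes> v (n - i)" "hp i s \<otimes> hp (n - i) t" "hp i s \<otimes> v (n - i)"]
        by (simp add: minus_eq l_distr r_distr l_minus r_minus)
      ultimately show ?thesis by simp
    qed
    have "(\<Oplus>\<^bsub>Q\<^esub>i\<in>{..n}. x i \<otimes>\<^bsub>Q\<^esub> y (n - i)) = I +> (\<Oplus>i\<in>{..n}. u i \<otimes> v (n - i))"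
      using u v Q_finsum[of "{..n}" "\<lambda>i. u i \<otimes> v (n - i)"] by (simp add: quotient_mult[OF I_ideal])
    then have "?m x y = K n (\<Oplus>i\<in>{..n}. u i \<otimes> v (n - i))" by (simp add: K_def)
    also have "\<dots> = K n (\<Oplus>i\<in>{..n}. hp i s \<otimes> hp (n - i) t)"
    proof (subst K_eq)
      show "(\<Oplus>i\<in>{..n}. u i \<otimes> v (n - i)) \<ominus> (\<Oplus>i\<in>{..n}. hp i s \<otimes> hp (n - i) t) \<in> M n"
        using u v c d by (subst finsum_minus) (auto intro!: M_finsum)
    qed (use u v c in \<open>auto intro!: finsum_closed\<close>)
    finally show ?thesis using c by (simp add: hp_mult)
  qed
  have x0: "(\<lambda>i. I +> hp i s) \<in> Pi UNIV (NM s)" "(\<lambda>i. I +> hp i t) \<in> Pi UNIV (NM t)"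
    using c by (auto simp: NM_def K_self)
  have "(\<Union>x\<in>Pi UNIV (NM s). \<Union>y\<in>Pi UNIV (NM t). ?m x y) = K n (hp n (s \<otimes> t))"
    by (rule UN_const_eq[OF x0(1)], rule UN_const_eq[OF x0(2)], rule key)
  then show "NM (s \<otimes> t) n = (NM s \<otimes>\<^bsub>GR\<^esub> NM t) n"
    by (simp add: NM_def[of "s \<otimes> t"] filtered_quotient_gr_def associated_graded_def)
qed

lemma NM_eq_iff: "s \<in> carrier A \<Longrightarrow> t \<in> carrier A \<Longrightarrow> NM s = NM t \<longleftrightarrow> (\<forall>n. hp n (s \<ominus> t) \<in> M n)"
  by (simp add: NM_def fun_eq_iff K_eq hp_minus)

lemma hp_M: "x \<in> filtration A n \<Longrightarrow> K n x = K n (hp n x)"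
  using prevF_M[OF prevF_top[of x n]] by (subst K_eq) auto

text \<open>The top forms of representatives of the entries of f are added up. The extra clause,
  that trivial entries are lifted by zero, makes the map surjective on each homogeneous
  component.\<close>

lemma NM_surj:
  assumes "f \<in> carrier GR"
  shows "\<exists>t\<in>carrier A. NM t = f \<and> (\<forall>n. f n = pv n \<longrightarrow> hp n t = \<zero>)"
proof -
  obtain x where x: "\<And>n. x n \<in> filtration A n" "\<And>n. f n = K n (x n)" and fin: "finite {n. f n \<noteq> pv n}"
    using assms unfolding GR_carrier by metis
  define N where "N = {n. f n \<noteq> pv n}"
  have fin: "finite N" and N: "n \<in> N \<longleftrightarrow> f n \<noteq> pv n" for n using fin by (simp_all add: N_def)
  define t where "t = (\<Oplus>n\<in>N. hp n (x n))"
  have xc: "x n \<in> carrier A" for n using x filt_carrier by blast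
  have h: "hp n t = (if n \<in> N then hp n (x n) else \<zero>)" for n
  proof -
    have "hp n t = (\<Oplus>m\<in>N. hp n (hp m (x m)))" unfolding t_def by (rule hp_finsum) (use fin xc in auto)
    also have "\<dots> = (\<Oplus>m\<in>N. if n = m then hp m (x m) else \<zero>)"
      by (rule add.finprod_cong') (use xc in \<open>auto simp: hp_hom[OF hp_comp]\<close>)
    also have "\<dots> = (if n \<in> N then hp n (x n) else \<zero>)"
    proof (cases "n \<in> N")
      case True
      then show ?thesis using add.finprod_singleton[OF True fin, of "\<lambda>m. hp m (x m)"] xc by auto
    next
      case False
      have "(\<Oplus>m\<in>N. if n = m then hp m (x m) else \<zero>) = \<zero>"
        by (rule add.finprod_one_eqI) (use False in auto)
      then show ?thesis using False by (simp only: if_False)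
    qed
    finally show ?thesis .
  qed
  show ?thesis
  proof (intro bexI[of _ t] conjI allI impI)
    show "t \<in> carrier A" unfolding t_def using xc by (intro finsum_closed) auto
    show "NM t = f"
    proof
      fix n show "NM t n = f n"
        using x(2)[of n] hp_M[OF x(1), of n] N[of n] by (cases "n \<in> N") (simp_all add: NM_def h pv_K)
    qed
    show "hp n t = \<zero>" if "f n = pv n" for n using that N[of n] by (simp add: h)
  qed
qed

text \<open>The natural map is always a surjective graded homomorphism, so PBW type is its
  injectivity. A form u of degree n with trivial image is p + i with p of degree below n and i \<in>
  I, and then u is the leading form of i = u - p. So injectivity says that the leading forms of
  \<open>I\<close> lie in \<open>IR\<close>.\<close>

theorem PBW_type_iff:
  "PBW_type A P \<longleftrightarrow> (\<forall>n. \<forall>x \<in> I \<inter> filtration A n. hp n x \<in> IR)"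
proof
  assume "PBW_type A P"
  then have inj: "inj_on (natural_map A P) (carrier QR)"
    by (auto simp: PBW_type_def graded_algebra_iso_def ring_iso_def bij_betw_def)
  show "\<forall>n. \<forall>x \<in> I \<inter> filtration A n. hp n x \<in> IR"
  proof (intro allI ballI)
    fix n x assume "x \<in> I \<inter> filtration A n"
    then have x: "x \<in> I" "x \<in> filtration A n" "x \<in> carrier A" by auto
    let ?t = "hp n x"
    have "?t \<in> M n"
    proof -
      have "x \<ominus> (x \<ominus> ?t) \<in> M n" by (rule M_minus[OF I_M[OF x(1)] prevF_M[OF prevF_top[OF x(2)]]])
      moreover have "x \<ominus> (x \<ominus> ?t) = ?t" using x by (simp add: add_diff_cancel)
      ultimately show ?thesis by simp
    qed
    then have "NM ?t = NM \<zero>" using x by (subst NM_eq_iff) (auto simp: hp_minus hp_hom[OF hp_comp] minus_eq)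
    then have "natural_map A P (IR +> ?t) = natural_map A P (IR +> \<zero>)" using x by (simp add: natural_map_eq)
    then have "IR +> ?t = IR +> \<zero>" using x by (intro inj_onD[OF inj]) (auto simp: quotient_carrier)
    then show "?t \<in> IR" using x by (simp add: rcos_eq_iff[OF IR_ideal] minus_eq)
  qed
next
  assume cond: "\<forall>n. \<forall>x \<in> I \<inter> filtration A n. hp n x \<in> IR"
  have inj: "inj_on (natural_map A P) (carrier QR)"
  proof (rule inj_onI)
    fix X Y assume "X \<in> carrier QR" "Y \<in> carrier QR" and e: "natural_map A P X = natural_map A P Y"
    then obtain s t where st: "s \<in> carrier A" "t \<in> carrier A" "X = IR +> s" "Y = IR +> t" by (auto simp: quotient_carrier)
    then have m: "\<forall>n. hp n (s \<ominus> t) \<in> M n" using e by (simp add: natural_map_eq NM_eq_iff)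
    have "hp n (s \<ominus> t) \<in> IR" for n
    proof -
      let ?u = "hp n (s \<ominus> t)"
      obtain p where p: "p \<in> prevF n" "?u \<ominus> p \<in> I" using m by (auto simp: M_def)
      have "?u \<ominus> p \<in> filtration A n" using p prevF_filt st by (auto intro!: filt_minus filt_comp[OF hp_comp])
      then have "hp n (?u \<ominus> p) \<in> IR" using cond p by blast
      moreover have "hp n (?u \<ominus> p) = ?u" using p st prevF_carrier[OF p(1)]
        by (subst hp_minus) (simp_all add: prevF_hp hp_hom[OF hp_comp] minus_eq)
      ultimately show ?thesis by simp
    qed
    then have "s \<ominus> t \<in> IR" using st by (rule_tac IR_hpI) simp_all
    then show "X = Y" using st by (simp add: rcos_eq_iff[OF IR_ideal])
  qed
  have surj: "natural_map A P ` carrier QR = carrier GR"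
  proof
    show "natural_map A P ` carrier QR \<subseteq> carrier GR" by (auto simp: quotient_carrier natural_map_eq NM_carrier)
    show "carrier GR \<subseteq> natural_map A P ` carrier QR"
    proof
      fix f assume "f \<in> carrier GR"
      then obtain t where "t \<in> carrier A" "NM t = f" using NM_surj by blast
      then show "f \<in> natural_map A P ` carrier QR"
        by (intro image_eqI[of _ _ "IR +> t"]) (auto simp: natural_map_eq quotient_carrier)
    qed
  qed
  have hom: "natural_map A P \<in> ring_hom QR GR"
    by (rule ring_hom_memI)
      (auto simp: quotient_carrier quotient_mult[OF IR_ideal] quotient_add[OF IR_ideal] quotient_one natural_map_eq
        NM_carrier NM_add NM_mult NM_one)
  have comps: "natural_map A P ` component QR n = component GR n" for n
  proof (intro Set.set_eqI iffI)
    fix f assume "f \<in> natural_map A P ` component QR n"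
    then obtain t where t: "t \<in> comp n" "f = NM t" by (auto simp: quotient_component natural_map_eq)
    then have "NM t m = pv m" if "m \<noteq> n" for m using that by (simp add: NM_def hp_hom pv_K)
    then show "f \<in> component GR n" using t by (simp add: GR_component NM_carrier)
  next
    fix f assume "f \<in> component GR n"
    then have f: "f \<in> carrier GR" "\<And>m. m \<noteq> n \<Longrightarrow> f m = pv m" by (auto simp: GR_component)
    obtain t where t: "t \<in> carrier A" "NM t = f" "\<And>n. f n = pv n \<Longrightarrow> hp n t = \<zero>"
      using NM_surj[OF f(1)] by auto
    have "t = hp n t" by (rule eqI_hp) (use t f in \<open>auto simp: hp_hom[OF hp_comp]\<close>)
    then have "t \<in> comp n" using hp_comp[OF t(1)] by metis
    then show "f \<in> natural_map A P ` component QR n" using t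
      by (intro image_eqI[of _ _ "IR +> t"]) (auto simp: natural_map_eq quotient_component)
  qed
  have sm: "natural_map A P (c \<odot>\<^bsub>QR\<^esub> X) = c \<odot>\<^bsub>GR\<^esub> natural_map A P X" if "X \<in> carrier QR" for c X
    using that by (auto simp: quotient_carrier quotient_smult[OF IR_ideal] natural_map_eq NM_smult)
  show "PBW_type A P"
    unfolding PBW_type_def graded_algebra_iso_def ring_iso_def bij_betw_def
    using inj surj hom comps sm by blast
qed

end

section \<open>Free generation and tensor products inside a graded algebra\<close>

context galg
begin

text \<open>The image of X \<otimes> Y, generated without negatives so that it coincides with the
  finite sums of \<open>tensor_sub\<close>; negatives are available as soon as X is closed under
  them.\<close>

inductive_set tspan :: "'a set \<Rightarrow> 'a set \<Rightarrow> 'a set" for X Y where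
  zero [simp]: "\<zero> \<in> tspan X Y"
| prod: "x \<in> X \<Longrightarrow> y \<in> Y \<Longrightarrow> x \<otimes> y \<in> tspan X Y"
| add: "a \<in> tspan X Y \<Longrightarrow> b \<in> tspan X Y \<Longrightarrow> a \<oplus> b \<in> tspan X Y"

text \<open>The graph of f \<otimes> g before it is known to be a function: an element is related to
  every value obtained from some expression of it as a sum of products. Single-valuedness is a
  flatness statement, proved separately.\<close>

inductive tpair :: "'a set \<Rightarrow> 'a set \<Rightarrow> ('a \<Rightarrow> 'a) \<Rightarrow> ('a \<Rightarrow> 'a) \<Rightarrow> 'a \<Rightarrow> 'a \<Rightarrow> bool" for X Y f g where
  zero [simp]: "tpair X Y f g \<zero> \<zero>"
| prod: "x \<in> X \<Longrightarrow> y \<in> Y \<Longrightarrow> tpair X Y f g (x \<otimes> y) (f x \<otimes> g y)"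
| add: "tpair X Y f g a a' \<Longrightarrow> tpair X Y f g b b' \<Longrightarrow> tpair X Y f g (a \<oplus> b) (a' \<oplus> b')"

lemma tspan_carrier: "z \<in> tspan X Y \<Longrightarrow> X \<subseteq> carrier A \<Longrightarrow> Y \<subseteq> carrier A \<Longrightarrow> z \<in> carrier A"
  by (induction rule: tspan.induct) auto

lemma tspan_mono: "z \<in> tspan X Y \<Longrightarrow> X \<subseteq> X' \<Longrightarrow> Y \<subseteq> Y' \<Longrightarrow> z \<in> tspan X' Y'"
  by (induction rule: tspan.induct) (auto intro: tspan.intros)

lemma tspan_uminus:
  assumes "z \<in> tspan X Y" "X \<subseteq> carrier A" "Y \<subseteq> carrier A" "\<And>x. x \<in> X \<Longrightarrow> \<ominus> x \<in> X"
  shows "\<ominus> z \<in> tspan X Y"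
  using assms(1)
proof (induction rule: tspan.induct)
  case (prod x y)
  then have "x \<in> carrier A" "y \<in> carrier A" using assms by auto
  then have "\<ominus> (x \<otimes> y) = \<ominus> x \<otimes> y" by (simp add: l_minus)
  then show ?case using prod assms(4) tspan.prod by metis
next
  case (add a b)
  then show ?case using tspan_carrier[OF _ assms(2,3)] by (simp add: minus_add tspan.add)
qed simp

lemma tpair_tspan: "tpair X Y f g a b \<Longrightarrow> a \<in> tspan X Y"
  by (induction rule: tpair.induct) (auto intro: tspan.intros)

lemma tspan_tpair: "a \<in> tspan X Y \<Longrightarrow> \<exists>b. tpair X Y f g a b"
proof (induction rule: tspan.induct)
  case (add a b)
  then show ?case using tpair.add[of X Y f g a _ b] by blast
qed (auto intro: tpair.intros)

lemma tpair_carrier: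
  assumes "tpair X Y f g a b" "X \<subseteq> carrier A" "Y \<subseteq> carrier A"
    "\<And>x. x \<in> X \<Longrightarrow> f x \<in> carrier A" "\<And>y. y \<in> Y \<Longrightarrow> g y \<in> carrier A"
  shows "a \<in> carrier A" "b \<in> carrier A"
  using assms(1) by (induction rule: tpair.induct) (use assms in auto)

lemma tpair_uminus:
  assumes t: "tpair X Y f g a b" and c: "X \<subseteq> carrier A" "Y \<subseteq> carrier A"
    "\<And>x. x \<in> X \<Longrightarrow> f x \<in> carrier A" "\<And>y. y \<in> Y \<Longrightarrow> g y \<in> carrier A"
    and X: "\<And>x. x \<in> X \<Longrightarrow> \<ominus> x \<in> X" "\<And>x. x \<in> X \<Longrightarrow> f (\<ominus> x) = \<ominus> f x"
  shows "tpair X Y f g (\<ominus> a) (\<ominus> b)"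
  using t
proof (induction rule: tpair.induct)
  case (prod x y)
  then have "x \<in> carrier A" "y \<in> carrier A" "f x \<in> carrier A" "g y \<in> carrier A" using c by auto
  then have "\<ominus> (x \<otimes> y) = \<ominus> x \<otimes> y" "\<ominus> (f x \<otimes> g y) = f (\<ominus> x) \<otimes> g y" using prod X by (simp_all add: l_minus)
  then show ?case using prod X(1) tpair.prod[of "\<ominus> x" X y Y f g] by simp
next
  case (add a a' b b')
  then show ?case using tpair_carrier[OF add(1) c] tpair_carrier[OF add(2) c] by (simp add: minus_add tpair.add)
qed simp

lemma finsum_lessThan_Suc:
  "(\<And>i. i < Suc n \<Longrightarrow> f i \<in> carrier A) \<Longrightarrow> (\<Oplus>i\<in>{..<Suc n}. f i) = f n \<oplus> (\<Oplus>i\<in>{..<n}. f i)"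
  by (simp add: lessThan_Suc Pi_def)

lemma finsum_append:
  fixes n m :: nat
  assumes "\<And>i. i < n \<Longrightarrow> f i \<in> carrier A" "\<And>i. i < m \<Longrightarrow> g i \<in> carrier A"
  shows "(\<Oplus>i\<in>{..<n + m}. if i < n then f i else g (i - n)) = (\<Oplus>i\<in>{..<n}. f i) \<oplus> (\<Oplus>i\<in>{..<m}. g i)"
  using assms(2)
proof (induction m)
  case 0
  have "(\<Oplus>i\<in>{..<n}. if i < n then f i else g (i - n)) = (\<Oplus>i\<in>{..<n}. f i)"
    by (rule add.finprod_cong') (use assms in auto)
  moreover have "(\<Oplus>i\<in>{..<n}. f i) \<in> carrier A" using assms by (auto intro!: finsum_closed)
  ultimately show ?case by simp
next
  case (Suc m)
  have c: "(\<Oplus>i\<in>{..<n}. f i) \<in> carrier A" "(\<Oplus>i\<in>{..<m}. g i) \<in> carrier A"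
    using assms Suc by (auto intro!: finsum_closed)
  have "(\<Oplus>i\<in>{..<Suc (n + m)}. if i < n then f i else g (i - n)) =
      g m \<oplus> (\<Oplus>i\<in>{..<n + m}. if i < n then f i else g (i - n))"
    by (subst finsum_lessThan_Suc) (use assms Suc in auto)
  then show ?case using Suc c by (simp add: finsum_lessThan_Suc a_lcomm)
qed

lemma tpair_iff:
  assumes c: "X \<subseteq> carrier A" "Y \<subseteq> carrier A"
    "\<And>x. x \<in> X \<Longrightarrow> f x \<in> carrier A" "\<And>y. y \<in> Y \<Longrightarrow> g y \<in> carrier A"
  shows "tpair X Y f g z t \<longleftrightarrow> (\<exists>(n::nat) x y. (\<forall>i < n. x i \<in> X \<and> y i \<in> Y) \<and>
     z = (\<Oplus>i \<in> {..<n}. x i \<otimes> y i) \<and> t = (\<Oplus>i \<in> {..<n}. f (x i) \<otimes> g (y i)))"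
proof
  assume "tpair X Y f g z t"
  then show "\<exists>(n::nat) x y. (\<forall>i < n. x i \<in> X \<and> y i \<in> Y) \<and>
     z = (\<Oplus>i \<in> {..<n}. x i \<otimes> y i) \<and> t = (\<Oplus>i \<in> {..<n}. f (x i) \<otimes> g (y i))"
  proof (induction rule: tpair.induct)
    case zero
    show ?case by (intro exI[of _ 0]) simp
  next
    case (prod x y)
    then have "x \<in> carrier A" "y \<in> carrier A" "f x \<in> carrier A" "g y \<in> carrier A" using c by auto
    then have h: "(\<forall>i<1. x \<in> X \<and> y \<in> Y) \<and> x \<otimes> y = (\<Oplus>i\<in>{..<1::nat}. x \<otimes> y) \<and>
        f x \<otimes> g y = (\<Oplus>i\<in>{..<1::nat}. f x \<otimes> g y)"
      using prod by (simp add: lessThan_Suc)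
    show ?case
      by (rule exI[of _ "1::nat"], rule exI[of _ "\<lambda>_. x"], rule exI[of _ "\<lambda>_. y"], rule h)
  next
    case (add a a' b b')
    then obtain n x y m x' y' where h: "\<forall>i<n. x i \<in> X \<and> y i \<in> Y" "a = (\<Oplus>i\<in>{..<n::nat}. x i \<otimes> y i)"
      "a' = (\<Oplus>i\<in>{..<n}. f (x i) \<otimes> g (y i))" "\<forall>i<m. x' i \<in> X \<and> y' i \<in> Y" "b = (\<Oplus>i\<in>{..<m::nat}. x' i \<otimes> y' i)"
      "b' = (\<Oplus>i\<in>{..<m}. f (x' i) \<otimes> g (y' i))" by blast
    define u where "u i = (if i < n then x i else x' (i - n))" for i
    define v where "v i = (if i < n then y i else y' (i - n))" for i
    have hc: "x i \<in> carrier A" "y i \<in> carrier A" "f (x i) \<in> carrier A" "g (y i) \<in> carrier A" if "i < n" for i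
      using h(1) that c by auto
    have hc': "x' i \<in> carrier A" "y' i \<in> carrier A" "f (x' i) \<in> carrier A" "g (y' i) \<in> carrier A" if "i < m" for i
      using h(4) that c by auto
    have e: "(\<lambda>i. u i \<otimes> v i) = (\<lambda>i. if i < n then x i \<otimes> y i else x' (i - n) \<otimes> y' (i - n))"
      "(\<lambda>i. f (u i) \<otimes> g (v i)) = (\<lambda>i. if i < n then f (x i) \<otimes> g (y i) else f (x' (i - n)) \<otimes> g (y' (i - n)))"
      by (auto simp: u_def v_def)
    have "(\<Oplus>i\<in>{..<n+m}. u i \<otimes> v i) = a \<oplus> b" unfolding e h(2,5)
      by (rule finsum_append) (use hc hc' in auto)
    moreover have "(\<Oplus>i\<in>{..<n+m}. f (u i) \<otimes> g (v i)) = a' \<oplus> b'" unfolding e h(3,6)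
      by (rule finsum_append) (use hc hc' in auto)
    moreover have "\<forall>i<n+m. u i \<in> X \<and> v i \<in> Y" using h by (auto simp: u_def v_def)
    ultimately show ?case by - (rule exI[of _ "n + m"], rule exI[of _ u], rule exI[of _ v], simp)
  qed
next
  assume "\<exists>(n::nat) x y. (\<forall>i < n. x i \<in> X \<and> y i \<in> Y) \<and>
     z = (\<Oplus>i \<in> {..<n}. x i \<otimes> y i) \<and> t = (\<Oplus>i \<in> {..<n}. f (x i) \<otimes> g (y i))"
  then obtain n x y where h: "\<forall>i<n. x i \<in> X \<and> y i \<in> Y" "z = (\<Oplus>i\<in>{..<n::nat}. x i \<otimes> y i)"
    "t = (\<Oplus>i\<in>{..<n}. f (x i) \<otimes> g (y i))" by blast
  have "tpair X Y f g (\<Oplus>i\<in>{..<n}. x i \<otimes> y i) (\<Oplus>i\<in>{..<n}. f (x i) \<otimes> g (y i))" using h(1)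
  proof (induction n)
    case (Suc n)
    have hc: "x i \<in> carrier A" "y i \<in> carrier A" "f (x i) \<in> carrier A" "g (y i) \<in> carrier A" if "i < Suc n" for i
      using Suc that c by auto
    have "tpair X Y f g (x n \<otimes> y n) (f (x n) \<otimes> g (y n))" using Suc by (intro tpair.prod) auto
    from tpair.add[OF this Suc.IH] Suc.prems show ?case
      using hc by (simp add: finsum_lessThan_Suc)
  qed simp
  then show "tpair X Y f g z t" by (simp add: h)
qed

lemma tensor_sub_eq:
  assumes "X \<subseteq> carrier A" "Y \<subseteq> carrier A" shows "tensor_sub A X Y = tspan X Y"
proof -
  have "tpair X Y (\<lambda>x. x) (\<lambda>x. x) z z \<longleftrightarrow> z \<in> tspan X Y" for z
  proof
    assume "z \<in> tspan X Y" then show "tpair X Y (\<lambda>x. x) (\<lambda>x. x) z z"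
    proof (induction rule: tspan.induct)
      case (prod x y)
      then show ?case using tpair.prod[of x X y Y "\<lambda>x. x" "\<lambda>x. x"] by simp
    qed (auto intro: tpair.intros)
  qed (rule tpair_tspan)
  moreover have "tpair X Y (\<lambda>x. x) (\<lambda>x. x) z z \<longleftrightarrow> (\<exists>(n::nat) x y. (\<forall>i < n. x i \<in> X \<and> y i \<in> Y) \<and>
     z = (\<Oplus>i \<in> {..<n}. x i \<otimes> y i) \<and> z = (\<Oplus>i \<in> {..<n}. x i \<otimes> y i))" for z
    by (rule tpair_iff) (use assms in auto)
  ultimately have "z \<in> tspan X Y \<longleftrightarrow> (\<exists>(n::nat) x y. (\<forall>i < n. x i \<in> X \<and> y i \<in> Y) \<and>
     z = (\<Oplus>i \<in> {..<n}. x i \<otimes> y i))" for z by simp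
  then show ?thesis unfolding tensor_sub_def Set.set_eq_iff mem_Collect_eq by blast
qed

text \<open>The relation is additive and closed under negation, so two values at z give their
  difference as a value at 0; it is single-valued once 0 is related only to 0. The definite
  description in \<open>tensor_hom\<close> then picks the given value.\<close>

lemma tensor_hom_eq:
  assumes c: "X \<subseteq> carrier A" "Y \<subseteq> carrier A"
    "\<And>x. x \<in> X \<Longrightarrow> f x \<in> carrier A" "\<And>y. y \<in> Y \<Longrightarrow> g y \<in> carrier A"
    and X: "\<And>x. x \<in> X \<Longrightarrow> \<ominus> x \<in> X" "\<And>x. x \<in> X \<Longrightarrow> f (\<ominus> x) = \<ominus> f x"
    and uniq: "\<And>t. tpair X Y f g \<zero> t \<Longrightarrow> t = \<zero>"
    and t: "tpair X Y f g z t"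
  shows "tensor_hom A X Y f g z = t"
proof -
  have "tensor_hom A X Y f g z = (THE t. tpair X Y f g z t)"
    unfolding tensor_hom_def by (simp only: tpair_iff[OF c])
  also have "\<dots> = t"
  proof (rule the_equality, rule t)
  fix s assume s: "tpair X Y f g z s"
  have cc: "z \<in> carrier A" "s \<in> carrier A" "t \<in> carrier A" using tpair_carrier[OF s c] tpair_carrier[OF t c] by auto
  have "tpair X Y f g (z \<oplus> \<ominus> z) (s \<oplus> \<ominus> t)" by (rule tpair.add[OF s tpair_uminus[OF t c X]])
  then have "s \<oplus> \<ominus> t = \<zero>" using cc by (intro uniq) (simp add: r_neg)
  then show "s = t" using cc diff_eq_0[of s t] by (simp add: minus_eq)
  qed
  finally show ?thesis .
qed

end

text \<open>\<open>eps\<close> and \<open>DL\<close> form a dual basis of the degree 1 part as a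
  right module over the degree 0 part, \<open>eps\<close> and \<open>DR\<close> one as a left
  module. The coordinate maps live on all of A: \<open>DL b\<close> strips off a first letter and is
  linear over everything to its right, \<open>DR b\<close> strips off a last letter. Flatness and
  the reconstruction of elements rest on these maps.\<close>

locale free_gen = galg +
  fixes B :: "'e set" and eps :: "'e \<Rightarrow> 'a" and DL DR :: "'e \<Rightarrow> 'a \<Rightarrow> 'a"
  assumes finite_B: "finite B" and eps_comp: "b \<in> B \<Longrightarrow> eps b \<in> component A 1"
    and DL_closed: "b \<in> B \<Longrightarrow> x \<in> carrier A \<Longrightarrow> DL b x \<in> carrier A"
    and DL_add: "b \<in> B \<Longrightarrow> x \<in> carrier A \<Longrightarrow> y \<in> carrier A \<Longrightarrow> DL b (x \<oplus> y) = DL b x \<oplus> DL b y"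
    and DL_comp0: "b \<in> B \<Longrightarrow> x \<in> component A 0 \<Longrightarrow> DL b x = \<zero>"
    and DL_comp: "b \<in> B \<Longrightarrow> u \<in> component A 1 \<Longrightarrow> DL b u \<in> component A 0"
    and DL_mult: "b \<in> B \<Longrightarrow> u \<in> component A 1 \<Longrightarrow> x \<in> carrier A \<Longrightarrow> DL b (u \<otimes> x) = DL b u \<otimes> x"
    and DL_sum: "u \<in> component A 1 \<Longrightarrow> u = (\<Oplus>b\<in>B. eps b \<otimes> DL b u)"
    and DR_closed: "b \<in> B \<Longrightarrow> x \<in> carrier A \<Longrightarrow> DR b x \<in> carrier A"
    and DR_add: "b \<in> B \<Longrightarrow> x \<in> carrier A \<Longrightarrow> y \<in> carrier A \<Longrightarrow> DR b (x \<oplus> y) = DR b x \<oplus> DR b y"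
    and DR_comp0: "b \<in> B \<Longrightarrow> x \<in> component A 0 \<Longrightarrow> DR b x = \<zero>"
    and DR_comp: "b \<in> B \<Longrightarrow> u \<in> component A 1 \<Longrightarrow> DR b u \<in> component A 0"
    and DR_mult: "b \<in> B \<Longrightarrow> u \<in> component A 1 \<Longrightarrow> x \<in> carrier A \<Longrightarrow> DR b (x \<otimes> u) = x \<otimes> DR b u"
    and DR_sum: "u \<in> component A 1 \<Longrightarrow> u = (\<Oplus>b\<in>B. DR b u \<otimes> eps b)"
    and gen_left: "x \<in> component A (Suc n) \<Longrightarrow> x \<in> tspan (component A 1) (component A n)"
    and gen_right: "x \<in> component A (Suc n) \<Longrightarrow> x \<in> tspan (component A n) (component A 1)"
begin

lemma comp_sub: "comp n \<subseteq> carrier A" using comp_carrier by blast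

lemma eps_car [simp]: "b \<in> B \<Longrightarrow> eps b \<in> carrier A" using eps_comp comp_carrier by blast

lemma DL_zero [simp]: "b \<in> B \<Longrightarrow> DL b \<zero> = \<zero>" by (rule DL_comp0) auto
lemma DR_zero [simp]: "b \<in> B \<Longrightarrow> DR b \<zero> = \<zero>" by (rule DR_comp0) auto

lemma DL_recon: "x \<in> tspan (comp 1) (carrier A) \<Longrightarrow> x = (\<Oplus>b\<in>B. eps b \<otimes> DL b x)"
proof (induction rule: tspan.induct)
  case zero
  have "(\<Oplus>b\<in>B. eps b \<otimes> DL b \<zero>) = \<zero>" by (rule add.finprod_one_eqI) simp
  then show ?case by simp
next
  case (prod u x)
  have c: "eps b \<in> carrier A" "DL b u \<in> carrier A" if "b \<in> B" for b
    using eps_comp[OF that] DL_comp[OF that prod(1)] by auto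
  have "u \<otimes> x = (\<Oplus>b\<in>B. eps b \<otimes> DL b u) \<otimes> x" using DL_sum prod by simp
  also have "\<dots> = (\<Oplus>b\<in>B. eps b \<otimes> DL b u \<otimes> x)" by (rule finsum_ldistr) (use finite_B prod c in auto)
  also have "\<dots> = (\<Oplus>b\<in>B. eps b \<otimes> DL b (u \<otimes> x))"
    by (rule add.finprod_cong') (use prod c in \<open>auto simp: DL_mult m_assoc\<close>)
  finally show ?case .
next
  case (add x y)
  have c: "x \<in> carrier A" "y \<in> carrier A" using add tspan_carrier[OF _ comp_sub] by auto
  have "(\<Oplus>b\<in>B. eps b \<otimes> DL b (x \<oplus> y)) = (\<Oplus>b\<in>B. eps b \<otimes> DL b x \<oplus> eps b \<otimes> DL b y)"
    by (rule add.finprod_cong') (use c eps_comp DL_closed in \<open>auto simp: DL_add r_distr\<close>)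
  also have "\<dots> = (\<Oplus>b\<in>B. eps b \<otimes> DL b x) \<oplus> (\<Oplus>b\<in>B. eps b \<otimes> DL b y)"
    by (rule add.finprod_multf) (use c eps_comp DL_closed in auto)
  finally show ?case using add by simp
qed

lemma DR_recon: "x \<in> tspan (carrier A) (comp 1) \<Longrightarrow> x = (\<Oplus>b\<in>B. DR b x \<otimes> eps b)"
proof (induction rule: tspan.induct)
  case zero
  have "(\<Oplus>b\<in>B. DR b \<zero> \<otimes> eps b) = \<zero>" by (rule add.finprod_one_eqI) simp
  then show ?case by simp
next
  case (prod x u)
  have c: "eps b \<in> carrier A" "DR b u \<in> carrier A" if "b \<in> B" for b
    using eps_comp[OF that] DR_comp[OF that prod(2)] by auto
  have "x \<otimes> u = x \<otimes> (\<Oplus>b\<in>B. DR b u \<otimes> eps b)" using DR_sum prod by simp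
  also have "\<dots> = (\<Oplus>b\<in>B. x \<otimes> (DR b u \<otimes> eps b))" by (rule finsum_rdistr) (use finite_B prod c in auto)
  also have "\<dots> = (\<Oplus>b\<in>B. DR b (x \<otimes> u) \<otimes> eps b)"
    by (rule add.finprod_cong') (use prod c in \<open>auto simp: DR_mult m_assoc\<close>)
  finally show ?case .
next
  case (add x y)
  have c: "x \<in> carrier A" "y \<in> carrier A" using add tspan_carrier[OF _ _ comp_sub] by auto
  have "(\<Oplus>b\<in>B. DR b (x \<oplus> y) \<otimes> eps b) = (\<Oplus>b\<in>B. DR b x \<otimes> eps b \<oplus> DR b y \<otimes> eps b)"
    by (rule add.finprod_cong') (use c eps_comp DR_closed in \<open>auto simp: DR_add l_distr\<close>)
  also have "\<dots> = (\<Oplus>b\<in>B. DR b x \<otimes> eps b) \<oplus> (\<Oplus>b\<in>B. DR b y \<otimes> eps b)"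
    by (rule add.finprod_multf) (use c eps_comp DR_closed in auto)
  finally show ?case using add by simp
qed

lemma DL_inj: "x \<in> tspan (comp 1) (carrier A) \<Longrightarrow> (\<And>b. b \<in> B \<Longrightarrow> DL b x = \<zero>) \<Longrightarrow> x = \<zero>"
  using DL_recon[of x] add.finprod_one_eqI[of B "\<lambda>b. eps b \<otimes> DL b x"] by simp

lemma DR_inj: "x \<in> tspan (carrier A) (comp 1) \<Longrightarrow> (\<And>b. b \<in> B \<Longrightarrow> DR b x = \<zero>) \<Longrightarrow> x = \<zero>"
  using DR_recon[of x] add.finprod_one_eqI[of B "\<lambda>b. DR b x \<otimes> eps b"] by simp

lemma comp_Suc_pos: "x \<in> comp (Suc n) \<Longrightarrow> y \<in> carrier A \<Longrightarrow> x \<otimes> y \<in> tspan (comp 1) (carrier A)"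
proof -
  assume "x \<in> comp (Suc n)" and y: "y \<in> carrier A"
  then have "x \<in> tspan (comp 1) (comp n)" using gen_left by blast
  then show ?thesis
  proof (induction rule: tspan.induct)
    case (prod u s)
    have "u \<otimes> (s \<otimes> y) \<in> tspan (comp 1) (carrier A)" using prod y by (intro tspan.prod) auto
    then show ?case using prod y by (simp add: m_assoc)
  next
    case (add a b)
    then show ?case using y tspan_carrier[OF _ comp_sub comp_sub] by (auto simp: l_distr intro: tspan.add)
  qed (use y in simp)
qed

lemma DL_mult_comp:
  assumes b: "b \<in> B" and "x \<in> comp (Suc n)" shows "DL b x \<in> comp n" "y \<in> carrier A \<Longrightarrow> DL b (x \<otimes> y) = DL b x \<otimes> y"
proof -
  have x: "x \<in> tspan (comp 1) (comp n)" using assms gen_left by blast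
  from x show "DL b x \<in> comp n"
  proof (induction rule: tspan.induct)
    case (prod u s)
    have "DL b (u \<otimes> s) = DL b u \<otimes> s" using prod b by (intro DL_mult) auto
    then show ?case using comp_mult[of "DL b u" 0 s n] DL_comp[OF b prod(1)] prod(2) by simp
  next
    case (add x y)
    then show ?case using b tspan_carrier[OF _ comp_sub comp_sub] by (auto simp: DL_add intro: comp_add)
  qed (use b in simp)
  assume y: "y \<in> carrier A"
  from x show "DL b (x \<otimes> y) = DL b x \<otimes> y"
  proof (induction rule: tspan.induct)
    case (prod u s)
    have "DL b (u \<otimes> s \<otimes> y) = DL b (u \<otimes> (s \<otimes> y))" using prod y by (simp add: m_assoc)
    also have "\<dots> = DL b u \<otimes> (s \<otimes> y)" using prod y b by (intro DL_mult) auto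
    also have "\<dots> = DL b u \<otimes> s \<otimes> y" using prod y DL_comp[OF b prod(1)] by (simp add: m_assoc)
    also have "DL b u \<otimes> s = DL b (u \<otimes> s)" using prod b by (intro DL_mult[symmetric]) auto
    finally show ?case .
  next
    case (add x z)
    have "x \<in> carrier A" "z \<in> carrier A" using add tspan_carrier[OF _ comp_sub comp_sub] by auto
    then show ?case using add b y by (simp add: DL_add l_distr DL_closed)
  qed (use b y in simp)
qed

text \<open>Flatness of \<open>T\<^sup>n\<close> as a right module over the degree \<open>0\<close> part, in the form needed for
  well-definedness of \<open>id \<otimes> \<psi>\<close>.\<close>

lemma tpair_unique_left:
  assumes Y: "Y \<subseteq> carrier A" "\<zero> \<in> Y" "\<And>x y. x \<in> Y \<Longrightarrow> y \<in> Y \<Longrightarrow> x \<oplus> y \<in> Y"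
      "\<And>b y. b \<in> comp 0 \<Longrightarrow> y \<in> Y \<Longrightarrow> b \<otimes> y \<in> Y"
    and g: "\<And>y. y \<in> Y \<Longrightarrow> g y \<in> carrier A" "\<And>x y. x \<in> Y \<Longrightarrow> y \<in> Y \<Longrightarrow> g (x \<oplus> y) = g x \<oplus> g y"
      "\<And>b y. b \<in> comp 0 \<Longrightarrow> y \<in> Y \<Longrightarrow> g (b \<otimes> y) = b \<otimes> g y"
  shows "tpair (comp n) Y (\<lambda>x. x) g \<zero> t \<Longrightarrow> t = \<zero>"
proof (induction n arbitrary: t)
  case 0
  have g0: "g \<zero> = \<zero>" using g(2)[OF Y(2,2)] g(1)[OF Y(2)] by simp
  have "z \<in> Y \<and> t = g z" if "tpair (comp 0) Y (\<lambda>x. x) g z t" for z t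
    using that by (induction rule: tpair.induct) (use Y g g0 in auto)
  from this[OF 0] show ?case using g0 by simp
next
  case (Suc n)
  have s: "t \<in> tspan (comp 1) (carrier A)" if "tpair (comp (Suc n)) Y (\<lambda>x. x) g z t" for z t
    using that
  proof (induction rule: tpair.induct)
    case (prod x y)
    then show ?case using comp_Suc_pos g by simp
  qed (auto intro: tspan.intros)
  \<comment> \<open>Stripping off the first letter with \<open>DL b\<close> sends a pair for degree
    \<open>Suc n\<close> to a pair for degree \<open>n\<close>; the coordinates of t vanish by
    induction, so t does.\<close>
  have "tpair (comp n) Y (\<lambda>x. x) g (DL b z) (DL b t)" if "tpair (comp (Suc n)) Y (\<lambda>x. x) g z t" and b: "b \<in> B" for b z t
    using that(1)
  proof (induction rule: tpair.induct)
    case (prod x y)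
    have "tpair (comp n) Y (\<lambda>x. x) g (DL b x \<otimes> y) (DL b x \<otimes> g y)"
      using prod DL_mult_comp(1)[OF b prod(1)] by (intro tpair.prod)
    then show ?case using prod b Y g by (auto simp: DL_mult_comp(2))
  next
    case (add a a' c c')
    have "a \<in> carrier A" "a' \<in> carrier A" "c \<in> carrier A" "c' \<in> carrier A"
      using tpair_carrier[OF add(1) comp_sub Y(1) _ g(1)] tpair_carrier[OF add(2) comp_sub Y(1) _ g(1)] by auto
    then show ?case using add b by (simp add: DL_add tpair.add)
  qed (use b in simp)
  from this[OF Suc.prems] have "DL b t = \<zero>" if "b \<in> B" for b using Suc.IH that by simp
  then show ?case using DL_inj s[OF Suc.prems] by blast
qed

text \<open>The projective factor has degree 1, so one coordinate map suffices: \<open>DR b\<close>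
  sends a pair (z, t) to (x, f x) with x in X, and z = 0 forces f x = f 0 = 0.\<close>

lemma tpair_unique_right:
  assumes X: "X \<subseteq> carrier A" "\<zero> \<in> X" "\<And>x y. x \<in> X \<Longrightarrow> y \<in> X \<Longrightarrow> x \<oplus> y \<in> X"
      "\<And>b y. b \<in> comp 0 \<Longrightarrow> y \<in> X \<Longrightarrow> y \<otimes> b \<in> X"
    and f: "\<And>y. y \<in> X \<Longrightarrow> f y \<in> carrier A" "\<And>x y. x \<in> X \<Longrightarrow> y \<in> X \<Longrightarrow> f (x \<oplus> y) = f x \<oplus> f y"
      "\<And>b y. b \<in> comp 0 \<Longrightarrow> y \<in> X \<Longrightarrow> f (y \<otimes> b) = f y \<otimes> b"
    and t: "tpair X (comp 1) f (\<lambda>x. x) \<zero> t"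
  shows "t = \<zero>"
proof -
  have f0: "f \<zero> = \<zero>" using f(2)[OF X(2,2)] f(1)[OF X(2)] by simp
  have s: "t \<in> tspan (carrier A) (comp 1)" if "tpair X (comp 1) f (\<lambda>x. x) z t" for z t
    using that
  proof (induction rule: tpair.induct)
    case (prod x y)
    then show ?case using tspan.prod[of "f x" "carrier A" y "comp 1"] f by simp
  qed (auto intro: tspan.intros)
  have "DR b z \<in> X \<and> DR b t = f (DR b z)" if "tpair X (comp 1) f (\<lambda>x. x) z t" and b: "b \<in> B" for b z t
    using that(1)
  proof (induction rule: tpair.induct)
    case (prod x y)
    have "x \<in> carrier A" using prod X by auto
    then show ?case using prod b X f DR_comp[OF b prod(2)] by (simp add: DR_mult)
  next
    case (add a a' c c')
    have "a \<in> carrier A" "a' \<in> carrier A" "c \<in> carrier A" "c' \<in> carrier A"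
      using tpair_carrier[OF add(1) X(1) comp_sub f(1)] tpair_carrier[OF add(2) X(1) comp_sub f(1)] by auto
    then show ?case using add b f X by (simp add: DR_add)
  qed (use b f0 X in simp)
  from this[OF t] have "DR b t = \<zero>" if "b \<in> B" for b using that f0 by simp
  then show ?thesis using DR_inj s[OF t] by blast
qed

end

locale filtered_bimodule = filtered_quotient +
  assumes P_sub: "subbimodule A P"
begin

lemma P_add: "x \<in> P \<Longrightarrow> y \<in> P \<Longrightarrow> x \<oplus> y \<in> P"
  using subgroup.m_closed[of P "add_monoid A"] P_sub by (simp add: subbimodule_def)
lemma P_zero [simp]: "\<zero> \<in> P"
  using subgroup.one_closed[of P "add_monoid A"] P_sub by (simp add: subbimodule_def)
lemma P_uminus: "x \<in> P \<Longrightarrow> \<ominus> x \<in> P"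
  using subgroup.m_inv_closed[of P "add_monoid A"] P_sub by (simp add: subbimodule_def a_inv_def)
lemma P_minus: "x \<in> P \<Longrightarrow> y \<in> P \<Longrightarrow> x \<ominus> y \<in> P" by (simp add: minus_eq P_add P_uminus)
lemma P_l: "b \<in> comp 0 \<Longrightarrow> x \<in> P \<Longrightarrow> b \<otimes> x \<in> P" using P_sub by (simp add: subbimodule_def)
lemma P_r: "b \<in> comp 0 \<Longrightarrow> x \<in> P \<Longrightarrow> x \<otimes> b \<in> P" using P_sub by (simp add: subbimodule_def)
lemma P_car [simp]: "x \<in> P \<Longrightarrow> x \<in> carrier A" using P_carrier by blast

lemma R_car [simp]: "x \<in> R \<Longrightarrow> x \<in> carrier A" using R_carrier by blast
lemma R_add: assumes "x \<in> R" "y \<in> R" shows "x \<oplus> y \<in> R"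
proof -
  obtain p q where "p \<in> P" "q \<in> P" "x = hp 2 p" "y = hp 2 q" using assms by blast
  then show ?thesis using P_add[of p q] by (intro image_eqI[of _ _ "p \<oplus> q"]) (auto simp: hp_add)
qed
lemma R_zero [simp]: "\<zero> \<in> R" using P_zero by (intro image_eqI[of _ _ "\<zero>"]) auto
lemma R_uminus: assumes "x \<in> R" shows "\<ominus> x \<in> R"
proof -
  obtain p where "p \<in> P" "x = hp 2 p" using assms by blast
  then show ?thesis using P_uminus[of p] by (intro image_eqI[of _ _ "\<ominus> p"]) (auto simp: hp_uminus)
qed
lemma R_l: assumes "b \<in> comp 0" "x \<in> R" shows "b \<otimes> x \<in> R"
proof -
  obtain p where "p \<in> P" "x = hp 2 p" using assms by blast
  then show ?thesis using P_l[OF assms(1), of p] assms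
    by (intro image_eqI[of _ _ "b \<otimes> p"]) (auto simp: hp_mult_l)
qed
lemma R_r: assumes "b \<in> comp 0" "x \<in> R" shows "x \<otimes> b \<in> R"
proof -
  obtain p where "p \<in> P" "x = hp 2 p" using assms by blast
  then show ?thesis using P_r[OF assms(1), of p] assms
    by (intro image_eqI[of _ _ "p \<otimes> b"]) (auto simp: hp_mult_r)
qed
lemma R_comp2: "x \<in> R \<Longrightarrow> x \<in> comp 2" using R_comp by blast

text \<open>An ideal generated by forms of degree 2 starts in degree 2, and there it is R itself
  because R is stable under degree 0 on both sides. The elements with these three properties form an
  ideal containing R.\<close>

lemma IR_low:
  assumes "x \<in> IR" shows "hp 0 x = \<zero>" "hp 1 x = \<zero>" "hp 2 x \<in> R"
proof -
  let ?Y = "{y \<in> carrier A. hp 0 y = \<zero> \<and> hp 1 y = \<zero> \<and> hp 2 y \<in> R}"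
  have "ideal ?Y A"
  proof (rule idealI[OF ring_axioms])
    show "subgroup ?Y (add_monoid A)"
      by unfold_locales (auto simp del: One_nat_def simp: hp_add hp_uminus R_add R_uminus a_inv_def[symmetric])
    fix a x assume a: "a \<in> ?Y" and x: "x \<in> carrier A"
    from x have "hp 0 (x \<otimes> a) = \<zero> \<and> hp 1 (x \<otimes> a) = \<zero> \<and> hp 2 (x \<otimes> a) \<in> R"
    proof (induction rule: graded_induct)
      case (hom x i)
      consider "i = 0" | "i = 1" | "i = 2" | "i > 2" by linarith
      then show ?case using a hom R_l[of x "hp 2 a"]
        by cases (auto simp: hp_mult_l numeral_2_eq_2 R_zero[unfolded numeral_2_eq_2])
    next
      case (add x y)
      then show ?case using a by (simp add: hp_add l_distr R_add del: One_nat_def)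
    qed
    then show "x \<otimes> a \<in> ?Y" using a x by simp
    from x have "hp 0 (a \<otimes> x) = \<zero> \<and> hp 1 (a \<otimes> x) = \<zero> \<and> hp 2 (a \<otimes> x) \<in> R"
    proof (induction rule: graded_induct)
      case (hom x i)
      consider "i = 0" | "i = 1" | "i = 2" | "i > 2" by linarith
      then show ?case using a hom R_r[of x "hp 2 a"]
        by cases (auto simp: hp_mult_r numeral_2_eq_2 R_zero[unfolded numeral_2_eq_2])
    next
      case (add x y)
      then show ?case using a by (simp add: hp_add r_distr R_add del: One_nat_def)
    qed
    then show "a \<otimes> x \<in> ?Y" using a x by simp
  qed
  moreover have "R \<subseteq> ?Y"
  proof
    fix r assume r: "r \<in> R"
    then show "r \<in> ?Y" by (simp add: hp_hom[OF R_comp2[OF r]])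
  qed
  ultimately have "IR \<subseteq> ?Y" by (rule genideal_minimal)
  then show "hp 0 x = \<zero>" "hp 1 x = \<zero>" "hp 2 x \<in> R" using assms by blast+
qed

end

text \<open>Koszulness enters the diamond argument only through \<open>koszul_step\<close>, so the
  argument can be run without mentioning V, S or G. The element x has degree m + 3; it ends in a
  relation, and it also ends in a letter preceded by an element of \<langle>R\<rangle>.\<close>

locale pbw = filtered_bimodule A P + free_gen A B eps DL DR
  for A :: "('k::field, 'a, 'm) graded_algebra_scheme" (structure) and P and B :: "'e set" and eps DL DR +
  assumes koszul_step: "x \<in> tspan (component A (Suc m)) (hom_part A 2 ` P) \<Longrightarrow>
      x \<in> tspan (genideal A (hom_part A 2 ` P) \<inter> component A (Suc (Suc m))) (component A 1) \<Longrightarrow>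
      \<exists>y z. x = y \<oplus> z \<and>
        y \<in> tspan (component A m) (tspan (hom_part A 2 ` P) (component A 1) \<inter> tspan (component A 1) (hom_part A 2 ` P)) \<and>
        z \<in> tspan (genideal A (hom_part A 2 ` P) \<inter> component A (Suc m)) (hom_part A 2 ` P)"

section \<open>The diamond argument\<close>

lemma (in galg) diff_zero [simp]: "x \<in> carrier A \<Longrightarrow> x \<ominus> \<zero> = x"
  by (simp add: minus_eq)

context pbw
begin

text \<open>The part of \<open>I\<close> that is reached without exceeding degree n: sums of t p u_1
  ... u_j with t \<in> F^m, p \<in> P, letters u_i and m + 2 + j = n. The aim is that every element
  of \<open>I\<close> in F^n lies in \<open>N n\<close>; from such an expression its leading form
  can be read off.\<close>

inductive N :: "nat \<Rightarrow> 'a \<Rightarrow> bool" where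
  zero [simp]: "N n \<zero>"
| add: "N n x \<Longrightarrow> N n y \<Longrightarrow> N n (x \<oplus> y)"
| base: "t \<in> filtration A m \<Longrightarrow> p \<in> P \<Longrightarrow> N (Suc (Suc m)) (t \<otimes> p)"
| step: "N n x \<Longrightarrow> u \<in> comp 1 \<Longrightarrow> N (Suc n) (x \<otimes> u)"

lemma N_carrier [simp]: "N n x \<Longrightarrow> x \<in> carrier A"
  by (induction rule: N.induct) auto

lemma N_filt: "N n x \<Longrightarrow> x \<in> filtration A n"
proof (induction rule: N.induct)
  case (base t m p)
  then show ?case using filt_mult[of t m p 2] P_filt by auto
next
  case (step n x u)
  then show ?case using filt_mult[of x n u 1] filt_comp[OF step(2) order_refl] by simp
qed (auto intro: filt_add)

lemma N_Suc: "N n x \<Longrightarrow> N (Suc n) x"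
proof (induction rule: N.induct)
  case (base t m p)
  show ?case by (rule N.base[OF filt_mono[OF base(1)] base(2)]) simp
qed (auto intro: N.intros)

lemma N_mono: "N n x \<Longrightarrow> n \<le> m \<Longrightarrow> N m x"
  by (induction m) (auto simp: le_Suc_eq intro: N_Suc)

lemma N_l: "N n x \<Longrightarrow> a \<in> filtration A i \<Longrightarrow> N (i + n) (a \<otimes> x)"
proof (induction rule: N.induct)
  case (base t m p)
  have "N (Suc (Suc (i + m))) ((a \<otimes> t) \<otimes> p)" by (rule N.base[OF filt_mult]) (use base in auto)
  then show ?case using base by (simp add: m_assoc)
next
  case (step n x u)
  have "N (Suc (i + n)) ((a \<otimes> x) \<otimes> u)" by (rule N.step) (use step in auto)
  then show ?case using step by (simp add: m_assoc)
qed (auto simp: r_distr intro: N.intros)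

lemma N_r0: "N n x \<Longrightarrow> b \<in> comp 0 \<Longrightarrow> N n (x \<otimes> b)"
proof (induction rule: N.induct)
  case (base t m p)
  have "N (Suc (Suc m)) (t \<otimes> (p \<otimes> b))" by (rule N.base) (use base P_r in auto)
  then show ?case using base by (simp add: m_assoc)
next
  case (step n x u)
  have "u \<otimes> b \<in> comp 1" using comp_mult[of u 1 b 0] step by simp
  then have "N (Suc n) (x \<otimes> (u \<otimes> b))" using step by (intro N.step) auto
  then show ?case using step by (simp add: m_assoc)
qed (auto simp: l_distr intro: N.intros)

lemma N_r_comp: "N n x \<Longrightarrow> t \<in> comp j \<Longrightarrow> N (n + j) (x \<otimes> t)"
proof (induction j arbitrary: t)
  case 0
  then show ?case by (simp add: N_r0)
next
  case (Suc j)
  have "t \<in> tspan (comp j) (comp 1)" using Suc gen_right by blast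
  then show ?case
  proof (induction rule: tspan.induct)
    case (prod s u)
    have "N (Suc (n + j)) ((x \<otimes> s) \<otimes> u)" by (rule N.step) (use prod Suc in auto)
    then show ?case using prod Suc by (simp add: m_assoc)
  next
    case (add a b)
    then show ?case using tspan_carrier[OF _ comp_sub comp_sub] Suc(2) by (auto simp: r_distr intro: N.add)
  qed (use Suc(2) in simp)
qed

lemma N_r: "N n x \<Longrightarrow> t \<in> filtration A j \<Longrightarrow> N (n + j) (x \<otimes> t)"
proof -
  assume x: "N n x" and "t \<in> filtration A j"
  from this(2) show ?thesis
  proof (induction rule: filt_induct)
    case (hom t i)
    then show ?case using N_mono[OF N_r_comp[OF x hom(1)], of "n + j"] by simp
  next
    case (add a b)
    then show ?case using x by (simp add: r_distr N.add)
  qed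
qed

lemma N_uminus: "N n x \<Longrightarrow> N n (\<ominus> x)"
  using N_l[of n x "\<ominus> \<one>" 0] filt_comp[OF comp_uminus[OF comp_one]] by (simp add: l_minus)

lemma N_minus: "N n x \<Longrightarrow> N n y \<Longrightarrow> N n (x \<ominus> y)"
  by (simp add: minus_eq N.add N_uminus)

text \<open>The union of all \<open>N n\<close> is a two-sided ideal: a left factor is absorbed into
  t, and a form of degree j on the right is a sum of products of j letters, up to a factor of degree
  0 that is absorbed by the last letter or by p.\<close>

lemma I_N: "x \<in> I \<Longrightarrow> \<exists>n. N n x"
proof -
  let ?Y = "{x. \<exists>n. N n x}"
  have "ideal ?Y A"
  proof (rule idealI[OF ring_axioms])
    show "subgroup ?Y (add_monoid A)"
    proof
      fix x y assume "x \<in> ?Y" "y \<in> ?Y"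
      then obtain n m where "N n x" "N m y" by blast
      then have "N (max n m) x" "N (max n m) y" using N_mono by auto
      then show "x \<otimes>\<^bsub>add_monoid A\<^esub> y \<in> ?Y" using N.add by auto
    qed (auto simp: a_inv_def[symmetric] intro: N_uminus exI[of _ 0])
    fix a x assume a: "a \<in> ?Y" and x: "x \<in> carrier A"
    obtain j where j: "x \<in> filtration A j" using filt_ex[OF x] by blast
    obtain n where n: "N n a" using a by blast
    show "x \<otimes> a \<in> ?Y" "a \<otimes> x \<in> ?Y" using N_l[OF n j] N_r[OF n j] by blast+
  qed
  moreover have "P \<subseteq> ?Y"
  proof
    fix p assume p: "p \<in> P"
    have "N 2 (\<one> \<otimes> p)" using N.base[of \<one> 0 p] p comp_one by (simp add: filt_comp numeral_2_eq_2)
    then show "p \<in> ?Y" using p by auto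
  qed
  ultimately have "I \<subseteq> ?Y" by (rule genideal_minimal)
  then show "x \<in> I \<Longrightarrow> \<exists>n. N n x" by blast
qed

end

text \<open>The derivations of the relation \<open>X = 0\<close> in the homogeneous algebra, together with the lower
  order terms \<open>Y\<close> by which they lift to the filtered algebra.\<close>

locale pbw_map = pbw +
  fixes psi :: "'a \<Rightarrow> 'a"
  assumes psi_filt: "x \<in> hom_part A 2 ` P \<Longrightarrow> psi x \<in> filtration A 1"
    and psi_add: "x \<in> hom_part A 2 ` P \<Longrightarrow> y \<in> hom_part A 2 ` P \<Longrightarrow> psi (x \<oplus> y) = psi x \<oplus> psi y"
    and psi_l: "b \<in> component A 0 \<Longrightarrow> x \<in> hom_part A 2 ` P \<Longrightarrow> psi (b \<otimes> x) = b \<otimes> psi x"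
    and psi_r: "b \<in> component A 0 \<Longrightarrow> x \<in> hom_part A 2 ` P \<Longrightarrow> psi (x \<otimes> b) = psi x \<otimes> b"
    and P_eq: "P = {x \<ominus> psi x | x. x \<in> hom_part A 2 ` P}"
begin

abbreviation "EE n \<equiv> tpair (comp n) R (\<lambda>x. x) psi"

lemma psi_car [simp]: "x \<in> R \<Longrightarrow> psi x \<in> carrier A" using psi_filt filt_carrier by blast

lemma psi_P: "x \<in> R \<Longrightarrow> x \<ominus> psi x \<in> P"
  by (subst P_eq) blast

lemma R_sub: "R \<subseteq> carrier A" using R_car by blast

lemma EE_zero: "EE n \<zero> t \<Longrightarrow> t = \<zero>"
  by (rule tpair_unique_left[OF R_sub R_zero R_add R_l psi_car psi_add psi_l])

lemma EE_car: assumes "EE n x y" shows "x \<in> carrier A" "y \<in> carrier A"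
  using tpair_carrier[OF assms comp_sub R_sub _ psi_car] by auto

text \<open>By flatness of T^n, id \<otimes> \<open>psi\<close> is a function on T^n \<otimes> R.
  The diamond argument uses this to identify two lifts that arise from different expressions of one
  element.\<close>

lemma EE_unique:
  assumes "EE n x y" "EE n x y'" shows "y = y'"
proof -
  have c: "x \<in> carrier A" "y \<in> carrier A" "y' \<in> carrier A"
    using tpair_carrier[OF assms(1) comp_sub R_sub] tpair_carrier[OF assms(2) comp_sub R_sub] by auto
  have "EE n (\<ominus> x) (\<ominus> y')"
    by (rule tpair_uminus[OF assms(2) comp_sub R_sub]) (auto intro: comp_uminus)
  then have "EE n (x \<oplus> \<ominus> x) (y \<oplus> \<ominus> y')" by (rule tpair.add[OF assms(1)])
  then have "y \<oplus> \<ominus> y' = \<zero>" using c EE_zero by (simp add: r_neg)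
  then show ?thesis using c diff_eq_0[of y y'] by (simp add: minus_eq)
qed

text \<open>X runs over the sums of t r u_1 ... u_j of degree n with r \<in> R, and Y is the same
  sum with r replaced by \<open>psi r\<close>, so that X - Y \<in> I. Y depends on the expression
  and not only on X; the diamond argument measures this dependence.\<close>

inductive D :: "nat \<Rightarrow> 'a \<Rightarrow> 'a \<Rightarrow> bool" where
  zero [simp]: "D n \<zero> \<zero>"
| add: "D n x y \<Longrightarrow> D n x' y' \<Longrightarrow> D n (x \<oplus> x') (y \<oplus> y')"
| base: "t \<in> comp m \<Longrightarrow> r \<in> R \<Longrightarrow> D (Suc (Suc m)) (t \<otimes> r) (t \<otimes> psi r)"
| step: "D n x y \<Longrightarrow> u \<in> comp 1 \<Longrightarrow> D (Suc n) (x \<otimes> u) (y \<otimes> u)"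

text \<open>The derivations in which every summand has a letter after its relation: elements of
  \<langle>R\<rangle> \<otimes> U together with lower terms that leave the last letter
  untouched.\<close>

inductive DU :: "nat \<Rightarrow> 'a \<Rightarrow> 'a \<Rightarrow> bool" where
  zero [simp]: "DU n \<zero> \<zero>"
| add: "DU n x y \<Longrightarrow> DU n x' y' \<Longrightarrow> DU n (x \<oplus> x') (y \<oplus> y')"
| step: "D n x y \<Longrightarrow> u \<in> comp 1 \<Longrightarrow> DU n (x \<otimes> u) (y \<otimes> u)"

lemma D_IR: "D n x y \<Longrightarrow> x \<in> IR \<inter> comp n"
proof (induction rule: D.induct)
  case (base t m r)
  have "t \<otimes> r \<in> comp (m + 2)" by (rule comp_mult[OF base(1) R_comp2[OF base(2)]])
  then show ?case using IR.I_l_closed[OF R_IR[OF base(2)], of t] base(1) by simp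
next
  case (step n x y u)
  then show ?case using comp_mult[of x n u 1] by (auto intro: IR.I_r_closed)
qed (auto intro: comp_add)

lemma D_prevF: "D n x y \<Longrightarrow> y \<in> prevF n"
proof (induction rule: D.induct)
  case (base t m r)
  then show ?case using filt_mult[OF filt_comp[OF base(1) order_refl] psi_filt[OF base(2)]] by (simp add: prevF_def)
next
  case (step n x y u)
  then show ?case using prevF_mult_l[OF step(3) filt_comp[OF step(2) order_refl]] by simp
qed (auto intro: prevF_add)

lemma D_car [simp]: assumes "D n x y" shows "x \<in> carrier A" "y \<in> carrier A"
  using D_IR[OF assms] prevF_carrier[OF D_prevF[OF assms]] by auto

lemma D_N: "D n x y \<Longrightarrow> N n (x \<ominus> y)"
proof (induction rule: D.induct)
  case (add n x y x' y')
  then show ?case using N.add[OF add(3,4)] by (simp add: diff_add_diff)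
next
  case (base t m r)
  have "N (Suc (Suc m)) (t \<otimes> (r \<ominus> psi r))" by (rule N.base[OF filt_comp psi_P]) (use base in auto)
  then show ?case using base by (simp add: minus_eq r_distr r_minus)
next
  case (step n x y u)
  have "N (Suc n) ((x \<ominus> y) \<otimes> u)" by (rule N.step) (use step in auto)
  then show ?case using step by (simp add: minus_eq l_distr l_minus)
qed simp

lemma D_r0: "D n x y \<Longrightarrow> b \<in> comp 0 \<Longrightarrow> D n (x \<otimes> b) (y \<otimes> b)"
proof (induction rule: D.induct)
  case (base t m r)
  have "D (Suc (Suc m)) (t \<otimes> (r \<otimes> b)) (t \<otimes> psi (r \<otimes> b))" by (rule D.base) (use base R_r in auto)
  then show ?case using base by (simp add: m_assoc psi_r)
next
  case (step n x y u)
  have "u \<otimes> b \<in> comp 1" using comp_mult[of u 1 b 0] step by simp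
  then have "D (Suc n) (x \<otimes> (u \<otimes> b)) (y \<otimes> (u \<otimes> b))" using step by (intro D.step) auto
  then show ?case using step by (simp add: m_assoc)
qed (auto simp: l_distr intro: D.intros)

lemma D_l: "D n x y \<Longrightarrow> a \<in> comp i \<Longrightarrow> D (i + n) (a \<otimes> x) (a \<otimes> y)"
proof (induction rule: D.induct)
  case (base t m r)
  have "D (Suc (Suc (i + m))) ((a \<otimes> t) \<otimes> r) ((a \<otimes> t) \<otimes> psi r)" by (rule D.base[OF comp_mult]) (use base in auto)
  then show ?case using base by (simp add: m_assoc)
next
  case (step n x y u)
  have "D (Suc (i + n)) ((a \<otimes> x) \<otimes> u) ((a \<otimes> y) \<otimes> u)" by (rule D.step) (use step in auto)
  then show ?case using step by (simp add: m_assoc)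
qed (auto simp: r_distr intro: D.intros)

lemma D_r: "D n x y \<Longrightarrow> t \<in> comp j \<Longrightarrow> D (n + j) (x \<otimes> t) (y \<otimes> t)"
proof (induction j arbitrary: t)
  case 0
  then show ?case by (simp add: D_r0)
next
  case (Suc j)
  have "t \<in> tspan (comp j) (comp 1)" using Suc gen_right by blast
  then show ?case
  proof (induction rule: tspan.induct)
    case (prod s u)
    have "D (Suc (n + j)) ((x \<otimes> s) \<otimes> u) ((y \<otimes> s) \<otimes> u)" by (rule D.step) (use prod Suc in auto)
    then show ?case using prod Suc by (simp add: m_assoc)
  next
    case (add a b)
    then show ?case using tspan_carrier[OF _ comp_sub comp_sub] Suc(2) by (auto simp: r_distr intro: D.add)
  qed (use Suc(2) in simp)
qed

lemma D_uminus: "D n x y \<Longrightarrow> D n (\<ominus> x) (\<ominus> y)"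
  using D_l[of n x y "\<ominus> \<one>" 0] comp_uminus[OF comp_one] by (simp add: l_minus)

lemma D_ex_zero: "Ex (D n \<zero>)" using D.zero by blast

text \<open>Every form in \<langle>R\<rangle> has a derivation, by the same ideal argument as for
  \<open>IR_hp\<close>; the lower terms depend on choices.\<close>

lemma IR_D: "x \<in> IR \<Longrightarrow> \<exists>y. D n (hp n x) y"
proof -
  let ?Y = "{x \<in> carrier A. \<forall>n. \<exists>y. D n (hp n x) y}"
  have "ideal ?Y A"
  proof (rule idealI[OF ring_axioms])
    show "subgroup ?Y (add_monoid A)"
    proof
      fix x y assume a: "x \<in> ?Y" "y \<in> ?Y"
      then have "\<exists>z. D n (hp n (x \<oplus> y)) z" for n using D.add[of n "hp n x" _ "hp n y"] by (fastforce simp: hp_add)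
      then show "x \<otimes>\<^bsub>add_monoid A\<^esub> y \<in> ?Y" using a by simp
    next
      fix x assume "x \<in> ?Y"
      then show "inv\<^bsub>add_monoid A\<^esub> x \<in> ?Y" using D_uminus by (fastforce simp: a_inv_def[symmetric] hp_uminus)
    qed (auto intro: D.zero)
    fix a x assume a: "a \<in> ?Y" and x: "x \<in> carrier A"
    from x have "\<forall>n. \<exists>y. D n (hp n (x \<otimes> a)) y"
    proof (induction rule: graded_induct)
      case (hom x i)
      have "\<exists>y. D n (x \<otimes> hp (n - i) a) y" if "i \<le> n" for n
        using a D_l[OF _ hom, of "n - i" "hp (n - i) a"] that by fastforce
      then show ?case using a hom D_ex_zero by (auto simp: hp_mult_l)
    next
      case (add x y)
      then have "\<exists>z. D n (hp n (x \<otimes> a) \<oplus> hp n (y \<otimes> a)) z" for n using D.add by blast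
      then show ?case using a add by (simp add: hp_add l_distr)
    qed
    then show "x \<otimes> a \<in> ?Y" using a x by simp
    from x have "\<forall>n. \<exists>y. D n (hp n (a \<otimes> x)) y"
    proof (induction rule: graded_induct)
      case (hom x i)
      have "\<exists>y. D n (hp (n - i) a \<otimes> x) y" if "i \<le> n" for n
        using a D_r[OF _ hom, of "n - i" "hp (n - i) a"] that by fastforce
      then show ?case using a hom D_ex_zero by (auto simp: hp_mult_r)
    next
      case (add x y)
      then have "\<exists>z. D n (hp n (a \<otimes> x) \<oplus> hp n (a \<otimes> y)) z" for n using D.add by blast
      then show ?case using a add by (simp add: hp_add r_distr)
    qed
    then show "a \<otimes> x \<in> ?Y" using a x by simp
  qed
  moreover have "R \<subseteq> ?Y"
  proof
    fix r assume r: "r \<in> R"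
    have "D 2 (\<one> \<otimes> r) (\<one> \<otimes> psi r)" using D.base[OF comp_one r] by (simp add: numeral_2_eq_2)
    then have "D 2 r (psi r)" using r by simp
    then show "r \<in> ?Y" using r D_ex_zero by (auto simp: hp_hom[OF R_comp2[OF r]])
  qed
  ultimately have "IR \<subseteq> ?Y" by (rule genideal_minimal)
  then show "x \<in> IR \<Longrightarrow> \<exists>y. D n (hp n x) y" by blast
qed

lemma DU_car [simp]: "DU n x y \<Longrightarrow> x \<in> carrier A" "DU n x y \<Longrightarrow> y \<in> carrier A"
  by (induction rule: DU.induct) auto

lemma DU_tspan: "DU n x y \<Longrightarrow> x \<in> tspan (IR \<inter> comp n) (comp 1)"
  by (induction rule: DU.induct) (auto intro: tspan.intros dest: D_IR)

lemma DU_uminus: "DU n x y \<Longrightarrow> DU n (\<ominus> x) (\<ominus> y)"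
proof (induction rule: DU.induct)
  case (step n x y u)
  have "DU n (\<ominus> x \<otimes> u) (\<ominus> y \<otimes> u)" by (rule DU.step[OF D_uminus]) (use step in auto)
  then show ?case using step by (simp add: l_minus)
qed (auto simp: minus_add intro: DU.intros)

text \<open>Since the last letter is untouched, taking a right coordinate leaves a derivation of one
  degree less.\<close>

lemma DU_DR: "DU n x y \<Longrightarrow> b \<in> B \<Longrightarrow> D n (DR b x) (DR b y)"
proof (induction rule: DU.induct)
  case (step n x y u)
  then show ?case using D_r0[OF step(1) DR_comp[OF step(3,2)]] by (simp add: DR_mult)
qed (auto simp: DR_add intro: D.intros)

lemma DU_pos: "DU n x y \<Longrightarrow> y \<in> tspan (carrier A) (comp 1)"
  by (induction rule: DU.induct) (auto intro: tspan.intros)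

text \<open>The summands t r u_1 ... u_j are sorted by whether j > 0 or j = 0. The former end in a
  letter, the latter lie in T^m \<otimes> R and are lifted by id \<otimes> \<open>psi\<close>. Below
  degree 2 there is no relation and everything is zero.\<close>

lemma D_split:
  "D n X Y \<Longrightarrow> (n < 2 \<longrightarrow> X = \<zero> \<and> Y = \<zero>) \<and>
    (\<forall>m. n = Suc (Suc m) \<longrightarrow> (\<exists>X1 Y1 X2 Y2. DU (Suc m) X1 Y1 \<and> EE m X2 Y2 \<and> X = X1 \<oplus> X2 \<and> Y = Y1 \<oplus> Y2))"
proof (induction rule: D.induct)
  case (zero n)
  have "\<zero> = \<zero> \<oplus> \<zero>" by simp
  then show ?case using DU.zero tpair.zero by blast
next
  case (add n x y x' y')
  have "\<exists>X1 Y1 X2 Y2. DU (Suc m) X1 Y1 \<and> EE m X2 Y2 \<and> x \<oplus> x' = X1 \<oplus> X2 \<and> y \<oplus> y' = Y1 \<oplus> Y2" if n: "n = Suc (Suc m)" for m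
  proof -
    obtain X1 Y1 X2 Y2 where 1: "DU (Suc m) X1 Y1" "EE m X2 Y2" "x = X1 \<oplus> X2" "y = Y1 \<oplus> Y2" using add n by blast
    obtain X1' Y1' X2' Y2' where 2: "DU (Suc m) X1' Y1'" "EE m X2' Y2'" "x' = X1' \<oplus> X2'" "y' = Y1' \<oplus> Y2'" using add n by blast
    note c = EE_car[OF 1(2)] EE_car[OF 2(2)]
      DU_car[OF 1(1)] DU_car[OF 2(1)]
    have "x \<oplus> x' = (X1 \<oplus> X1') \<oplus> (X2 \<oplus> X2')" "y \<oplus> y' = (Y1 \<oplus> Y1') \<oplus> (Y2 \<oplus> Y2')"
      using c 1 2 by (simp_all add: a_ac)
    then show ?thesis using DU.add[OF 1(1) 2(1)] tpair.add[OF 1(2) 2(2)] by blast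
  qed
  then show ?case using add by auto
next
  case (base t m r)
  have "t \<otimes> r = \<zero> \<oplus> t \<otimes> r" "t \<otimes> psi r = \<zero> \<oplus> t \<otimes> psi r" using base by auto
  moreover have "DU (Suc m) \<zero> \<zero>" "EE m (t \<otimes> r) (t \<otimes> psi r)"
    using tpair.prod[OF base, of "\<lambda>x. x" psi] by auto
  ultimately have "\<exists>X1 Y1 X2 Y2. DU (Suc m) X1 Y1 \<and> EE m X2 Y2 \<and> t \<otimes> r = X1 \<oplus> X2 \<and> t \<otimes> psi r = Y1 \<oplus> Y2"
    by blast
  then show ?case by simp
next
  case (step n x y u)
  show ?case
  proof (intro conjI allI impI)
    assume "Suc n < 2"
    then show "x \<otimes> u = \<zero>" "y \<otimes> u = \<zero>" using step by auto
  next
    fix m assume "Suc n = Suc (Suc m)"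
    then have "DU (Suc m) (x \<otimes> u) (y \<otimes> u)" using DU.step[OF step(1,2)] by simp
    moreover have "x \<otimes> u = x \<otimes> u \<oplus> \<zero>" "y \<otimes> u = y \<otimes> u \<oplus> \<zero>" using step by auto
    ultimately show "\<exists>X1 Y1 X2 Y2. DU (Suc m) X1 Y1 \<and> EE m X2 Y2 \<and> x \<otimes> u = X1 \<oplus> X2 \<and> y \<otimes> u = Y1 \<oplus> Y2"
      using tpair.zero by blast
  qed
qed

text \<open>In a r with a \<in> \<langle>R\<rangle> the relation r may be treated as mere letters:
  it is a sum of products of two letters, and a derivation of a that is continued by them ends in a
  letter.\<close>

lemma DU_ideal_R:
  assumes a: "D n a a'" and r: "r \<in> R" shows "DU (Suc n) (a \<otimes> r) (a' \<otimes> r)"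
proof -
  have "r \<in> comp (Suc 1)" using R_comp2[OF r] by (simp add: numeral_2_eq_2)
  then have "r \<in> tspan (comp 1) (comp 1)" using gen_right by blast
  then show ?thesis
  proof (induction rule: tspan.induct)
    case (prod s u)
    have "DU (Suc n) ((a \<otimes> s) \<otimes> u) ((a' \<otimes> s) \<otimes> u)" by (rule DU.step[OF D.step[OF a]]) (use prod in auto)
    then show ?case using prod a by (simp add: m_assoc)
  next
    case (add x y)
    then show ?case using a tspan_carrier[OF _ comp_sub comp_sub] by (auto simp: r_distr intro: DU.add)
  qed (use a in simp)
qed

text \<open>The element a r can be reduced at r or inside a, with lower terms a \<open>psi r\<close>
  and a' r. The two relations do not overlap, and the results differ by (a - a')
  \<open>psi r\<close> - a' (r - \<open>psi r\<close>). Both terms stay in degree n + 1, because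
  \<open>psi r\<close> has degree at most 1 and a' has degree at most n - 1.\<close>

lemma N_ideal_R:
  assumes a: "D n a a'" and r: "r \<in> R" shows "N (Suc n) (a \<otimes> psi r \<ominus> a' \<otimes> r)"
proof -
  have "N (n + 1) ((a \<ominus> a') \<otimes> psi r)" by (rule N_r[OF D_N[OF a] psi_filt[OF r]])
  moreover have "N (Suc n) (a' \<otimes> (r \<ominus> psi r))"
  proof (cases n)
    case 0
    \<comment> \<open>The convention F^(-1) = 0: below degree 0 there are no lower terms.\<close>
    then have "a' = \<zero>" using D_prevF[OF a] by (simp add: prevF_def)
    then show ?thesis using r by simp
  next
    case (Suc m)
    then show ?thesis using N.base[OF _ psi_P[OF r], of a' m] D_prevF[OF a] by (simp add: prevF_def)
  qed
  ultimately have "N (Suc n) ((a \<ominus> a') \<otimes> psi r \<ominus> a' \<otimes> (r \<ominus> psi r))" using N_minus by simp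
  moreover have "(a \<ominus> a') \<otimes> psi r \<ominus> a' \<otimes> (r \<ominus> psi r) = a \<otimes> psi r \<ominus> a' \<otimes> r"
  proof -
    have "(a \<ominus> a') \<otimes> psi r \<ominus> a' \<otimes> (r \<ominus> psi r) = (a \<otimes> psi r \<ominus> a' \<otimes> psi r) \<ominus> (a' \<otimes> r \<ominus> a' \<otimes> psi r)"
      using a r by (simp add: minus_eq l_distr r_distr l_minus r_minus)
    then show ?thesis using a r by (simp add: diff_diff_cancel)
  qed
  ultimately show ?thesis by simp
qed

abbreviation "WW \<equiv> tspan R (comp 1) \<inter> tspan (comp 1) R"

lemma EE_l: "EE n x y \<Longrightarrow> s \<in> comp m \<Longrightarrow> EE (m + n) (s \<otimes> x) (s \<otimes> y)"
proof (induction rule: tpair.induct)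
  case (prod t r)
  have "EE (m + n) ((s \<otimes> t) \<otimes> r) ((s \<otimes> t) \<otimes> psi r)" by (rule tpair.prod[OF comp_mult]) (use prod in auto)
  then show ?case using prod by (simp add: m_assoc)
next
  case (add a a' b b')
  then show ?case using EE_car[OF add(1)] EE_car[OF add(2)]
    by (simp add: r_distr tpair.add)
qed simp

lemma DU_l: "tpair R (comp 1) psi (\<lambda>x. x) x y \<Longrightarrow> s \<in> comp m \<Longrightarrow> DU (Suc (Suc m)) (s \<otimes> x) (s \<otimes> y)"
proof (induction rule: tpair.induct)
  case (prod r u)
  have "DU (Suc (Suc m)) ((s \<otimes> r) \<otimes> u) ((s \<otimes> psi r) \<otimes> u)" by (rule DU.step[OF D.base]) (use prod in auto)
  then show ?case using prod by (simp add: m_assoc)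
next
  case (add a a' b b')
  then show ?case using tpair_carrier[OF add(1) R_sub comp_sub psi_car] tpair_carrier[OF add(2) R_sub comp_sub psi_car]
    by (simp add: r_distr DU.add)
qed simp

text \<open>A derivation of 0 in degree n + 1 leaves lower terms Y \<in> I of degree at most n, and
  Y has to be reached within degree n. The summands that end in a relation add up to X2 = - X1, an
  element of \<langle>R\<rangle> \<otimes> U; the Koszul step rewrites them so that they end in a
  letter, at a cost in \<open>N\<close>. What remains is a derivation of 0 whose summands all end in
  a letter, and its right coordinates are derivations of 0 in one degree less.\<close>

lemma diamond:
  assumes cond: "\<And>k kL kR. tpair R (comp 1) psi (\<lambda>x. x) k kL \<Longrightarrow> EE 1 k kR \<Longrightarrow> kL \<ominus> kR \<in> P"
  shows "D (Suc n) \<zero> Y \<Longrightarrow> N n Y"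
proof (induction n arbitrary: Y)
  case 0
  then show ?case using D_split[OF 0] by simp
next
  case (Suc n)
  obtain X1 Y1 X2 Y2 where h: "DU (Suc n) X1 Y1" "EE n X2 Y2" "\<zero> = X1 \<oplus> X2" "Y = Y1 \<oplus> Y2"
    using D_split[OF Suc.prems] by blast
  note c = DU_car[OF h(1)] EE_car[OF h(2)]
  have "X2 \<oplus> X1 = \<zero>" using h(3) c a_comm[of X1 X2] by simp
  then have X2: "X2 = \<ominus> X1" using c by (intro minus_equality[symmetric])
  have t1: "X2 \<in> tspan (comp n) R" by (rule tpair_tspan[OF h(2)])
  have t2: "X2 \<in> tspan (IR \<inter> comp (Suc n)) (comp 1)" using DU_tspan[OF DU_uminus[OF h(1)]] X2 by simp
  \<comment> \<open>The elements with one reduction ending in a relation and one ending in a letter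
    whose results agree modulo \<open>N (Suc n)\<close>. They are closed under sums, so each summand
    given by the Koszul step can be treated by itself.\<close>
  define Z where "Z x = (\<exists>y y'. EE n x y \<and> DU (Suc n) x y' \<and> N (Suc n) (y \<ominus> y'))" for x
  have Z0: "Z \<zero>" unfolding Z_def by (rule exI[of _ \<zero>], rule exI[of _ \<zero>]) (simp add: minus_eq)
  have Zadd: "Z (x \<oplus> x')" if "Z x" "Z x'" for x x'
  proof -
    obtain y z where 1: "EE n x y" "DU (Suc n) x z" "N (Suc n) (y \<ominus> z)" using \<open>Z x\<close> by (auto simp: Z_def)
    obtain y' z' where 2: "EE n x' y'" "DU (Suc n) x' z'" "N (Suc n) (y' \<ominus> z')" using \<open>Z x'\<close> by (auto simp: Z_def)
    note c = EE_car[OF 1(1)] EE_car[OF 2(1)]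
      DU_car[OF 1(2)] DU_car[OF 2(2)]
    have "N (Suc n) ((y \<oplus> y') \<ominus> (z \<oplus> z'))" using N.add[OF 1(3) 2(3)] c by (simp add: diff_add_diff)
    then show ?thesis unfolding Z_def using tpair.add[OF 1(1) 2(1)] DU.add[OF 1(2) 2(2)] by blast
  qed
  have "Z X2"
  proof (cases n)
    case 0
    \<comment> \<open>In total degree 2 there are no overlaps: \<langle>R\<rangle> has no part of
      degree 1.\<close>
    have "x = \<zero>" if "x \<in> tspan (IR \<inter> comp 1) (comp 1)" for x
      using that
    proof (induction rule: tspan.induct)
      case (prod x y)
      then have "x = \<zero>" using IR_low(2)[of x] hp_hom[of x 1 1] by auto
      then show ?case using prod by simp
    qed auto
    then have "X2 = \<zero>" using t2 0 by simp
    then show ?thesis using Z0 by simp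
  next
    case (Suc m)
    obtain y z where yz: "X2 = y \<oplus> z" "y \<in> tspan (comp m) WW" "z \<in> tspan (IR \<inter> comp (Suc m)) R"
      using koszul_step[of X2 m] t1 t2 Suc by auto
    have "Z y" using yz(2)
    proof (induction rule: tspan.induct)
      case (prod s k)
      obtain kL where kL: "tpair R (comp 1) psi (\<lambda>x. x) k kL" using tspan_tpair[of k R "comp 1"] prod by blast
      obtain kR where kR: "EE 1 k kR" using tspan_tpair[of k "comp 1" R] prod by blast
      note c = tpair_carrier[OF kL R_sub comp_sub psi_car] EE_car[OF kR]
      have "EE n (s \<otimes> k) (s \<otimes> kR)" using EE_l[OF kR prod(1)] Suc by simp
      moreover have "DU (Suc n) (s \<otimes> k) (s \<otimes> kL)" using DU_l[OF kL prod(1)] Suc by simp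
      moreover have "N (Suc n) (s \<otimes> kR \<ominus> s \<otimes> kL)"
      proof -
        \<comment> \<open>The overlap condition puts \<open>kL \<ominus> kR\<close> into P, so the
          two reductions differ by s times an element of P, which stays in degree m + 2 = n +
          1.\<close>
        have "N (Suc (Suc m)) (s \<otimes> (kL \<ominus> kR))"
          by (rule N.base[OF filt_comp[OF prod(1) order_refl] cond[OF kL kR]])
        then have "N (Suc n) (\<ominus> (s \<otimes> (kL \<ominus> kR)))" using N_uminus Suc by simp
        moreover have "\<ominus> (s \<otimes> (kL \<ominus> kR)) = s \<otimes> kR \<ominus> s \<otimes> kL" using c prod(1)
          by (simp add: minus_eq r_distr r_minus minus_add minus_minus a_comm)
        ultimately show ?thesis by simp
      qed
      ultimately show ?case unfolding Z_def by blast
    qed (use Z0 Zadd in auto)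
    moreover have "Z z" using yz(3)
    proof (induction rule: tspan.induct)
      case (prod a r)
      obtain a' where a': "D (Suc m) a a'" using IR_D[of a "Suc m"] prod by (auto simp: hp_hom)
      have "EE n (a \<otimes> r) (a \<otimes> psi r)" using tpair.prod[of a "comp n" r R "\<lambda>x. x" psi] prod Suc by simp
      then show ?case unfolding Z_def using DU_ideal_R[OF a' prod(2)] N_ideal_R[OF a' prod(2)] Suc by blast
    qed (use Z0 Zadd in auto)
    ultimately show ?thesis using Zadd yz(1) by simp
  qed
  then obtain y y' where z: "EE n X2 y" "DU (Suc n) X2 y'" "N (Suc n) (y \<ominus> y')" by (auto simp: Z_def)
  have y: "y = Y2" by (rule EE_unique[OF z(1) h(2)])
  \<comment> \<open>The derivation of X2 ending in relations is replaced by the one ending in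
    letters; the total is still 0.\<close>
  have DU: "DU (Suc n) \<zero> (Y1 \<oplus> y')" using DU.add[OF h(1) z(2)] h(3) by simp
  have NY: "N (Suc n) (Y1 \<oplus> y')"
  proof -
    have "N n (DR b (Y1 \<oplus> y'))" if b: "b \<in> B" for b
      using Suc.IH DU_DR[OF DU b] b by simp
    then have n: "N (Suc n) (DR b (Y1 \<oplus> y') \<otimes> eps b)" if "b \<in> B" for b using N.step eps_comp that by blast
    have "N (Suc n) (\<Oplus>b\<in>F. DR b (Y1 \<oplus> y') \<otimes> eps b)" if "finite F" "F \<subseteq> B" for F
      using that
    proof (induction F rule: finite_induct)
      case (insert b F)
      have "(\<lambda>b. DR b (Y1 \<oplus> y') \<otimes> eps b) \<in> F \<rightarrow> carrier A" "DR b (Y1 \<oplus> y') \<otimes> eps b \<in> carrier A"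
        using n N_carrier insert by blast+
      then show ?case using insert n N.add by simp
    qed simp
    from this[OF finite_B] show ?thesis using DR_recon[OF DU_pos[OF DU]] by simp
  qed
  have "Y = (Y1 \<oplus> y') \<oplus> (Y2 \<ominus> y')" using h(4) c DU_car[OF z(2)] by (simp add: minus_eq a_ac r_neg2 r_neg)
  then show ?case using N.add[OF NY z(3)] y by simp
qed

text \<open>Leading terms: t is replaced by its top form, and p = r - \<open>psi r\<close>
  contributes r to X and \<open>psi r\<close> to Y. The rest of t gives products of one degree less,
  hence the part in \<open>N (n - 1)\<close>.\<close>

lemma N_split: "N n x \<Longrightarrow> n > 0 \<Longrightarrow> \<exists>X Y z. x = (X \<ominus> Y) \<oplus> z \<and> D n X Y \<and> N (n - 1) z"
proof (induction rule: N.induct)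
  case (zero n)
  have "\<zero> = (\<zero> \<ominus> \<zero>) \<oplus> \<zero>" by (simp add: minus_eq)
  then show ?case using D.zero N.zero by blast
next
  case (add n x y)
  then obtain X Y z X' Y' z' where h: "x = (X \<ominus> Y) \<oplus> z" "D n X Y" "N (n - 1) z" "y = (X' \<ominus> Y') \<oplus> z'" "D n X' Y'" "N (n - 1) z'"
    by blast
  note c = D_car[OF h(2)] D_car[OF h(5)] N_carrier[OF h(3)] N_carrier[OF h(6)]
  have "x \<oplus> y = ((X \<oplus> X') \<ominus> (Y \<oplus> Y')) \<oplus> (z \<oplus> z')" using c h(1,4) by (simp add: diff_add_diff a_ac)
  then show ?case using D.add[OF h(2,5)] N.add[OF h(3,6)] by blast
next
  case (base t m p)
  obtain r where r: "r \<in> R" "p = r \<ominus> psi r" using base(2) P_eq by blast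
  let ?t = "hp m t"
  have t: "t \<in> carrier A" "?t \<in> comp m" using base hp_comp by auto
  have d: "D (Suc (Suc m)) (?t \<otimes> r) (?t \<otimes> psi r)" by (rule D.base[OF t(2) r(1)])
  have "N (Suc m) ((t \<ominus> ?t) \<otimes> p)"
  proof (cases m)
    case 0
    then have "t \<ominus> ?t = \<zero>" using prevF_top[OF base(1)] by (simp add: prevF_def)
    then show ?thesis using base by simp
  next
    case (Suc k)
    then show ?thesis using N.base[OF _ base(2), of "t \<ominus> ?t" k] prevF_top[OF base(1)] by (simp add: prevF_def)
  qed
  moreover have "t \<otimes> p = (?t \<otimes> r \<ominus> ?t \<otimes> psi r) \<oplus> (t \<ominus> ?t) \<otimes> p"
  proof -
    have "?t \<otimes> r \<ominus> ?t \<otimes> psi r = ?t \<otimes> p" using t r by (simp add: minus_eq r_distr r_minus)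
    moreover have "?t \<otimes> p \<oplus> (t \<ominus> ?t) \<otimes> p = t \<otimes> p"
      using t base by (simp add: l_distr[symmetric] add_diff_cancel)
    ultimately show ?thesis by simp
  qed
  ultimately show ?case using d by fastforce
next
  case (step n x u)
  show ?case
  proof (cases "n = 0")
    case True
    have "x = \<zero>" if "N 0 x" for x
      using that by (induction "0::nat" x rule: N.induct) auto
    from this[of x] have "x = \<zero>" using step(1) True by blast
    then have "x \<otimes> u = (\<zero> \<ominus> \<zero>) \<oplus> \<zero>" using comp_carrier[OF step(2)] by (simp add: minus_eq)
    then show ?thesis using D.zero N.zero by blast
  next
    case False
    then obtain X Y z where h: "x = (X \<ominus> Y) \<oplus> z" "D n X Y" "N (n - 1) z" using step by blast
    note c = D_car[OF h(2)] N_carrier[OF h(3)]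
    have "x \<otimes> u = (X \<otimes> u \<ominus> Y \<otimes> u) \<oplus> z \<otimes> u" using c h(1) step(2) by (simp add: minus_eq l_distr l_minus)
    moreover have "N n (z \<otimes> u)" using N.step[OF h(3) step(2)] False by simp
    ultimately show ?thesis using D.step[OF h(2) step(2)] by fastforce
  qed
qed

text \<open>If x \<in> \<open>N m\<close> has degree below m, its leading part X in
  \<open>N_split\<close> is zero, and \<open>diamond\<close> puts Y, hence x, into
  \<open>N (m - 1)\<close>. Descending to n, the leading form of x becomes a sum of t r u_1 ... u_j
  and lies in \<langle>R\<rangle>. The hypothesis \<open>cond\<close> says that the two reductions
  of an overlap agree modulo P.\<close>

theorem PBW_type_if:
  assumes cond: "\<And>k kL kR. tpair R (comp 1) psi (\<lambda>x. x) k kL \<Longrightarrow> EE 1 k kR \<Longrightarrow> kL \<ominus> kR \<in> P"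
  shows "PBW_type A P"
  unfolding PBW_type_iff
proof (intro allI ballI)
  fix n x assume "x \<in> I \<inter> filtration A n"
  then have x: "x \<in> I" "x \<in> filtration A n" "x \<in> carrier A" by auto
  have desc: "N n x" if "N m x" "n \<le> m" for m
    using that
  proof (induction m rule: less_induct)
    case (less m)
    show ?case
    proof (cases "n = m")
      case True
      then show ?thesis using less by simp
    next
      case False
      then obtain k where k: "m = Suc k" "n \<le> k" using less by (cases m) auto
      then obtain X Y z where h: "x = (X \<ominus> Y) \<oplus> z" "D m X Y" "N k z" using N_split[OF less(2)] by auto
      have cX: "X \<in> comp m" using D_IR[OF h(2)] by blast
      have "hp m Y = \<zero>" using D_prevF[OF h(2)] by (rule prevF_hp)
      moreover have "hp m z = \<zero>" using N_filt[OF h(3)] k by (simp add: filtration_iff)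
      moreover have "hp m x = \<zero>" using x k by (simp add: filtration_iff)
      ultimately have "X = \<zero>" using h cX D_car[OF h(2)] N_carrier[OF h(3)]
        by (simp add: hp_add hp_minus hp_hom)
      then have "D (Suc k) \<zero> Y" using h(2) k by simp
      then have "N k Y" by (rule diamond[rotated]) (rule cond)
      then have "N k x" using h(1,3) \<open>X = \<zero>\<close> D_car[OF h(2)] N.add[OF N_minus[OF N.zero]] by simp
      then show ?thesis using less(1)[of k] k by simp
    qed
  qed
  obtain m where m: "N m x" using I_N[OF x(1)] by blast
  have N: "N n x" using desc[of "max n m"] N_mono[OF m, of "max n m"] by simp
  show "hp n x \<in> IR"
  proof (cases "n = 0")
    case True
    have "x = \<zero>" if "N 0 x" for x
      using that by (induction "0::nat" x rule: N.induct) auto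
    from this[of x] have "x = \<zero>" using N True by blast
    then show ?thesis by simp
  next
    case False
    then obtain X Y z where h: "x = (X \<ominus> Y) \<oplus> z" "D n X Y" "N (n - 1) z" using N_split[OF N] by auto
    have cX: "X \<in> comp n" "X \<in> IR" using D_IR[OF h(2)] by auto
    have "hp n Y = \<zero>" using D_prevF[OF h(2)] by (rule prevF_hp)
    moreover have "hp n z = \<zero>" using N_filt[OF h(3)] False by (simp add: filtration_iff)
    ultimately have "hp n x = X" using h cX D_car[OF h(2)] N_carrier[OF h(3)]
      by (simp add: hp_add hp_minus hp_hom)
    then show ?thesis using cX by simp
  qed
qed

end

section \<open>Conditions (i), (ii), (iii) and the overlap condition\<close>

lemma (in galg) diff_diff_cancel_left:
  assumes "x \<in> carrier A" "y \<in> carrier A" "z \<in> carrier A"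
  shows "(z \<ominus> y) \<ominus> (z \<ominus> x) = x \<ominus> y" "(z \<oplus> y) \<ominus> (z \<ominus> x) = y \<oplus> x"
  using assms by algebra+

context pbw
begin

definition "dif f z = tensor_hom A R (comp 1) f (\<lambda>x. x) z \<ominus> tensor_hom A (comp 1) R (\<lambda>x. x) f z"

lemma R_subset: "R \<subseteq> carrier A" using R_car by blast

context
  fixes f n assumes f: "f \<in> bimodule_hom A R (comp n)"
begin

lemma bh_comp: "x \<in> R \<Longrightarrow> f x \<in> comp n" using f unfolding bimodule_hom_def by blast
lemma bh_car [simp]: "x \<in> R \<Longrightarrow> f x \<in> carrier A" using bh_comp comp_carrier by blast
lemma bh_add: "x \<in> R \<Longrightarrow> y \<in> R \<Longrightarrow> f (x \<oplus> y) = f x \<oplus> f y" using f unfolding bimodule_hom_def by blast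
lemma bh_l: "b \<in> comp 0 \<Longrightarrow> x \<in> R \<Longrightarrow> f (b \<otimes> x) = b \<otimes> f x" using f unfolding bimodule_hom_def by blast
lemma bh_r: "b \<in> comp 0 \<Longrightarrow> x \<in> R \<Longrightarrow> f (x \<otimes> b) = f x \<otimes> b" using f unfolding bimodule_hom_def by blast

lemma bh_uminus: assumes "x \<in> R" shows "f (\<ominus> x) = \<ominus> f x"
proof -
  have "f \<zero> = \<zero>" using bh_add[of \<zero> \<zero>] by simp
  then have "f (\<ominus> x) \<oplus> f x = \<zero>" using bh_add[of "\<ominus> x" x] assms R_uminus by (simp add: l_neg)
  then show ?thesis using assms R_uminus by (intro minus_equality[symmetric]) auto
qed

text \<open>Flatness on both sides makes f \<otimes> id and id \<otimes> f single-valued, so the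
  definite descriptions in \<open>tensor_hom\<close> may be computed from any expression of
  z.\<close>

lemma dif_eq:
  assumes "tpair R (comp 1) f (\<lambda>x. x) z zL" "tpair (comp 1) R (\<lambda>x. x) f z zR"
  shows "dif f z = zL \<ominus> zR"
proof -
  have uL: "t = \<zero>" if "tpair R (comp 1) f (\<lambda>x. x) \<zero> t" for t
    by (rule tpair_unique_right[OF R_subset R_zero R_add R_r bh_car bh_add bh_r that])
  have uR: "t = \<zero>" if "tpair (comp 1) R (\<lambda>x. x) f \<zero> t" for t
    by (rule tpair_unique_left[OF R_subset R_zero R_add R_l bh_car bh_add bh_l that])
  have "tensor_hom A R (comp 1) f (\<lambda>x. x) z = zL"
    by (rule tensor_hom_eq[OF R_subset comp_sub bh_car comp_carrier R_uminus bh_uminus uL assms(1)])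
  moreover have "tensor_hom A (comp 1) R (\<lambda>x. x) f z = zR"
    by (rule tensor_hom_eq[OF comp_sub R_subset comp_carrier bh_car comp_uminus refl uR assms(2)])
  ultimately show ?thesis by (simp add: dif_def)
qed

lemma pair_L_comp: "tpair R (comp 1) f (\<lambda>x. x) z y \<Longrightarrow> y \<in> comp (Suc n)"
proof (induction rule: tpair.induct)
  case (prod x y)
  then show ?case using comp_mult[OF bh_comp[OF prod(1)] prod(2)] by simp
qed (auto intro: comp_add)

lemma pair_R_comp: "tpair (comp 1) R (\<lambda>x. x) f z y \<Longrightarrow> y \<in> comp (Suc n)"
proof (induction rule: tpair.induct)
  case (prod x y)
  then show ?case using comp_mult[OF prod(1) bh_comp[OF prod(2)]] by simp
qed (auto intro: comp_add)

end

text \<open>With f of degree 1 and g of degree 0 this separates the lower terms of an overlap into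
  their parts of degree 2 and degree 1.\<close>

lemma pair_sum_L:
  assumes f: "f \<in> bimodule_hom A R (comp n)" and g: "g \<in> bimodule_hom A R (comp m)"
  shows "tpair R (comp 1) (\<lambda>x. f x \<oplus> g x) (\<lambda>x. x) z y \<Longrightarrow>
    \<exists>a b. tpair R (comp 1) f (\<lambda>x. x) z a \<and> tpair R (comp 1) g (\<lambda>x. x) z b \<and> y = a \<oplus> b"
proof (induction rule: tpair.induct)
  case zero
  show ?case by (rule exI[of _ \<zero>], rule exI[of _ \<zero>]) simp
next
  case (prod x u)
  have "(f x \<oplus> g x) \<otimes> u = f x \<otimes> u \<oplus> g x \<otimes> u" using prod bh_car[OF f] bh_car[OF g] by (simp add: l_distr)
  then show ?case using tpair.prod[OF prod, of f "\<lambda>x. x"] tpair.prod[OF prod, of g "\<lambda>x. x"] by blast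
next
  case (add z y z' y')
  then obtain a b a' b' where h: "tpair R (comp 1) f (\<lambda>x. x) z a" "tpair R (comp 1) g (\<lambda>x. x) z b" "y = a \<oplus> b"
    "tpair R (comp 1) f (\<lambda>x. x) z' a'" "tpair R (comp 1) g (\<lambda>x. x) z' b'" "y' = a' \<oplus> b'" by blast
  have "a \<in> carrier A" "b \<in> carrier A" "a' \<in> carrier A" "b' \<in> carrier A"
    using pair_L_comp[OF f h(1)] pair_L_comp[OF g h(2)] pair_L_comp[OF f h(4)] pair_L_comp[OF g h(5)] by auto
  then have "y \<oplus> y' = (a \<oplus> a') \<oplus> (b \<oplus> b')" using h by (simp add: a_ac)
  then show ?case using tpair.add[OF h(1,4)] tpair.add[OF h(2,5)] by blast
qed

lemma pair_sum_R:
  assumes f: "f \<in> bimodule_hom A R (comp n)" and g: "g \<in> bimodule_hom A R (comp m)"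
  shows "tpair (comp 1) R (\<lambda>x. x) (\<lambda>x. f x \<oplus> g x) z y \<Longrightarrow>
    \<exists>a b. tpair (comp 1) R (\<lambda>x. x) f z a \<and> tpair (comp 1) R (\<lambda>x. x) g z b \<and> y = a \<oplus> b"
proof (induction rule: tpair.induct)
  case zero
  show ?case by (rule exI[of _ \<zero>], rule exI[of _ \<zero>]) simp
next
  case (prod u x)
  have "u \<otimes> (f x \<oplus> g x) = u \<otimes> f x \<oplus> u \<otimes> g x" using prod bh_car[OF f] bh_car[OF g] by (simp add: r_distr)
  then show ?case using tpair.prod[OF prod, of "\<lambda>x. x" f] tpair.prod[OF prod, of "\<lambda>x. x" g] by blast
next
  case (add z y z' y')
  then obtain a b a' b' where h: "tpair (comp 1) R (\<lambda>x. x) f z a" "tpair (comp 1) R (\<lambda>x. x) g z b" "y = a \<oplus> b"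
    "tpair (comp 1) R (\<lambda>x. x) f z' a'" "tpair (comp 1) R (\<lambda>x. x) g z' b'" "y' = a' \<oplus> b'" by blast
  have "a \<in> carrier A" "b \<in> carrier A" "a' \<in> carrier A" "b' \<in> carrier A"
    using pair_R_comp[OF f h(1)] pair_R_comp[OF g h(2)] pair_R_comp[OF f h(4)] pair_R_comp[OF g h(5)] by auto
  then have "y \<oplus> y' = (a \<oplus> a') \<oplus> (b \<oplus> b')" using h by (simp add: a_ac)
  then show ?case using tpair.add[OF h(1,4)] tpair.add[OF h(2,5)] by blast
qed

text \<open>With \<open>psi\<close> = f + g, the difference kL - kR of the two reductions of an
  overlap k is d + b, where d = \<open>dif f k\<close> and b = \<open>dif g k\<close>. Condition (i)
  gives d \<in> R, and (ii), (iii) turn d + b into d - f d - g d, an element of P.\<close>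

lemma conditions_imp_PBW:
  assumes f: "f \<in> bimodule_hom A R (comp 1)" and g: "g \<in> bimodule_hom A R (comp 0)"
    and P: "P = {x \<ominus> f x \<ominus> g x | x. x \<in> R}"
    and c1: "dif f ` WW' \<subseteq> R" and c2: "\<forall>z\<in>WW'. f (dif f z) = \<ominus> dif g z" and c3: "\<forall>z\<in>WW'. g (dif f z) = \<zero>"
    and WW': "WW' = tspan R (comp 1) \<inter> tspan (comp 1) R"
  shows "PBW_type A P"
proof -
  note fc = bh_car[OF f] and gc = bh_car[OF g]
  let ?psi = "\<lambda>x. f x \<oplus> g x"
  have e: "x \<ominus> f x \<ominus> g x = x \<ominus> ?psi x" if "x \<in> R" for x
    using that fc gc diff_diff_cancel(3)[of x "g x" "f x"] a_comm[of "f x" "g x"] by simp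
  interpret pbw_map A P B eps DL DR ?psi
  proof unfold_locales
    fix x assume x: "x \<in> R"
    show "?psi x \<in> filtration A 1"
      by (rule filt_add) (use filt_comp[OF bh_comp[OF f x]] filt_comp[OF bh_comp[OF g x]] in auto)
    fix b assume b: "b \<in> comp 0"
    show "?psi (b \<otimes> x) = b \<otimes> ?psi x" using b x fc gc by (simp add: bh_l[OF f] bh_l[OF g] r_distr)
    show "?psi (x \<otimes> b) = ?psi x \<otimes> b" using b x fc gc by (simp add: bh_r[OF f] bh_r[OF g] l_distr)
  next
    fix x y assume "x \<in> R" "y \<in> R"
    then show "?psi (x \<oplus> y) = ?psi x \<oplus> ?psi y" using fc gc by (simp add: bh_add[OF f] bh_add[OF g] a_ac)
  next
    show "P = {x \<ominus> ?psi x | x. x \<in> R}"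
      by (subst P) (metis (lifting) e)
  qed
  show ?thesis
  proof (rule PBW_type_if)
    fix k kL kR assume L: "tpair R (comp 1) ?psi (\<lambda>x. x) k kL" and Rr: "EE 1 k kR"
    obtain aL bL where l: "tpair R (comp 1) f (\<lambda>x. x) k aL" "tpair R (comp 1) g (\<lambda>x. x) k bL" "kL = aL \<oplus> bL"
      using pair_sum_L[OF f g L] by blast
    obtain aR bR where r: "tpair (comp 1) R (\<lambda>x. x) f k aR" "tpair (comp 1) R (\<lambda>x. x) g k bR" "kR = aR \<oplus> bR"
      using pair_sum_R[OF f g Rr] by blast
    have c: "aL \<in> carrier A" "bL \<in> carrier A" "aR \<in> carrier A" "bR \<in> carrier A"
      using pair_L_comp[OF f l(1)] pair_L_comp[OF g l(2)] pair_R_comp[OF f r(1)] pair_R_comp[OF g r(2)] by auto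
    have k: "k \<in> WW'" unfolding WW' using tpair_tspan[OF l(1)] tpair_tspan[OF r(1)] by blast
    have d: "dif f k = aL \<ominus> aR" "dif g k = bL \<ominus> bR" using dif_eq[OF f l(1) r(1)] dif_eq[OF g l(2) r(2)] by auto
    let ?d = "dif f k"
    have dR: "?d \<in> R" using c1 k by blast
    have "?d \<ominus> f ?d \<ominus> g ?d \<in> P" using psi_P[OF dR] e[OF dR] by simp
    moreover have "?d \<ominus> f ?d \<ominus> g ?d = (aL \<ominus> aR) \<oplus> (bL \<ominus> bR)"
    proof -
      have "f ?d = \<ominus> (bL \<ominus> bR)" "g ?d = \<zero>" using c2 c3 k d by auto
      then show ?thesis using c d by (simp add: minus_eq)
    qed
    ultimately show "kL \<ominus> kR \<in> P" using l r c by (simp add: diff_add_diff)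
  qed
qed

text \<open>PBW type puts leading forms of \<open>I\<close> into \<langle>R\<rangle>, which vanishes
  in degrees 0 and 1 and is R in degree 2. Hence I \<inter> F^1 = 0, the projection P \<rightarrow>
  R is bijective, and f, g are the negated lower parts of its inverse. Reducing an overlap z in two
  ways puts d + b, with d = \<open>dif f z\<close> and b = \<open>dif g z\<close>, into
  \<open>I\<close>; its leading form and the remainder give the three conditions.\<close>

lemma PBW_imp_conditions:
  assumes pbw: "PBW_type A P"
  shows "P \<inter> filtration A 1 = {\<zero>}"
    "\<exists>f g. f \<in> bimodule_hom A R (comp 1) \<and> g \<in> bimodule_hom A R (comp 0) \<and>
      P = {x \<ominus> f x \<ominus> g x | x. x \<in> R} \<and>
      (\<forall>z \<in> tspan R (comp 1) \<inter> tspan (comp 1) R. dif f z \<in> R \<and> f (dif f z) = \<ominus> dif g z \<and> g (dif f z) = \<zero>)"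
proof -
  have cond: "hp n x \<in> IR" if "x \<in> I" "x \<in> filtration A n" for n x
    using pbw that unfolding PBW_type_iff by blast
  have I1: "x = \<zero>" if x: "x \<in> I" "x \<in> filtration A 1" for x
  proof (rule eqI_hp)
    have xc: "x \<in> carrier A" using x by simp
    have "hp 1 x = \<zero>" using IR_low(2)[OF cond[OF x]] xc hp_hom[OF hp_comp[OF xc], of 1 1] by simp
    then have x0: "x \<in> filtration A 0" using x by (simp add: filtration_iff) (metis Suc_lessI)
    have "hp 0 x = \<zero>" using IR_low(1)[OF cond[OF x(1) x0]] xc hp_hom[OF hp_comp[OF xc], of 0 0] by simp
    then show "hp n x = hp n \<zero>" for n using x0 by (cases n) (auto simp: filtration_iff)
  qed (use x in auto)
  show PF: "P \<inter> filtration A 1 = {\<zero>}" using I1 P_I by auto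
  have uniq: "p = q" if "p \<in> P" "q \<in> P" "hp 2 p = hp 2 q" for p q
  proof -
    have "p \<ominus> q \<in> filtration A 1" unfolding filtration_iff
    proof (intro conjI allI impI)
      fix n :: nat assume "1 < n"
      then consider "n = 2" | "n > 2" by linarith
      then show "hp n (p \<ominus> q) = \<zero>" using that subsetD[OF P_filt that(1)] subsetD[OF P_filt that(2)]
        by cases (auto simp: hp_minus filtration_iff)
    qed (use that in simp)
    then have "p \<ominus> q = \<zero>" using PF P_minus that by blast
    then show ?thesis using that diff_eq_0[of p q] by simp
  qed
  \<comment> \<open>The inverse of the projection from P to R; it is a bimodule map by
    uniqueness.\<close>
  define sec where "sec x = (SOME p. p \<in> P \<and> hp 2 p = x)" for x
  have sec: "sec x \<in> P" "hp 2 (sec x) = x" if "x \<in> R" for x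
  proof -
    have "\<exists>p. p \<in> P \<and> hp 2 p = x" using that by blast
    then have "sec x \<in> P \<and> hp 2 (sec x) = x" unfolding sec_def by (rule someI_ex)
    then show "sec x \<in> P" "hp 2 (sec x) = x" by auto
  qed
  have sec_hp: "sec (hp 2 p) = p" if "p \<in> P" for p
    using sec[of "hp 2 p"] uniq[of "sec (hp 2 p)" p] that by blast
  have sec_add: "sec (x \<oplus> y) = sec x \<oplus> sec y" if "x \<in> R" "y \<in> R" for x y
    using sec_hp[OF P_add[OF sec(1)[OF that(1)] sec(1)[OF that(2)]]] that sec by (simp add: hp_add)
  have sec_l: "sec (b \<otimes> x) = b \<otimes> sec x" if "b \<in> comp 0" "x \<in> R" for b x
    using sec_hp[OF P_l[OF that(1) sec(1)[OF that(2)]]] that sec by (simp add: hp_mult_l)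
  have sec_r: "sec (x \<otimes> b) = sec x \<otimes> b" if "b \<in> comp 0" "x \<in> R" for b x
    using sec_hp[OF P_r[OF that(1) sec(1)[OF that(2)]]] that sec by (simp add: hp_mult_r)
  have sec_car: "sec x \<in> carrier A" if "x \<in> R" for x using sec(1)[OF that] by simp
  define f where "f x = \<ominus> hp 1 (sec x)" for x
  define g where "g x = \<ominus> hp 0 (sec x)" for x
  have bh: "(\<lambda>x. \<ominus> hp n (sec x)) \<in> bimodule_hom A R (comp n)" for n
    unfolding bimodule_hom_def
  proof (intro CollectI conjI ballI)
    show "(\<lambda>x. \<ominus> hp n (sec x)) \<in> R \<rightarrow> comp n" using sec_car by (intro Pi_I comp_uminus hp_comp)
    fix x assume x: "x \<in> R"
    fix y assume y: "y \<in> R"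
    show "\<ominus> hp n (sec (x \<oplus> y)) = \<ominus> hp n (sec x) \<oplus> \<ominus> hp n (sec y)"
      using sec_car[OF x] sec_car[OF y] by (simp add: sec_add[OF x y] hp_add minus_add)
  next
    fix b x assume b: "b \<in> comp 0" and x: "x \<in> R"
    show "\<ominus> hp n (sec (b \<otimes> x)) = b \<otimes> \<ominus> hp n (sec x)" "\<ominus> hp n (sec (x \<otimes> b)) = \<ominus> hp n (sec x) \<otimes> b"
      using b sec_car[OF x] by (simp_all add: sec_l[OF b x] sec_r[OF b x] hp_mult_l hp_mult_r l_minus r_minus)
  qed
  have f: "f \<in> bimodule_hom A R (comp 1)" and g: "g \<in> bimodule_hom A R (comp 0)"
    unfolding f_def[abs_def] g_def[abs_def] by (rule bh)+
  have sec_eq: "sec x = x \<ominus> f x \<ominus> g x" if x: "x \<in> R" for x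
  proof (rule eqI_hp)
    show "x \<ominus> f x \<ominus> g x \<in> carrier A" using x bh_car[OF f x] bh_car[OF g x] by simp
    fix n :: nat
    have c: "x \<in> carrier A" "f x \<in> carrier A" "g x \<in> carrier A" "sec x \<in> carrier A"
      using x bh_car[OF f x] bh_car[OF g x] sec_car[OF x] by auto
    have e: "hp n (x \<ominus> f x \<ominus> g x) = (if n = 2 then x else \<zero>) \<ominus> (if n = 1 then f x else \<zero>) \<ominus> (if n = 0 then g x else \<zero>)"
      using c by (simp only: hp_minus minus_closed hp_hom[OF R_comp2[OF x]] hp_hom[OF bh_comp[OF f x]] hp_hom[OF bh_comp[OF g x]])
    have gt: "hp n (sec x) = \<zero>" if "n > 2" using subsetD[OF P_filt sec(1)[OF x]] that by (simp add: filtration_iff)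
    consider "n = 0" | "n = 1" | "n = 2" | "n > 2" by linarith
    then show "hp n (sec x) = hp n (x \<ominus> f x \<ominus> g x)"
      unfolding e using c sec(2)[OF x] gt by cases (simp_all add: f_def g_def minus_eq)
  qed (use sec_car x in simp)
  have P: "P = {x \<ominus> f x \<ominus> g x | x. x \<in> R}"
  proof (intro Set.set_eqI iffI)
    fix p assume p: "p \<in> P"
    then have "p = hp 2 p \<ominus> f (hp 2 p) \<ominus> g (hp 2 p)" using sec_eq[of "hp 2 p"] sec_hp[OF p] by auto
    then show "p \<in> {x \<ominus> f x \<ominus> g x | x. x \<in> R}" using p by blast
  next
    fix p assume "p \<in> {x \<ominus> f x \<ominus> g x | x. x \<in> R}"
    then obtain x where "x \<in> R" "p = x \<ominus> f x \<ominus> g x" by blast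
    then show "p \<in> P" using sec_eq sec(1) by metis
  qed
  have main: "dif f z \<in> R \<and> f (dif f z) = \<ominus> dif g z \<and> g (dif f z) = \<zero>"
    if z: "z \<in> tspan R (comp 1) \<inter> tspan (comp 1) R" for z
  proof -
    let ?psi = "\<lambda>x. f x \<oplus> g x"
    have psi_c: "?psi x \<in> carrier A" if "x \<in> R" for x using that bh_car[OF f] bh_car[OF g] by simp
    have psi_P: "x \<ominus> ?psi x \<in> I" if "x \<in> R" for x
      using P_I[OF sec(1)[OF that]] that sec_eq[OF that] bh_car[OF f that] bh_car[OF g that]
        diff_diff_cancel(3)[of x "g x" "f x"] a_comm[of "f x" "g x"] by simp
    obtain kL where kL: "tpair R (comp 1) ?psi (\<lambda>x. x) z kL" using z tspan_tpair by blast
    obtain kR where kR: "tpair (comp 1) R (\<lambda>x. x) ?psi z kR" using z tspan_tpair by blast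
    have IL: "z \<ominus> kL \<in> I" using kL
    proof (induction rule: tpair.induct)
      case (prod x u)
      have "x \<otimes> u \<ominus> ?psi x \<otimes> u = (x \<ominus> ?psi x) \<otimes> u" using prod psi_c by (simp add: minus_eq l_distr l_minus)
      then show ?case using I.I_r_closed[OF psi_P[OF prod(1)]] prod by simp
    next
      case (add a a' b b')
      then show ?case using tpair_carrier[OF add(1) R_subset comp_sub psi_c] tpair_carrier[OF add(2) R_subset comp_sub psi_c]
        by (simp add: diff_add_diff)
    qed simp
    have IR: "z \<ominus> kR \<in> I" using kR
    proof (induction rule: tpair.induct)
      case (prod u x)
      have "u \<otimes> x \<ominus> u \<otimes> ?psi x = u \<otimes> (x \<ominus> ?psi x)" using prod psi_c by (simp add: minus_eq r_distr r_minus)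
      then show ?case using I.I_l_closed[OF psi_P[OF prod(2)]] prod by simp
    next
      case (add a a' b b')
      then show ?case using tpair_carrier[OF add(1) comp_sub R_subset _ psi_c] tpair_carrier[OF add(2) comp_sub R_subset _ psi_c]
        by (simp add: diff_add_diff)
    qed simp
    obtain aL bL where l: "tpair R (comp 1) f (\<lambda>x. x) z aL" "tpair R (comp 1) g (\<lambda>x. x) z bL" "kL = aL \<oplus> bL"
      using pair_sum_L[OF f g kL] by blast
    obtain aR bR where r: "tpair (comp 1) R (\<lambda>x. x) f z aR" "tpair (comp 1) R (\<lambda>x. x) g z bR" "kR = aR \<oplus> bR"
      using pair_sum_R[OF f g kR] by blast
    have d: "dif f z = aL \<ominus> aR" "dif g z = bL \<ominus> bR" using dif_eq[OF f l(1) r(1)] dif_eq[OF g l(2) r(2)] by auto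
    have c: "aL \<in> comp 2" "bL \<in> comp 1" "aR \<in> comp 2" "bR \<in> comp 1"
      using pair_L_comp[OF f l(1)] pair_L_comp[OF g l(2)] pair_R_comp[OF f r(1)] pair_R_comp[OF g r(2)] by (auto simp: numeral_2_eq_2)
    have zc: "z \<in> carrier A" using tspan_carrier[of z R "comp 1"] z R_subset comp_sub by blast
    let ?d = "dif f z" and ?b = "dif g z"
    have dc: "?d \<in> comp 2" "?b \<in> comp 1" using d c comp_minus by auto
    have "(z \<ominus> kR) \<ominus> (z \<ominus> kL) \<in> I" using IL IR by (simp add: minus_eq I.a_closed)
    moreover have "(z \<ominus> kR) \<ominus> (z \<ominus> kL) = ?d \<oplus> ?b"
    proof -
      have "(z \<ominus> kR) \<ominus> (z \<ominus> kL) = kL \<ominus> kR" using zc c l(3) r(3) comp_carrier by (simp add: diff_diff_cancel_left)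
      then show ?thesis using c l(3) r(3) d by (simp add: diff_add_diff)
    qed
    ultimately have db: "?d \<oplus> ?b \<in> I" by simp
    have "?d \<oplus> ?b \<in> filtration A 2" using filt_comp[OF dc(1)] filt_comp[OF dc(2), of 2] by (simp add: filt_add)
    from cond[OF db this] have "?d \<in> IR" using dc by (simp add: hp_add hp_hom[OF dc(1)] hp_hom[OF dc(2)])
    then have dR: "?d \<in> R" using IR_low(3)[of ?d] by (simp add: hp_hom[OF dc(1)])
    have fgc: "f ?d \<in> comp 1" "g ?d \<in> comp 0" using bh_comp[OF f dR] bh_comp[OF g dR] by auto
    \<comment> \<open>The relation with leading form d is subtracted. The remainder b + f d + g d
      lies in I \<inter> F^1 and so is zero; its part of degree 1 is condition (ii), its part of
      degree 0 condition (iii).\<close>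
    have "(?d \<oplus> ?b) \<ominus> (?d \<ominus> ?psi ?d) \<in> I" using db psi_P[OF dR] by (simp add: minus_eq I.a_closed)
    moreover have "(?d \<oplus> ?b) \<ominus> (?d \<ominus> ?psi ?d) = ?b \<oplus> ?psi ?d"
      using dc fgc comp_carrier by (simp add: diff_diff_cancel_left)
    ultimately have "?b \<oplus> ?psi ?d \<in> I" by simp
    moreover have "?b \<oplus> ?psi ?d \<in> filtration A 1"
      using filt_comp[OF dc(2)] filt_comp[OF fgc(1)] filt_comp[OF fgc(2), of 1] by (simp add: filt_add)
    ultimately have z0: "?b \<oplus> ?psi ?d = \<zero>" by (rule I1)
    have "hp 1 (?b \<oplus> ?psi ?d) = ?b \<oplus> f ?d"
      using dc fgc by (simp add: hp_add hp_hom[OF dc(2)] hp_hom[OF fgc(1)] hp_hom[OF fgc(2)])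
    then have "?b \<oplus> f ?d = \<zero>" using z0 by simp
    then have "f ?d = \<ominus> ?b" using dc fgc by (intro minus_equality[symmetric]) (auto simp: a_comm)
    moreover have "hp 0 (?b \<oplus> ?psi ?d) = g ?d"
      using dc fgc by (simp add: hp_add hp_hom[OF dc(2)] hp_hom[OF fgc(1)] hp_hom[OF fgc(2)])
    then have "g ?d = \<zero>" using z0 by simp
    ultimately show ?thesis using dR by blast
  qed
  show "\<exists>f g. f \<in> bimodule_hom A R (comp 1) \<and> g \<in> bimodule_hom A R (comp 0) \<and>
      P = {x \<ominus> f x \<ominus> g x | x. x \<in> R} \<and>
      (\<forall>z \<in> tspan R (comp 1) \<inter> tspan (comp 1) R. dif f z \<in> R \<and> f (dif f z) = \<ominus> dif g z \<and> g (dif f z) = \<zero>)"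
    using f g P main by blast
qed

theorem PBW_criterion:
  "PBW_type A P \<longleftrightarrow>
    P \<inter> filtration A 1 = {\<zero>} \<and>
    (\<exists>f g. f \<in> bimodule_hom A R (comp 1) \<and> g \<in> bimodule_hom A R (comp 0) \<and>
      P = {x \<ominus> f x \<ominus> g x | x. x \<in> R} \<and>
      (let U = comp 1;
           W = tensor_sub A R U \<inter> tensor_sub A U R;
           dif = (\<lambda>\<phi> z. tensor_hom A R U \<phi> id z \<ominus> tensor_hom A U R id \<phi> z) in
        dif f ` W \<subseteq> R \<and>
        (\<forall>z \<in> W. f (dif f z) = \<ominus> dif g z) \<and>
        (\<forall>z \<in> W. g (dif f z) = \<zero>)))"
proof -
  have dif: "tensor_hom A R (comp 1) \<phi> id z \<ominus> tensor_hom A (comp 1) R id \<phi> z = dif \<phi> z" for \<phi> z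
    by (simp add: dif_def id_def)
  show ?thesis
    unfolding Let_def dif tensor_sub_eq[OF R_subset comp_sub] tensor_sub_eq[OF comp_sub R_subset]
  proof (rule iffI, goal_cases)
    case 1
    from PBW_imp_conditions[OF 1] show ?case by blast
  next
    case 2
    then obtain f g where h: "f \<in> bimodule_hom A R (comp 1)" "g \<in> bimodule_hom A R (comp 0)"
      "P = {x \<ominus> f x \<ominus> g x | x. x \<in> R}"
      "dif f ` (tspan R (comp 1) \<inter> tspan (comp 1) R) \<subseteq> R"
      "\<forall>z\<in>tspan R (comp 1) \<inter> tspan (comp 1) R. f (dif f z) = \<ominus> dif g z"
      "\<forall>z\<in>tspan R (comp 1) \<inter> tspan (comp 1) R. g (dif f z) = \<zero>" by blast
    show ?case by (rule conditions_imp_PBW[OF h refl])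
  qed
qed

end

section \<open>The bar complex\<close>

text \<open>Keeps the structure map of tensor algebras over a field in the form \<^term>\<open>id\<close>; the simplifier
  otherwise reduces eta-expanded instances of it to a different term.\<close>

declare id_def [symmetric, simp]

text \<open>The coordinate functions of U over the base ring extend to \<open>T\<close> by
  \<open>left_lift\<close> and \<open>right_lift\<close>; their linearity is the balancing condition
  of those lifts.\<close>

lemma (in bimod) free_gen_exists:
  assumes B: "finite B" "\<And>b. b \<in> B \<Longrightarrow> eps b \<in> carrier U"
    and cl: "\<And>b u v. u \<in> carrier U \<Longrightarrow> v \<in> carrier U \<Longrightarrow> cl b (u \<oplus> v) = cl b u + cl b v"
      "\<And>b u c. u \<in> carrier U \<Longrightarrow> cl b (rsmult U u c) = cl b u * c"
      "\<And>u. u \<in> carrier U \<Longrightarrow> gen u = (\<Oplus>\<^bsub>T\<^esub>b\<in>B. gen (eps b) \<otimes>\<^sub>T inB (cl b u))"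
    and cr: "\<And>b u v. u \<in> carrier U \<Longrightarrow> v \<in> carrier U \<Longrightarrow> cr b (u \<oplus> v) = cr b u + cr b v"
      "\<And>b u c. u \<in> carrier U \<Longrightarrow> cr b (c \<odot> u) = c * cr b u"
      "\<And>u. u \<in> carrier U \<Longrightarrow> gen u = (\<Oplus>\<^bsub>T\<^esub>b\<in>B. inB (cr b u) \<otimes>\<^sub>T gen (eps b))"
  shows "\<exists>DL DR. free_gen T B (\<lambda>b. gen (eps b)) DL DR \<and>
    (\<forall>b. \<forall>u\<in>carrier U. \<forall>t\<in>carrier T. DL b (gen u \<otimes>\<^sub>T t) = inB (cl b u) \<otimes>\<^sub>T t) \<and>
    (\<forall>b. \<forall>u\<in>carrier U. \<forall>t\<in>carrier T. DR b (t \<otimes>\<^sub>T gen u) = t \<otimes>\<^sub>T inB (cr b u))"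
proof -
  have "\<forall>b. \<exists>L. lift_map T L \<and> (\<forall>u \<in> carrier U. \<forall>t \<in> carrier T. L (gen u \<otimes>\<^sub>T t) = inB (cl b u) \<otimes>\<^sub>T t)"
    by (intro allI left_lift) (simp_all add: T_abelian_group cl(1,2) inB_add inB_mult T.l_distr T.r_distr T.m_assoc)
  from choice[OF this] obtain DL where DL': "\<And>b. lift_map T (DL b)"
    "\<And>b u t. u \<in> carrier U \<Longrightarrow> t \<in> carrier T \<Longrightarrow> DL b (gen u \<otimes>\<^sub>T t) = inB (cl b u) \<otimes>\<^sub>T t" by blast
  note DL = lift_mapD[OF DL'(1)] DL'(2)
  have "\<forall>b. \<exists>L. lift_map T L \<and> (\<forall>u \<in> carrier U. \<forall>t \<in> carrier T. L (t \<otimes>\<^sub>T gen u) = t \<otimes>\<^sub>T inB (cr b u))"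
    by (intro allI right_lift) (simp_all add: T_abelian_group cr(1,2) inB_add inB_mult T.l_distr T.r_distr T.m_assoc)
  from choice[OF this] obtain DR where DR': "\<And>b. lift_map T (DR b)"
    "\<And>b u t. u \<in> carrier U \<Longrightarrow> t \<in> carrier T \<Longrightarrow> DR b (t \<otimes>\<^sub>T gen u) = t \<otimes>\<^sub>T inB (cr b u)" by blast
  note DR = lift_mapD[OF DR'(1)] DR'(2)
  have DLg: "DL b (gen u) = inB (cl b u)" if "u \<in> carrier U" for b u
    using DL(4)[OF that T.one_closed, of b] that by simp
  have DRg: "DR b (gen u) = inB (cr b u)" if "u \<in> carrier U" for b u
    using DR(4)[OF that T.one_closed, of b] that by simp
  have "free_gen T B (\<lambda>b. gen (eps b)) DL DR"
  proof (rule free_gen.intro[OF T_galg], rule free_gen_axioms.intro)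
    show "finite B" by (rule B)
    show "gen (eps b) \<in> component T 1" if "b \<in> B" for b using B(2)[OF that] by (rule gen_comp1)
    show "DL b x \<in> carrier T" "DR b x \<in> carrier T" if "x \<in> carrier T" for b x using DL(1) DR(1) that by auto
    show "DL b (x \<oplus>\<^sub>T y) = DL b x \<oplus>\<^sub>T DL b y" "DR b (x \<oplus>\<^sub>T y) = DR b x \<oplus>\<^sub>T DR b y"
      if "x \<in> carrier T" "y \<in> carrier T" for b x y using DL(2) DR(2) that by auto
    show "DL b x = \<zero>\<^sub>T" "DR b x = \<zero>\<^sub>T" if "x \<in> component T 0" for b x using that DL(3) DR(3) by (auto simp: comp_0)
    show "DL b x \<in> component T 0" "DR b x \<in> component T 0" if "x \<in> component T 1" for b x
      using that unfolding comp_1 by (auto simp: DLg DRg)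
    show "DL b (u \<otimes>\<^sub>T x) = DL b u \<otimes>\<^sub>T x" "DR b (x \<otimes>\<^sub>T u) = x \<otimes>\<^sub>T DR b u"
      if "u \<in> component T 1" "x \<in> carrier T" for b u x
      using that unfolding comp_1 by (auto simp: DLg DRg DL(4) DR(4))
    show "u = (\<Oplus>\<^bsub>T\<^esub>b\<in>B. gen (eps b) \<otimes>\<^sub>T DL b u)" "u = (\<Oplus>\<^bsub>T\<^esub>b\<in>B. DR b u \<otimes>\<^sub>T gen (eps b))" if "u \<in> component T 1" for u
      using that unfolding comp_1 by (auto simp: DLg DRg cl(3)[symmetric] cr(3)[symmetric])
    show "x \<in> galg.tspan T (component T 1) (component T n)" if "x \<in> component T (Suc n)" for x n
      using that by (induction rule: comp_Suc_induct_left) (auto intro: T.tspan.intros gen_comp1)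
    show "x \<in> galg.tspan T (component T n) (component T 1)" if "x \<in> component T (Suc n)" for x n
      using that by (induction rule: comp_Suc_induct_right) (auto intro: T.tspan.intros gen_comp1)
  qed
  then show ?thesis using DL(4) DR(4) by blast
qed

text \<open>Values are recorded on products of two and of three generators, as the Koszul complex
  will be used at S \<otimes> K^2 and S \<otimes> K^3.\<close>

lemma (in bimod) tensor_map_props:
  assumes U': "bimod U' eta'"
    and f: "\<And>u. u \<in> carrier U \<Longrightarrow> f u \<in> carrier U'"
      "\<And>u v. u \<in> carrier U \<Longrightarrow> v \<in> carrier U \<Longrightarrow> f (u \<oplus> v) = f u \<oplus>\<^bsub>U'\<^esub> f v"
      "\<And>u b. u \<in> carrier U \<Longrightarrow> f (b \<odot> u) = b \<odot>\<^bsub>U'\<^esub> f u"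
      "\<And>u b. u \<in> carrier U \<Longrightarrow> f (rsmult U u b) = rsmult U' (f u) b"
  shows "t \<in> carrier T \<Longrightarrow> tensor_map U' f t \<in> carrier (tensor_algebra eta' U')"
    "s \<in> carrier T \<Longrightarrow> t \<in> carrier T \<Longrightarrow>
      tensor_map U' f (s \<oplus>\<^bsub>T\<^esub> t) = tensor_map U' f s \<oplus>\<^bsub>tensor_algebra eta' U'\<^esub> tensor_map U' f t"
    "u \<in> carrier U \<Longrightarrow> v \<in> carrier U \<Longrightarrow> tensor_map U' f (gen u \<otimes>\<^bsub>T\<^esub> gen v) =
      tensor_generator U' (f u) \<otimes>\<^bsub>tensor_algebra eta' U'\<^esub> tensor_generator U' (f v)"
    "u \<in> carrier U \<Longrightarrow> v \<in> carrier U \<Longrightarrow> w \<in> carrier U \<Longrightarrow> tensor_map U' f (gen u \<otimes>\<^bsub>T\<^esub> (gen v \<otimes>\<^bsub>T\<^esub> gen w)) =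
      tensor_generator U' (f u) \<otimes>\<^bsub>tensor_algebra eta' U'\<^esub> (tensor_generator U' (f v) \<otimes>\<^bsub>tensor_algebra eta' U'\<^esub> tensor_generator U' (f w))"
proof -
  interpret U': bimod U' eta' by fact
  let ?F = "\<lambda>w. frag_of (map f w)"
  let ?T' = "tensor_algebra eta' U'"
  have null: "frag_extend ?F x \<in> tensor_null U'" if "x \<in> null" for x
  proof (rule frag_extend_null[OF _ _ U' that])
    fix p q u v assume a: "set p \<subseteq> carrier U" "set q \<subseteq> carrier U" "u \<in> carrier U" "v \<in> carrier U"
    then have s: "set (map f p) \<subseteq> carrier U'" "set (map f q) \<subseteq> carrier U'" using f(1) by auto
    show "?F (p @ (u \<oplus> v) # q) - ?F (p @ u # q) - ?F (p @ v # q) \<in> tensor_null U'"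
      using U'.relator_null[OF U'.add_relator[OF s f(1)[OF a(3)] f(1)[OF a(4)]]] a f by simp
    fix b
    show "?F (p @ rsmult U u b # v # q) - ?F (p @ u # b \<odot> v # q) \<in> tensor_null U'"
      using U'.relator_null[OF U'.bal_relator[OF s f(1)[OF a(3)] f(1)[OF a(4)], of b]] a f by simp
  qed
  have keys: "Poly_Mapping.keys (frag_extend ?F x) \<subseteq> tensor_words U'" if "Poly_Mapping.keys x \<subseteq> words" for x
    by (rule keys_frag_extend_sub[OF _ that]) (use f(1) in \<open>auto simp: tensor_words_def\<close>)
  have eq: "tensor_map U' f (b, cls x) = (b, tensor_class U' (frag_extend ?F x))" for b x
  proof -
    have "(\<Union>y\<in>cls x. tensor_class U' (frag_extend ?F y)) = tensor_class U' (frag_extend ?F x)"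
    proof (rule UN_const_eq[where x = x])
      fix y assume "y \<in> cls x"
      then have "frag_extend ?F (y - x) \<in> tensor_null U'" by (intro null) (simp add: cls_mem)
      then show "tensor_class U' (frag_extend ?F y) = tensor_class U' (frag_extend ?F x)"
        by (simp add: U'.cls_eq frag_extend_diff)
    qed simp
    then show ?thesis by (simp add: tensor_map_def)
  qed
  show "t \<in> carrier T \<Longrightarrow> tensor_map U' f t \<in> carrier ?T'"
    by (elim T_cases) (simp add: eq U'.T_carrier keys)
  show "s \<in> carrier T \<Longrightarrow> t \<in> carrier T \<Longrightarrow> tensor_map U' f (s \<oplus>\<^bsub>T\<^esub> t) = tensor_map U' f s \<oplus>\<^bsub>?T'\<^esub> tensor_map U' f t"
    by (elim T_cases) (simp add: eq T_add U'.T_add keys frag_extend_add)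
  have W: "tensor_map U' f (W w) = U'.W (map f w)" if "w \<in> words" for w
    using that f(1) by (simp add: W_word eq) (subst U'.W_word, auto simp: tensor_words_def)
  show "tensor_map U' f (gen u \<otimes>\<^bsub>T\<^esub> gen v) = U'.gen (f u) \<otimes>\<^bsub>?T'\<^esub> U'.gen (f v)" if "u \<in> carrier U" "v \<in> carrier U" for u v
    using W[of "[u, v]"] that f(1) by (simp add: tensor_words_def W_Cons U'.W_Cons)
  show "tensor_map U' f (gen u \<otimes>\<^bsub>T\<^esub> (gen v \<otimes>\<^bsub>T\<^esub> gen w)) = U'.gen (f u) \<otimes>\<^bsub>?T'\<^esub> (U'.gen (f v) \<otimes>\<^bsub>?T'\<^esub> U'.gen (f w))"
    if "u \<in> carrier U" "v \<in> carrier U" "w \<in> carrier U" for u v w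
    using W[of "[u, v, w]"] that f(1) by (simp add: tensor_words_def W_Cons U'.W_Cons)
qed

text \<open>The inner part of the bar differential, without the augmentation term, as the recursion
  d(s \<otimes> s' \<otimes> w) = s s' \<otimes> w - s \<otimes> d(s' \<otimes> w). In this form
  additivity and balancing in a letter can be shown by list induction.\<close>

fun bar_sum :: "('k, 'a, 'm) module_scheme \<Rightarrow> 'a list \<Rightarrow> ('a list \<Rightarrow>\<^sub>0 int)" where
  "bar_sum S [] = 0"
| "bar_sum S [s] = 0"
| "bar_sum S (s # s' # w) = frag_of ((s \<otimes>\<^bsub>S\<^esub> s') # w) - frag_extend (\<lambda>v. frag_of (s # v)) (bar_sum S (s' # w))"

lemma bar_sum_eq:
  "(\<Sum>i<length w - 1. frag_cmul ((-1) ^ i) (frag_of (take i w @ [w ! i \<otimes>\<^bsub>S\<^esub> w ! Suc i] @ drop (i + 2) w))) = bar_sum S w"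
proof (induction S w rule: bar_sum.induct)
  case (3 S s s' w)
  let ?f = "\<lambda>w i. frag_of (take i w @ [w ! i \<otimes>\<^bsub>S\<^esub> w ! Suc i] @ drop (i + 2) w)"
  have "(\<Sum>i<Suc (length w). frag_cmul ((-1) ^ i) (?f (s # s' # w) i)) =
      frag_of ((s \<otimes>\<^bsub>S\<^esub> s') # w) + (\<Sum>i<length w. frag_cmul ((-1) ^ Suc i) (?f (s # s' # w) (Suc i)))"
    by (subst sum.lessThan_Suc_shift) simp
  also have "(\<Sum>i<length w. frag_cmul ((-1) ^ Suc i) (?f (s # s' # w) (Suc i))) =
      - (\<Sum>i<length w. frag_extend (\<lambda>v. frag_of (s # v)) (frag_cmul ((-1) ^ i) (?f (s' # w) i)))"
    by (simp add: frag_extend_cmul sum_negf[symmetric])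
  also have "(\<Sum>i<length w. frag_extend (\<lambda>v. frag_of (s # v)) (frag_cmul ((-1) ^ i) (?f (s' # w) i))) =
      frag_extend (\<lambda>v. frag_of (s # v)) (bar_sum S (s' # w))"
  proof -
    have "bar_sum S (s' # w) = (\<Sum>i<length w. frag_cmul ((-1) ^ i) (?f (s' # w) i))" using 3 by simp
    then show ?thesis by (simp only: frag_extend_sum[OF finite_lessThan] comp_def)
  qed
  finally show ?case by simp
qed simp_all

locale bar = S: ring S + bimod "algebra_bimodule S" id
  for S :: "('k::field, 'a, 'm) module_scheme" +
  fixes e :: "'a \<Rightarrow> 'k"
  assumes e_add: "s \<in> carrier S \<Longrightarrow> s' \<in> carrier S \<Longrightarrow> e (s \<oplus>\<^bsub>S\<^esub> s') = e s + e s'"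
    and e_smult: "s \<in> carrier S \<Longrightarrow> e (c \<odot>\<^bsub>S\<^esub> s) = c * e s"
    and S_smult_l: "s \<in> carrier S \<Longrightarrow> s' \<in> carrier S \<Longrightarrow> (c \<odot>\<^bsub>S\<^esub> s) \<otimes>\<^bsub>S\<^esub> s' = c \<odot>\<^bsub>S\<^esub> (s \<otimes>\<^bsub>S\<^esub> s')"
    and S_smult_r: "s \<in> carrier S \<Longrightarrow> s' \<in> carrier S \<Longrightarrow> s \<otimes>\<^bsub>S\<^esub> (c \<odot>\<^bsub>S\<^esub> s') = c \<odot>\<^bsub>S\<^esub> (s \<otimes>\<^bsub>S\<^esub> s')"
begin

abbreviation BT_mult (infixl "\<otimes>\<^sub>T" 70) where "x \<otimes>\<^sub>T y \<equiv> x \<otimes>\<^bsub>T\<^esub> y"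
abbreviation BT_add (infixl "\<oplus>\<^sub>T" 65) where "x \<oplus>\<^sub>T y \<equiv> x \<oplus>\<^bsub>T\<^esub> y"
abbreviation BT_zero ("\<zero>\<^sub>T") where "\<zero>\<^sub>T \<equiv> \<zero>\<^bsub>T\<^esub>"

lemma AB_simps [simp]: "carrier (algebra_bimodule S) = carrier S" "ring.add (algebra_bimodule S) = ring.add S"
  "ring.zero (algebra_bimodule S) = ring.zero S"
  "smult (algebra_bimodule S) = smult S" "rsmult (algebra_bimodule S) s c = c \<odot>\<^bsub>S\<^esub> s"
  by (simp_all add: algebra_bimodule_def)

lemma S_smult_closed [simp]: "s \<in> carrier S \<Longrightarrow> c \<odot>\<^bsub>S\<^esub> s \<in> carrier S"
  using lact_closed[of s c] by simp

definition "BS w = (0::'k, cls (bar_sum S w))"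

lemma bar_sum_closed: "set w \<subseteq> carrier S \<Longrightarrow> Poly_Mapping.keys (bar_sum S w) \<subseteq> words"
proof (induction w rule: induct_list012)
  case (3 s s' w)
  then have "Poly_Mapping.keys (bar_sum S (s' # w)) \<subseteq> words" by simp
  then have "Poly_Mapping.keys (frag_extend (\<lambda>v. frag_of (s # v)) (bar_sum S (s' # w))) \<subseteq> words"
    by (rule keys_frag_extend_sub[rotated]) (use 3 in \<open>auto simp: tensor_words_def\<close>)
  then show ?case using 3 unfolding bar_sum.simps by (intro keys_diff_sub) (auto simp: tensor_words_def)
qed auto

lemma BS_closed [simp]: "set w \<subseteq> carrier S \<Longrightarrow> BS w \<in> carrier T"
  by (simp add: BS_def T_carrier bar_sum_closed)

lemma BS_one [simp]: "BS [s] = \<zero>\<^sub>T" by (simp add: BS_def T_zero)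

lemma BS_Cons: "s \<in> carrier S \<Longrightarrow> s' \<in> carrier S \<Longrightarrow> set w \<subseteq> carrier S \<Longrightarrow>
    BS (s # s' # w) = W ((s \<otimes>\<^bsub>S\<^esub> s') # w) \<ominus>\<^bsub>T\<^esub> gen s \<otimes>\<^sub>T BS (s' # w)"
proof -
  assume a: "s \<in> carrier S" "s' \<in> carrier S" "set w \<subseteq> carrier S"
  let ?x = "frag_extend (\<lambda>v. frag_of (s # v)) (bar_sum S (s' # w))"
  have x: "?x = word_mult (frag_of [s]) (bar_sum S (s' # w))" by (simp add: word_mult_def)
  have k: "Poly_Mapping.keys (bar_sum S (s' # w)) \<subseteq> words" "Poly_Mapping.keys (frag_of [s]) \<subseteq> words"
    using a by (auto simp: bar_sum_closed)
  have w: "(s \<otimes>\<^bsub>S\<^esub> s') # w \<in> words" using a by (auto simp: tensor_words_def)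
  have "BS (s # s' # w) = (0, cls (frag_of ((s \<otimes>\<^bsub>S\<^esub> s') # w))) \<ominus>\<^bsub>T\<^esub> (0, cls ?x)"
    unfolding BS_def bar_sum.simps by (rule pos_diff) (use w k in \<open>simp_all add: x\<close>)
  also have "(0, cls ?x) = gen s \<otimes>\<^sub>T BS (s' # w)"
    unfolding x BS_def gen_eq by (rule T_mult_00[symmetric]) (rule k)+
  finally show ?thesis using w by (simp add: W_word)
qed

lemma gen_smult: "u \<in> carrier S \<Longrightarrow> gen (c \<odot>\<^bsub>S\<^esub> u) = inB c \<otimes>\<^sub>T gen u"
  using inB_gen[of u c] by simp

lemma BS_lact: "s \<in> carrier S \<Longrightarrow> set w \<subseteq> carrier S \<Longrightarrow> BS ((c \<odot>\<^bsub>S\<^esub> s) # w) = inB c \<otimes>\<^sub>T BS (s # w)"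
proof (cases w)
  case (Cons s' w')
  assume "s \<in> carrier S" "set w \<subseteq> carrier S"
  then show ?thesis using Cons
    by (simp add: BS_Cons S_smult_l W_Cons T.minus_eq T.r_distr T.r_minus T.m_assoc[symmetric] inB_gen)
qed simp

text \<open>The induction goes by two letters, as the recursion of \<open>bar_sum\<close> does. The
  cases are whether the changed letter is the first, the second, or lies beyond the two letters that
  are multiplied.\<close>

lemma BS_add: "set p \<subseteq> carrier S \<Longrightarrow> set q \<subseteq> carrier S \<Longrightarrow> u \<in> carrier S \<Longrightarrow> v \<in> carrier S \<Longrightarrow>
    BS (p @ (u \<oplus>\<^bsub>S\<^esub> v) # q) = BS (p @ u # q) \<oplus>\<^sub>T BS (p @ v # q)"
proof (induction p rule: induct_list012)
  case 1
  have g: "gen (u \<oplus>\<^bsub>S\<^esub> v) = gen u \<oplus>\<^sub>T gen v" using gen_add[of u v] 1 by simp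
  show ?case
  proof (cases q)
    case (Cons s q')
    have "W (((u \<oplus>\<^bsub>S\<^esub> v) \<otimes>\<^bsub>S\<^esub> s) # q') = W ((u \<otimes>\<^bsub>S\<^esub> s) # q') \<oplus>\<^sub>T W ((v \<otimes>\<^bsub>S\<^esub> s) # q')"
      using W_add[of "[]" q' "u \<otimes>\<^bsub>S\<^esub> s" "v \<otimes>\<^bsub>S\<^esub> s"] 1 Cons by (simp add: S.l_distr)
    then show ?thesis using 1 Cons g by (simp add: BS_Cons T.l_distr T.minus_eq T.minus_add T.a_ac)
  qed simp
next
  case (2 a)
  have "W ((a \<otimes>\<^bsub>S\<^esub> (u \<oplus>\<^bsub>S\<^esub> v)) # q) = W ((a \<otimes>\<^bsub>S\<^esub> u) # q) \<oplus>\<^sub>T W ((a \<otimes>\<^bsub>S\<^esub> v) # q)"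
    using W_add[of "[]" q "a \<otimes>\<^bsub>S\<^esub> u" "a \<otimes>\<^bsub>S\<^esub> v"] 2 by (simp add: S.r_distr)
  moreover have "BS ((u \<oplus>\<^bsub>S\<^esub> v) # q) = BS (u # q) \<oplus>\<^sub>T BS (v # q)"
  proof (cases q)
    case (Cons s q')
    have "W (((u \<oplus>\<^bsub>S\<^esub> v) \<otimes>\<^bsub>S\<^esub> s) # q') = W ((u \<otimes>\<^bsub>S\<^esub> s) # q') \<oplus>\<^sub>T W ((v \<otimes>\<^bsub>S\<^esub> s) # q')"
      using W_add[of "[]" q' "u \<otimes>\<^bsub>S\<^esub> s" "v \<otimes>\<^bsub>S\<^esub> s"] 2 Cons by (simp add: S.l_distr)
    moreover have "gen (u \<oplus>\<^bsub>S\<^esub> v) = gen u \<oplus>\<^sub>T gen v" using gen_add[of u v] 2 by simp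
    ultimately show ?thesis using 2 Cons by (simp add: BS_Cons T.l_distr T.minus_eq T.minus_add T.a_ac)
  qed simp
  ultimately show ?case using 2 by (simp add: BS_Cons T.r_distr T.minus_eq T.minus_add T.a_ac)
next
  case (3 a c p)
  have "W ((a \<otimes>\<^bsub>S\<^esub> c) # p @ (u \<oplus>\<^bsub>S\<^esub> v) # q) = W ((a \<otimes>\<^bsub>S\<^esub> c) # p @ u # q) \<oplus>\<^sub>T W ((a \<otimes>\<^bsub>S\<^esub> c) # p @ v # q)"
    using W_add[of "(a \<otimes>\<^bsub>S\<^esub> c) # p" q u v] 3 by simp
  then show ?case using 3 by (simp add: BS_Cons T.r_distr T.minus_eq T.minus_add T.a_ac)
qed

lemma BS_bal: "set p \<subseteq> carrier S \<Longrightarrow> set q \<subseteq> carrier S \<Longrightarrow> u \<in> carrier S \<Longrightarrow> v \<in> carrier S \<Longrightarrow>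
    BS (p @ (c \<odot>\<^bsub>S\<^esub> u) # v # q) = BS (p @ u # (c \<odot>\<^bsub>S\<^esub> v) # q)"
proof (induction p rule: induct_list012)
  case 1
  have "gen u \<otimes>\<^sub>T inB c = inB c \<otimes>\<^sub>T gen u" using eta_central[of "gen u" c] 1 by simp
  then show ?case using 1
    by (simp add: BS_Cons BS_lact S_smult_l S_smult_r gen_smult T.m_assoc[symmetric])
next
  case (2 a)
  have "W ((a \<otimes>\<^bsub>S\<^esub> (c \<odot>\<^bsub>S\<^esub> u)) # v # q) = W ((a \<otimes>\<^bsub>S\<^esub> u) # (c \<odot>\<^bsub>S\<^esub> v) # q)"
    using W_bal[of "[]" q "a \<otimes>\<^bsub>S\<^esub> u" v c] 2 by (simp add: S_smult_r)
  moreover have "BS ((c \<odot>\<^bsub>S\<^esub> u) # v # q) = BS (u # (c \<odot>\<^bsub>S\<^esub> v) # q)"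
  proof -
    have "gen u \<otimes>\<^sub>T inB c = inB c \<otimes>\<^sub>T gen u" using eta_central[of "gen u" c] 2 by simp
    then show ?thesis using 2
      by (simp add: BS_Cons BS_lact S_smult_l S_smult_r gen_smult T.m_assoc[symmetric])
  qed
  ultimately show ?case using 2 by (simp add: BS_Cons)
next
  case (3 a d p)
  have "W ((a \<otimes>\<^bsub>S\<^esub> d) # p @ (c \<odot>\<^bsub>S\<^esub> u) # v # q) = W ((a \<otimes>\<^bsub>S\<^esub> d) # p @ u # (c \<odot>\<^bsub>S\<^esub> v) # q)"
    using W_bal[of "(a \<otimes>\<^bsub>S\<^esub> d) # p" q u v c] 3 by simp
  then show ?case using 3 by (simp add: BS_Cons)
qed

text \<open>The augmentation term of the differential without its sign: on a word w followed by s it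
  is e(s) w.\<close>

definition "LS w = (0::'k, cls (frag_of ((e (last w) \<odot>\<^bsub>S\<^esub> hd w) # tl (butlast w))))"

lemma LS_eq: "set w \<subseteq> carrier S \<Longrightarrow> w \<noteq> [] \<Longrightarrow> s \<in> carrier S \<Longrightarrow> LS (w @ [s]) = W w \<otimes>\<^sub>T inB (e s)"
proof -
  assume a: "set w \<subseteq> carrier S" "w \<noteq> []" "s \<in> carrier S"
  then obtain x w' where w: "w = x # w'" by (cases w) auto
  have "LS (w @ [s]) = W ((e s \<odot>\<^bsub>S\<^esub> x) # w')" using a w
    by (simp add: LS_def W_word tensor_words_def)
  also have "\<dots> = inB (e s) \<otimes>\<^sub>T W w" using a w by (simp add: W_Cons T.m_assoc[symmetric] inB_gen)
  also have "\<dots> = W w \<otimes>\<^sub>T inB (e s)" using eta_central[of "W w" "e s"] a by simp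
  finally show ?thesis .
qed

lemma LS_add: "set p \<subseteq> carrier S \<Longrightarrow> set q \<subseteq> carrier S \<Longrightarrow> u \<in> carrier S \<Longrightarrow> v \<in> carrier S \<Longrightarrow> p @ q \<noteq> [] \<Longrightarrow>
    LS (p @ (u \<oplus>\<^bsub>S\<^esub> v) # q) = LS (p @ u # q) \<oplus>\<^sub>T LS (p @ v # q)"
proof (cases q rule: rev_cases)
  case Nil
  assume "set p \<subseteq> carrier S" "u \<in> carrier S" "v \<in> carrier S" "p @ q \<noteq> []"
  then show ?thesis using Nil by (simp add: LS_eq e_add inB_add T.r_distr)
next
  case (snoc q' s)
  assume "set p \<subseteq> carrier S" "set q \<subseteq> carrier S" "u \<in> carrier S" "v \<in> carrier S"
  then show ?thesis using snoc LS_eq[of "p @ (u \<oplus>\<^bsub>S\<^esub> v) # q'" s] LS_eq[of "p @ u # q'" s] LS_eq[of "p @ v # q'" s] W_add[of p q' u v]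
    by (simp add: T.l_distr)
qed

lemma LS_bal: "set p \<subseteq> carrier S \<Longrightarrow> set q \<subseteq> carrier S \<Longrightarrow> u \<in> carrier S \<Longrightarrow> v \<in> carrier S \<Longrightarrow>
    LS (p @ (c \<odot>\<^bsub>S\<^esub> u) # v # q) = LS (p @ u # (c \<odot>\<^bsub>S\<^esub> v) # q)"
proof (cases q rule: rev_cases)
  case Nil
  assume a: "set p \<subseteq> carrier S" "u \<in> carrier S" "v \<in> carrier S"
  have "LS ((p @ [c \<odot>\<^bsub>S\<^esub> u]) @ [v]) = W (p @ [c \<odot>\<^bsub>S\<^esub> u]) \<otimes>\<^sub>T inB (e v)"
    by (rule LS_eq) (use a in auto)
  also have "W (p @ [c \<odot>\<^bsub>S\<^esub> u]) = W p \<otimes>\<^sub>T (gen u \<otimes>\<^sub>T inB c)" using a by (simp add: W_snoc gen_inB)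
  also have "W p \<otimes>\<^sub>T (gen u \<otimes>\<^sub>T inB c) \<otimes>\<^sub>T inB (e v) = W (p @ [u]) \<otimes>\<^sub>T inB (e (c \<odot>\<^bsub>S\<^esub> v))"
    using a by (simp add: W_snoc T.m_assoc e_smult inB_mult)
  also have "\<dots> = LS ((p @ [u]) @ [c \<odot>\<^bsub>S\<^esub> v])"
    by (rule LS_eq[symmetric]) (use a in auto)
  finally show ?thesis using Nil by simp
next
  case (snoc q' s)
  assume "set p \<subseteq> carrier S" "set q \<subseteq> carrier S" "u \<in> carrier S" "v \<in> carrier S"
  then show ?thesis using snoc LS_eq[of "p @ (c \<odot>\<^bsub>S\<^esub> u) # v # q'" s] LS_eq[of "p @ u # (c \<odot>\<^bsub>S\<^esub> v) # q'" s] W_bal[of p q' u v c]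
    by simp
qed

lemma frag_cmul_sign_null: "x \<in> null \<Longrightarrow> frag_cmul ((-1) ^ n) x \<in> null"
  by (cases "even n") (auto intro: null_minus)

lemma frag_cmul_diff: "frag_cmul c (x - y) = frag_cmul c x - frag_cmul c (y :: 'x \<Rightarrow>\<^sub>0 int)"
  using frag_cmul_distrib2[of c "x - y" y] by (simp add: algebra_simps)

lemma null_combine3: "a - b - c \<in> null \<Longrightarrow> l - m - n \<in> null \<Longrightarrow>
    (a + frag_cmul ((-1) ^ k) l) - (b + frag_cmul ((-1) ^ k) m) - (c + frag_cmul ((-1) ^ k) n) \<in> null"
  using null_add[OF _ frag_cmul_sign_null[of "l - m - n" k], of "a - b - c"] by (simp add: frag_cmul_diff frag_cmul_distrib2 algebra_simps)

lemma null_combine2: "a - b \<in> null \<Longrightarrow> l - m \<in> null \<Longrightarrow>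
    (a + frag_cmul ((-1) ^ k) l) - (b + frag_cmul ((-1) ^ k) m) \<in> null"
  using null_add[OF _ frag_cmul_sign_null[of "l - m" k], of "a - b"] by (simp add: frag_cmul_diff algebra_simps)

lemma bar_word_eq: "bar_word S e w = bar_sum S w +
    (if length w \<le> 1 then 0 else frag_cmul ((-1) ^ (length w - 1)) (frag_of ((e (last w) \<odot>\<^bsub>S\<^esub> hd w) # tl (butlast w))))"
proof (cases "length w \<le> 1")
  case True
  then show ?thesis by (cases w) (auto simp: bar_word_def)
next
  case False
  then show ?thesis using bar_sum_eq[of w S] by (simp add: bar_word_def Let_def)
qed

lemma pos_add_eq: "Poly_Mapping.keys x \<subseteq> words \<Longrightarrow> Poly_Mapping.keys y \<subseteq> words \<Longrightarrow> Poly_Mapping.keys z \<subseteq> words \<Longrightarrow>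
  (0, cls x) = (0, cls y) \<oplus>\<^sub>T (0, cls z) \<longleftrightarrow> x - y - z \<in> null"
  by (simp add: T_add cls_eq diff_diff_eq)

lemma bar_word_closed: "set w \<subseteq> carrier S \<Longrightarrow> Poly_Mapping.keys (bar_word S e w) \<subseteq> words"
proof (cases "length w \<le> 1")
  case False
  assume w: "set w \<subseteq> carrier S"
  have "2 \<le> length w" using False by linarith
  then obtain x w' where "w = x # w'" "w' \<noteq> []" by (auto simp: numeral_2_eq_2 Suc_le_length_iff)
  then have "(e (last w) \<odot>\<^bsub>S\<^esub> hd w) # tl (butlast w) \<in> words" using w by (auto simp: tensor_words_def dest: in_set_butlastD)
  then have "Poly_Mapping.keys (frag_cmul ((-1) ^ (length w - 1)) (frag_of ((e (last w) \<odot>\<^bsub>S\<^esub> hd w) # tl (butlast w)))) \<subseteq> words"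
    using keys_cmul[of "(-1) ^ (length w - 1)" "frag_of ((e (last w) \<odot>\<^bsub>S\<^esub> hd w) # tl (butlast w))"] by auto
  then show ?thesis unfolding bar_word_eq using False bar_sum_closed[OF w] by (simp add: keys_add_sub)
qed (simp add: bar_word_eq bar_sum_closed)

text \<open>The sign of the augmentation term depends only on the length of a word, and the words of
  one relator have equal length; so the inner part and the augmentation term can be treated
  separately and recombined with one sign. Words of length one have no augmentation term here and
  are split off.\<close>

lemma bar_null: "x \<in> null \<Longrightarrow> frag_extend (bar_word S e) x \<in> null"
proof (rule frag_extend_null[OF _ _ bimod])
  fix p q u v assume "set p \<subseteq> carrier (algebra_bimodule S)" "set q \<subseteq> carrier (algebra_bimodule S)"
    "u \<in> carrier (algebra_bimodule S)" "v \<in> carrier (algebra_bimodule S)"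
  then have a: "set p \<subseteq> carrier S" "set q \<subseteq> carrier S" "u \<in> carrier S" "v \<in> carrier S" by auto
  have w: "set (p @ (u \<oplus>\<^bsub>S\<^esub> v) # q) \<subseteq> carrier S" "set (p @ u # q) \<subseteq> carrier S" "set (p @ v # q) \<subseteq> carrier S" using a by auto
  let ?l = "\<lambda>w. frag_of ((e (last w) \<odot>\<^bsub>S\<^esub> hd w) # tl (butlast w))"
  have 1: "bar_sum S (p @ (u \<oplus>\<^bsub>S\<^esub> v) # q) - bar_sum S (p @ u # q) - bar_sum S (p @ v # q) \<in> null"
    using BS_add[OF a] unfolding BS_def pos_add_eq[OF bar_sum_closed[OF w(1)] bar_sum_closed[OF w(2)] bar_sum_closed[OF w(3)]] .
  have "bar_word S e (p @ (u \<oplus>\<^bsub>S\<^esub> v) # q) - bar_word S e (p @ u # q) - bar_word S e (p @ v # q) \<in> null"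
  proof (cases "p @ q = []")
    case True
    then show ?thesis using 1 by (simp add: bar_word_eq)
  next
    case False
    have k: "Poly_Mapping.keys (?l w) \<subseteq> words" if "set w \<subseteq> carrier S" "length w > 1" for w
    proof -
      have "2 \<le> length w" using that by linarith
      then obtain x w' where "w = x # w'" "w' \<noteq> []" by (auto simp: numeral_2_eq_2 Suc_le_length_iff)
      then show ?thesis using that by (auto simp: tensor_words_def dest: in_set_butlastD)
    qed
    have len: "1 < length (p @ x # q)" for x using False by (cases p; cases q) auto
    have "?l (p @ (u \<oplus>\<^bsub>S\<^esub> v) # q) - ?l (p @ u # q) - ?l (p @ v # q) \<in> null"
      using LS_add[OF a False] unfolding LS_def pos_add_eq[OF k[OF w(1) len] k[OF w(2) len] k[OF w(3) len]] .
    note null_combine3[OF 1 this, of "length p + length q"]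
    moreover have "bar_word S e (p @ x # q) = bar_sum S (p @ x # q) + frag_cmul ((-1) ^ (length p + length q)) (?l (p @ x # q))" for x
      using len[of x] unfolding bar_word_eq by simp
    ultimately show ?thesis by (simp only:)
  qed
  then show "bar_word S e (p @ (u \<oplus>\<^bsub>algebra_bimodule S\<^esub> v) # q) - bar_word S e (p @ u # q) - bar_word S e (p @ v # q) \<in> null"
    by simp
  fix c
  have w: "set (p @ (c \<odot>\<^bsub>S\<^esub> u) # v # q) \<subseteq> carrier S" "set (p @ u # (c \<odot>\<^bsub>S\<^esub> v) # q) \<subseteq> carrier S" using a by auto
  have 1: "bar_sum S (p @ (c \<odot>\<^bsub>S\<^esub> u) # v # q) - bar_sum S (p @ u # (c \<odot>\<^bsub>S\<^esub> v) # q) \<in> null"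
    using BS_bal[OF a, of c] by (simp add: BS_def cls_eq)
  have "?l (p @ (c \<odot>\<^bsub>S\<^esub> u) # v # q) - ?l (p @ u # (c \<odot>\<^bsub>S\<^esub> v) # q) \<in> null"
    using LS_bal[OF a, of c] by (simp add: LS_def cls_eq)
  note null_combine2[OF 1 this, of "Suc (length p + length q)"]
  moreover have "bar_word S e (p @ x # y # q) = bar_sum S (p @ x # y # q) + frag_cmul ((-1) ^ Suc (length p + length q)) (?l (p @ x # y # q))" for x y
    unfolding bar_word_eq by simp
  ultimately have "bar_word S e (p @ (c \<odot>\<^bsub>S\<^esub> u) # v # q) - bar_word S e (p @ u # (c \<odot>\<^bsub>S\<^esub> v) # q) \<in> null"
    by (simp only:)
  then show "bar_word S e (p @ rsmult (algebra_bimodule S) u c # v # q) - bar_word S e (p @ u # c \<odot>\<^bsub>algebra_bimodule S\<^esub> v # q) \<in> null"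
    by simp
qed

lemma bar_augmentation_superset:
  assumes "finite A" "Poly_Mapping.keys x \<subseteq> A"
  shows "bar_augmentation e x = (\<Sum>w\<in>A. if length w = 1 then of_int (Poly_Mapping.lookup x w) * e (hd w) else 0)"
proof -
  have "bar_augmentation e x = (\<Sum>w\<in>{w \<in> A. length w = 1}. of_int (Poly_Mapping.lookup x w) * e (hd w))"
    unfolding bar_augmentation_def
    by (rule sum.mono_neutral_left) (use assms in \<open>auto simp: in_keys_iff\<close>)
  then show ?thesis using assms(1) by (simp add: sum.inter_filter)
qed

lemma bar_augmentation_diff: "bar_augmentation e (x - y) = bar_augmentation e x - bar_augmentation e y"
proof -
  let ?A = "Poly_Mapping.keys x \<union> Poly_Mapping.keys y"
  have "finite ?A" "Poly_Mapping.keys (x - y) \<subseteq> ?A" "Poly_Mapping.keys x \<subseteq> ?A" "Poly_Mapping.keys y \<subseteq> ?A"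
    using keys_diff[of x y] by auto
  then show ?thesis
    by (simp add: bar_augmentation_superset[of ?A] sum_subtractf[symmetric] lookup_minus left_diff_distrib if_distrib
        cong: if_cong sum.cong)
qed

lemma bar_augmentation_of: "bar_augmentation e (frag_of w) = (if length w = 1 then e (hd w) else 0)"
  using bar_augmentation_superset[of "{w}" "frag_of w"] by simp

lemma bar_augmentation_null: "x \<in> null \<Longrightarrow> bar_augmentation e x = 0"
proof (induction rule: null_induct)
  case zero
  show ?case by (simp add: bar_augmentation_def)
next
  case (rel r)
  then show ?case
  proof (cases rule: relator_cases)
    case (add p q u v)
    then show ?thesis
      by (cases p; cases q) (auto simp: bar_augmentation_diff bar_augmentation_of e_add)
  next
    case (bal p q u v b)
    then show ?thesis by (simp add: bar_augmentation_diff bar_augmentation_of)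
  qed
next
  case (diff x y)
  then show ?case by (simp add: bar_augmentation_diff)
qed

abbreviation "d \<equiv> bar_differential S e"

lemma d_eq:
  "d (c, cls x) = (bar_augmentation e x, cls (frag_extend (bar_word S e) x))"
proof -
  have 1: "bar_augmentation e y = bar_augmentation e x" if "y \<in> cls x" for y
    using bar_augmentation_null[of "y - x"] that by (simp add: cls_mem bar_augmentation_diff)
  then have "bar_augmentation e ` cls x = {bar_augmentation e x}" using cls_self[of x] by blast
  moreover have "(\<Union>y\<in>cls x. cls (frag_extend (bar_word S e) y)) = cls (frag_extend (bar_word S e) x)"
    by (rule cls_UN) (simp add: frag_extend_diff[symmetric] bar_null)
  ultimately show ?thesis by (simp add: bar_differential_def)
qed

lemma bar_extend_closed: "Poly_Mapping.keys x \<subseteq> words \<Longrightarrow> Poly_Mapping.keys (frag_extend (bar_word S e) x) \<subseteq> words"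
proof (rule keys_frag_extend_sub[of words])
  fix w assume "w \<in> words"
  then show "Poly_Mapping.keys (bar_word S e w) \<subseteq> words" by (intro bar_word_closed) (simp add: tensor_words_def)
qed

lemma d_add: "s \<in> carrier T \<Longrightarrow> t \<in> carrier T \<Longrightarrow> d (s \<oplus>\<^sub>T t) = d s \<oplus>\<^sub>T d t"
proof (elim T_cases)
  fix b x c y assume a: "Poly_Mapping.keys x \<subseteq> words" "s = (b, cls x)" "Poly_Mapping.keys y \<subseteq> words" "t = (c, cls y)"
  have "bar_augmentation e (x + y) = bar_augmentation e x + bar_augmentation e y"
    using bar_augmentation_diff[of "x + y" y] by simp
  then show ?thesis using a by (simp add: T_add d_eq bar_extend_closed frag_extend_add)
qed

lemma d_zero: "d \<zero>\<^sub>T = \<zero>\<^sub>T"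
  by (simp add: T_zero d_eq bar_augmentation_def)

text \<open>When the last letter has augmentation 0, the term e(s) w vanishes modulo
  \<open>null\<close> and only the inner part is left. This covers S \<otimes> K^n for n > 0, where
  the last letters come from V.\<close>

lemma d_word:
  assumes "set w \<subseteq> carrier S" "w \<noteq> []" "s \<in> carrier S" "e s = 0"
  shows "d (W (w @ [s])) = BS (w @ [s])"
proof -
  let ?l = "frag_of ((e (last (w @ [s])) \<odot>\<^bsub>S\<^esub> hd (w @ [s])) # tl (butlast (w @ [s])))"
  have "LS (w @ [s]) = \<zero>\<^sub>T" using LS_eq[of w s] assms by (simp add: inB_zero)
  then have "?l \<in> null" by (simp add: LS_def T_zero cls_eq)
  from frag_cmul_sign_null[OF this, of "length w"]
  have "cls (bar_word S e (w @ [s])) = cls (bar_sum S (w @ [s]))" using assms by (simp add: cls_eq bar_word_eq)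
  then show ?thesis using assms
    by (simp add: W_def d_eq bar_augmentation_of BS_def)
qed

lemma d_word3:
  assumes "r \<in> carrier S" "s \<in> carrier S" "t \<in> carrier S" "e t = 0"
  shows "d (gen r \<otimes>\<^sub>T (gen s \<otimes>\<^sub>T gen t)) = gen (r \<otimes>\<^bsub>S\<^esub> s) \<otimes>\<^sub>T gen t \<ominus>\<^bsub>T\<^esub> gen r \<otimes>\<^sub>T gen (s \<otimes>\<^bsub>S\<^esub> t)"
  using d_word[of "[r, s]" t] assms by (simp add: W_Cons BS_Cons T.minus_eq)

lemma d_word4:
  assumes "q \<in> carrier S" "r \<in> carrier S" "s \<in> carrier S" "t \<in> carrier S" "e t = 0"
  shows "d (gen q \<otimes>\<^sub>T (gen r \<otimes>\<^sub>T (gen s \<otimes>\<^sub>T gen t))) =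
    gen (q \<otimes>\<^bsub>S\<^esub> r) \<otimes>\<^sub>T (gen s \<otimes>\<^sub>T gen t) \<ominus>\<^bsub>T\<^esub> gen q \<otimes>\<^sub>T (gen (r \<otimes>\<^bsub>S\<^esub> s) \<otimes>\<^sub>T gen t)
      \<oplus>\<^sub>T gen q \<otimes>\<^sub>T (gen r \<otimes>\<^sub>T gen (s \<otimes>\<^bsub>S\<^esub> t))"
  using d_word[of "[q, r, s]" t] assms
  by (simp add: W_Cons BS_Cons T.minus_eq T.r_distr T.r_minus T.minus_add T.minus_minus T.a_assoc)

end

section \<open>Koszul algebras\<close>

lemma (in galg) smult_plus: "x \<in> carrier A \<Longrightarrow> (c + c') \<odot> x = c \<odot> x \<oplus> c' \<odot> x"
  by (simp add: smult_eq[of x] smult_one_add l_distr comp_carrier[OF smult_one_comp])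

lemma (in galg) smult_smult: "x \<in> carrier A \<Longrightarrow> (c * c') \<odot> x = c \<odot> (c' \<odot> x)"
  by (simp add: smult_eq[of x] smult_eq[of "(c' \<odot> \<one>) \<otimes> x"] smult_one_mult m_assoc comp_carrier[OF smult_one_comp])

lemma (in galg) smult_one [simp]: "x \<in> carrier A \<Longrightarrow> 1 \<odot> x = x"
  by (simp add: smult_eq[of x] smult_one_one)

lemma (in galg) smult_mult_l: "x \<in> carrier A \<Longrightarrow> y \<in> carrier A \<Longrightarrow> (c \<odot> x) \<otimes> y = c \<odot> (x \<otimes> y)"
  by (simp add: smult_eq[of x] smult_eq[of "x \<otimes> y"] m_assoc comp_carrier[OF smult_one_comp])

lemma (in galg) smult_mult_r: "x \<in> carrier A \<Longrightarrow> y \<in> carrier A \<Longrightarrow> x \<otimes> (c \<odot> y) = c \<odot> (x \<otimes> y)"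
  using smult_comm[of x c]
  by (simp add: smult_eq[of y] smult_eq[of "x \<otimes> y"] m_assoc[symmetric] comp_carrier[OF smult_one_comp])

lemma (in galg) quotient_bar:
  fixes e :: "'a set \<Rightarrow> 'k"
  assumes I: "ideal I A"
    and e: "\<And>x y. x \<in> carrier A \<Longrightarrow> y \<in> carrier A \<Longrightarrow> e (I +> (x \<oplus> y)) = e (I +> x) + e (I +> y)"
      "\<And>x c. x \<in> carrier A \<Longrightarrow> e (I +> (c \<odot> x)) = c * e (I +> x)"
  shows "bar (quotient_algebra A I) e"
proof -
  let ?S = "quotient_algebra A I"
  note s = quotient_add[OF I] quotient_mult[OF I] quotient_smult[OF I]
  interpret S: ring ?S by (rule quotient_ring[OF I])
  have el: thesis if "X \<in> carrier ?S" "\<And>x. x \<in> carrier A \<Longrightarrow> X = I +> x \<Longrightarrow> thesis" for X thesis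
    using that by (auto simp: quotient_carrier)
  have cl: "I +> x \<in> carrier ?S" if "x \<in> carrier A" for x using that by (auto simp: quotient_carrier)
  have ag: "abelian_group (algebra_bimodule ?S)"
    by (rule abelian_groupI) (auto simp: algebra_bimodule_def S.a_ac intro: S.l_neg S.a_inv_closed)
  have "bimod (algebra_bimodule ?S) id"
    by (intro bimod.intro ag bimod_axioms.intro) (auto simp: algebra_bimodule_def
      smult_add smult_plus smult_smult mult.commute s cl elim!: el, (simp add: smult_smult[symmetric] mult.commute)+)
  then show ?thesis
    by (intro bar.intro bar_axioms.intro S.ring_axioms)
      (auto simp: s cl e smult_mult_l smult_mult_r elim!: el)
qed

lemma (in bimod) comp_2_induct [consumes 1, case_names gen add]:
  assumes t: "t \<in> component T 2"
    and G: "\<And>u v. u \<in> carrier U \<Longrightarrow> v \<in> carrier U \<Longrightarrow> P (gen u \<otimes>\<^sub>T gen v)"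
    and A: "\<And>x y. x \<in> carrier T \<Longrightarrow> y \<in> carrier T \<Longrightarrow> P x \<Longrightarrow> P y \<Longrightarrow> P (x \<oplus>\<^sub>T y)"
  shows "P t"
proof -
  have "t \<in> component T (Suc 1)" using t by (simp add: numeral_2_eq_2)
  then show ?thesis
  proof (induction rule: comp_Suc_induct_left)
    case (gen u s)
    then obtain v where "v \<in> carrier U" "s = gen v" unfolding comp_1 by blast
    then show ?case using G gen(1) by simp
  qed (rule A)
qed

lemma (in bimod) comp_3_induct [consumes 1, case_names gen add]:
  assumes t: "t \<in> component T 3"
    and G: "\<And>u v w. u \<in> carrier U \<Longrightarrow> v \<in> carrier U \<Longrightarrow> w \<in> carrier U \<Longrightarrow> P (gen u \<otimes>\<^sub>T (gen v \<otimes>\<^sub>T gen w))"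
    and A: "\<And>x y. x \<in> carrier T \<Longrightarrow> y \<in> carrier T \<Longrightarrow> P x \<Longrightarrow> P y \<Longrightarrow> P (x \<oplus>\<^sub>T y)"
  shows "P t"
proof -
  have "t \<in> component T (Suc 2)" using t by (simp add: numeral_3_eq_3 numeral_2_eq_2)
  then show ?thesis
  proof (induction rule: comp_Suc_induct_left)
    case (gen u s)
    from gen(2) show ?case
    proof (induction rule: comp_2_induct)
      case (add x y)
      then show ?case using gen(1) A[of "gen u \<otimes>\<^sub>T x" "gen u \<otimes>\<^sub>T y"] by (simp add: T.r_distr)
    qed (use G gen(1) in blast)
  qed (rule A)
qed

locale quadratic = finite_dimensional_vector_space scale Basis
  for scale :: "'k::field \<Rightarrow> 'v::ab_group_add \<Rightarrow> 'v" and Basis +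
  fixes R'
  assumes R'_comp: "R' \<subseteq> component (tensor_algebra_field scale) 2"
    and R'_sub: "subbimodule (tensor_algebra_field scale) R'"
begin

lemma VB_simps [simp]: "carrier (vector_bimodule scale) = UNIV" "ring.add (vector_bimodule scale) = (+)"
  "ring.zero (vector_bimodule scale) = 0"
  "smult (vector_bimodule scale) = scale" "rsmult (vector_bimodule scale) v c = scale c v"
  by (simp_all add: vector_bimodule_def)

lemma VB_bimod: "bimod (vector_bimodule scale) id"
proof -
  have ag: "abelian_group (vector_bimodule scale)"
    by (rule abelian_groupI) (auto simp: add.assoc add.commute intro: exI[of _ "- x" for x] add.left_inverse)
  show ?thesis
    by (intro bimod.intro ag bimod_axioms.intro)
      (auto simp: scale_right_distrib scale_left_distrib mult.commute)
qed

sublocale V: bimod "vector_bimodule scale" id by (rule VB_bimod)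

abbreviation VT_mult (infixl "\<otimes>\<^sub>V" 70) where "x \<otimes>\<^sub>V y \<equiv> x \<otimes>\<^bsub>V.T\<^esub> y"
abbreviation VT_add (infixl "\<oplus>\<^sub>V" 65) where "x \<oplus>\<^sub>V y \<equiv> x \<oplus>\<^bsub>V.T\<^esub> y"
abbreviation VT_zero ("\<zero>\<^sub>V") where "\<zero>\<^sub>V \<equiv> \<zero>\<^bsub>V.T\<^esub>"

definition "coef b v = representation Basis v b"

lemma coef_add: "coef b (u + v) = coef b u + coef b v"
  by (simp add: coef_def representation_add[OF independent_Basis] span_Basis)
lemma coef_scale: "coef b (scale c v) = c * coef b v"
  by (simp add: coef_def representation_scale[OF independent_Basis] span_Basis)
lemma coef_sum: "(\<Sum>b\<in>Basis. scale (coef b v) b) = v"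
  unfolding coef_def by (rule sum_representation_eq) (use independent_Basis finite_Basis span_Basis in auto)

lemma gen_sum: "finite F \<Longrightarrow> V.gen (\<Sum>b\<in>F. f b) = (\<Oplus>\<^bsub>V.T\<^esub>b\<in>F. V.gen (f b))"
proof (induction F rule: finite_induct)
  case empty
  then show ?case using V.gen_zero by simp
next
  case (insert x F)
  then show ?case using V.gen_add[of "f x" "sum f F"] by (simp add: Pi_def)
qed

lemma gen_scale: "V.gen (scale c v) = V.inB c \<otimes>\<^sub>V V.gen v"
  using V.inB_gen[of v c] by simp
lemma gen_scale': "V.gen (scale c v) = V.gen v \<otimes>\<^sub>V V.inB c"
  using V.gen_inB[of v c] by simp

lemma inB_central: "t \<in> carrier V.T \<Longrightarrow> t \<otimes>\<^sub>V V.inB c = V.inB c \<otimes>\<^sub>V t"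
  using V.eta_central[of t c] by simp

lemma free_gen_ex: "\<exists>DL DR. free_gen V.T Basis V.gen DL DR \<and>
    (\<forall>b v. \<forall>t\<in>carrier V.T. DL b (V.gen v \<otimes>\<^sub>V t) = V.inB (coef b v) \<otimes>\<^sub>V t) \<and>
    (\<forall>b v. \<forall>t\<in>carrier V.T. DR b (t \<otimes>\<^sub>V V.gen v) = t \<otimes>\<^sub>V V.inB (coef b v))"
proof -
  have g: "V.gen v = (\<Oplus>\<^bsub>V.T\<^esub>b\<in>Basis. V.gen (scale (coef b v) b))" for v
    using gen_sum[OF finite_Basis, of "\<lambda>b. scale (coef b v) b"] by (simp add: coef_sum)
  have "\<exists>DL DR. free_gen V.T Basis (\<lambda>b. V.gen (id b)) DL DR \<and>
    (\<forall>b. \<forall>v\<in>carrier (vector_bimodule scale). \<forall>t\<in>carrier V.T. DL b (V.gen v \<otimes>\<^sub>V t) = V.inB (coef b v) \<otimes>\<^sub>V t) \<and>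
    (\<forall>b. \<forall>v\<in>carrier (vector_bimodule scale). \<forall>t\<in>carrier V.T. DR b (t \<otimes>\<^sub>V V.gen v) = t \<otimes>\<^sub>V V.inB (coef b v))"
    by (rule V.free_gen_exists[OF finite_Basis])
      (simp_all add: coef_add coef_scale mult.commute gen_scale[symmetric] gen_scale'[symmetric] g[symmetric])
  then show ?thesis by simp
qed

text \<open>Both families of coordinate maps are chosen as one pair, so that they become constants
  with which \<open>free_gen\<close> is interpreted for the whole locale.\<close>

definition DLR where "DLR = (SOME p. free_gen V.T Basis V.gen (fst p) (snd p) \<and>
    (\<forall>b v. \<forall>t\<in>carrier V.T. fst p b (V.gen v \<otimes>\<^sub>V t) = V.inB (coef b v) \<otimes>\<^sub>V t) \<and>
    (\<forall>b v. \<forall>t\<in>carrier V.T. snd p b (t \<otimes>\<^sub>V V.gen v) = t \<otimes>\<^sub>V V.inB (coef b v)))"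
definition "DL = fst DLR"
definition "DR = snd DLR"

lemma DLR: "free_gen V.T Basis V.gen DL DR"
    "t \<in> carrier V.T \<Longrightarrow> DL b (V.gen v \<otimes>\<^sub>V t) = V.inB (coef b v) \<otimes>\<^sub>V t"
    "t \<in> carrier V.T \<Longrightarrow> DR b (t \<otimes>\<^sub>V V.gen v) = t \<otimes>\<^sub>V V.inB (coef b v)"
proof -
  obtain L R where "free_gen V.T Basis V.gen L R \<and>
    (\<forall>b v. \<forall>t\<in>carrier V.T. L b (V.gen v \<otimes>\<^sub>V t) = V.inB (coef b v) \<otimes>\<^sub>V t) \<and>
    (\<forall>b v. \<forall>t\<in>carrier V.T. R b (t \<otimes>\<^sub>V V.gen v) = t \<otimes>\<^sub>V V.inB (coef b v))"
    using free_gen_ex by blast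
  then have "\<exists>p. free_gen V.T Basis V.gen (fst p) (snd p) \<and>
    (\<forall>b v. \<forall>t\<in>carrier V.T. fst p b (V.gen v \<otimes>\<^sub>V t) = V.inB (coef b v) \<otimes>\<^sub>V t) \<and>
    (\<forall>b v. \<forall>t\<in>carrier V.T. snd p b (t \<otimes>\<^sub>V V.gen v) = t \<otimes>\<^sub>V V.inB (coef b v))"
    by (intro exI[of _ "(L, R)"]) simp
  note h = someI_ex[OF this, folded DLR_def, folded DL_def DR_def]
  show "free_gen V.T Basis V.gen DL DR" using h by blast
  show "t \<in> carrier V.T \<Longrightarrow> DL b (V.gen v \<otimes>\<^sub>V t) = V.inB (coef b v) \<otimes>\<^sub>V t" using h by blast
  show "t \<in> carrier V.T \<Longrightarrow> DR b (t \<otimes>\<^sub>V V.gen v) = t \<otimes>\<^sub>V V.inB (coef b v)" using h by blast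
qed

sublocale F: free_gen V.T Basis V.gen DL DR by (rule DLR)

lemma hp_R': "hom_part V.T 2 ` R' = R'"
proof -
  have "hom_part V.T 2 r = r" if "r \<in> R'" for r using R'_comp that V.T.hp_hom[of r 2 2] by auto
  then show ?thesis by (metis image_cong image_ident)
qed

text \<open>The homogeneous case P = R' of the filtered setting. Here \<open>I\<close> and
  \<open>IR\<close> both become J, so the homogeneity of J and its description in degrees up to 2
  are inherited.\<close>

sublocale Q: filtered_bimodule V.T R'
  by unfold_locales (use R'_comp R'_sub in \<open>auto intro: V.T.filt_comp\<close>)

abbreviation "J \<equiv> genideal V.T R'"
abbreviation "S \<equiv> quadratic_algebra scale R'"
abbreviation "cl t \<equiv> J +>\<^bsub>V.T\<^esub> t"

lemma S_eq: "S = quotient_algebra V.T J" by (simp add: quadratic_algebra_def)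

lemma J_ideal: "ideal J V.T" by (rule Q.I_ideal)

lemma J_car: "x \<in> J \<Longrightarrow> x \<in> carrier V.T"
  using Q.I.a_subset by blast

lemma J_low: assumes "x \<in> J" shows "hom_part V.T 0 x = \<zero>\<^sub>V" "hom_part V.T 1 x = \<zero>\<^sub>V"
  using Q.IR_low(1,2)[unfolded hp_R', OF assms] by auto

lemma J_hp: "x \<in> J \<Longrightarrow> hom_part V.T n x \<in> J"
  using Q.IR_hp[unfolded hp_R'] by blast

lemma R'_J: "r \<in> R' \<Longrightarrow> r \<in> J" using Q.P_I by blast
lemma R'_car [simp]: "r \<in> R' \<Longrightarrow> r \<in> carrier V.T" by (rule Q.P_car)
lemma R'_c2: "r \<in> R' \<Longrightarrow> r \<in> component V.T 2" using R'_comp by blast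

abbreviation S_mult (infixl "\<otimes>\<^sub>S" 70) where "x \<otimes>\<^sub>S y \<equiv> x \<otimes>\<^bsub>S\<^esub> y"
abbreviation S_add (infixl "\<oplus>\<^sub>S" 65) where "x \<oplus>\<^sub>S y \<equiv> x \<oplus>\<^bsub>S\<^esub> y"
abbreviation S_zero ("\<zero>\<^sub>S") where "\<zero>\<^sub>S \<equiv> \<zero>\<^bsub>S\<^esub>"

lemma cl_add: "x \<in> carrier V.T \<Longrightarrow> y \<in> carrier V.T \<Longrightarrow> cl (x \<oplus>\<^sub>V y) = cl x \<oplus>\<^sub>S cl y"
  by (simp add: S_eq V.T.quotient_add[OF J_ideal])
lemma cl_mult: "x \<in> carrier V.T \<Longrightarrow> y \<in> carrier V.T \<Longrightarrow> cl (x \<otimes>\<^sub>V y) = cl x \<otimes>\<^sub>S cl y"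
  by (simp add: S_eq V.T.quotient_mult[OF J_ideal])
lemma cl_smult: "x \<in> carrier V.T \<Longrightarrow> cl (c \<odot>\<^bsub>V.T\<^esub> x) = c \<odot>\<^bsub>S\<^esub> cl x"
  by (simp add: S_eq V.T.quotient_smult[OF J_ideal])
lemma cl_eq: "x \<in> carrier V.T \<Longrightarrow> y \<in> carrier V.T \<Longrightarrow> cl x = cl y \<longleftrightarrow> x \<ominus>\<^bsub>V.T\<^esub> y \<in> J"
  by (rule V.T.rcos_eq_iff[OF J_ideal])
lemma S_zero: "\<zero>\<^sub>S = J" by (simp add: S_eq V.T.quotient_zero)
lemma cl_zero_iff: "x \<in> carrier V.T \<Longrightarrow> cl x = \<zero>\<^sub>S \<longleftrightarrow> x \<in> J"
  using cl_eq[of x "\<zero>\<^sub>V"] V.T.rcos_zero[OF J_ideal] by (simp add: S_zero V.T.minus_eq)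
lemma cl_closed [simp]: "x \<in> carrier V.T \<Longrightarrow> cl x \<in> carrier S"
  unfolding S_eq V.T.quotient_carrier by blast
lemma S_cases: "s \<in> carrier S \<Longrightarrow> (\<And>x. x \<in> carrier V.T \<Longrightarrow> s = cl x \<Longrightarrow> thesis) \<Longrightarrow> thesis"
  by (auto simp: S_eq V.T.quotient_carrier)
lemma rep_mem: "x \<in> carrier V.T \<Longrightarrow> y \<in> cl x \<Longrightarrow> y \<in> carrier V.T \<and> y \<ominus>\<^bsub>V.T\<^esub> x \<in> J"
  using V.T.rcos_mem_iff[OF J_ideal, of x y] V.T.rcos_carrier[OF J_ideal, of x y] by blast
lemma cl_self: "x \<in> carrier V.T \<Longrightarrow> x \<in> cl x"
  using V.T.rcos_mem_iff[OF J_ideal, of x x] Q.I.zero_closed by (simp add: V.T.minus_eq V.T.r_neg)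

lemma the_elem_cl:
  assumes x: "x \<in> carrier V.T"
    and f: "\<And>y z. y \<in> carrier V.T \<Longrightarrow> z \<in> carrier V.T \<Longrightarrow> y \<ominus>\<^bsub>V.T\<^esub> z \<in> J \<Longrightarrow> f y = f z"
  shows "the_elem (f ` cl x) = f x"
proof -
  have "f y = f x" if "y \<in> cl x" for y using rep_mem[OF x that] f x by blast
  then have "f ` cl x = {f x}" using cl_self[OF x] by blast
  then show ?thesis by simp
qed

text \<open>J starts in degree 2, so the parts of degree 0 and 1 descend to functions on S.\<close>

lemma hp_diff_J: "n \<le> 1 \<Longrightarrow> y \<in> carrier V.T \<Longrightarrow> z \<in> carrier V.T \<Longrightarrow> y \<ominus>\<^bsub>V.T\<^esub> z \<in> J \<Longrightarrow> hom_part V.T n y = hom_part V.T n z"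
proof -
  assume a: "n \<le> 1" "y \<in> carrier V.T" "z \<in> carrier V.T" "y \<ominus>\<^bsub>V.T\<^esub> z \<in> J"
  have "n = 0 \<or> n = 1" using a(1) by linarith
  then have "hom_part V.T n (y \<ominus>\<^bsub>V.T\<^esub> z) = \<zero>\<^sub>V" using J_low[OF a(4)] by blast
  then show ?thesis using a V.T.diff_eq_0[of "hom_part V.T n y" "hom_part V.T n z"] by (simp add: V.T.hp_minus)
qed

lemma fst_hp0: "t \<in> carrier V.T \<Longrightarrow> hom_part V.T 0 t = V.inB (fst t)"
proof (induction rule: V.T_induct_left)
  case (base b)
  then show ?case using V.T.hp_hom[OF V.comp_inB, of 0 b] by (simp add: V.inB_def)
next
  case (add x y)
  then have "fst (x \<oplus>\<^sub>V y) = fst x + fst y" by (elim V.T_cases) (simp add: V.T_add)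
  then show ?case using add by (simp add: V.T.hp_add V.inB_add)
next
  case (gen u t)
  then have "fst (V.gen u \<otimes>\<^sub>V t) = 0" by (elim V.T_cases) (simp add: V.gen_eq V.T_mult)
  then show ?case using gen V.T.hp_mult_l[OF V.gen_comp1, of u t 0] by (simp add: V.inB_zero)
qed

lemma inB_fst: "x \<in> component V.T 0 \<Longrightarrow> V.inB (fst x) = x"
  by (auto simp: V.comp_0 V.inB_def)

lemma augmentation_cl: "x \<in> carrier V.T \<Longrightarrow> augmentation (cl x) = fst x"
  unfolding augmentation_def
proof (rule the_elem_cl)
  fix y z assume "y \<in> carrier V.T" "z \<in> carrier V.T" "y \<ominus>\<^bsub>V.T\<^esub> z \<in> J"
  then show "fst y = fst z" using hp_diff_J[of 0 y z] by (simp add: fst_hp0 V.inB_inj)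
qed

lemma fst_add: "x \<in> carrier V.T \<Longrightarrow> y \<in> carrier V.T \<Longrightarrow> fst (x \<oplus>\<^sub>V y) = fst x + fst y"
  by (elim V.T_cases) (simp add: V.T_add)

lemma fst_mult: "x \<in> carrier V.T \<Longrightarrow> y \<in> carrier V.T \<Longrightarrow> fst (x \<otimes>\<^sub>V y) = fst x * fst y"
  by (elim V.T_cases) (simp add: V.T_mult)

sublocale S: bar S augmentation
  unfolding S_eq
proof (rule V.T.quotient_bar[OF J_ideal])
  show "augmentation (cl (x \<oplus>\<^sub>V y)) = augmentation (cl x) + augmentation (cl y)"
    if "x \<in> carrier V.T" "y \<in> carrier V.T" for x y using that by (simp add: augmentation_cl fst_add)
  show "augmentation (cl (c \<odot>\<^bsub>V.T\<^esub> x)) = c * augmentation (cl x)" if "x \<in> carrier V.T" for x c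
    using that fst_mult[of "V.inB c" x] augmentation_cl[of "V.inB c \<otimes>\<^sub>V x"]
    by (simp add: augmentation_cl V.T_smult_eq) (simp add: V.inB_def)
qed

section \<open>Lifting the differential of the Koszul complex to T_k(V)\<close>

abbreviation ST_mult (infixl "\<otimes>\<^sub>B" 70) where "x \<otimes>\<^sub>B y \<equiv> x \<otimes>\<^bsub>S.T\<^esub> y"
abbreviation ST_add (infixl "\<oplus>\<^sub>B" 65) where "x \<oplus>\<^sub>B y \<equiv> x \<oplus>\<^bsub>S.T\<^esub> y"
abbreviation ST_zero ("\<zero>\<^sub>B") where "\<zero>\<^sub>B \<equiv> \<zero>\<^bsub>S.T\<^esub>"

definition "sg t = S.gen (cl t)"

lemma sg_closed [simp]: "t \<in> carrier V.T \<Longrightarrow> sg t \<in> carrier S.T" by (simp add: sg_def)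
lemma sg_comp: "t \<in> carrier V.T \<Longrightarrow> sg t \<in> component S.T 1"
  unfolding sg_def by (rule S.gen_comp1) simp
lemma sg_add: "s \<in> carrier V.T \<Longrightarrow> t \<in> carrier V.T \<Longrightarrow> sg (s \<oplus>\<^sub>V t) = sg s \<oplus>\<^sub>B sg t"
  using S.gen_add[of "cl s" "cl t"] by (simp add: sg_def cl_add)
lemma sg_eq_zero: "t \<in> carrier V.T \<Longrightarrow> sg t = \<zero>\<^sub>B \<longleftrightarrow> t \<in> J"
  using S.gen_eq_zero[of "cl t"] S.gen_zero by (auto simp: sg_def cl_zero_iff[symmetric])
lemma sg_J [simp]: "t \<in> J \<Longrightarrow> sg t = \<zero>\<^sub>B" using sg_eq_zero J_car by blast
lemma sg_zero [simp]: "sg \<zero>\<^sub>V = \<zero>\<^sub>B" using Q.I.zero_closed by (intro sg_J)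
lemma sg_inB: "t \<in> carrier V.T \<Longrightarrow> sg (t \<otimes>\<^sub>V V.inB c) = sg t \<otimes>\<^sub>B S.inB c"
  using S.gen_inB[of "cl t" c] by (simp add: sg_def inB_central V.T_smult_eq[symmetric, of t c, simplified] cl_smult)
lemma sg_inB_l: "t \<in> carrier V.T \<Longrightarrow> sg (V.inB c \<otimes>\<^sub>V t) = S.inB c \<otimes>\<^sub>B sg t"
  using S.inB_gen[of "cl t" c] by (simp add: sg_def V.T_smult_eq[symmetric, of t c, simplified] cl_smult)
text \<open>L is f \<otimes> (V \<rightarrow> S), read on the part of T_k(V) of positive degree.
  Iterating it peels letters off from the right.\<close>

definition "lifts_right L f \<longleftrightarrow> V.lift_map S.T L \<and> (\<forall>v. \<forall>t \<in> carrier V.T. L (t \<otimes>\<^sub>V V.gen v) = f t \<otimes>\<^sub>B sg (V.gen v))"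

lemma lifts_right_ex:
  assumes "\<And>t. t \<in> carrier V.T \<Longrightarrow> f t \<in> carrier S.T"
    "\<And>s t. s \<in> carrier V.T \<Longrightarrow> t \<in> carrier V.T \<Longrightarrow> f (s \<oplus>\<^sub>V t) = f s \<oplus>\<^sub>B f t"
    "\<And>t c. t \<in> carrier V.T \<Longrightarrow> f (t \<otimes>\<^sub>V V.inB c) = f t \<otimes>\<^sub>B S.inB c"
  shows "\<exists>L. lifts_right L f"
proof -
  have "sg (V.gen (u + v)) = sg (V.gen u) \<oplus>\<^sub>B sg (V.gen v)" for u v
    using V.gen_add[of u v] by (simp add: sg_add)
  then have "\<exists>L. V.lift_map S.T L \<and> (\<forall>v\<in>carrier (vector_bimodule scale). \<forall>t \<in> carrier V.T. L (t \<otimes>\<^sub>V V.gen v) = f t \<otimes>\<^sub>B sg (V.gen v))"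
    by (intro V.right_lift[OF S.T.is_abelian_group])
      (simp_all add: assms S.T.r_distr S.T.l_distr gen_scale sg_inB_l S.T.m_assoc)
  then show ?thesis by (simp add: lifts_right_def)
qed

lemma lifts_right_inB:
  assumes "lifts_right L f" "t \<in> carrier V.T"
    "\<And>t. t \<in> carrier V.T \<Longrightarrow> f t \<in> carrier S.T"
    "\<And>t c. t \<in> carrier V.T \<Longrightarrow> f (t \<otimes>\<^sub>V V.inB c) = f t \<otimes>\<^sub>B S.inB c"
  shows "L (t \<otimes>\<^sub>V V.inB c) = L t \<otimes>\<^sub>B S.inB c"
  using assms(2)
proof (induction rule: V.T_induct_right)
  case (base b)
  then show ?case using assms(1) by (simp add: V.inB_mult[symmetric] lifts_right_def V.lift_map_def)
next
  case (add x y)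
  then show ?case using assms(1) by (simp add: lifts_right_def V.lift_map_def V.T.l_distr S.T.l_distr)
next
  case (gen v t)
  have "V.gen v \<otimes>\<^sub>V V.inB c = V.gen (scale c v)" by (simp add: gen_scale')
  then have "L (t \<otimes>\<^sub>V V.gen v \<otimes>\<^sub>V V.inB c) = L (t \<otimes>\<^sub>V V.gen (scale c v))"
    using gen by (simp add: V.T.m_assoc)
  also have "\<dots> = f t \<otimes>\<^sub>B sg (V.gen (scale c v))" using assms(1) gen by (simp add: lifts_right_def V.lift_map_def)
  also have "\<dots> = f t \<otimes>\<^sub>B sg (V.gen v) \<otimes>\<^sub>B S.inB c" using gen assms(3) by (simp add: gen_scale' sg_inB S.T.m_assoc)
  finally show ?case using assms(1) gen by (simp add: lifts_right_def V.lift_map_def)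
qed

text \<open>The map T_k(V) \<otimes> V \<rightarrow> S \<otimes> V that reduces everything before
  the last letter modulo J. It vanishes on J \<otimes> V.\<close>

definition "Th1 = (SOME L. lifts_right L sg)"
lemma Th1: "lifts_right Th1 sg"
  unfolding Th1_def by (rule someI_ex[of "\<lambda>L. lifts_right L sg"], rule lifts_right_ex) (simp_all add: sg_add sg_inB)
lemma Th1_inB: "t \<in> carrier V.T \<Longrightarrow> Th1 (t \<otimes>\<^sub>V V.inB c) = Th1 t \<otimes>\<^sub>B S.inB c"
  by (rule lifts_right_inB[OF Th1]) (simp_all add: sg_inB)
lemma Th1_props: "t \<in> carrier V.T \<Longrightarrow> Th1 t \<in> carrier S.T"
  "s \<in> carrier V.T \<Longrightarrow> t \<in> carrier V.T \<Longrightarrow> Th1 (s \<oplus>\<^sub>V t) = Th1 s \<oplus>\<^sub>B Th1 t"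
  "Th1 (V.inB b) = \<zero>\<^sub>B"
  "t \<in> carrier V.T \<Longrightarrow> Th1 (t \<otimes>\<^sub>V V.gen v) = sg t \<otimes>\<^sub>B sg (V.gen v)"
  using Th1 by (auto simp: lifts_right_def V.lift_map_def)

text \<open>The same with the last two letters kept, with values in S \<otimes> V \<otimes> V inside
  the third tensor power of S. It sends T_k(V) \<otimes> R' to S \<otimes> K^2 and so carries a
  membership question in T_k(V) to a question about cycles of the Koszul complex.\<close>

definition "Th2 = (SOME L. lifts_right L Th1)"
lemma Th2: "lifts_right Th2 Th1"
  unfolding Th2_def by (rule someI_ex[of "\<lambda>L. lifts_right L Th1"], rule lifts_right_ex) (simp_all add: Th1_props Th1_inB)
lemma Th2_props: "t \<in> carrier V.T \<Longrightarrow> Th2 t \<in> carrier S.T"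
  "s \<in> carrier V.T \<Longrightarrow> t \<in> carrier V.T \<Longrightarrow> Th2 (s \<oplus>\<^sub>V t) = Th2 s \<oplus>\<^sub>B Th2 t"
  "Th2 (V.inB b) = \<zero>\<^sub>B"
  "t \<in> carrier V.T \<Longrightarrow> Th2 (t \<otimes>\<^sub>V V.gen v) = Th1 t \<otimes>\<^sub>B sg (V.gen v)"
  using Th2 by (auto simp: lifts_right_def V.lift_map_def)

lemma ThL_ex: "\<exists>L. V.lift_map S.T L \<and> (\<forall>v\<in>carrier (vector_bimodule scale). \<forall>t \<in> carrier V.T. L (V.gen v \<otimes>\<^sub>V t) = sg (V.gen v) \<otimes>\<^sub>B sg t)"
proof (rule V.left_lift[OF S.T.is_abelian_group])
  have "sg (V.gen (u + v)) = sg (V.gen u) \<oplus>\<^sub>B sg (V.gen v)" for u v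
    using V.gen_add[of u v] by (simp add: sg_add)
  then show "sg (V.gen (u \<oplus>\<^bsub>vector_bimodule scale\<^esub> v)) \<otimes>\<^sub>B sg t = sg (V.gen u) \<otimes>\<^sub>B sg t \<oplus>\<^sub>B sg (V.gen v) \<otimes>\<^sub>B sg t"
    if "t \<in> carrier V.T" for u v t using that by (simp add: S.T.l_distr)
qed (simp_all add: sg_add S.T.r_distr gen_scale' sg_inB sg_inB_l S.T.m_assoc)

text \<open>The mirror image: the first letter is kept and the rest is reduced modulo J, so that V
  \<otimes> R' is sent to zero.\<close>

definition "ThL = (SOME L. V.lift_map S.T L \<and> (\<forall>v\<in>carrier (vector_bimodule scale). \<forall>t \<in> carrier V.T. L (V.gen v \<otimes>\<^sub>V t) = sg (V.gen v) \<otimes>\<^sub>B sg t))"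

lemma ThL_props: "t \<in> carrier V.T \<Longrightarrow> ThL t \<in> carrier S.T"
  "s \<in> carrier V.T \<Longrightarrow> t \<in> carrier V.T \<Longrightarrow> ThL (s \<oplus>\<^sub>V t) = ThL s \<oplus>\<^sub>B ThL t"
  "ThL (V.inB b) = \<zero>\<^sub>B"
  "t \<in> carrier V.T \<Longrightarrow> ThL (V.gen v \<otimes>\<^sub>V t) = sg (V.gen v) \<otimes>\<^sub>B sg t"
  using someI_ex[OF ThL_ex, folded ThL_def] by (auto simp: V.lift_map_def)

lemma Th_zero: "Th1 \<zero>\<^sub>V = \<zero>\<^sub>B" "Th2 \<zero>\<^sub>V = \<zero>\<^sub>B" "ThL \<zero>\<^sub>V = \<zero>\<^sub>B"
  using Th1_props(3)[of 0] Th2_props(3)[of 0] ThL_props(3)[of 0] by (simp_all add: V.inB_zero)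

lemma Th1_eq_0: "x \<in> V.T.tspan J (component V.T 1) \<Longrightarrow> x \<in> carrier V.T \<and> Th1 x = \<zero>\<^sub>B"
proof (induction rule: V.T.tspan.induct)
  case (prod j u)
  then obtain v where "u = V.gen v" unfolding V.comp_1 by blast
  then show ?case using prod J_car[of j] by (simp add: Th1_props)
qed (simp_all add: Th_zero Th1_props)

lemma ThL_eq_0: "x \<in> V.T.tspan (component V.T 1) R' \<Longrightarrow> x \<in> carrier V.T \<and> ThL x = \<zero>\<^sub>B"
proof (induction rule: V.T.tspan.induct)
  case (prod u r)
  then obtain v where "u = V.gen v" unfolding V.comp_1 by blast
  then show ?case using prod by (simp add: ThL_props R'_J)
qed (simp_all add: Th_zero ThL_props)

abbreviation "iota \<equiv> tensor_map (algebra_bimodule S) (quadratic_generator scale R')"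

lemma generator_eq: "quadratic_generator scale R' v = cl (V.gen v)"
  by (simp add: quadratic_generator_def)

lemma iota:
  "t \<in> carrier V.T \<Longrightarrow> iota t \<in> carrier S.T"
  "s \<in> carrier V.T \<Longrightarrow> t \<in> carrier V.T \<Longrightarrow> iota (s \<oplus>\<^sub>V t) = iota s \<oplus>\<^sub>B iota t"
  "iota (V.gen u \<otimes>\<^sub>V V.gen v) = sg (V.gen u) \<otimes>\<^sub>B sg (V.gen v)"
  "iota (V.gen u \<otimes>\<^sub>V (V.gen v \<otimes>\<^sub>V V.gen w)) = sg (V.gen u) \<otimes>\<^sub>B (sg (V.gen v) \<otimes>\<^sub>B sg (V.gen w))"
proof -
  have a: "quadratic_generator scale R' (u + v) = quadratic_generator scale R' u \<oplus>\<^sub>S quadratic_generator scale R' v" for u v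
    using V.gen_add[of u v] by (simp add: generator_eq cl_add)
  have s: "quadratic_generator scale R' (scale c v) = c \<odot>\<^bsub>S\<^esub> quadratic_generator scale R' v" for c v
    by (simp add: generator_eq gen_scale cl_smult[symmetric] V.T_smult_eq)
  have c: "quadratic_generator scale R' v \<in> carrier S" for v by (simp add: generator_eq)
  note p = V.tensor_map_props[OF S.bimod, of "quadratic_generator scale R'"]
  show "t \<in> carrier V.T \<Longrightarrow> iota t \<in> carrier S.T"
    by (rule p(1)) (simp_all add: a s c)
  show "s \<in> carrier V.T \<Longrightarrow> t \<in> carrier V.T \<Longrightarrow> iota (s \<oplus>\<^sub>V t) = iota s \<oplus>\<^sub>B iota t"
    by (rule p(2)) (simp_all add: a s c)
  have "iota (V.gen u \<otimes>\<^sub>V V.gen v) = S.gen (quadratic_generator scale R' u) \<otimes>\<^sub>B S.gen (quadratic_generator scale R' v)"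
    by (rule p(3)) (simp_all add: a s c)
  then show "iota (V.gen u \<otimes>\<^sub>V V.gen v) = sg (V.gen u) \<otimes>\<^sub>B sg (V.gen v)" by (simp add: generator_eq sg_def)
  have "iota (V.gen u \<otimes>\<^sub>V (V.gen v \<otimes>\<^sub>V V.gen w)) = S.gen (quadratic_generator scale R' u) \<otimes>\<^sub>B (S.gen (quadratic_generator scale R' v) \<otimes>\<^sub>B S.gen (quadratic_generator scale R' w))"
    by (rule p(4)) (simp_all add: a s c)
  then show "iota (V.gen u \<otimes>\<^sub>V (V.gen v \<otimes>\<^sub>V V.gen w)) = sg (V.gen u) \<otimes>\<^sub>B (sg (V.gen v) \<otimes>\<^sub>B sg (V.gen w))" by (simp add: generator_eq sg_def)
qed

lemma augmentation_gen: "augmentation (cl (V.gen v)) = 0"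
proof -
  have "augmentation (cl (V.gen v)) = fst (V.gen v)" by (rule augmentation_cl) simp
  then show ?thesis by (simp add: tensor_generator_def)
qed

lemma Th2_prod2:
  assumes t: "t \<in> carrier V.T" and q: "q \<in> component V.T 2"
  shows "Th2 (t \<otimes>\<^sub>V q) = sg t \<otimes>\<^sub>B iota q"
  using q
proof (induction rule: V.comp_2_induct)
  case (gen u v)
  then show ?case using t by (simp add: V.T.m_assoc[symmetric] Th2_props Th1_props iota S.T.m_assoc)
next
  case (add x y)
  then show ?case using t by (simp add: V.T.r_distr Th2_props iota S.T.r_distr)
qed

text \<open>On letters, d(s \<otimes> u \<otimes> v) = s u \<otimes> v - s \<otimes> u v. For q
  \<in> R' the second term is zero, so d after \<open>Th2\<close> becomes \<open>Th1\<close> on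
  T_k(V) \<otimes> R'.\<close>

lemma d_prod2:
  assumes t: "t \<in> carrier V.T" and q: "q \<in> component V.T 2"
  shows "S.d (sg t \<otimes>\<^sub>B iota q) = Th1 (t \<otimes>\<^sub>V q) \<ominus>\<^bsub>S.T\<^esub> sg t \<otimes>\<^sub>B sg q"
  using q
proof (induction rule: V.comp_2_induct)
  case (gen u v)
  have "S.d (sg t \<otimes>\<^sub>B iota (V.gen u \<otimes>\<^sub>V V.gen v)) =
      sg (t \<otimes>\<^sub>V V.gen u) \<otimes>\<^sub>B sg (V.gen v) \<ominus>\<^bsub>S.T\<^esub> sg t \<otimes>\<^sub>B sg (V.gen u \<otimes>\<^sub>V V.gen v)"
    using t S.d_word3[of "cl t" "cl (V.gen u)" "cl (V.gen v)"]
    by (simp add: iota augmentation_gen sg_def cl_mult)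
  then show ?case using t by (simp add: V.T.m_assoc[symmetric] Th1_props)
next
  case (add x y)
  have "S.d (sg t \<otimes>\<^sub>B iota (x \<oplus>\<^sub>V y)) = S.d (sg t \<otimes>\<^sub>B iota x) \<oplus>\<^sub>B S.d (sg t \<otimes>\<^sub>B iota y)"
    using t add by (simp add: iota S.T.r_distr S.d_add)
  then show ?case using t add by (simp add: V.T.r_distr Th1_props sg_add S.T.r_distr S.T.diff_add_diff)
qed

text \<open>The three terms multiply s u, u v and v w. On (R' \<otimes> V) \<inter> (V \<otimes> R')
  the last two vanish, through \<open>Th1\<close> and \<open>ThL\<close>, so that d of a generator
  of S \<otimes> K^3 is \<open>Th2\<close> of an explicit lift.\<close>

lemma d_prod3:
  assumes t: "t \<in> carrier V.T" and q: "q \<in> component V.T 3"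
  shows "S.d (sg t \<otimes>\<^sub>B iota q) = Th2 (t \<otimes>\<^sub>V q) \<ominus>\<^bsub>S.T\<^esub> sg t \<otimes>\<^sub>B Th1 q \<oplus>\<^sub>B sg t \<otimes>\<^sub>B ThL q"
  using q
proof (induction rule: V.comp_3_induct)
  case (gen u v w)
  have 1: "Th2 (t \<otimes>\<^sub>V (V.gen u \<otimes>\<^sub>V (V.gen v \<otimes>\<^sub>V V.gen w))) = sg (t \<otimes>\<^sub>V V.gen u) \<otimes>\<^sub>B (sg (V.gen v) \<otimes>\<^sub>B sg (V.gen w))"
    using t by (simp add: V.T.m_assoc[symmetric] Th2_props Th1_props) (simp add: S.T.m_assoc)
  have 2: "Th1 (V.gen u \<otimes>\<^sub>V (V.gen v \<otimes>\<^sub>V V.gen w)) = sg (V.gen u \<otimes>\<^sub>V V.gen v) \<otimes>\<^sub>B sg (V.gen w)"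
    by (simp add: V.T.m_assoc[symmetric] Th1_props)
  have 3: "ThL (V.gen u \<otimes>\<^sub>V (V.gen v \<otimes>\<^sub>V V.gen w)) = sg (V.gen u) \<otimes>\<^sub>B sg (V.gen v \<otimes>\<^sub>V V.gen w)"
    by (simp add: ThL_props)
  show ?case unfolding 1 2 3 iota(4)
    using t S.d_word4[of "cl t" "cl (V.gen u)" "cl (V.gen v)" "cl (V.gen w)"]
    by (simp add: augmentation_gen sg_def cl_mult)
next
  case (add x y)
  have c: "(a \<ominus>\<^bsub>S.T\<^esub> b \<oplus>\<^sub>B c) \<oplus>\<^sub>B (a' \<ominus>\<^bsub>S.T\<^esub> b' \<oplus>\<^sub>B c') = (a \<oplus>\<^sub>B a') \<ominus>\<^bsub>S.T\<^esub> (b \<oplus>\<^sub>B b') \<oplus>\<^sub>B (c \<oplus>\<^sub>B c')"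
    if "a \<in> carrier S.T" "b \<in> carrier S.T" "c \<in> carrier S.T" "a' \<in> carrier S.T" "b' \<in> carrier S.T" "c' \<in> carrier S.T" for a b c a' b' c'
    using that by (simp add: S.T.diff_add_diff S.T.a_ac)
  have "S.d (sg t \<otimes>\<^sub>B iota (x \<oplus>\<^sub>V y)) = S.d (sg t \<otimes>\<^sub>B iota x) \<oplus>\<^sub>B S.d (sg t \<otimes>\<^sub>B iota y)"
    using t add by (simp add: iota S.T.r_distr S.d_add)
  then show ?case using t add by (simp add: V.T.r_distr Th1_props Th2_props ThL_props S.T.r_distr c)
qed

text \<open>The coordinate at b of the degree 1 part of s, under S_1 = V. It is defined on all of S
  so that it can contract letters of T_k(S).\<close>

definition "phi b s = the_elem ((\<lambda>t. fst (DR b (hom_part V.T 1 t))) ` s)"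

lemma phi_cl: "t \<in> carrier V.T \<Longrightarrow> phi b (cl t) = fst (DR b (hom_part V.T 1 t))"
  unfolding phi_def
proof (rule the_elem_cl)
  fix y z assume "y \<in> carrier V.T" "z \<in> carrier V.T" "y \<ominus>\<^bsub>V.T\<^esub> z \<in> J"
  from hp_diff_J[OF order_refl this] show "fst (DR b (hom_part V.T 1 y)) = fst (DR b (hom_part V.T 1 z))"
    by (simp only:)
qed

lemma DR_gen: "DR b (V.gen v) = V.inB (coef b v)"
  using DLR(3)[of "\<one>\<^bsub>V.T\<^esub>" b v] by simp

lemma phi_gen: "phi b (cl (V.gen v)) = coef b v"
  using V.T.hp_hom[OF V.gen_comp1, of v 1] by (simp add: phi_cl DR_gen) (simp add: V.inB_def)

text \<open>Contraction of the last letter of T_k(S) with \<open>phi b\<close>. On values of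
  \<open>Th1\<close> and \<open>Th2\<close> it becomes the coordinate map \<open>DR b\<close> of
  T_k(V).\<close>

lemma SDR_ex:
  assumes b: "b \<in> Basis"
  shows "\<exists>L. S.lift_map S.T L \<and> (\<forall>s \<in> carrier (algebra_bimodule S). \<forall>t \<in> carrier S.T. L (t \<otimes>\<^sub>B S.gen s) = t \<otimes>\<^sub>B S.inB (phi b s))"
proof (rule S.right_lift[OF S.T.is_abelian_group])
  have hp1: "hom_part V.T 1 x \<in> component V.T 1" if "x \<in> carrier V.T" for x using that by (rule V.T.hp_comp)
  have DRc: "DR b (hom_part V.T 1 x) \<in> carrier V.T" if "x \<in> carrier V.T" for x using F.DR_closed[OF b] that by simp
  show "t \<otimes>\<^sub>B S.inB (phi b s) \<in> carrier S.T" if "s \<in> carrier (algebra_bimodule S)" "t \<in> carrier S.T" for s t using that by simp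
  show "t \<otimes>\<^sub>B S.inB (phi b (s \<oplus>\<^bsub>algebra_bimodule S\<^esub> s')) = t \<otimes>\<^sub>B S.inB (phi b s) \<oplus>\<^sub>B t \<otimes>\<^sub>B S.inB (phi b s')"
    if a: "s \<in> carrier (algebra_bimodule S)" "s' \<in> carrier (algebra_bimodule S)" "t \<in> carrier S.T" for s s' t
  proof -
    obtain x y where xy: "x \<in> carrier V.T" "s = cl x" "y \<in> carrier V.T" "s' = cl y" using a by (auto elim!: S_cases)
    then have "phi b (s \<oplus>\<^sub>S s') = phi b s + phi b s'"
      using b DRc by (simp add: cl_add[symmetric] phi_cl V.T.hp_add F.DR_add fst_add del: One_nat_def)
    then show ?thesis using a by (simp add: S.inB_add S.T.r_distr)
  qed
  show "(s \<oplus>\<^sub>B t) \<otimes>\<^sub>B S.inB (phi b u) = s \<otimes>\<^sub>B S.inB (phi b u) \<oplus>\<^sub>B t \<otimes>\<^sub>B S.inB (phi b u)"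
    if "u \<in> carrier (algebra_bimodule S)" "s \<in> carrier S.T" "t \<in> carrier S.T" for u s t using that by (simp add: S.T.l_distr)
  show "t \<otimes>\<^sub>B S.inB (phi b (c \<odot>\<^bsub>algebra_bimodule S\<^esub> s)) = t \<otimes>\<^sub>B S.inB c \<otimes>\<^sub>B S.inB (phi b s)"
    if a: "s \<in> carrier (algebra_bimodule S)" "t \<in> carrier S.T" for s t c
  proof -
    obtain x where x: "x \<in> carrier V.T" "s = cl x" using a by (auto elim!: S_cases)
    have "DR b (V.inB c \<otimes>\<^sub>V hom_part V.T 1 x) = V.inB c \<otimes>\<^sub>V DR b (hom_part V.T 1 x)"
      by (rule F.DR_mult[OF b hp1[OF x(1)]]) simp
    then have "phi b (c \<odot>\<^bsub>S\<^esub> s) = c * phi b s"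
      using x DRc[OF x(1)] V.T.hp_mult_l[OF V.comp_inB, of x 1 c]
      by (simp add: cl_smult[symmetric] phi_cl V.T_smult_eq fst_mult del: One_nat_def) (simp add: V.inB_def)
    then show ?thesis using a by (simp add: S.inB_mult S.T.m_assoc)
  qed
qed
definition "SDR b = (SOME L. S.lift_map S.T L \<and> (\<forall>s \<in> carrier (algebra_bimodule S). \<forall>t \<in> carrier S.T. L (t \<otimes>\<^sub>B S.gen s) = t \<otimes>\<^sub>B S.inB (phi b s)))"

lemma SDR: assumes b: "b \<in> Basis"
  shows "s \<in> carrier S.T \<Longrightarrow> t \<in> carrier S.T \<Longrightarrow> SDR b (s \<oplus>\<^sub>B t) = SDR b s \<oplus>\<^sub>B SDR b t"
    "SDR b \<zero>\<^sub>B = \<zero>\<^sub>B"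
    "t \<in> carrier S.T \<Longrightarrow> SDR b (t \<otimes>\<^sub>B sg (V.gen v)) = t \<otimes>\<^sub>B S.inB (coef b v)"
  using someI_ex[OF SDR_ex[OF b], folded SDR_def] by (auto simp: S.lift_map_def sg_def phi_gen S.inB_zero[symmetric])

section \<open>The kernel of \<open>Th2\<close> and elimination in T_k(V) \<otimes> R'\<close>

lemma DR_inB: "b \<in> Basis \<Longrightarrow> DR b (V.inB c) = \<zero>\<^sub>V" by (rule F.DR_comp0) auto

lemma SDR_Th1: "b \<in> Basis \<Longrightarrow> t \<in> carrier V.T \<Longrightarrow> SDR b (Th1 t) = sg (DR b t)"
proof (rotate_tac, induction rule: V.T_induct_right)
  case (gen u t)
  then show ?case by (simp add: Th1_props SDR DLR sg_inB)
qed (simp_all add: Th1_props SDR DR_inB F.DR_add F.DR_closed sg_add)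

lemma SDR_Th2: "b \<in> Basis \<Longrightarrow> t \<in> carrier V.T \<Longrightarrow> SDR b (Th2 t) = Th1 (DR b t)"
proof (rotate_tac, induction rule: V.T_induct_right)
  case (gen u t)
  then show ?case by (simp add: Th2_props Th1_props SDR DLR Th1_inB)
qed (simp_all add: Th1_props Th2_props SDR DR_inB F.DR_add F.DR_closed Th_zero)

text \<open>Contracting the last two letters turns the vanishing of \<open>Th2 z\<close> into
  conditions on coefficients: those of z with respect to its last two letters lie in J. This is J
  \<otimes> V \<otimes> V in coordinates.\<close>

lemma Th2_eq_0:
  assumes "z \<in> carrier V.T" "Th2 z = \<zero>\<^sub>B" "b \<in> Basis" "b' \<in> Basis" shows "DR b (DR b' z) \<in> J"
proof -
  have "sg (DR b (DR b' z)) = SDR b (SDR b' (Th2 z))" using assms(1,3,4) by (simp add: SDR_Th1 SDR_Th2 F.DR_closed)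
  also have "\<dots> = \<zero>\<^sub>B" using assms by (simp add: SDR)
  finally show ?thesis using assms sg_eq_zero by (simp add: F.DR_closed)
qed

lemma DR_DR_prod:
  assumes b: "b \<in> Basis" "b' \<in> Basis" and q: "q \<in> component V.T 2"
  shows "DR b' q \<in> component V.T 1 \<and> DR b (DR b' q) \<in> component V.T 0 \<and>
    (\<forall>t \<in> carrier V.T. DR b (DR b' (t \<otimes>\<^sub>V q)) = t \<otimes>\<^sub>V DR b (DR b' q))"
  using q
proof (induction rule: V.comp_2_induct)
  case (gen u v)
  have e: "DR b' (t \<otimes>\<^sub>V (V.gen u \<otimes>\<^sub>V V.gen v)) = t \<otimes>\<^sub>V V.gen (scale (coef b' v) u)" if "t \<in> carrier V.T" for t
    using that DLR(3)[of "t \<otimes>\<^sub>V V.gen u" b' v] by (simp add: V.T.m_assoc gen_scale')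
  have e1: "DR b' (V.gen u \<otimes>\<^sub>V V.gen v) = V.gen (scale (coef b' v) u)" using DLR(3)[of "V.gen u" b' v] by (simp add: gen_scale')
  show ?case by (simp add: e e1 DLR DR_gen del: One_nat_def)
next
  case (add x y)
  then show ?case using b
    by (auto simp: F.DR_add F.DR_closed V.T.r_distr intro: V.comp_add)
qed

lemma DR_DR_scalar: "b \<in> Basis \<Longrightarrow> b' \<in> Basis \<Longrightarrow> q \<in> component V.T 2 \<Longrightarrow> t \<in> carrier V.T \<Longrightarrow>
    DR b (DR b' (t \<otimes>\<^sub>V q)) = t \<otimes>\<^sub>V V.inB (fst (DR b (DR b' q)))"
  using DR_DR_prod[of b b' q] by (simp add: inB_fst)

lemma DR_DR_eq_0:
  assumes q: "q \<in> component V.T 2" and z: "\<And>b b'. b \<in> Basis \<Longrightarrow> b' \<in> Basis \<Longrightarrow> DR b (DR b' q) = \<zero>\<^sub>V"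
  shows "q = \<zero>\<^sub>V"
proof -
  have t: "x \<in> V.T.tspan (carrier V.T) (component V.T 1)" if "x \<in> component V.T (Suc n)" for x n
    using F.gen_right[OF that] by (rule V.T.tspan_mono) (use V.comp_sub in auto)
  have 1: "DR b' q = \<zero>\<^sub>V" if b': "b' \<in> Basis" for b'
  proof (rule F.DR_inj)
    show "DR b' q \<in> V.T.tspan (carrier V.T) (component V.T 1)"
      using DR_DR_prod[OF b' b' q] by (intro t[of _ 0]) simp
  qed (rule z[OF _ b'])
  show ?thesis
  proof (rule F.DR_inj)
    show "q \<in> V.T.tspan (carrier V.T) (component V.T 1)"
      by (rule t[of _ 1]) (use q in \<open>simp add: numeral_2_eq_2\<close>)
  qed (rule 1)
qed

text \<open>The index counts the summands t r and is the induction parameter of the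
  elimination.\<close>

inductive rep :: "nat \<Rightarrow> 'k \<times> ('v list \<Rightarrow>\<^sub>0 int) set \<Rightarrow> bool" where
  zero: "rep 0 \<zero>\<^sub>V"
| add: "rep n x \<Longrightarrow> t \<in> carrier V.T \<Longrightarrow> r \<in> R' \<Longrightarrow> rep (Suc n) (x \<oplus>\<^sub>V t \<otimes>\<^sub>V r)"

lemma rep_carrier: "rep n x \<Longrightarrow> x \<in> carrier V.T"
  by (induction rule: rep.induct) auto

lemma rep_plus: "rep m y \<Longrightarrow> rep n x \<Longrightarrow> rep (n + m) (x \<oplus>\<^sub>V y)"
proof (induction rule: rep.induct)
  case (add m y t r)
  then show ?case using rep.add[of "n + m" "x \<oplus>\<^sub>V y" t r] rep_carrier[of n x] rep_carrier[of m y]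
    by (simp add: V.T.a_assoc)
qed (simp add: rep_carrier)

lemma tspan_rep: "x \<in> V.T.tspan (carrier V.T) R' \<Longrightarrow> \<exists>n. rep n x"
proof (induction rule: V.T.tspan.induct)
  case (prod t r)
  then show ?case using rep.add[OF rep.zero, of t r] by auto
qed (use rep.zero rep_plus in blast)+

text \<open>One step of Gaussian elimination with pivot c, the coefficient of r at (b, b'): a
  multiple of r is subtracted from every relation so that its coefficient there becomes 0, and the
  multiples are collected in s. The number of summands of the rest does not grow.\<close>

lemma rep_eliminate:
  assumes b: "b \<in> Basis" "b' \<in> Basis" and r: "r \<in> R'" "fst (DR b (DR b' r)) = c" "c \<noteq> 0"
  shows "rep n x \<Longrightarrow> \<exists>s \<in> carrier V.T. \<exists>x1. rep n x1 \<and> x = x1 \<oplus>\<^sub>V s \<otimes>\<^sub>V r \<and> DR b (DR b' x1) = \<zero>\<^sub>V"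
proof (induction rule: rep.induct)
  case zero
  show ?case using r b by (intro bexI[of _ "\<zero>\<^sub>V"] exI[of _ "\<zero>\<^sub>V"]) (auto intro: rep.zero)
next
  case (add n x t r0)
  then obtain s x1 where s: "s \<in> carrier V.T" "rep n x1" "x = x1 \<oplus>\<^sub>V s \<otimes>\<^sub>V r" "DR b (DR b' x1) = \<zero>\<^sub>V" by blast
  \<comment> \<open>The multiple of r that cancels the coefficient of r0 at (b, b').\<close>
  define e where "e = fst (DR b (DR b' r0)) / c"
  let ?y = "V.inB e \<otimes>\<^sub>V r"
  have y: "?y \<in> R'" using r(1) by (intro Q.P_l) auto
  define r1 where "r1 = r0 \<ominus>\<^bsub>V.T\<^esub> ?y"
  have r1: "r1 \<in> R'" using add(3) y by (simp add: r1_def Q.P_minus)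
  have r0: "r0 = r1 \<oplus>\<^sub>V ?y" using add(3) y by (simp add: r1_def V.T.add_diff_cancel)
  have "DR b (DR b' r0) = DR b (DR b' r1) \<oplus>\<^sub>V DR b (DR b' ?y)"
    using b r1 y by (subst r0) (simp add: F.DR_add F.DR_closed)
  moreover have "DR b (DR b' ?y) = V.inB (e * c)"
    using DR_DR_scalar[OF b R'_c2[OF r(1)], of "V.inB e"] r by (simp add: V.inB_mult)
  moreover have "DR b (DR b' r0) = V.inB (e * c)"
    using DR_DR_prod[OF b R'_c2[OF add(3)]] inB_fst[of "DR b (DR b' r0)"] r(3) by (simp add: e_def)
  ultimately have z: "DR b (DR b' r1) = \<zero>\<^sub>V"
    using V.T.add.r_cancel_one[of "V.inB (e * c)" "DR b (DR b' r1)"] b r1 by (simp add: F.DR_closed)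
  have "DR b (DR b' (x1 \<oplus>\<^sub>V t \<otimes>\<^sub>V r1)) = DR b (DR b' x1) \<oplus>\<^sub>V t \<otimes>\<^sub>V DR b (DR b' r1)"
    using b r1 add(2) rep_carrier[OF s(2)] DR_DR_prod[OF b R'_c2[OF r1]] by (simp add: F.DR_add F.DR_closed)
  then have 1: "DR b (DR b' (x1 \<oplus>\<^sub>V t \<otimes>\<^sub>V r1)) = \<zero>\<^sub>V" using z s(4) add(2) by simp
  have 2: "rep (Suc n) (x1 \<oplus>\<^sub>V t \<otimes>\<^sub>V r1)" by (rule rep.add[OF s(2) add(2) r1])
  have "x \<oplus>\<^sub>V t \<otimes>\<^sub>V r0 = x1 \<oplus>\<^sub>V s \<otimes>\<^sub>V r \<oplus>\<^sub>V t \<otimes>\<^sub>V (r1 \<oplus>\<^sub>V ?y)" using s(3) r0 by simp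
  also have "\<dots> = (x1 \<oplus>\<^sub>V t \<otimes>\<^sub>V r1) \<oplus>\<^sub>V (s \<oplus>\<^sub>V t \<otimes>\<^sub>V V.inB e) \<otimes>\<^sub>V r"
    using rep_carrier[OF s(2)] s(1) add(2) r1 r(1) by (simp add: V.T.l_distr V.T.r_distr V.T.m_assoc V.T.a_ac)
  finally show ?case using 1 2 s(1) add(2)
    by (intro bexI[of _ "s \<oplus>\<^sub>V t \<otimes>\<^sub>V V.inB e"] exI[of _ "x1 \<oplus>\<^sub>V t \<otimes>\<^sub>V r1"]) auto
qed

text \<open>Over a field, \<open>T \<otimes> R'\<close> meets \<open>J \<otimes> V \<otimes> V\<close> in \<open>J \<otimes> R'\<close>: the number of summands is reduced
  by eliminating one element of \<open>R'\<close> from the others.\<close>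

lemma rep_tspan:
  "rep n x \<Longrightarrow> (\<And>b b'. b \<in> Basis \<Longrightarrow> b' \<in> Basis \<Longrightarrow> DR b (DR b' x) \<in> J) \<Longrightarrow> x \<in> V.T.tspan J R'"
proof (induction n arbitrary: x)
  case 0
  then have "x = \<zero>\<^sub>V" by (cases rule: rep.cases) auto
  then show ?case by simp
next
  case (Suc n)
  obtain x0 t r where x: "x = x0 \<oplus>\<^sub>V t \<otimes>\<^sub>V r" "rep n x0" "t \<in> carrier V.T" "r \<in> R'"
    using Suc.prems(1) by (cases rule: rep.cases) auto
  show ?case
  proof (cases "r = \<zero>\<^sub>V")
    case True
    then have "x = x0" using x rep_carrier[OF x(2)] by simp
    then show ?thesis using Suc.IH[OF x(2)] Suc.prems(2) by simp
  next
    case False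
    then obtain b b' where b: "b \<in> Basis" "b' \<in> Basis" "DR b (DR b' r) \<noteq> \<zero>\<^sub>V"
      using DR_DR_eq_0[OF R'_c2[OF x(4)]] by blast
    define c where "c = fst (DR b (DR b' r))"
    have c: "DR b (DR b' r) = V.inB c" using DR_DR_prod[OF b(1,2) R'_c2[OF x(4)]] by (simp add: c_def inB_fst)
    then have "c \<noteq> 0" using b(3) by (auto simp: V.inB_zero)
    then obtain s x1 where s: "s \<in> carrier V.T" "rep n x1" "x0 = x1 \<oplus>\<^sub>V s \<otimes>\<^sub>V r" "DR b (DR b' x1) = \<zero>\<^sub>V"
      using rep_eliminate[OF b(1,2) x(4) c_def[symmetric] _ x(2)] by blast
    note x1 = rep_carrier[OF s(2)]
    let ?j = "s \<oplus>\<^sub>V t"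
    have xe: "x = x1 \<oplus>\<^sub>V ?j \<otimes>\<^sub>V r" using s x x1 by (simp add: V.T.l_distr V.T.a_assoc)
    have Dx: "DR d (DR d' x) = DR d (DR d' x1) \<oplus>\<^sub>V ?j \<otimes>\<^sub>V DR d (DR d' r)" if "d \<in> Basis" "d' \<in> Basis" for d d'
      unfolding xe using that x1 s(1) x(3,4) DR_DR_prod[OF that R'_c2[OF x(4)]] by (simp add: F.DR_add F.DR_closed)
    \<comment> \<open>After the elimination only r contributes at (b, b'), so the coefficient there
      is \<open>?j\<close> times c. It lies in J, and c is invertible.\<close>
    have "?j \<otimes>\<^sub>V V.inB c \<in> J"
      using Suc.prems(2)[OF b(1,2)] Dx[OF b(1,2)] s x(3) c by simp
    then have "?j \<otimes>\<^sub>V V.inB c \<otimes>\<^sub>V V.inB (1 / c) \<in> J" by (rule Q.I.I_r_closed) simp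
    then have j: "?j \<in> J" using \<open>c \<noteq> 0\<close> s(1) x(3) by (simp add: V.T.m_assoc V.inB_mult[symmetric] V.inB_one)
    have "DR d (DR d' x1) \<in> J" if d: "d \<in> Basis" "d' \<in> Basis" for d d'
    proof -
      have k: "?j \<otimes>\<^sub>V DR d (DR d' r) \<in> J" using j x(4) d by (intro Q.I.I_r_closed) (simp_all add: F.DR_closed)
      have "DR d (DR d' x1) = DR d (DR d' x) \<ominus>\<^bsub>V.T\<^esub> ?j \<otimes>\<^sub>V DR d (DR d' r)"
        using Dx[OF d] x1 d J_car[OF k] by (simp add: V.T.add_diff_cancel F.DR_closed)
      then show ?thesis using Suc.prems(2)[OF d] k by (simp add: V.T.minus_eq Q.I.a_closed Q.I.a_inv_closed)
    qed
    then have "x1 \<in> V.T.tspan J R'" by (rule Suc.IH[OF s(2)])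
    then show ?thesis unfolding xe by (rule V.T.tspan.add) (rule V.T.tspan.prod[OF j x(4)])
  qed
qed

section \<open>Exactness at S \<otimes> K^2\<close>

lemma tspan_comp3: "w \<in> V.T.tspan (component V.T 1) R' \<Longrightarrow> w \<in> component V.T 3"
proof (induction rule: V.T.tspan.induct)
  case (prod u r)
  then show ?case using V.comp_mult[of u 1 r 2] R'_c2 by (simp add: numeral_eq_Suc)
qed (auto intro: V.comp_add)

text \<open>\<open>Th2 x\<close> lies in S \<otimes> K^2, and its differential is
  \<open>Th1 x\<close>, which is 0 because x \<in> J \<otimes> V. By exactness \<open>Th2 x\<close>
  = d c with c \<in> S \<otimes> K^3, and c lifts to some y in T_k(V) \<otimes> K^3 with
  \<open>Th2 y\<close> = d c. The difference x - y lies in T_k(V) \<otimes> R' and in the kernel of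
  \<open>Th2\<close>, so elimination places it in J \<otimes> R'.\<close>

lemma koszul_step_ungraded:
  assumes K: "koszul scale R'" and x: "x \<in> V.T.tspan (carrier V.T) R'" "x \<in> V.T.tspan J (component V.T 1)"
  shows "\<exists>y z. x = y \<oplus>\<^sub>V z \<and>
    y \<in> V.T.tspan (carrier V.T) (V.T.tspan R' (component V.T 1) \<inter> V.T.tspan (component V.T 1) R') \<and> z \<in> V.T.tspan J R'"
proof -
  let ?T = V.T
  let ?C = "koszul_complex scale R'"
  let ?W = "V.T.tspan R' (component V.T 1) \<inter> V.T.tspan (component V.T 1) R'"
  have R: "R' \<subseteq> carrier ?T" by auto
  have c1: "component ?T n \<subseteq> carrier ?T" for n by (rule V.comp_sub)
  have sub: "X \<subseteq> carrier ?T \<Longrightarrow> Y \<subseteq> carrier ?T \<Longrightarrow> V.T.tspan X Y \<subseteq> carrier ?T" for X Y using V.T.tspan_carrier by blast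
  \<comment> \<open>The instance n = 2: cycles in S \<otimes> K^2, boundaries from S \<otimes>
    K^3.\<close>
  have exact: "{z \<in> ?C 2. S.d z = \<zero>\<^sub>B} = S.d ` ?C 3"
    using K unfolding koszul_def Let_def by (metis eval_nat_numeral(3))
  \<comment> \<open>By definition K^2 is k \<otimes> R' \<otimes> k; the outer factors are supplied
    by 1.\<close>
  have R2: "R' \<subseteq> koszul_space scale R' 2"
  proof
    fix r assume r: "r \<in> R'"
    have "\<one>\<^bsub>?T\<^esub> \<otimes>\<^bsub>?T\<^esub> r \<otimes>\<^bsub>?T\<^esub> \<one>\<^bsub>?T\<^esub> \<in> V.T.tspan (V.T.tspan (component ?T 0) R') (component ?T 0)"
      using r V.T.comp_one by (intro V.T.tspan.prod)
    then show "r \<in> koszul_space scale R' 2" using r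
      unfolding koszul_space_def Let_def by (simp add: V.T.tensor_sub_eq sub R c1)
  qed
  \<comment> \<open>The indices j = 0 and j = 1 give R' \<otimes> V and V \<otimes> R', once the
    factor k in front or behind is absorbed into R'.\<close>
  have K3: "koszul_space scale R' 3 \<subseteq> ?W"
  proof
    fix k assume "k \<in> koszul_space scale R' 3"
    then have "\<And>j. j \<in> {..1} \<Longrightarrow> k \<in> V.T.tspan (V.T.tspan (component ?T j) R') (component ?T (1 - j))"
      unfolding koszul_space_def Let_def by (simp add: V.T.tensor_sub_eq sub R c1 numeral_3_eq_3 numeral_2_eq_2)
    from this[of 0] this[of 1] have k: "k \<in> V.T.tspan (V.T.tspan (component ?T 0) R') (component ?T 1)"
      "k \<in> V.T.tspan (V.T.tspan (component ?T 1) R') (component ?T 0)" by auto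
    have "V.T.tspan (component ?T 0) R' \<subseteq> R'"
    proof
      fix y assume "y \<in> V.T.tspan (component ?T 0) R'"
      then show "y \<in> R'" by (induction rule: V.T.tspan.induct) (auto intro: Q.P_l Q.P_add)
    qed
    with k(1) have 1: "k \<in> V.T.tspan R' (component ?T 1)" by (rule V.T.tspan_mono) simp
    have r: "y \<in> V.T.tspan (component ?T 1) R' \<Longrightarrow> b \<in> component ?T 0 \<Longrightarrow> y \<otimes>\<^bsub>?T\<^esub> b \<in> V.T.tspan (component ?T 1) R'" for y b
    proof (induction rule: V.T.tspan.induct)
      case (prod u r)
      then have "u \<otimes>\<^bsub>?T\<^esub> (r \<otimes>\<^bsub>?T\<^esub> b) \<in> V.T.tspan (component ?T 1) R'" by (intro V.T.tspan.prod Q.P_r)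
      then show ?case using prod c1 by (simp add: V.T.m_assoc subset_iff)
    next
      case (add y z)
      then have "y \<in> carrier ?T" "z \<in> carrier ?T" "b \<in> carrier ?T" using sub[OF c1 R, of 1] c1[of 0] by blast+
      then show ?case using add by (simp add: V.T.l_distr V.T.tspan.add)
    qed (use c1[of 0] in auto)
    from k(2) have 2: "k \<in> V.T.tspan (component ?T 1) R'"
      by (induction rule: V.T.tspan.induct) (auto intro: r V.T.tspan.add simp del: One_nat_def)
    show "k \<in> ?W" using 1 2 by simp
  qed
  have W3: "?W \<subseteq> component ?T 3" using tspan_comp3 by blast
  have Ceq: "?C n = S.T.tspan (component S.T 1) (iota ` koszul_space scale R' n)" if "koszul_space scale R' n \<subseteq> carrier ?T" for n
    unfolding koszul_complex_def Let_def by (rule S.T.tensor_sub_eq) (use that iota(1) S.comp_sub in auto)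
  have Wc: "koszul_space scale R' 3 \<subseteq> carrier ?T" using K3 W3 c1[of 3] by blast
  have "koszul_space scale R' 2 \<subseteq> carrier ?T"
    unfolding koszul_space_def Let_def using sub[OF sub[OF c1 R] c1, of 0 0] by (simp add: V.T.tensor_sub_eq sub R c1)
  note C2 = Ceq[OF this] and C3 = Ceq[OF Wc]
  have xc: "x \<in> carrier ?T" using x(1) sub[OF subset_refl R] by blast
  from x(1) have "Th2 x \<in> ?C 2 \<and> S.d (Th2 x) = Th1 x" unfolding C2
  proof (induction rule: V.T.tspan.induct)
    case zero
    then show ?case by (simp add: Th_zero S.d_zero)
  next
    case (prod t r)
    then have "sg t \<otimes>\<^sub>B iota r \<in> S.T.tspan (component S.T 1) (iota ` koszul_space scale R' 2)"
      using R2 sg_comp by (intro S.T.tspan.prod) auto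
    then show ?case using prod
      by (simp add: Th2_prod2 d_prod2 R'_c2 R'_J iota Th1_props S.T.minus_eq)
  next
    case (add x y)
    then have "x \<in> carrier ?T" "y \<in> carrier ?T" using sub[OF subset_refl R] by auto
    then show ?case using add by (simp add: Th2_props Th1_props S.d_add S.T.tspan.add)
  qed
  then have "Th2 x \<in> {z \<in> ?C 2. S.d z = \<zero>\<^sub>B}" using Th1_eq_0[OF x(2)] by simp
  then obtain c where c: "c \<in> ?C 3" "Th2 x = S.d c" unfolding exact by blast
  from c(1) have "\<exists>y \<in> V.T.tspan (carrier ?T) ?W. S.d c = Th2 y \<and> c \<in> carrier S.T" unfolding C3
  proof (induction rule: S.T.tspan.induct)
    case zero
    then show ?case by (intro bexI[of _ "\<zero>\<^bsub>?T\<^esub>"]) (simp_all add: Th_zero S.d_zero)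
  next
    case (prod s k')
    obtain s' where s': "s' \<in> carrier S" "s = S.gen s'" using prod(1) unfolding S.comp_1 by auto
    obtain t where t0: "t \<in> carrier ?T" "s' = cl t" by (rule S_cases[OF s'(1)])
    have t: "t \<in> carrier ?T" "s = sg t" using t0 s'(2) by (simp_all only: sg_def)
    obtain k where k: "k \<in> ?W" "k' = iota k" using prod(2) K3 by blast
    have kc: "k \<in> carrier ?T" "k \<in> component ?T 3" using k(1) W3 c1[of 3] by auto
    have R1: "k \<in> V.T.tspan J (component ?T 1)" using k(1) V.T.tspan_mono[of k R' "component ?T 1" J] R'_J by blast
    have "S.d (s \<otimes>\<^sub>B k') = Th2 (t \<otimes>\<^bsub>?T\<^esub> k)"
      unfolding t k(2) d_prod3[OF t(1) kc(2)] using t(1) kc ThL_eq_0[of k] k(1) Th1_eq_0[OF R1]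
      by (simp add: S.T.minus_eq Th2_props)
    moreover have "t \<otimes>\<^bsub>?T\<^esub> k \<in> V.T.tspan (carrier ?T) ?W" by (rule V.T.tspan.prod[OF t(1) k(1)])
    ultimately show ?case using t k(2) kc iota(1)[OF kc(1)] by auto
  next
    case (add a b)
    then obtain y y' where y: "y \<in> V.T.tspan (carrier ?T) ?W" "y' \<in> V.T.tspan (carrier ?T) ?W"
      "S.d a = Th2 y" "S.d b = Th2 y'" "a \<in> carrier S.T" "b \<in> carrier S.T" by blast
    moreover have "y \<in> carrier ?T" "y' \<in> carrier ?T" using y sub[of "carrier ?T" ?W] W3 c1[of 3] by blast+
    ultimately show ?case by (intro bexI[of _ "y \<oplus>\<^bsub>?T\<^esub> y'"]) (auto simp: S.d_add Th2_props intro: V.T.tspan.add)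
  qed
  then obtain y where y: "y \<in> V.T.tspan (carrier ?T) ?W" "Th2 x = Th2 y" using c(2) by auto
  \<comment> \<open>An overlap lies in V \<otimes> R'; moving its letter into the left factor makes
    y, and so x - y, an element of T_k(V) \<otimes> R'.\<close>
  have yR: "y \<in> V.T.tspan (carrier ?T) R'" using y(1)
  proof (induction rule: V.T.tspan.induct)
    case (prod t w)
    from prod(2) have "w \<in> V.T.tspan (component ?T 1) R'" by simp
    then have "w \<in> V.T.tspan (carrier ?T) R'" by (rule V.T.tspan_mono) (use c1 in auto)
    then show ?case
    proof (induction rule: V.T.tspan.induct)
      case (prod s r)
      have "(t \<otimes>\<^bsub>?T\<^esub> s) \<otimes>\<^bsub>?T\<^esub> r \<in> V.T.tspan (carrier ?T) R'" using prod \<open>t \<in> carrier ?T\<close> by (intro V.T.tspan.prod) auto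
      then show ?case using prod \<open>t \<in> carrier ?T\<close> by (simp add: V.T.m_assoc)
    next
      case (add a b)
      then have "a \<in> carrier ?T" "b \<in> carrier ?T" using sub[OF subset_refl R] by blast+
      then show ?case using add \<open>t \<in> carrier ?T\<close> by (simp add: V.T.r_distr V.T.tspan.add)
    qed (use \<open>t \<in> carrier ?T\<close> in simp)
  qed (auto intro: V.T.tspan.add)
  have yc: "y \<in> carrier ?T" using yR sub[OF subset_refl R] by blast
  let ?z = "x \<ominus>\<^bsub>?T\<^esub> y"
  have zR: "?z \<in> V.T.tspan (carrier ?T) R'"
    unfolding V.T.minus_eq using x(1) V.T.tspan_uminus[OF yR] R by (intro V.T.tspan.add) auto
  have "Th2 x = Th2 ?z \<oplus>\<^sub>B Th2 y" using xc yc Th2_props(2)[of ?z y] by (simp add: V.T.add_diff_cancel)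
  then have "Th2 ?z = \<zero>\<^sub>B" using y(2) xc yc S.T.add.r_cancel_one[of "Th2 y" "Th2 ?z"] by (simp add: Th2_props)
  then have "DR b (DR b' ?z) \<in> J" if "b \<in> Basis" "b' \<in> Basis" for b b' using xc yc that by (intro Th2_eq_0) auto
  moreover obtain n where "rep n ?z" using tspan_rep[OF zR] by blast
  ultimately have "?z \<in> V.T.tspan J R'" using rep_tspan by blast
  moreover have "x = y \<oplus>\<^bsub>?T\<^esub> ?z" using xc yc by (simp add: V.T.add_diff_cancel)
  ultimately show ?thesis using y(1) by blast
qed

text \<open>R', J and the overlaps are graded, so the part of degree m + 3 of an ungraded
  decomposition of x decomposes x with factors in the prescribed degrees: overlaps have degree 3 and
  leave m, relations have degree 2 and leave m + 1.\<close>

lemma koszul_step: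
  assumes K: "koszul scale R'" and x: "x \<in> V.T.tspan (component V.T (Suc m)) R'"
    "x \<in> V.T.tspan (J \<inter> component V.T (Suc (Suc m))) (component V.T 1)"
  shows "\<exists>y z. x = y \<oplus>\<^sub>V z \<and>
    y \<in> V.T.tspan (component V.T m) (V.T.tspan R' (component V.T 1) \<inter> V.T.tspan (component V.T 1) R') \<and>
    z \<in> V.T.tspan (J \<inter> component V.T (Suc m)) R'"
proof -
  let ?T = V.T
  let ?W = "V.T.tspan R' (component V.T 1) \<inter> V.T.tspan (component V.T 1) R'"
  let ?h = "hom_part ?T (m + 3)"
  have "x \<in> V.T.tspan (carrier ?T) R'" by (rule V.T.tspan_mono[OF x(1)]) (use V.comp_sub in auto)
  moreover have "x \<in> V.T.tspan J (component V.T 1)" by (rule V.T.tspan_mono[OF x(2)]) auto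
  ultimately obtain y z where yz: "x = y \<oplus>\<^bsub>?T\<^esub> z" "y \<in> V.T.tspan (carrier ?T) ?W" "z \<in> V.T.tspan J R'"
    using koszul_step_ungraded[OF K] by blast
  have W3: "w \<in> component ?T 3" if "w \<in> ?W" for w using that tspan_comp3 by blast
  from x(1) have "x \<in> component ?T (m + 3)"
  proof (induction rule: V.T.tspan.induct)
    case (prod u r)
    then show ?case using V.comp_mult[of u "Suc m" r 2] R'_c2 by (simp add: numeral_eq_Suc)
  qed (auto intro: V.comp_add)
  then have hx: "?h x = x" using V.T.hp_hom[of x "m + 3" "m + 3"] by simp
  from yz(2) have y: "y \<in> carrier ?T \<and> ?h y \<in> V.T.tspan (component ?T m) ?W"
  proof (induction rule: V.T.tspan.induct)
    case (prod t w)
    have w: "w \<in> component ?T 3" by (rule W3[OF prod(2)])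
    have "?h (t \<otimes>\<^bsub>?T\<^esub> w) = hom_part ?T m t \<otimes>\<^bsub>?T\<^esub> w"
      using V.T.hp_mult_r[OF w prod(1), of "m + 3"] by simp
    moreover have "hom_part ?T m t \<otimes>\<^bsub>?T\<^esub> w \<in> V.T.tspan (component ?T m) ?W"
      by (rule V.T.tspan.prod[OF _ prod(2)]) (rule V.T.hp_comp[OF prod(1)])
    ultimately show ?case using prod(1) V.T.comp_carrier[OF w] by simp
  qed (auto simp: V.T.hp_add intro: V.T.tspan.add)
  from yz(3) have z: "z \<in> carrier ?T \<and> ?h z \<in> V.T.tspan (J \<inter> component ?T (Suc m)) R'"
  proof (induction rule: V.T.tspan.induct)
    case (prod j r)
    have "?h (j \<otimes>\<^bsub>?T\<^esub> r) = hom_part ?T (Suc m) j \<otimes>\<^bsub>?T\<^esub> r"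
      using V.T.hp_mult_r[OF R'_c2[OF prod(2)] J_car[OF prod(1)], of "m + 3"] by (simp add: numeral_3_eq_3 numeral_2_eq_2)
    moreover have "hom_part ?T (Suc m) j \<otimes>\<^bsub>?T\<^esub> r \<in> V.T.tspan (J \<inter> component ?T (Suc m)) R'"
      using J_hp[OF prod(1)] V.T.hp_comp[OF J_car[OF prod(1)]] prod(2) by (intro V.T.tspan.prod) auto
    ultimately show ?case using prod J_car by simp
  qed (auto simp: V.T.hp_add intro: V.T.tspan.add)
  have "x = ?h y \<oplus>\<^bsub>?T\<^esub> ?h z" using hx yz(1) y z by (simp add: V.T.hp_add)
  then show ?thesis using y z by blast
qed

end

section \<open>Skew group algebras\<close>

text \<open>Coordinates as total functions: existence, uniqueness on \<open>B\<close>, additivity,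
  and the value 0 off \<open>B\<close>, so that linearity can be stated for every index.\<close>

definition (in bimod) coefficients :: "'e set \<Rightarrow> ('e \<Rightarrow> 'b \<Rightarrow> _) \<Rightarrow> ('e \<Rightarrow> 'u \<Rightarrow> 'b) \<Rightarrow> bool" where
  "coefficients B X k \<longleftrightarrow> (\<forall>u \<in> carrier U. gen u = (\<Oplus>\<^bsub>T\<^esub>b\<in>B. X b (k b u))) \<and>
    (\<forall>u c. \<forall>b \<in> B. u \<in> carrier U \<longrightarrow> gen u = (\<Oplus>\<^bsub>T\<^esub>b\<in>B. X b (c b)) \<longrightarrow> k b u = c b) \<and>
    (\<forall>u \<in> carrier U. \<forall>v \<in> carrier U. \<forall>b. k b (u \<oplus> v) = k b u + k b v) \<and> (\<forall>u b. b \<notin> B \<longrightarrow> k b u = 0)"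

lemmas (in bimod) coefficientsD = iffD1[OF coefficients_def, THEN conjunct1, rule_format]
  iffD1[OF coefficients_def, THEN conjunct2, THEN conjunct1, rule_format]
  iffD1[OF coefficients_def, THEN conjunct2, THEN conjunct2, THEN conjunct1, rule_format]
  iffD1[OF coefficients_def, THEN conjunct2, THEN conjunct2, THEN conjunct2, rule_format]

lemma (in bimod) coefficients_exist:
  assumes B: "finite B" and X: "\<And>b c. b \<in> B \<Longrightarrow> X b c \<in> carrier T"
      "\<And>b c d. b \<in> B \<Longrightarrow> X b (c + d) = X b c \<oplus>\<^sub>T X b (d :: 'b)"
    and ex: "\<And>u. u \<in> carrier U \<Longrightarrow> \<exists>c. gen u = (\<Oplus>\<^bsub>T\<^esub>b\<in>B. X b (c b))"
    and un: "\<And>c b. (\<Oplus>\<^bsub>T\<^esub>b\<in>B. X b (c b)) = \<zero>\<^sub>T \<Longrightarrow> b \<in> B \<Longrightarrow> c b = 0"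
  shows "\<exists>k. coefficients B X k"
proof -
  let ?s = "\<lambda>c. \<Oplus>\<^bsub>T\<^esub>b\<in>B. X b (c b)"
  have cl: "?s c \<in> carrier T" for c using X by (intro T.finsum_closed) auto
  have add: "?s (\<lambda>b. c b + d b) = ?s c \<oplus>\<^sub>T ?s d" for c d
  proof -
    have "?s (\<lambda>b. c b + d b) = (\<Oplus>\<^bsub>T\<^esub>b\<in>B. X b (c b) \<oplus>\<^sub>T X b (d b))"
      by (rule T.finsum_cong') (use X in auto)
    also have "\<dots> = ?s c \<oplus>\<^sub>T ?s d" by (rule T.finsum_addf) (use X in auto)
    finally show ?thesis .
  qed
  have eq: "c b = d b" if "?s c = ?s d" "b \<in> B" for c d b
  proof -
    have "?s (\<lambda>b. c b - d b) \<oplus>\<^sub>T ?s d = ?s d" by (subst add[symmetric]) (simp add: that(1))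
    then have "?s (\<lambda>b. c b - d b) = \<zero>\<^sub>T" using T.add.r_cancel_one[OF cl cl] by simp
    from un[OF this that(2)] show ?thesis by simp
  qed
  define k where "k b u = (if b \<in> B then (SOME c. gen u = ?s c) b else 0)" for b u
  have k: "gen u = ?s (\<lambda>b. k b u)" if "u \<in> carrier U" for u
    by (subst someI_ex[OF ex[OF that]], rule T.finsum_cong') (use X in \<open>auto simp: k_def\<close>)
  have k_eq: "k b u = c b" if "u \<in> carrier U" "b \<in> B" "gen u = ?s c" for u c b
    by (rule eq[of "\<lambda>b. k b u" c]) (use that k[OF that(1)] in simp_all)
  have "k b (u \<oplus> v) = k b u + k b v" if "u \<in> carrier U" "v \<in> carrier U" for u v b
  proof (cases "b \<in> B")
    case True
    have "gen (u \<oplus> v) = ?s (\<lambda>b. k b u + k b v)"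
      by (subst add) (simp add: gen_add that k[symmetric])
    then show ?thesis using that True by (intro k_eq) auto
  qed (simp add: k_def)
  then show ?thesis unfolding coefficients_def using k k_eq by (intro exI[of _ k]) (simp add: k_def)
qed

text \<open>Existence and uniqueness of coordinates over the base ring, on each side, are enough:
  linearity of the coordinate functions follows from uniqueness. The last clause serves to compute
  left coordinates from a given expansion.\<close>

lemma (in bimod) free_gen_exists_unique:
  assumes B: "finite B" "\<And>b. b \<in> B \<Longrightarrow> eps b \<in> carrier U"
    and exL: "\<And>u. u \<in> carrier U \<Longrightarrow> \<exists>c. gen u = (\<Oplus>\<^bsub>T\<^esub>b\<in>B. gen (eps b) \<otimes>\<^sub>T inB (c b))"
    and unL: "\<And>c b. (\<Oplus>\<^bsub>T\<^esub>b\<in>B. gen (eps b) \<otimes>\<^sub>T inB (c b)) = \<zero>\<^sub>T \<Longrightarrow> b \<in> B \<Longrightarrow> c b = 0"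
    and exR: "\<And>u. u \<in> carrier U \<Longrightarrow> \<exists>c. gen u = (\<Oplus>\<^bsub>T\<^esub>b\<in>B. inB (c b) \<otimes>\<^sub>T gen (eps b))"
    and unR: "\<And>c b. (\<Oplus>\<^bsub>T\<^esub>b\<in>B. inB (c b) \<otimes>\<^sub>T gen (eps b)) = \<zero>\<^sub>T \<Longrightarrow> b \<in> B \<Longrightarrow> c b = 0"
  shows "\<exists>DL DR. free_gen T B (\<lambda>b. gen (eps b)) DL DR \<and>
    (\<forall>u c. \<forall>b\<in>B. u \<in> carrier U \<longrightarrow> gen u = (\<Oplus>\<^bsub>T\<^esub>b\<in>B. gen (eps b) \<otimes>\<^sub>T inB (c b)) \<longrightarrow> DL b (gen u) = inB (c b))"
proof -
  have "\<exists>k. coefficients B (\<lambda>b c. gen (eps b) \<otimes>\<^sub>T inB c) k"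
  proof (rule coefficients_exist)
    show "d b = 0" if "(\<Oplus>\<^bsub>T\<^esub>b\<in>B. gen (eps b) \<otimes>\<^sub>T inB (d b)) = \<zero>\<^sub>T" "b \<in> B" for d b by (rule unL[OF that])
  qed (use B exL in \<open>auto simp: inB_add T.r_distr\<close>)
  then obtain cl where "coefficients B (\<lambda>b c. gen (eps b) \<otimes>\<^sub>T inB c) cl" ..
  note cl = coefficientsD[OF this]
  have "\<exists>k. coefficients B (\<lambda>b c. inB c \<otimes>\<^sub>T gen (eps b)) k"
  proof (rule coefficients_exist)
    show "d b = 0" if "(\<Oplus>\<^bsub>T\<^esub>b\<in>B. inB (d b) \<otimes>\<^sub>T gen (eps b)) = \<zero>\<^sub>T" "b \<in> B" for d b by (rule unR[OF that])
  qed (use B exR in \<open>auto simp: inB_add T.l_distr\<close>)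
  then obtain cr where "coefficients B (\<lambda>b c. inB c \<otimes>\<^sub>T gen (eps b)) cr" ..
  note cr = coefficientsD[OF this]
  have mL: "gen (rsmult U u d) = (\<Oplus>\<^bsub>T\<^esub>b\<in>B. gen (eps b) \<otimes>\<^sub>T inB (cl b u * d))" if "u \<in> carrier U" for u d
  proof -
    have "gen (rsmult U u d) = (\<Oplus>\<^bsub>T\<^esub>b\<in>B. gen (eps b) \<otimes>\<^sub>T inB (cl b u)) \<otimes>\<^sub>T inB d"
      using cl(1)[OF that] gen_inB[OF that, of d] by simp
    also have "\<dots> = (\<Oplus>\<^bsub>T\<^esub>b\<in>B. gen (eps b) \<otimes>\<^sub>T inB (cl b u) \<otimes>\<^sub>T inB d)"
      by (rule T.finsum_ldistr) (use B in auto)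
    also have "\<dots> = (\<Oplus>\<^bsub>T\<^esub>b\<in>B. gen (eps b) \<otimes>\<^sub>T inB (cl b u * d))"
      by (rule T.finsum_cong') (use B in \<open>auto simp: T.m_assoc inB_mult\<close>)
    finally show ?thesis .
  qed
  have mR: "gen (d \<odot> u) = (\<Oplus>\<^bsub>T\<^esub>b\<in>B. inB (d * cr b u) \<otimes>\<^sub>T gen (eps b))" if "u \<in> carrier U" for u d
  proof -
    have "gen (d \<odot> u) = inB d \<otimes>\<^sub>T (\<Oplus>\<^bsub>T\<^esub>b\<in>B. inB (cr b u) \<otimes>\<^sub>T gen (eps b))"
      using cr(1)[OF that] inB_gen[OF that, of d] by simp
    also have "\<dots> = (\<Oplus>\<^bsub>T\<^esub>b\<in>B. inB d \<otimes>\<^sub>T (inB (cr b u) \<otimes>\<^sub>T gen (eps b)))"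
      by (rule T.finsum_rdistr) (use B in auto)
    also have "\<dots> = (\<Oplus>\<^bsub>T\<^esub>b\<in>B. inB (d * cr b u) \<otimes>\<^sub>T gen (eps b))"
      by (rule T.finsum_cong') (use B in \<open>auto simp: T.m_assoc inB_mult\<close>)
    finally show ?thesis .
  qed
  have "\<exists>DL DR. free_gen T B (\<lambda>b. gen (eps b)) DL DR \<and>
    (\<forall>b. \<forall>u\<in>carrier U. \<forall>t\<in>carrier T. DL b (gen u \<otimes>\<^sub>T t) = inB (cl b u) \<otimes>\<^sub>T t) \<and>
    (\<forall>b. \<forall>u\<in>carrier U. \<forall>t\<in>carrier T. DR b (t \<otimes>\<^sub>T gen u) = t \<otimes>\<^sub>T inB (cr b u))"
  proof (rule free_gen_exists[OF B cl(3) _ cl(1) cr(3) _ cr(1)])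
    show "cl b (rsmult U u c) = cl b u * c" if "u \<in> carrier U" for b u c
      using cl(2)[OF _ _ mL[OF that]] that cl(4) by (cases "b \<in> B") simp_all
    show "cr b (c \<odot> u) = c * cr b u" if "u \<in> carrier U" for b u c
      using cr(2)[OF _ _ mR[OF that]] that cr(4) by (cases "b \<in> B") simp_all
  qed
  then obtain DL DR where D: "free_gen T B (\<lambda>b. gen (eps b)) DL DR"
    "\<And>b u t. u \<in> carrier U \<Longrightarrow> t \<in> carrier T \<Longrightarrow> DL b (gen u \<otimes>\<^sub>T t) = inB (cl b u) \<otimes>\<^sub>T t" by blast
  have "DL b (gen u) = inB (c b)" if "b \<in> B" "u \<in> carrier U" "gen u = (\<Oplus>\<^bsub>T\<^esub>b\<in>B. gen (eps b) \<otimes>\<^sub>T inB (c b))" for u c b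
    using D(2)[OF that(2) T.one_closed, of b] cl(2)[OF that] that(2) by simp
  then show ?thesis using D(1) by blast
qed

section \<open>Group actions on S and the lift of S # G in low degrees\<close>

locale quadratic_action = quadratic scale Basis R'
  for scale :: "'k::field \<Rightarrow> 'v::ab_group_add \<Rightarrow> 'v" and Basis R' +
  fixes act :: "'g::{group_add,finite} \<Rightarrow> ('k \<times> ('v list \<Rightarrow>\<^sub>0 int) set) set \<Rightarrow> ('k \<times> ('v list \<Rightarrow>\<^sub>0 int) set) set"
  assumes act: "graded_action act (quadratic_algebra scale R')"
begin

lemma act_iso: "act g \<in> graded_algebra_iso S S" using act by (simp add: graded_action_def)

lemma act_hom: "act g \<in> ring_hom S S"
  using act_iso[of g] by (simp add: graded_algebra_iso_def ring_iso_def)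

lemma act_closed [simp]: "x \<in> carrier S \<Longrightarrow> act g x \<in> carrier S" using ring_hom_closed[OF act_hom] .
lemma act_one [simp]: "act g \<one>\<^bsub>S\<^esub> = \<one>\<^bsub>S\<^esub>" using ring_hom_one[OF act_hom] .
lemma act_smult: "x \<in> carrier S \<Longrightarrow> act g (c \<odot>\<^bsub>S\<^esub> x) = c \<odot>\<^bsub>S\<^esub> act g x"
  using act_iso[of g] by (simp add: graded_algebra_iso_def)
lemma act_comp: "x \<in> component S n \<Longrightarrow> act g x \<in> component S n"
proof -
  assume x: "x \<in> component S n"
  have "act g ` component S n = component S n" using act_iso[of g] by (simp add: graded_algebra_iso_def)
  then show ?thesis using x by blast
qed
lemma act_zero [simp]: "act g \<zero>\<^sub>S = \<zero>\<^sub>S"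
  using ring_hom_add[OF act_hom, of "\<zero>\<^sub>S" "\<zero>\<^sub>S" g] by simp
lemma act_0: "x \<in> carrier S \<Longrightarrow> act 0 x = x" using act by (simp add: graded_action_def)
lemma act_plus: "x \<in> carrier S \<Longrightarrow> act (g + h) x = act g (act h x)" using act by (simp add: graded_action_def)
lemma act_minus: "x \<in> carrier S \<Longrightarrow> act g (act (- g) x) = x" "x \<in> carrier S \<Longrightarrow> act (- g) (act g x) = x"
  using act_plus[of x g "- g"] act_plus[of x "- g" g] by (simp_all add: act_0)

lemma S_comp: "component S n = cl ` component V.T n"
  by (simp add: S_eq V.T.quotient_component)

lemma S_comp_1: "s \<in> component S 1 \<Longrightarrow> \<exists>v. s = cl (V.gen v)"
  unfolding S_comp V.comp_1 by blast
lemma S_comp_0: "s \<in> component S 0 \<Longrightarrow> \<exists>c. s = cl (V.inB c)"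
  unfolding S_comp V.comp_0 by blast
lemma cl_zero: "cl \<zero>\<^sub>V = \<zero>\<^sub>S" by (simp add: cl_zero_iff Q.I.zero_closed)
lemma cl_one: "cl \<one>\<^bsub>V.T\<^esub> = \<one>\<^bsub>S\<^esub>" by (simp add: S_eq V.T.quotient_one)
lemma cl_inB: "cl (V.inB c) = c \<odot>\<^bsub>S\<^esub> \<one>\<^bsub>S\<^esub>"
  unfolding cl_one[symmetric] by (simp add: cl_smult[symmetric] V.T_smult_eq)
lemma act_inB: "act g (cl (V.inB c)) = cl (V.inB c)" by (simp add: cl_inB act_smult)

lemma cl_gen_eq_0: "cl (V.gen v) = \<zero>\<^sub>S \<Longrightarrow> v = 0"
proof -
  assume "cl (V.gen v) = \<zero>\<^sub>S"
  then have "V.gen v \<in> J" by (simp add: cl_zero_iff)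
  then have "V.gen v = \<zero>\<^sub>V" using J_low(2) V.T.hp_hom[OF V.gen_comp1, of v 1] by simp
  then show "v = 0" using V.gen_eq_zero[of v] by simp
qed
lemma cl_inB_eq_0: "cl (V.inB c) = \<zero>\<^sub>S \<Longrightarrow> c = 0"
proof -
  assume "cl (V.inB c) = \<zero>\<^sub>S"
  then have "V.inB c \<in> J" by (simp add: cl_zero_iff)
  then have "V.inB c = \<zero>\<^sub>V" using J_low(1) V.T.hp_hom[OF V.comp_inB, of 0 c] by simp
  then show "c = 0" by (simp add: V.inB_zero[symmetric] V.inB_inj)
qed

lemma cl_gen_sum: "finite F \<Longrightarrow> cl (V.gen (\<Sum>b\<in>F. f b)) = (\<Oplus>\<^bsub>S\<^esub>b\<in>F. cl (V.gen (f b)))"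
proof (induction F rule: finite_induct)
  case empty
  then show ?case using V.gen_zero by (simp add: cl_zero_iff Q.I.zero_closed)
next
  case (insert x F)
  then show ?case using V.gen_add[of "f x" "sum f F"] by (simp add: Pi_def cl_add)
qed

end

text \<open>\<open>q\<close> stands for the projection to the homogeneous quotient followed by an
  isomorphism onto S # G, the elements of which are functions on G. The base ring and U are left
  abstract: degrees 0 and 1 are only used through \<open>q\<close>, because the isomorphism may move
  kG and V.\<close>

locale skew_quotient = quadratic_action scale Basis R' act + G: bimod U eta + GP: filtered_bimodule "tensor_algebra eta U" P
  for scale :: "'k::field \<Rightarrow> 'v::ab_group_add \<Rightarrow> 'v" and Basis R'
    and act :: "'g::{group_add,finite} \<Rightarrow> ('k \<times> ('v list \<Rightarrow>\<^sub>0 int) set) set \<Rightarrow> ('k \<times> ('v list \<Rightarrow>\<^sub>0 int) set) set"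
    and U :: "('b::ring_1, 'u, 'm) bimodule_scheme" and eta :: "'k \<Rightarrow> 'b" and P +
  fixes q :: "_ \<Rightarrow> 'g \<Rightarrow> ('k \<times> ('v list \<Rightarrow>\<^sub>0 int) set) set"
  assumes koszul: "koszul scale R'"
    and q_closed [simp]: "t \<in> carrier (tensor_algebra eta U) \<Longrightarrow> q t x \<in> carrier (quadratic_algebra scale R')"
    and q_add: "s \<in> carrier (tensor_algebra eta U) \<Longrightarrow> t \<in> carrier (tensor_algebra eta U) \<Longrightarrow>
      q (s \<oplus>\<^bsub>tensor_algebra eta U\<^esub> t) x = q s x \<oplus>\<^bsub>quadratic_algebra scale R'\<^esub> q t x"
    and q_mult: "s \<in> carrier (tensor_algebra eta U) \<Longrightarrow> t \<in> carrier (tensor_algebra eta U) \<Longrightarrow>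
      q (s \<otimes>\<^bsub>tensor_algebra eta U\<^esub> t) x =
        (\<Oplus>\<^bsub>quadratic_algebra scale R'\<^esub>g\<in>UNIV. q s g \<otimes>\<^bsub>quadratic_algebra scale R'\<^esub> act g (q t (- g + x)))"
    and q_one: "q \<one>\<^bsub>tensor_algebra eta U\<^esub> x =
      (if x = 0 then \<one>\<^bsub>quadratic_algebra scale R'\<^esub> else \<zero>\<^bsub>quadratic_algebra scale R'\<^esub>)"
    and q_smult: "t \<in> carrier (tensor_algebra eta U) \<Longrightarrow>
      q (c \<odot>\<^bsub>tensor_algebra eta U\<^esub> t) x = c \<odot>\<^bsub>quadratic_algebra scale R'\<^esub> q t x"
    and q_comp: "q ` component (tensor_algebra eta U) n = {f. \<forall>x. f x \<in> component (quadratic_algebra scale R') n}"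
    and q_ker: "t \<in> carrier (tensor_algebra eta U) \<Longrightarrow> (\<forall>x. q t x = \<zero>\<^bsub>quadratic_algebra scale R'\<^esub>) \<longleftrightarrow>
      t \<in> genideal (tensor_algebra eta U) (hom_part (tensor_algebra eta U) 2 ` P)"
begin

abbreviation GT_mult (infixl "\<otimes>\<^sub>G" 70) where "x \<otimes>\<^sub>G y \<equiv> x \<otimes>\<^bsub>G.T\<^esub> y"
abbreviation GT_add (infixl "\<oplus>\<^sub>G" 65) where "x \<oplus>\<^sub>G y \<equiv> x \<oplus>\<^bsub>G.T\<^esub> y"
abbreviation GT_zero ("\<zero>\<^sub>G") where "\<zero>\<^sub>G \<equiv> \<zero>\<^bsub>G.T\<^esub>"

lemma q_zero [simp]: "q \<zero>\<^sub>G x = \<zero>\<^sub>S"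
  using q_add[of "\<zero>\<^sub>G" "\<zero>\<^sub>G" x] by simp

lemma q_finsum: "finite F \<Longrightarrow> (\<And>b. b \<in> F \<Longrightarrow> f b \<in> carrier G.T) \<Longrightarrow> q (\<Oplus>\<^bsub>G.T\<^esub>b\<in>F. f b) x = (\<Oplus>\<^bsub>S\<^esub>b\<in>F. q (f b) x)"
  by (induction F rule: finite_induct) (simp_all add: Pi_def q_add)

text \<open>For a first factor supported at one group element the twisted convolution has a single
  summand.\<close>

lemma q_mult_left:
  assumes s: "s \<in> carrier G.T" "t \<in> carrier G.T" "\<And>x. q s x = (if x = a then r else \<zero>\<^sub>S)" and r: "r \<in> carrier S"
  shows "q (s \<otimes>\<^sub>G t) x = r \<otimes>\<^sub>S act a (q t (- a + x))"
proof -
  have "q (s \<otimes>\<^sub>G t) x = (\<Oplus>\<^bsub>S\<^esub>g\<in>UNIV. if a = g then r \<otimes>\<^sub>S act g (q t (- g + x)) else \<zero>\<^sub>S)"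
    unfolding q_mult[OF s(1,2)] by (rule S.S.finsum_cong') (use s r in auto)
  also have "\<dots> = r \<otimes>\<^sub>S act a (q t (- a + x))"
    by (rule S.S.add.finprod_singleton) (use s r in auto)
  finally show ?thesis .
qed

lemma q_mult_right:
  assumes s: "s \<in> carrier G.T" "t \<in> carrier G.T" "\<And>x. q t x = (if x = 0 then r else \<zero>\<^sub>S)" and r: "r \<in> carrier S"
  shows "q (s \<otimes>\<^sub>G t) x = q s x \<otimes>\<^sub>S act x r"
proof -
  have "q (s \<otimes>\<^sub>G t) x = (\<Oplus>\<^bsub>S\<^esub>g\<in>UNIV. if x = g then q s g \<otimes>\<^sub>S act g r else \<zero>\<^sub>S)"
    unfolding q_mult[OF s(1,2)]
    by (rule S.S.finsum_cong') (use s r in \<open>auto simp: neg_eq_iff_add_eq_0[symmetric]\<close>)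
  also have "\<dots> = q s x \<otimes>\<^sub>S act x r"
    by (rule S.S.add.finprod_singleton) (use s r in auto)
  finally show ?thesis .
qed

text \<open>The kernel of \<open>q\<close> is \<langle>R\<rangle>, which starts in degree 2.
  Identities between forms of degree 0 or 1 may therefore be verified in S # G.\<close>

lemma q_inj:
  assumes "s \<in> component G.T n" "t \<in> component G.T n" "n \<le> 1" "\<And>x. q s x = q t x" shows "s = t"
proof -
  have c: "s \<in> carrier G.T" "t \<in> carrier G.T" using assms G.comp_sub by blast+
  let ?d = "s \<ominus>\<^bsub>G.T\<^esub> t"
  have "q ?d x = \<zero>\<^sub>S" for x
    using q_add[of ?d t x] assms(4)[of x] c S.S.add.r_cancel_one[of "q t x" "q ?d x"] by (simp add: G.T.add_diff_cancel)
  then have d: "?d \<in> GP.IR" using q_ker[of ?d] c by simp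
  have "n = 0 \<or> n = 1" using assms(3) by linarith
  then have "hom_part G.T n ?d = \<zero>\<^sub>G" using GP.IR_low(1,2)[OF d] by blast
  moreover have "hom_part G.T n ?d = ?d" using G.T.hp_hom[of ?d n n] G.comp_diff[OF assms(1,2)] by simp
  ultimately have "?d = \<zero>\<^sub>G" by (simp only:)
  then show ?thesis by (rule G.T.diff_eq_0[OF c])
qed

lemma q_ex: "(\<And>x. f x \<in> component S n) \<Longrightarrow> \<exists>t \<in> component G.T n. q t = f"
proof -
  assume "\<And>x. f x \<in> component S n"
  then have "f \<in> q ` component G.T n" unfolding q_comp by simp
  then show ?thesis by (elim imageE) (simp add: bexI)
qed

lemma q_compD: "t \<in> component G.T n \<Longrightarrow> q t x \<in> component S n"
  using q_comp[of n] by blast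

lemma eps_ex: "\<exists>u \<in> carrier U. q (G.gen u) = (\<lambda>x. if x = 0 then cl (V.gen v) else \<zero>\<^sub>S)"
proof -
  have "\<zero>\<^sub>V \<in> component V.T 1" by simp
  then have "\<zero>\<^sub>S \<in> component S 1" unfolding S_comp by (metis image_eqI cl_zero)
  moreover have "cl (V.gen v) \<in> component S 1" unfolding S_comp by (intro imageI V.gen_comp1) simp
  ultimately have "\<exists>t \<in> component G.T 1. q t = (\<lambda>x. if x = 0 then cl (V.gen v) else \<zero>\<^sub>S)" by (intro q_ex) simp
  then show ?thesis unfolding G.comp_1 by blast
qed

text \<open>The lift of v # 1 to U, unique by \<open>q_inj\<close>; it need not be the element v
  \<otimes> 1 of U.\<close>

definition "eps v = (SOME u. u \<in> carrier U \<and> q (G.gen u) = (\<lambda>x. if x = 0 then cl (V.gen v) else \<zero>\<^sub>S))"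

lemma eps: "eps v \<in> carrier U" "q (G.gen (eps v)) x = (if x = 0 then cl (V.gen v) else \<zero>\<^sub>S)"
  using someI_ex[OF eps_ex[of v, unfolded Bex_def], folded eps_def] by (auto dest: fun_cong)

abbreviation "E v \<equiv> G.gen (eps v)"

lemma E_car [simp]: "E v \<in> carrier G.T" by (simp add: eps)
lemma E_comp: "E v \<in> component G.T 1" by (rule G.gen_comp1) (rule eps)

lemma gam_ex: "\<exists>t \<in> component G.T 0. q t = (\<lambda>x. if x = g then \<one>\<^bsub>S\<^esub> else \<zero>\<^sub>S)"
proof (rule q_ex)
  have "\<zero>\<^sub>V \<in> component V.T 0" "\<one>\<^bsub>V.T\<^esub> \<in> component V.T 0" by (simp_all add: V.T.comp_one)
  then have "\<zero>\<^sub>S \<in> component S 0" "\<one>\<^bsub>S\<^esub> \<in> component S 0" unfolding S_comp by (metis image_eqI cl_zero cl_one)+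
  then show "(if x = g then \<one>\<^bsub>S\<^esub> else \<zero>\<^sub>S) \<in> component S 0" for x by simp
qed

text \<open>The lift of 1 # g to degree 0. By \<open>gam_plus\<close> and \<open>gam_0\<close> these
  elements multiply like G, although they need not be the group elements of the base ring.\<close>

definition "gam g = (SOME t. t \<in> component G.T 0 \<and> q t = (\<lambda>x. if x = g then \<one>\<^bsub>S\<^esub> else \<zero>\<^sub>S))"

lemma gam: "gam g \<in> component G.T 0" "q (gam g) x = (if x = g then \<one>\<^bsub>S\<^esub> else \<zero>\<^sub>S)"
  using someI_ex[OF gam_ex[of g, unfolded Bex_def], folded gam_def] by (auto dest: fun_cong)
lemma gam_car [simp]: "gam g \<in> carrier G.T" using gam(1) G.comp_sub by blast

lemma q_gam: "t \<in> carrier G.T \<Longrightarrow> q (gam g \<otimes>\<^sub>G t) x = act g (q t (- g + x))"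
  using q_mult_left[of "gam g" t g "\<one>\<^bsub>S\<^esub>" x] by (simp add: gam)

lemma q_E: "t \<in> carrier G.T \<Longrightarrow> q (E v \<otimes>\<^sub>G t) x = cl (V.gen v) \<otimes>\<^sub>S q t x"
  using q_mult_left[of "E v" t 0 "cl (V.gen v)" x] by (simp add: eps act_0)

lemma eq_neg_plus: "- g + x = h \<longleftrightarrow> x = g + (h::'g)"
  by (metis add.assoc add.left_inverse add.right_inverse add_0)

lemma gam_plus: "gam g \<otimes>\<^sub>G gam h = gam (g + h)"
proof (rule q_inj[of _ 0])
  show "gam g \<otimes>\<^sub>G gam h \<in> component G.T 0" using G.comp_mult[OF gam(1) gam(1), of g h] by simp
  show "q (gam g \<otimes>\<^sub>G gam h) x = q (gam (g + h)) x" for x by (simp add: q_gam gam eq_neg_plus)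
qed (simp_all add: gam)

lemma gam_0: "gam 0 = \<one>\<^bsub>G.T\<^esub>"
  by (rule q_inj[of _ 0]) (simp_all add: gam q_one G.T.comp_one)

text \<open>The rule (1 # g)(v # 1) = (gv # 1)(1 # g) of the skew group algebra, pulled back along
  \<open>q\<close> in degree 1.\<close>

lemma gam_E: "\<exists>w. gam g \<otimes>\<^sub>G E v = E w \<otimes>\<^sub>G gam g"
proof -
  have "cl (V.gen v) \<in> component S 1" unfolding S_comp by (intro imageI V.gen_comp1) simp
  then obtain w where w: "act g (cl (V.gen v)) = cl (V.gen w)" using act_comp S_comp_1 by blast
  have "gam g \<otimes>\<^sub>G E v = E w \<otimes>\<^sub>G gam g"
  proof (rule q_inj[of _ 1])
    show "gam g \<otimes>\<^sub>G E v \<in> component G.T 1" using G.comp_mult[OF gam(1) E_comp, of g v] by simp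
    show "E w \<otimes>\<^sub>G gam g \<in> component G.T 1" using G.comp_mult[OF E_comp gam(1), of w g] by simp
    show "q (gam g \<otimes>\<^sub>G E v) x = q (E w \<otimes>\<^sub>G gam g) x" for x
      by (simp add: q_gam q_E eps gam eq_neg_plus w)
  qed simp
  then show ?thesis ..
qed

lemma smult_S_zero: "c \<odot>\<^bsub>S\<^esub> \<zero>\<^sub>S = \<zero>\<^sub>S"
  unfolding cl_zero[symmetric] by (simp add: cl_smult[symmetric] V.T_smult_eq)

lemma q_eta: "q (G.inB (eta c)) x = (if x = 0 then cl (V.inB c) else \<zero>\<^sub>S)"
  using q_smult[of "\<one>\<^bsub>G.T\<^esub>" c x] by (simp add: G.T_smult_eq q_one cl_inB smult_S_zero)

lemma q_inB_ex: "\<exists>k. \<forall>x. q (G.inB d) x = cl (V.inB (k x))"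
proof (rule choice, rule allI)
  fix x show "\<exists>c. q (G.inB d) x = cl (V.inB c)" using S_comp_0 q_compD[OF G.comp_inB] by blast
qed

lemma inB_ex: "\<exists>d. \<forall>x. q (G.inB d) x = cl (V.inB (k x))"
proof -
  have "cl (V.inB (k x)) \<in> component S 0" for x unfolding S_comp by (intro imageI V.comp_inB)
  then obtain t where "t \<in> component G.T 0" "q t = (\<lambda>x. cl (V.inB (k x)))" using q_ex[of "\<lambda>x. cl (V.inB (k x))" 0] by blast
  moreover then obtain d where "t = G.inB d" unfolding G.comp_0 by blast
  ultimately have "\<forall>x. q (G.inB d) x = cl (V.inB (k x))" by simp
  then show ?thesis by (rule exI)
qed

lemma inB_eqI: "(\<And>x. q (G.inB d) x = \<zero>\<^sub>S) \<Longrightarrow> d = 0"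
proof -
  assume "\<And>x. q (G.inB d) x = \<zero>\<^sub>S"
  then have "G.inB d = \<zero>\<^sub>G" by (intro q_inj[of _ 0]) simp_all
  then show ?thesis by (simp add: G.inB_zero[symmetric] G.inB_inj)
qed

lemma E_add: "E (u + v) = E u \<oplus>\<^sub>G E v"
proof (rule q_inj[of _ 1])
  show "q (E (u + v)) x = q (E u \<oplus>\<^sub>G E v) x" for x
    using V.gen_add[of u v] by (simp add: q_add eps cl_add)
  show "E u \<oplus>\<^sub>G E v \<in> component G.T 1" by (intro G.comp_add E_comp)
qed (simp_all add: E_comp del: One_nat_def)

lemma E_scale: "E (scale c v) = E v \<otimes>\<^sub>G G.inB (eta c)"
proof (rule q_inj[of _ 1])
  show "q (E (scale c v)) x = q (E v \<otimes>\<^sub>G G.inB (eta c)) x" for x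
    by (simp add: q_E q_eta eps gen_scale' cl_mult)
  show "E v \<otimes>\<^sub>G G.inB (eta c) \<in> component G.T 1" using G.comp_mult[OF E_comp G.comp_inB] by simp
qed (simp_all add: E_comp del: One_nat_def)

lemma E_sum: "finite F \<Longrightarrow> E (\<Sum>b\<in>F. f b) = (\<Oplus>\<^bsub>G.T\<^esub>b\<in>F. E (f b))"
proof (induction F rule: finite_induct)
  case empty
  have "E 0 \<oplus>\<^sub>G E 0 = E 0" using E_add[of 0 0] by simp
  then show ?case using G.T.add.r_cancel_one[of "E 0" "E 0"] by simp
next
  case (insert x F)
  then show ?case by (simp add: Pi_def E_add)
qed

abbreviation "lsum c \<equiv> \<Oplus>\<^bsub>G.T\<^esub>b\<in>Basis. E b \<otimes>\<^sub>G G.inB (c b)"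
abbreviation "rsum c \<equiv> \<Oplus>\<^bsub>G.T\<^esub>b\<in>Basis. G.inB (c b) \<otimes>\<^sub>G E b"

lemma q_left_sum:
  assumes "\<And>b x. q (G.inB (c b)) x = cl (V.inB (k b x))"
  shows "q (lsum c) x = cl (V.gen (\<Sum>b\<in>Basis. scale (k b x) b))"
proof -
  have "q (lsum c) x = (\<Oplus>\<^bsub>S\<^esub>b\<in>Basis. q (E b \<otimes>\<^sub>G G.inB (c b)) x)"
    by (rule q_finsum[OF finite_Basis]) simp
  also have "\<dots> = (\<Oplus>\<^bsub>S\<^esub>b\<in>Basis. cl (V.gen (scale (k b x) b)))"
    by (rule S.S.finsum_cong') (simp_all add: q_E assms gen_scale' cl_mult Pi_def)
  finally show ?thesis by (simp add: cl_gen_sum[OF finite_Basis])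
qed

lemma act_finsum: "finite F \<Longrightarrow> (\<And>b. b \<in> F \<Longrightarrow> f b \<in> carrier S) \<Longrightarrow> act g (\<Oplus>\<^bsub>S\<^esub>b\<in>F. f b) = (\<Oplus>\<^bsub>S\<^esub>b\<in>F. act g (f b))"
  by (induction F rule: finite_induct) (simp_all add: Pi_def ring_hom_add[OF act_hom])

text \<open>With coefficients on the left, the group element x stands in front of the basis vector
  and acts on it, so the value at x is twisted by \<open>act x\<close>. The twist is invertible for
  each x.\<close>

lemma q_right_sum:
  assumes "\<And>b x. q (G.inB (c b)) x = cl (V.inB (k b x))"
  shows "q (rsum c) x = act x (cl (V.gen (\<Sum>b\<in>Basis. scale (k b x) b)))"
proof -
  have e: "q (G.inB (c b) \<otimes>\<^sub>G E b) x = act x (cl (V.gen (scale (k b x) b)))" for b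
  proof -
    have "q (G.inB (c b) \<otimes>\<^sub>G E b) x = cl (V.inB (k b x)) \<otimes>\<^sub>S act x (cl (V.gen b))"
      using q_mult_right[of "G.inB (c b)" "E b" "cl (V.gen b)" x] by (simp add: eps assms)
    also have "\<dots> = act x (cl (V.inB (k b x)) \<otimes>\<^sub>S cl (V.gen b))"
      by (subst ring_hom_mult[OF act_hom]) (simp_all add: act_inB)
    finally show ?thesis by (simp add: gen_scale cl_mult)
  qed
  have "q (rsum c) x = (\<Oplus>\<^bsub>S\<^esub>b\<in>Basis. q (G.inB (c b) \<otimes>\<^sub>G E b) x)"
    by (rule q_finsum[OF finite_Basis]) simp
  also have "\<dots> = act x (\<Oplus>\<^bsub>S\<^esub>b\<in>Basis. cl (V.gen (scale (k b x) b)))"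
    by (simp add: e act_finsum[OF finite_Basis])
  finally show ?thesis by (simp add: cl_gen_sum[OF finite_Basis])
qed

lemma q_gen_ex: "u \<in> carrier U \<Longrightarrow> \<exists>w. \<forall>x. q (G.gen u) x = cl (V.gen (w x))"
proof (rule choice, rule allI)
  fix x assume "u \<in> carrier U"
  then show "\<exists>v. q (G.gen u) x = cl (V.gen v)" using S_comp_1 q_compD[OF G.gen_comp1] by blast
qed

lemma sum_comp1: "(\<And>b. b \<in> F \<Longrightarrow> f b \<in> component G.T 1) \<Longrightarrow> finite F \<Longrightarrow> (\<Oplus>\<^bsub>G.T\<^esub>b\<in>F. f b) \<in> component G.T 1"
proof (rotate_tac, induction F rule: finite_induct)
  case (insert x F)
  then have "f \<in> F \<rightarrow> carrier G.T" "f x \<in> carrier G.T" using G.comp_sub by blast+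
  then show ?case using insert by (simp del: One_nat_def add: G.comp_add)
qed simp

lemma left_comp1: "(lsum c) \<in> component G.T 1"
  using G.comp_mult[OF E_comp G.comp_inB] by (intro sum_comp1 finite_Basis) simp
lemma right_comp1: "(rsum c) \<in> component G.T 1"
  using G.comp_mult[OF G.comp_inB E_comp] by (intro sum_comp1 finite_Basis) simp

lemma T_free_left:
  "u \<in> carrier U \<Longrightarrow> \<exists>c. G.gen u = lsum c"
proof -
  assume u: "u \<in> carrier U"
  then obtain w where w: "\<And>x. q (G.gen u) x = cl (V.gen (w x))" using q_gen_ex by blast
  have "\<forall>b. \<exists>d. \<forall>x. q (G.inB d) x = cl (V.inB (coef b (w x)))" using inB_ex[of "\<lambda>x. coef b (w x)" for b] by blast
  then obtain c where "\<forall>b. \<forall>x. q (G.inB (c b)) x = cl (V.inB (coef b (w x)))" using choice[of "\<lambda>b d. \<forall>x. q (G.inB d) x = cl (V.inB (coef b (w x)))"] by blast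
  then have c: "\<And>b x. q (G.inB (c b)) x = cl (V.inB (coef b (w x)))" by blast
  have "G.gen u = lsum c"
    by (rule q_inj[OF G.gen_comp1[OF u] left_comp1 order_refl]) (simp add: w q_left_sum[OF c] coef_sum)
  then show ?thesis by (rule exI[of _ c])
qed

lemma T_free_right:
  "u \<in> carrier U \<Longrightarrow> \<exists>c. G.gen u = rsum c"
proof -
  assume u: "u \<in> carrier U"
  \<comment> \<open>The twist in \<open>q_right_sum\<close> is undone before coordinates in V are
    taken.\<close>
  have "\<forall>x. \<exists>v. act (- x) (q (G.gen u) x) = cl (V.gen v)"
    using S_comp_1 act_comp q_compD[OF G.gen_comp1[OF u]] by blast
  then obtain w where w: "\<And>x. act (- x) (q (G.gen u) x) = cl (V.gen (w x))"
    using choice[of "\<lambda>x v. act (- x) (q (G.gen u) x) = cl (V.gen v)"] by blast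
  have "\<forall>b. \<exists>d. \<forall>x. q (G.inB d) x = cl (V.inB (coef b (w x)))" using inB_ex[of "\<lambda>x. coef b (w x)" for b] by blast
  then obtain c where "\<forall>b. \<forall>x. q (G.inB (c b)) x = cl (V.inB (coef b (w x)))" using choice[of "\<lambda>b d. \<forall>x. q (G.inB d) x = cl (V.inB (coef b (w x)))"] by blast
  then have c: "\<And>b x. q (G.inB (c b)) x = cl (V.inB (coef b (w x)))" by blast
  have "G.gen u = rsum c"
    by (rule q_inj[OF G.gen_comp1[OF u] right_comp1 order_refl])
      (simp add: w[symmetric] q_right_sum[OF c] coef_sum act_minus u)
  then show ?thesis by (rule exI[of _ c])
qed

lemma T_free_unique:
  assumes "lsum c = \<zero>\<^sub>G \<or> rsum c = \<zero>\<^sub>G"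
    and b: "b \<in> Basis"
  shows "c b = 0"
proof -
  have "\<forall>b. \<exists>k. \<forall>x. q (G.inB (c b)) x = cl (V.inB (k x))" using q_inB_ex by blast
  then obtain k where k: "\<And>b x. q (G.inB (c b)) x = cl (V.inB (k b x))"
    using choice[of "\<lambda>b k. \<forall>x. q (G.inB (c b)) x = cl (V.inB (k x))"] by blast
  have "cl (V.gen (\<Sum>b\<in>Basis. scale (k b x) b)) = \<zero>\<^sub>S" for x
    using assms(1)
  proof
    assume "lsum c = \<zero>\<^sub>G"
    then show ?thesis using q_left_sum[where c = c and k = k and x = x, OF k] by simp
  next
    assume "rsum c = \<zero>\<^sub>G"
    then have "act x (cl (V.gen (\<Sum>b\<in>Basis. scale (k b x) b))) = \<zero>\<^sub>S" using q_right_sum[where c = c and k = k and x = x, OF k] by simp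
    then show ?thesis using act_minus(2)[where x = "cl (V.gen (\<Sum>b\<in>Basis. scale (k b x) b))" and g = x] by simp
  qed
  then have "(\<Sum>b\<in>Basis. scale (k b x) b) = 0" for x by (rule cl_gen_eq_0)
  then have "k b x = 0" for x
    using independentD[OF independent_Basis finite_Basis subset_refl, of "\<lambda>b. k b x"] b by blast
  then show ?thesis by (intro inB_eqI) (simp add: k V.inB_zero cl_zero)
qed

text \<open>The lifts E b of the basis of V form a basis of U over the base ring on both sides. On
  the lifted copy of V the left coordinates are the scalar ones, which links \<open>TL\<close> to
  \<open>DL\<close>.\<close>

lemma T_free_gen: "\<exists>TL TR. free_gen G.T Basis E TL TR \<and>
    (\<forall>b\<in>Basis. \<forall>v. TL b (E v) = G.inB (eta (coef b v)))"
proof -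
  obtain TL TR where D: "free_gen G.T Basis E TL TR"
    "\<forall>u c. \<forall>b\<in>Basis. u \<in> carrier U \<longrightarrow> G.gen u = lsum c \<longrightarrow> TL b (G.gen u) = G.inB (c b)"
  proof -
    have "\<exists>TL TR. free_gen G.T Basis E TL TR \<and> (\<forall>u c. \<forall>b\<in>Basis. u \<in> carrier U \<longrightarrow> G.gen u = lsum c \<longrightarrow> TL b (G.gen u) = G.inB (c b))"
      by (rule G.free_gen_exists_unique[OF finite_Basis eps(1)])
        (erule T_free_left, rule T_free_unique[OF disjI1], assumption, assumption, erule T_free_right, rule T_free_unique[OF disjI2])
    then show ?thesis using that by blast
  qed
  have "E v = (\<Oplus>\<^bsub>G.T\<^esub>b\<in>Basis. E b \<otimes>\<^sub>G G.inB (eta (coef b v)))" for v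
    using E_sum[OF finite_Basis, of "\<lambda>b. scale (coef b v) b"] by (simp add: coef_sum E_scale)
  then have "TL b (E v) = G.inB (eta (coef b v))" if "b \<in> Basis" for b v
    by (rule D(2)[rule_format, OF that eps(1), where c = "\<lambda>b. eta (coef b v)"])
  then show ?thesis using D(1) by blast
qed

section \<open>The decomposition of T into the pieces j(T_k(V)) \<gamma>_g\<close>

lemma j_ex: "\<exists>j. j \<in> ring_hom V.T G.T \<and> (\<forall>c. j (V.inB c) = G.inB (eta c)) \<and> (\<forall>v. j (V.gen v) = E v)"
proof -
  have ring: "ring G.T" ..
  have c: "G.inB (eta c) \<otimes>\<^sub>G E v = E v \<otimes>\<^sub>G G.inB (eta c)" for c v
    by (rule G.eta_central[symmetric]) simp
  show ?thesis
  proof (rule V.universal_property[OF ring, of "\<lambda>c. G.inB (eta c)" E])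
    fix j assume "j \<in> ring_hom V.T G.T" "\<And>c. j (V.inB c) = G.inB (eta c)" "\<And>v. v \<in> carrier (vector_bimodule scale) \<Longrightarrow> j (V.gen v) = E v"
    then show ?thesis by (intro exI[of _ j]) simp
  qed (simp_all add: G.eta_add G.eta_mult G.inB_add G.inB_mult G.inB_one E_add E_scale c)
qed

definition "j = (SOME j. j \<in> ring_hom V.T G.T \<and> (\<forall>c. j (V.inB c) = G.inB (eta c)) \<and> (\<forall>v. j (V.gen v) = E v))"

lemma j: "j \<in> ring_hom V.T G.T" "j (V.inB c) = G.inB (eta c)" "j (V.gen v) = E v"
  using someI_ex[OF j_ex, folded j_def] by auto

lemma j_closed [simp]: "t \<in> carrier V.T \<Longrightarrow> j t \<in> carrier G.T" by (rule ring_hom_closed[OF j(1)])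
lemma j_add: "s \<in> carrier V.T \<Longrightarrow> t \<in> carrier V.T \<Longrightarrow> j (s \<oplus>\<^sub>V t) = j s \<oplus>\<^sub>G j t" by (rule ring_hom_add[OF j(1)])
lemma j_mult: "s \<in> carrier V.T \<Longrightarrow> t \<in> carrier V.T \<Longrightarrow> j (s \<otimes>\<^sub>V t) = j s \<otimes>\<^sub>G j t" by (rule ring_hom_mult[OF j(1)])
lemma j_zero [simp]: "j \<zero>\<^sub>V = \<zero>\<^sub>G"
  using j_add[of "\<zero>\<^sub>V" "\<zero>\<^sub>V"] by simp

lemma q_j: "t \<in> carrier V.T \<Longrightarrow> q (j t) x = (if x = 0 then cl t else \<zero>\<^sub>S)"
proof (induction rule: V.T_induct_left)
  case (base c)
  then show ?case by (simp add: j q_eta)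
next
  case (add s t)
  then show ?case by (simp add: j_add q_add cl_add)
next
  case (gen v t)
  then show ?case by (simp add: j_mult j(3) q_E cl_mult)
qed

lemma q_j_gam: "t \<in> carrier V.T \<Longrightarrow> q (j t \<otimes>\<^sub>G gam g) x = (if x = g then cl t else \<zero>\<^sub>S)"
  using q_mult_left[of "j t" "gam g" 0 "cl t" x] by (simp add: q_j gam act_0)

lemma j_comp: "t \<in> component V.T n \<Longrightarrow> j t \<in> component G.T n"
proof (induction n arbitrary: t)
  case 0
  then show ?case by (auto simp: V.comp_0 j)
next
  case (Suc n)
  from Suc.prems show ?case
  proof (induction rule: V.comp_Suc_induct_left)
    case (gen v s)
    then show ?case using G.comp_mult[OF E_comp Suc.IH[OF gen(2)], of v] V.comp_sub[of n] by (simp add: j_mult j(3) subset_iff)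
  next
    case (add x y)
    then show ?case by (simp add: j_add G.comp_add)
  qed
qed

lemma (in galg) tspan_finsum:
  "finite F \<Longrightarrow> X \<subseteq> carrier A \<Longrightarrow> Y \<subseteq> carrier A \<Longrightarrow> (\<And>i. i \<in> F \<Longrightarrow> f i \<in> tspan X Y) \<Longrightarrow> (\<Oplus>i\<in>F. f i) \<in> tspan X Y"
proof (induction F rule: finite_induct)
  case (insert i F)
  then have "f \<in> F \<rightarrow> carrier A" "f i \<in> carrier A" using tspan_carrier by blast+
  then show ?case using insert by (simp add: tspan.add)
qed simp

text \<open>The subspace j(X) kG, with the \<gamma>_g in place of G. The components of T, the ideal
  \<langle>R\<rangle> in each degree and R itself all have this form.\<close>

abbreviation "hat X \<equiv> G.T.tspan (j ` X) (range gam)"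

lemma hat_carrier: "X \<subseteq> carrier V.T \<Longrightarrow> z \<in> hat X \<Longrightarrow> z \<in> carrier G.T"
  by (rule G.T.tspan_carrier[of z "j ` X" "range gam"]) (auto simp: subset_iff)

lemma hat_mono: "z \<in> hat X \<Longrightarrow> X \<subseteq> Y \<Longrightarrow> z \<in> hat Y"
  by (erule G.T.tspan_mono) auto

lemma hat_j: "x \<in> X \<Longrightarrow> x \<in> carrier V.T \<Longrightarrow> j x \<in> hat X"
proof -
  assume x: "x \<in> X" "x \<in> carrier V.T"
  have "j x \<otimes>\<^sub>G gam 0 \<in> hat X" by (rule G.T.tspan.prod) (use x in auto)
  then show ?thesis using x by (simp add: gam_0)
qed

abbreviation "jsum t \<equiv> \<Oplus>\<^bsub>G.T\<^esub>g\<in>UNIV. j (t g) \<otimes>\<^sub>G gam g"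

lemma hat_finsum: "X \<subseteq> carrier V.T \<Longrightarrow> (\<And>g. t g \<in> X) \<Longrightarrow> (jsum t) \<in> hat X"
  by (rule G.T.tspan_finsum) (auto intro: G.T.tspan.prod)

lemma finsum_j_add: "(\<And>g. t g \<in> carrier V.T) \<Longrightarrow> (\<And>g. s g \<in> carrier V.T) \<Longrightarrow>
  (\<Oplus>\<^bsub>G.T\<^esub>g\<in>UNIV. j (t g \<oplus>\<^sub>V s g) \<otimes>\<^sub>G gam g) =
    (jsum t) \<oplus>\<^sub>G (jsum s)"
  by (simp add: j_add G.T.l_distr G.T.finsum_addf)

lemma hat_normal_form:
  assumes X: "X \<subseteq> carrier V.T" "\<zero>\<^sub>V \<in> X" "\<And>x y. x \<in> X \<Longrightarrow> y \<in> X \<Longrightarrow> x \<oplus>\<^sub>V y \<in> X"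
    and z: "z \<in> hat X"
  shows "\<exists>t. (\<forall>g. t g \<in> X) \<and> z = jsum t"
  using z
proof (induction rule: G.T.tspan.induct)
  case zero
  have "(\<Oplus>\<^bsub>G.T\<^esub>g\<in>UNIV. j \<zero>\<^sub>V \<otimes>\<^sub>G gam g) = \<zero>\<^sub>G" by (simp add: G.T.add.finprod_one_eqI)
  then show ?case using X(2) by (intro exI[of _ "\<lambda>g. \<zero>\<^sub>V"]) simp
next
  case (prod y a)
  then obtain x g where x: "x \<in> X" "y = j x" "a = gam g" by blast
  then have xc: "x \<in> carrier V.T" using X by blast
  let ?t = "\<lambda>h. if h = g then x else \<zero>\<^sub>V"
  have "(\<Oplus>\<^bsub>G.T\<^esub>h\<in>UNIV. j (?t h) \<otimes>\<^sub>G gam h) = (\<Oplus>\<^bsub>G.T\<^esub>h\<in>UNIV. if g = h then j x \<otimes>\<^sub>G gam h else \<zero>\<^sub>G)"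
    by (rule G.T.finsum_cong') (use xc in auto)
  also have "\<dots> = j x \<otimes>\<^sub>G gam g" by (rule G.T.add.finprod_singleton) (use xc in auto)
  finally show ?case using x X(2) by (intro exI[of _ ?t]) simp
next
  case (add a b)
  obtain t where t: "\<forall>g. t g \<in> X" "a = jsum t" using add.IH(1) by blast
  obtain s where s: "\<forall>g. s g \<in> X" "b = jsum s" using add.IH(2) by blast
  have ts: "\<And>g. t g \<in> X" "\<And>g. s g \<in> X" using t(1) s(1) by auto
  have "(\<Oplus>\<^bsub>G.T\<^esub>g\<in>UNIV. j (t g \<oplus>\<^sub>V s g) \<otimes>\<^sub>G gam g) = a \<oplus>\<^sub>G b"
    unfolding t(2) s(2) by (rule finsum_j_add) (use ts X(1) in blast)+
  then show ?case using X(3) ts(1,2) by (intro exI[of _ "\<lambda>g. t g \<oplus>\<^sub>V s g"]) simp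
qed

text \<open>Invariance of Y under G, expressed by commutation in T: no action on T_k(V) has been
  constructed, only the \<gamma>_g are at hand.\<close>

definition "gam_stable (Y :: ('k \<times> ('v list \<Rightarrow>\<^sub>0 int) set) set) \<longleftrightarrow> (\<forall>g. \<forall>y\<in>Y. \<exists>y'\<in>Y. gam g \<otimes>\<^sub>G j y = j y' \<otimes>\<^sub>G gam g)"

text \<open>In j(x) \<gamma>_g j(y) \<gamma>_h the factor \<gamma>_g is moved to the right of j(y),
  which by stability replaces y by another element of Y.\<close>

lemma hat_tspan:
  assumes X: "X \<subseteq> carrier V.T" and Y: "Y \<subseteq> carrier V.T" "gam_stable Y"
    and z: "z \<in> G.T.tspan (hat X) (hat Y)"
  shows "z \<in> hat (V.T.tspan X Y)"
  using z
proof (induction rule: G.T.tspan.induct)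
  case (prod a b)
  note b = prod(2)
  have bc: "b \<in> carrier G.T" by (rule hat_carrier[OF Y(1) b])
  from prod(1) show ?case
  proof (induction rule: G.T.tspan.induct)
    case (prod x' g')
    then obtain x g where x: "x \<in> X" "x' = j x" "g' = gam g" by blast
    have xc: "x \<in> carrier V.T" using x X by blast
    from b show ?case
    proof (induction rule: G.T.tspan.induct)
      case (prod y' h')
      then obtain y h where y: "y \<in> Y" "y' = j y" "h' = gam h" by blast
      obtain y1 where y1: "y1 \<in> Y" "gam g \<otimes>\<^sub>G j y = j y1 \<otimes>\<^sub>G gam g" using Y(2) y(1) unfolding gam_stable_def by blast
      have yc: "y \<in> carrier V.T" "y1 \<in> carrier V.T" using y y1 Y by blast+
      have "j x \<otimes>\<^sub>G gam g \<otimes>\<^sub>G (j y \<otimes>\<^sub>G gam h) = j x \<otimes>\<^sub>G (gam g \<otimes>\<^sub>G j y) \<otimes>\<^sub>G gam h"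
        using xc yc by (simp add: G.T.m_assoc)
      also have "\<dots> = j x \<otimes>\<^sub>G j y1 \<otimes>\<^sub>G (gam g \<otimes>\<^sub>G gam h)"
        unfolding y1(2) using xc yc by (simp add: G.T.m_assoc del: gam_plus)
      also have "\<dots> = j (x \<otimes>\<^sub>V y1) \<otimes>\<^sub>G gam (g + h)" using xc yc by (simp add: gam_plus j_mult)
      finally have "x' \<otimes>\<^sub>G g' \<otimes>\<^sub>G (y' \<otimes>\<^sub>G h') = j (x \<otimes>\<^sub>V y1) \<otimes>\<^sub>G gam (g + h)" using x y by simp
      moreover have "x \<otimes>\<^sub>V y1 \<in> V.T.tspan X Y" by (rule V.T.tspan.prod[OF x(1) y1(1)])
      ultimately show ?case by (simp add: G.T.tspan.prod)
    next
      case (add b b')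
      then have "b \<in> carrier G.T" "b' \<in> carrier G.T" using hat_carrier[OF Y(1)] by blast+
      then show ?case using add x xc by (simp add: G.T.r_distr G.T.tspan.add)
    qed (use x xc in simp)
  next
    case (add a a')
    then have "a \<in> carrier G.T" "a' \<in> carrier G.T" using hat_carrier[OF X] by blast+
    then show ?case using add bc by (simp add: G.T.l_distr G.T.tspan.add)
  qed (use bc in simp)
qed (auto intro: G.T.tspan.add)

lemma tspan_hat:
  assumes X: "X \<subseteq> carrier V.T" and Y: "Y \<subseteq> carrier V.T" and z: "z \<in> hat (V.T.tspan X Y)"
  shows "z \<in> G.T.tspan (hat X) (hat Y)"
  using z
proof (induction rule: G.T.tspan.induct)
  case (prod w' g')
  then obtain w g where w: "w \<in> V.T.tspan X Y" "w' = j w" "g' = gam g" by blast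
  from w(1) have "j w \<otimes>\<^sub>G gam g \<in> G.T.tspan (hat X) (hat Y)"
  proof (induction rule: V.T.tspan.induct)
    case (prod x y)
    then have c: "x \<in> carrier V.T" "y \<in> carrier V.T" using X Y by blast+
    have "j x \<otimes>\<^sub>G (j y \<otimes>\<^sub>G gam g) \<in> G.T.tspan (hat X) (hat Y)"
      using prod by (intro G.T.tspan.prod hat_j[OF prod(1) c(1)]) auto
    then show ?case using c by (simp add: j_mult G.T.m_assoc)
  next
    case (add a b)
    then have "a \<in> carrier V.T" "b \<in> carrier V.T" using V.T.tspan_carrier[OF _ X Y] by blast+
    then show ?case using add by (simp add: j_add G.T.l_distr G.T.tspan.add)
  qed simp
  then show ?case using w by simp
qed (auto intro: G.T.tspan.add)

text \<open>In degree 0 the coefficients are read off by \<open>q\<close>, as k embeds in S. In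
  higher degrees \<open>q\<close> may lose information; there \<open>TL b\<close> strips off the
  first letter, since it sends j(s) \<gamma>_g to j(\<open>DL b s\<close>) \<gamma>_g, and the
  degree drops.\<close>

lemma homogeneous_unique:
  "(\<And>g. t g \<in> component V.T n) \<Longrightarrow> jsum t = \<zero>\<^sub>G \<Longrightarrow> t h = \<zero>\<^sub>V"
proof (induction n arbitrary: t h)
  case 0
  have c: "t g \<in> carrier V.T" for g using 0(1) V.comp_sub by blast
  have "cl (t h) = (\<Oplus>\<^bsub>S\<^esub>g\<in>UNIV. if h = g then cl (t g) else \<zero>\<^sub>S)"
    by (rule S.S.add.finprod_singleton[symmetric]) (auto simp: c)
  also have "\<dots> = q (jsum t) h"
    by (subst q_finsum) (simp_all add: c q_j_gam)
  finally have "cl (t h) = \<zero>\<^sub>S" using 0(2) by simp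
  moreover obtain d where "t h = V.inB d" using 0(1)[of h] unfolding V.comp_0 by blast
  ultimately show ?case using cl_inB_eq_0[of d] by (simp add: V.inB_zero[symmetric] V.inB_inj)
next
  case (Suc n)
  have c: "t g \<in> carrier V.T" for g using Suc.prems(1) V.comp_sub by blast
  obtain TL TR where F: "free_gen G.T Basis E TL TR" "\<And>b v. b \<in> Basis \<Longrightarrow> TL b (E v) = G.inB (eta (coef b v))"
    using T_free_gen by blast
  interpret F': free_gen G.T Basis E TL TR by (rule F(1))
  have TLj: "TL b (j s \<otimes>\<^sub>G gam g) = j (DL b s) \<otimes>\<^sub>G gam g" if b: "b \<in> Basis" and s: "s \<in> component V.T (Suc n)" for b s g
    using s
  proof (induction rule: V.comp_Suc_induct_left)
    case (gen v s)
    then have sc: "s \<in> carrier V.T" using V.comp_sub by blast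
    have "TL b (j (V.gen v \<otimes>\<^sub>V s) \<otimes>\<^sub>G gam g) = TL b (E v \<otimes>\<^sub>G (j s \<otimes>\<^sub>G gam g))"
      using sc by (simp add: j_mult j(3) G.T.m_assoc)
    also have "\<dots> = G.inB (eta (coef b v)) \<otimes>\<^sub>G (j s \<otimes>\<^sub>G gam g)"
      using F'.DL_mult[OF b E_comp, of "j s \<otimes>\<^sub>G gam g" v] sc F(2)[OF b] by simp
    also have "\<dots> = j (DL b (V.gen v \<otimes>\<^sub>V s)) \<otimes>\<^sub>G gam g"
      using sc by (simp add: DLR(2) j_mult j(2) G.T.m_assoc)
    finally show ?case .
  next
    case (add x y)
    then show ?case using b by (simp add: j_add G.T.l_distr F'.DL_add F.DL_add F.DL_closed)
  qed
  have TLsum: "TL b (\<Oplus>\<^bsub>G.T\<^esub>g\<in>F. f g) = (\<Oplus>\<^bsub>G.T\<^esub>g\<in>F. TL b (f g))" if "b \<in> Basis" "finite F" "\<And>g. f g \<in> carrier G.T" for b F and f :: "'g \<Rightarrow> _"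
    using that(2) by (induction F rule: finite_induct) (simp_all add: that Pi_def F'.DL_add F'.DL_closed)
  have z: "DL b (t h) = \<zero>\<^sub>V" if b: "b \<in> Basis" for b
  proof (rule Suc.IH[of "\<lambda>g. DL b (t g)"])
    show "DL b (t g) \<in> component V.T n" for g by (rule F.DL_mult_comp(1)[OF b Suc.prems(1)])
    have "(\<Oplus>\<^bsub>G.T\<^esub>g\<in>UNIV. j (DL b (t g)) \<otimes>\<^sub>G gam g) = (\<Oplus>\<^bsub>G.T\<^esub>g\<in>UNIV. TL b (j (t g) \<otimes>\<^sub>G gam g))"
      by (simp add: TLj[OF b Suc.prems(1)])
    also have "\<dots> = TL b (jsum t)"
      by (rule TLsum[OF b, symmetric]) (simp_all add: c)
    also have "\<dots> = \<zero>\<^sub>G" using b by (simp add: Suc.prems(2))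
    finally show "(\<Oplus>\<^bsub>G.T\<^esub>g\<in>UNIV. j (DL b (t g)) \<otimes>\<^sub>G gam g) = \<zero>\<^sub>G" .
  qed
  show ?case
  proof (rule F.DL_inj)
    show "t h \<in> V.T.tspan (component V.T 1) (carrier V.T)"
      by (rule V.T.tspan_mono[OF F.gen_left[OF Suc.prems(1)]]) (use V.comp_sub in auto)
  qed (rule z)
qed

lemma normal_form_eq:
  assumes t: "\<And>g. t g \<in> component V.T n" "\<And>g. s g \<in> component V.T n"
    and eq: "jsum t = jsum s"
  shows "t h = s h"
proof -
  have c: "t g \<in> carrier V.T" "s g \<in> carrier V.T" for g using t V.comp_sub by blast+
  let ?d = "\<lambda>g. t g \<ominus>\<^bsub>V.T\<^esub> s g"
  have "jsum t = (\<Oplus>\<^bsub>G.T\<^esub>g\<in>UNIV. j (?d g) \<otimes>\<^sub>G gam g) \<oplus>\<^sub>G (jsum s)"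
    using finsum_j_add[of ?d s] c by (simp add: V.T.add_diff_cancel)
  moreover have "(\<Oplus>\<^bsub>G.T\<^esub>g\<in>UNIV. j (?d g) \<otimes>\<^sub>G gam g) \<in> carrier G.T" "(jsum s) \<in> carrier G.T"
    using c by (simp_all add: Pi_def)
  ultimately have "(\<Oplus>\<^bsub>G.T\<^esub>g\<in>UNIV. j (?d g) \<otimes>\<^sub>G gam g) = \<zero>\<^sub>G"
    using eq G.T.add.r_cancel_one[of "jsum s" "\<Oplus>\<^bsub>G.T\<^esub>g\<in>UNIV. j (?d g) \<otimes>\<^sub>G gam g"] by simp
  then have "?d h = \<zero>\<^sub>V" by (rule homogeneous_unique[rotated]) (rule V.comp_diff[OF t])
  then show ?thesis using V.T.diff_eq_0 c by blast
qed

lemma stable_0: "gam_stable (component V.T 0)"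
proof -
  have "gam g \<otimes>\<^sub>G j (V.inB c) = j (V.inB c) \<otimes>\<^sub>G gam g" for g c
    unfolding j(2) by (rule G.eta_central) simp
  then show ?thesis unfolding gam_stable_def V.comp_0 by blast
qed

lemma stable_1: "gam_stable (component V.T 1)"
  unfolding gam_stable_def
proof (intro allI ballI)
  fix g y assume "y \<in> component V.T 1"
  then obtain v where v: "y = V.gen v" unfolding V.comp_1 by blast
  obtain w where "gam g \<otimes>\<^sub>G E v = E w \<otimes>\<^sub>G gam g" using gam_E by blast
  then show "\<exists>y' \<in> component V.T 1. gam g \<otimes>\<^sub>G j y = j y' \<otimes>\<^sub>G gam g"
    unfolding v by (intro bexI[of _ "V.gen w"] V.gen_comp1) (simp_all add: j)
qed

lemma J_comp2: "r \<in> J \<Longrightarrow> r \<in> component V.T 2 \<Longrightarrow> r \<in> R'"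
  using Q.IR_low(3)[unfolded hp_R', of r] V.T.hp_hom[of r 2 2] by simp

text \<open>Commuting \<gamma>_g past two letters gives some y of degree 2. Applying
  \<open>q\<close> shows that the class of y in S is g applied to the class of r, which is 0; so y
  lies in J in degree 2, that is, in R'.\<close>

lemma stable_R': "gam_stable R'"
  unfolding gam_stable_def
proof (intro allI ballI)
  fix g r assume r: "r \<in> R'"
  have "\<exists>y \<in> component V.T 2. gam g \<otimes>\<^sub>G j r = j y \<otimes>\<^sub>G gam g"
    using R'_c2[OF r]
  proof (induction rule: V.comp_2_induct)
    case (gen u v)
    obtain u' v' where w: "gam g \<otimes>\<^sub>G E u = E u' \<otimes>\<^sub>G gam g" "gam g \<otimes>\<^sub>G E v = E v' \<otimes>\<^sub>G gam g" using gam_E by meson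
    have "gam g \<otimes>\<^sub>G j (V.gen u \<otimes>\<^sub>V V.gen v) = (gam g \<otimes>\<^sub>G E u) \<otimes>\<^sub>G E v"
      by (simp add: j_mult j(3) G.T.m_assoc)
    also have "\<dots> = E u' \<otimes>\<^sub>G (gam g \<otimes>\<^sub>G E v)" unfolding w(1) by (simp add: G.T.m_assoc)
    also have "\<dots> = j (V.gen u' \<otimes>\<^sub>V V.gen v') \<otimes>\<^sub>G gam g" unfolding w(2) by (simp add: j_mult j(3) G.T.m_assoc)
    finally show ?case using V.comp_mult[of "V.gen u'" 1 "V.gen v'" 1] by (intro bexI) (auto simp: numeral_2_eq_2)
  next
    case (add x y)
    then obtain x' y' where w: "x' \<in> component V.T 2" "gam g \<otimes>\<^sub>G j x = j x' \<otimes>\<^sub>G gam g"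
      "y' \<in> component V.T 2" "gam g \<otimes>\<^sub>G j y = j y' \<otimes>\<^sub>G gam g" by blast
    then have "x' \<in> carrier V.T" "y' \<in> carrier V.T" using V.comp_sub by blast+
    then show ?case using add(1,2) w
      by (intro bexI[of _ "x' \<oplus>\<^sub>V y'"] V.comp_add) (simp_all add: j_add G.T.l_distr G.T.r_distr)
  qed
  then obtain y where y: "y \<in> component V.T 2" "gam g \<otimes>\<^sub>G j r = j y \<otimes>\<^sub>G gam g" by blast
  have yc: "y \<in> carrier V.T" using y(1) V.comp_sub by blast
  have "cl y = q (j y \<otimes>\<^sub>G gam g) g" using q_j_gam[OF yc, of g g] by simp
  also have "\<dots> = act g (cl r)" unfolding y(2)[symmetric] using r by (simp add: q_gam q_j)
  also have "\<dots> = \<zero>\<^sub>S" using r cl_zero_iff[of r] R'_J by simp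
  finally have "y \<in> R'" using cl_zero_iff[OF yc] J_comp2 y(1) by blast
  then show "\<exists>y \<in> R'. gam g \<otimes>\<^sub>G j r = j y \<otimes>\<^sub>G gam g" using y(2) by blast
qed

text \<open>The \<gamma>_g span degree 0 over k: an element of the base ring and the combination
  with its coefficients under \<open>q\<close> have the same image, hence are equal.\<close>

lemma inB_hat: "G.inB d \<in> hat (component V.T 0)"
proof -
  obtain k where k: "\<And>x. q (G.inB d) x = cl (V.inB (k x))" using q_inB_ex by blast
  let ?s = "\<Oplus>\<^bsub>G.T\<^esub>g\<in>UNIV. j (V.inB (k g)) \<otimes>\<^sub>G gam g"
  have h: "?s \<in> hat (component V.T 0)" by (rule hat_finsum) (use V.comp_sub in auto)
  have s0: "?s \<in> component G.T 0"
  proof -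
    have i: "(\<Oplus>\<^bsub>G.T\<^esub>g\<in>F. j (V.inB (k g)) \<otimes>\<^sub>G gam g) \<in> component G.T 0" if "finite F" for F :: "'g set"
      using that
    proof (induction F rule: finite_induct)
      case (insert g F)
      then show ?case using G.comp_mult[OF j_comp[OF V.comp_inB] gam(1), of "k g" g] by (simp add: Pi_def G.comp_add)
    qed simp
    show ?thesis by (rule i) simp
  qed
  have "G.inB d = ?s"
  proof (rule q_inj[of _ 0])
    fix x
    have "q ?s x = (\<Oplus>\<^bsub>S\<^esub>g\<in>UNIV. if x = g then cl (V.inB (k g)) else \<zero>\<^sub>S)"
      by (subst q_finsum) (simp_all add: q_j_gam)
    also have "\<dots> = cl (V.inB (k x))" by (rule S.S.add.finprod_singleton) auto
    finally show "q (G.inB d) x = q ?s x" by (simp add: k)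
  qed (simp_all add: s0)
  then show ?thesis using h by simp
qed

lemma comp_hat: "z \<in> component G.T n \<Longrightarrow> z \<in> hat (component V.T n)"
proof (induction n arbitrary: z)
  case 0
  then obtain d where d: "z = G.inB d" unfolding G.comp_0 by blast
  then show ?case by (simp add: inB_hat)
next
  case (Suc n)
  have gen1: "G.gen u \<in> hat (component V.T 1)" if u: "u \<in> carrier U" for u
  proof -
    obtain c where c: "G.gen u = lsum c" using T_free_left[OF u] by blast
    have "E b \<in> hat (component V.T 1)" for b
      using hat_j[of "V.gen b" "component V.T 1"] V.gen_comp1[of b] by (simp add: j(3))
    then have "E b \<otimes>\<^sub>G G.inB (c b) \<in> G.T.tspan (hat (component V.T 1)) (hat (component V.T 0))" for b
      by (intro G.T.tspan.prod inB_hat)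
    then have "G.gen u \<in> G.T.tspan (hat (component V.T 1)) (hat (component V.T 0))" unfolding c
      by (intro G.T.tspan_finsum finite_Basis) (use hat_carrier V.comp_sub in blast)+
    then have "G.gen u \<in> hat (V.T.tspan (component V.T 1) (component V.T 0))"
      by (intro hat_tspan stable_0 V.comp_sub)
    moreover have "V.T.tspan (component V.T 1) (component V.T 0) \<subseteq> component V.T 1"
    proof
      fix x assume "x \<in> V.T.tspan (component V.T 1) (component V.T 0)"
      then show "x \<in> component V.T 1"
      proof (induction rule: V.T.tspan.induct)
        case (prod a b)
        then show ?case using V.comp_mult[of a 1 b 0] by simp
      qed (auto intro: V.comp_add simp del: One_nat_def)
    qed
    ultimately show ?thesis by (rule hat_mono)
  qed
  have sub: "V.T.tspan (component V.T n) (component V.T 1) \<subseteq> component V.T (Suc n)"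
  proof
    fix x assume "x \<in> V.T.tspan (component V.T n) (component V.T 1)"
    then show "x \<in> component V.T (Suc n)"
    proof (induction rule: V.T.tspan.induct)
      case (prod a b)
      then show ?case using V.comp_mult[of a n b 1] by simp
    qed (auto intro: V.comp_add)
  qed
  from Suc.prems show ?case
  proof (induction rule: G.comp_Suc_induct_right)
    case (gen u s)
    have "s \<otimes>\<^sub>G G.gen u \<in> G.T.tspan (hat (component V.T n)) (hat (component V.T 1))"
      by (rule G.T.tspan.prod[OF Suc.IH[OF gen(2)] gen1[OF gen(1)]])
    then have "s \<otimes>\<^sub>G G.gen u \<in> hat (V.T.tspan (component V.T n) (component V.T 1))"
      by (intro hat_tspan stable_1 V.comp_sub)
    then show ?case using sub by (rule hat_mono)
  qed (rule G.T.tspan.add)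
qed

text \<open>For z in normal form the value of \<open>q z\<close> at x is the class of the
  coefficient \<open>t x\<close>. It is 0 because z \<in> \<langle>R\<rangle>, so all coefficients
  lie in J.\<close>

lemma IR_hat:
  assumes z: "z \<in> GP.IR" "z \<in> component G.T n" shows "z \<in> hat (J \<inter> component V.T n)"
proof -
  obtain t where t: "\<And>g. t g \<in> component V.T n" "z = jsum t"
    using hat_normal_form[OF V.comp_sub V.comp_zero V.comp_add comp_hat[OF z(2)]] by blast
  have c: "t g \<in> carrier V.T" for g using t(1) V.comp_sub by blast
  have "t x \<in> J" for x
  proof -
    have "z \<in> carrier G.T" using z(2) G.comp_sub by blast
    then have "\<zero>\<^sub>S = q z x" using q_ker z(1) by metis
    also have "\<dots> = (\<Oplus>\<^bsub>S\<^esub>g\<in>UNIV. if x = g then cl (t g) else \<zero>\<^sub>S)"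
      unfolding t(2) by (subst q_finsum) (simp_all add: q_j_gam c)
    also have "\<dots> = cl (t x)" by (rule S.S.add.finprod_singleton) (auto simp: c)
    finally show ?thesis using cl_zero_iff[OF c] by metis
  qed
  then show ?thesis unfolding t(2) using t(1) c by (intro hat_finsum) auto
qed

lemma hat_IR: "z \<in> hat (J \<inter> component V.T n) \<Longrightarrow> z \<in> GP.IR \<and> z \<in> component G.T n"
proof (induction rule: G.T.tspan.induct)
  case zero
  show ?case by (simp add: GP.IR.zero_closed)
next
  case (prod x g')
  then obtain t g where t: "t \<in> J" "t \<in> component V.T n" "x = j t" "g' = gam g" by blast
  have c: "t \<in> carrier V.T" by (rule J_car[OF t(1)])
  have "cl t = \<zero>\<^sub>S" using cl_zero_iff[OF c] t(1) by blast
  then have "q (j t \<otimes>\<^sub>G gam g) x = \<zero>\<^sub>S" for x unfolding q_j_gam[OF c] by (simp only: if_cancel)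
  then have "j t \<otimes>\<^sub>G gam g \<in> GP.IR" using q_ker[of "j t \<otimes>\<^sub>G gam g"] c by simp
  moreover have "j t \<otimes>\<^sub>G gam g \<in> component G.T n"
    using G.comp_mult[OF j_comp[OF t(2)] gam(1), of g] by simp
  ultimately show ?case using t by simp
next
  case (add a b)
  then show ?case by (simp add: GP.IR.a_closed G.comp_add)
qed

lemma R_hat: "r \<in> GP.R \<Longrightarrow> r \<in> hat R'"
proof -
  assume r: "r \<in> GP.R"
  have "r \<in> hat (J \<inter> component V.T 2)" by (rule IR_hat[OF GP.R_IR[OF r] GP.R_comp2[OF r]])
  then show ?thesis by (rule hat_mono) (use J_comp2 in blast)
qed

lemma hat_R: "r \<in> hat R' \<Longrightarrow> r \<in> GP.R"
proof -
  assume "r \<in> hat R'"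
  then have "r \<in> hat (J \<inter> component V.T 2)" by (rule hat_mono) (use R'_J R'_c2 in blast)
  then have "r \<in> GP.IR" "r \<in> component G.T 2" using hat_IR by blast+
  then show ?thesis using GP.IR_low(3)[of r] G.T.hp_hom[of r 2 2] by simp
qed

lemma hat_comp: "z \<in> hat (component V.T n) \<Longrightarrow> z \<in> component G.T n"
proof (induction rule: G.T.tspan.induct)
  case (prod x g')
  then obtain t g where t: "t \<in> component V.T n" "x = j t" "g' = gam g" by blast
  then show ?case using G.comp_mult[OF j_comp[OF t(1)] gam(1), of g] by simp
qed (simp_all add: G.comp_add)

text \<open>Each membership of x gives a normal form, one with coefficients in T_k(V) \<otimes> R'
  and one with coefficients in J \<otimes> V. By uniqueness in degree m + 3 they are equal, so the
  Koszul step of T_k(V) applies to every coefficient, and the pieces are reassembled with the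
  \<gamma>_g.\<close>

lemma koszul_step_skew:
  assumes x: "x \<in> G.T.tspan (component G.T (Suc m)) GP.R"
    "x \<in> G.T.tspan (GP.IR \<inter> component G.T (Suc (Suc m))) (component G.T 1)"
  shows "\<exists>y z. x = y \<oplus>\<^sub>G z \<and>
    y \<in> G.T.tspan (component G.T m) (G.T.tspan GP.R (component G.T 1) \<inter> G.T.tspan (component G.T 1) GP.R) \<and>
    z \<in> G.T.tspan (GP.IR \<inter> component G.T (Suc m)) GP.R"
proof -
  let ?X = "V.T.tspan (component V.T (Suc m)) R'"
  let ?X' = "V.T.tspan (J \<inter> component V.T (Suc (Suc m))) (component V.T 1)"
  let ?W = "V.T.tspan R' (component V.T 1) \<inter> V.T.tspan (component V.T 1) R'"
  let ?Y = "V.T.tspan (component V.T m) ?W"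
  let ?Z = "V.T.tspan (J \<inter> component V.T (Suc m)) R'"
  have Rc: "R' \<subseteq> carrier V.T" by auto
  have Jc: "J \<inter> component V.T n \<subseteq> carrier V.T" for n using V.comp_sub by blast
  have sub: "A \<subseteq> carrier V.T \<Longrightarrow> B \<subseteq> carrier V.T \<Longrightarrow> V.T.tspan A B \<subseteq> carrier V.T" for A B using V.T.tspan_carrier by blast
  have Wc: "?W \<subseteq> carrier V.T" using sub[OF Rc V.comp_sub] by blast
  have "x \<in> G.T.tspan (hat (component V.T (Suc m))) (hat R')"
    by (rule G.T.tspan_mono[OF x(1)]) (use comp_hat R_hat in blast)+
  then have "x \<in> hat ?X" by (rule hat_tspan[OF V.comp_sub Rc stable_R'])
  from hat_normal_form[OF sub[OF V.comp_sub Rc] V.T.tspan.zero V.T.tspan.add this]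
  obtain t where t: "\<And>g. t g \<in> ?X" "x = jsum t" by blast
  have "x \<in> G.T.tspan (hat (J \<inter> component V.T (Suc (Suc m)))) (hat (component V.T 1))"
    by (rule G.T.tspan_mono[OF x(2)]) (use comp_hat IR_hat in blast)+
  then have "x \<in> hat ?X'" by (rule hat_tspan[OF Jc V.comp_sub stable_1])
  from hat_normal_form[OF sub[OF Jc V.comp_sub] V.T.tspan.zero V.T.tspan.add this]
  obtain s where s: "\<And>g. s g \<in> ?X'" "x = jsum s" by blast
  have tc: "u \<in> component V.T (Suc (Suc (Suc m)))" if "u \<in> ?X" for u
    using that
  proof (induction rule: V.T.tspan.induct)
    case (prod a r)
    then show ?case using V.comp_mult[OF prod(1) R'_c2[OF prod(2)]] by simp
  qed (auto intro: V.comp_add)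
  have sc: "u \<in> component V.T (Suc (Suc (Suc m)))" if "u \<in> ?X'" for u
    using that
  proof (induction rule: V.T.tspan.induct)
    case (prod a r)
    then show ?case using V.comp_mult[of a "Suc (Suc m)" r 1] by simp
  qed (auto intro: V.comp_add)
  have "t g = s g" for g
    by (rule normal_form_eq[OF tc[OF t(1)] sc[OF s(1)]]) (use t(2) s(2) in simp)
  then have ts: "t g \<in> ?X'" for g using s(1) by simp
  have "\<forall>g. \<exists>p. t g = fst p \<oplus>\<^sub>V snd p \<and> fst p \<in> ?Y \<and> snd p \<in> ?Z"
  proof
    fix g
    obtain y z where "t g = y \<oplus>\<^sub>V z" "y \<in> ?Y" "z \<in> ?Z" using koszul_step[OF koszul t(1) ts, of g] by blast
    then show "\<exists>p. t g = fst p \<oplus>\<^sub>V snd p \<and> fst p \<in> ?Y \<and> snd p \<in> ?Z" by (intro exI[of _ "(y, z)"]) simp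
  qed
  then obtain p where p: "\<forall>g. t g = fst (p g) \<oplus>\<^sub>V snd (p g) \<and> fst (p g) \<in> ?Y \<and> snd (p g) \<in> ?Z" using choice by meson
  let ?y = "\<Oplus>\<^bsub>G.T\<^esub>g\<in>UNIV. j (fst (p g)) \<otimes>\<^sub>G gam g"
  let ?z = "\<Oplus>\<^bsub>G.T\<^esub>g\<in>UNIV. j (snd (p g)) \<otimes>\<^sub>G gam g"
  have Yc: "?Y \<subseteq> carrier V.T" by (rule sub[OF V.comp_sub Wc])
  have Zc: "?Z \<subseteq> carrier V.T" by (rule sub[OF Jc Rc])
  have xe: "x = ?y \<oplus>\<^sub>G ?z"
  proof -
    have "x = (\<Oplus>\<^bsub>G.T\<^esub>g\<in>UNIV. j (fst (p g) \<oplus>\<^sub>V snd (p g)) \<otimes>\<^sub>G gam g)" unfolding t(2) using p by simp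
    also have "\<dots> = ?y \<oplus>\<^sub>G ?z" by (rule finsum_j_add) (use p Yc Zc in blast)+
    finally show ?thesis .
  qed
  have "?y \<in> hat ?Y" by (rule hat_finsum[OF Yc]) (use p in blast)
  then have y: "?y \<in> G.T.tspan (hat (component V.T m)) (hat ?W)" by (rule tspan_hat[OF V.comp_sub Wc])
  have W: "hat ?W \<subseteq> G.T.tspan GP.R (component G.T 1) \<inter> G.T.tspan (component G.T 1) GP.R"
  proof
    fix w assume w: "w \<in> hat ?W"
    have "w \<in> G.T.tspan (hat R') (hat (component V.T 1))"
      by (rule tspan_hat[OF Rc V.comp_sub hat_mono[OF w]]) blast
    then have 1: "w \<in> G.T.tspan GP.R (component G.T 1)" by (rule G.T.tspan_mono) (use hat_R hat_comp in blast)+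
    have "w \<in> G.T.tspan (hat (component V.T 1)) (hat R')"
      by (rule tspan_hat[OF V.comp_sub Rc hat_mono[OF w]]) blast
    then have 2: "w \<in> G.T.tspan (component G.T 1) GP.R" by (rule G.T.tspan_mono) (use hat_R hat_comp in blast)+
    show "w \<in> G.T.tspan GP.R (component G.T 1) \<inter> G.T.tspan (component G.T 1) GP.R" using 1 2 by (rule IntI)
  qed
  have y: "?y \<in> G.T.tspan (component G.T m) (G.T.tspan GP.R (component G.T 1) \<inter> G.T.tspan (component G.T 1) GP.R)"
    by (rule G.T.tspan_mono[OF y _ W]) (use hat_comp in blast)
  have "?z \<in> hat ?Z" by (rule hat_finsum[OF Zc]) (use p in blast)
  then have "?z \<in> G.T.tspan (hat (J \<inter> component V.T (Suc m))) (hat R')" by (rule tspan_hat[OF Jc Rc])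
  then have z: "?z \<in> G.T.tspan (GP.IR \<inter> component G.T (Suc m)) GP.R"
    by (rule G.T.tspan_mono) (use hat_IR hat_R in blast)+
  show ?thesis using xe y z by blast
qed

lemma ex_pbw: "\<exists>TL TR. pbw G.T P Basis E TL TR"
proof -
  obtain TL TR where F: "free_gen G.T Basis E TL TR" using T_free_gen by blast
  have "pbw G.T P Basis E TL TR"
    by (intro pbw.intro F GP.filtered_bimodule_axioms pbw_axioms.intro koszul_step_skew)
  then show ?thesis by blast
qed

end

section \<open>The group bimodule and the theorem\<close>

lemma sum_shift:
  fixes f :: "'g::{group_add,finite} \<Rightarrow> 'a::comm_monoid_add"
  shows "(\<Sum>g\<in>UNIV. f g) = (\<Sum>l\<in>UNIV. f (h + l))"
  by (rule sum.reindex_bij_witness[of _ "\<lambda>l. h + l" "\<lambda>g. - h + g"]) (simp_all add: add.assoc[symmetric])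

lemma minus_plus_eq: "- (h + l) + x = - l + (- h + (x :: 'g::group_add))"
  by (metis minus_add add.assoc)

lemma minus_plus_eq_zero: "- h + x = 0 \<longleftrightarrow> h = (x :: 'g::group_add)"
  by (metis add.left_inverse add_left_cancel)

lemma lookup_mult_finite:
  fixes a b :: "'g::{group_add,finite} \<Rightarrow>\<^sub>0 'k::semiring_0"
  shows "Poly_Mapping.lookup (a * b) x = (\<Sum>g\<in>UNIV. Poly_Mapping.lookup a g * Poly_Mapping.lookup b (- g + x))"
proof -
  have e: "x = l + r \<longleftrightarrow> r = - l + x" for l r :: 'g
    by (metis add.assoc add.left_inverse add.right_inverse add_0)
  have "(\<Sum>r. Poly_Mapping.lookup b r when x = l + r) = Poly_Mapping.lookup b (- l + x)" for l
    by (subst Sum_any.expand_superset[of UNIV]) (simp_all add: e when_def)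
  then show ?thesis
    unfolding lookup_mult by (subst Sum_any.expand_superset[of UNIV]) simp_all
qed

text \<open>The three associativity laws equate double sums over G that agree after exchanging the
  sums and substituting g = h + l. The structure map has values supported at the neutral element,
  hence central.\<close>

lemma (in vector_space) group_bimodule_bimod:
  fixes \<rho> :: "'g::{group_add,finite} \<Rightarrow> 'b \<Rightarrow> 'b"
  assumes add: "\<And>g u v. \<rho> g (u + v) = \<rho> g u + \<rho> g v"
    and sc: "\<And>g c v. \<rho> g (scale c v) = scale c (\<rho> g v)"
    and zero: "\<And>v. \<rho> 0 v = v" and plus: "\<And>g h v. \<rho> (g + h) v = \<rho> g (\<rho> h v)"
  shows "bimod (group_bimodule scale \<rho>) (Poly_Mapping.single 0)"
proof -
  let ?U = "group_bimodule scale \<rho>"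
  let ?l = "Poly_Mapping.lookup"
  have \<rho>0: "\<rho> g 0 = 0" for g using add[of g 0 0] by simp
  have \<rho>sum: "\<rho> g (\<Sum>h\<in>F. f h) = (\<Sum>h\<in>F. \<rho> g (f h))" if "finite F" for g f and F :: "'g set"
    using that by (induction F rule: finite_induct) (simp_all add: add \<rho>0)
  have sc_if: "scale (if P then a else 0) v = (if P then scale a v else 0)" for P a v by simp
  have simps: "carrier ?U = UNIV" "u \<oplus>\<^bsub>?U\<^esub> v = (\<lambda>x. u x + v x)" "\<zero>\<^bsub>?U\<^esub> = (\<lambda>x. 0)"
    "a \<odot>\<^bsub>?U\<^esub> u = (\<lambda>x. \<Sum>g\<in>UNIV. scale (?l a g) (\<rho> g (u (- g + x))))"
    "rsmult ?U u a = (\<lambda>x. \<Sum>h\<in>UNIV. scale (?l a (- h + x)) (u h))" for u v a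
    by (simp_all add: group_bimodule_def)
  have ag: "abelian_group ?U"
  proof (rule abelian_groupI)
    fix u show "\<exists>v\<in>carrier ?U. v \<oplus>\<^bsub>?U\<^esub> u = \<zero>\<^bsub>?U\<^esub>"
      by (rule bexI[of _ "\<lambda>x. - u x"]) (simp_all add: simps)
  qed (simp_all add: simps ac_simps)
  show ?thesis
  proof (intro bimod.intro ag bimod_axioms.intro)
    fix b c u v
    show "b \<odot>\<^bsub>?U\<^esub> (u \<oplus>\<^bsub>?U\<^esub> v) = b \<odot>\<^bsub>?U\<^esub> u \<oplus>\<^bsub>?U\<^esub> b \<odot>\<^bsub>?U\<^esub> v"
      by (simp add: simps add scale_right_distrib sum.distrib)
    show "(b + c) \<odot>\<^bsub>?U\<^esub> u = b \<odot>\<^bsub>?U\<^esub> u \<oplus>\<^bsub>?U\<^esub> c \<odot>\<^bsub>?U\<^esub> u"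
      by (simp add: simps lookup_add scale_left_distrib sum.distrib)
    show "rsmult ?U (u \<oplus>\<^bsub>?U\<^esub> v) b = rsmult ?U u b \<oplus>\<^bsub>?U\<^esub> rsmult ?U v b"
      by (simp add: simps scale_right_distrib sum.distrib)
    show "rsmult ?U u (b + c) = rsmult ?U u b \<oplus>\<^bsub>?U\<^esub> rsmult ?U u c"
      by (simp add: simps lookup_add scale_left_distrib sum.distrib)
    show "(b * c) \<odot>\<^bsub>?U\<^esub> u = b \<odot>\<^bsub>?U\<^esub> (c \<odot>\<^bsub>?U\<^esub> u)"
    proof
      fix x
      have "((b * c) \<odot>\<^bsub>?U\<^esub> u) x = (\<Sum>g\<in>UNIV. \<Sum>h\<in>UNIV. scale (?l b h * ?l c (- h + g)) (\<rho> g (u (- g + x))))"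
        by (simp add: simps lookup_mult_finite scale_sum_left)
      also have "\<dots> = (\<Sum>h\<in>UNIV. \<Sum>g\<in>UNIV. scale (?l b h * ?l c (- h + g)) (\<rho> g (u (- g + x))))" by (rule sum.swap)
      also have "\<dots> = (\<Sum>h\<in>UNIV. \<Sum>l\<in>UNIV. scale (?l b h * ?l c (- h + (h + l))) (\<rho> (h + l) (u (- (h + l) + x))))"
        by (rule sum.cong[OF refl], rule sum_shift)
      also have "\<dots> = (b \<odot>\<^bsub>?U\<^esub> (c \<odot>\<^bsub>?U\<^esub> u)) x"
        by (simp add: simps \<rho>sum sc plus scale_sum_right minus_plus_eq add.assoc[symmetric, of "- a" a for a], (simp add: add.assoc)?)
      finally show "((b * c) \<odot>\<^bsub>?U\<^esub> u) x = (b \<odot>\<^bsub>?U\<^esub> (c \<odot>\<^bsub>?U\<^esub> u)) x" .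
    qed
    show "rsmult ?U u (b * c) = rsmult ?U (rsmult ?U u b) c"
    proof
      fix x
      have "rsmult ?U (rsmult ?U u b) c x = (\<Sum>m\<in>UNIV. \<Sum>h\<in>UNIV. scale (?l c (- m + x) * ?l b (- h + m)) (u h))"
        by (simp add: simps scale_sum_right)
      also have "\<dots> = (\<Sum>h\<in>UNIV. \<Sum>m\<in>UNIV. scale (?l c (- m + x) * ?l b (- h + m)) (u h))" by (rule sum.swap)
      also have "\<dots> = (\<Sum>h\<in>UNIV. \<Sum>l\<in>UNIV. scale (?l c (- (h + l) + x) * ?l b (- h + (h + l))) (u h))"
        by (rule sum.cong[OF refl], rule sum_shift)
      also have "\<dots> = rsmult ?U u (b * c) x"
        by (simp add: simps lookup_mult_finite scale_sum_left minus_plus_eq mult.commute add.assoc[symmetric, of "- a" a for a], (simp add: add.assoc)?)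
      finally show "rsmult ?U u (b * c) x = rsmult ?U (rsmult ?U u b) c x" by simp
    qed
    show "b \<odot>\<^bsub>?U\<^esub> rsmult ?U u c = rsmult ?U (b \<odot>\<^bsub>?U\<^esub> u) c"
    proof
      fix x
      have "rsmult ?U (b \<odot>\<^bsub>?U\<^esub> u) c x = (\<Sum>m\<in>UNIV. \<Sum>g\<in>UNIV. scale (?l c (- m + x) * ?l b g) (\<rho> g (u (- g + m))))"
        by (simp add: simps scale_sum_right)
      also have "\<dots> = (\<Sum>g\<in>UNIV. \<Sum>m\<in>UNIV. scale (?l c (- m + x) * ?l b g) (\<rho> g (u (- g + m))))" by (rule sum.swap)
      also have "\<dots> = (\<Sum>g\<in>UNIV. \<Sum>h\<in>UNIV. scale (?l c (- (g + h) + x) * ?l b g) (\<rho> g (u (- g + (g + h)))))"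
        by (rule sum.cong[OF refl], rule sum_shift)
      also have "\<dots> = (b \<odot>\<^bsub>?U\<^esub> rsmult ?U u c) x"
        by (simp add: simps \<rho>sum sc scale_sum_right minus_plus_eq mult.commute add.assoc[symmetric, of "- a" a for a], (simp add: add.assoc)?)
      finally show "(b \<odot>\<^bsub>?U\<^esub> rsmult ?U u c) x = rsmult ?U (b \<odot>\<^bsub>?U\<^esub> u) c x" by simp
    qed
    have l1: "(Poly_Mapping.single 0 a \<odot>\<^bsub>?U\<^esub> u) x = scale a (u x)" for a x
      by (simp add: simps sum_lookup_single[of "\<lambda>c g. scale c (\<rho> g (u (- g + x)))"] zero)
    have r1: "rsmult ?U u (Poly_Mapping.single 0 a) x = scale a (u x)" for a x
    proof -
      show ?thesis by (simp add: simps lookup_single when_def sc_if minus_plus_eq_zero)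
    qed
    show "1 \<odot>\<^bsub>?U\<^esub> u = u" "rsmult ?U u 1 = u" using l1[of 1] r1[of 1] by (auto simp: fun_eq_iff)
    fix a a' :: 'a
    show "rsmult ?U u (Poly_Mapping.single 0 a) = Poly_Mapping.single 0 a \<odot>\<^bsub>?U\<^esub> u" using l1 r1 by (auto simp: fun_eq_iff)
    show "Poly_Mapping.single (0::'g) (a + a') = Poly_Mapping.single 0 a + Poly_Mapping.single 0 a'" by (rule single_add)
    show "Poly_Mapping.single (0::'g) (a * a') = Poly_Mapping.single 0 a * Poly_Mapping.single 0 a'" by (simp add: mult_single)
    show "Poly_Mapping.single 0 a * b = b * Poly_Mapping.single 0 a"
    proof (rule poly_mapping_eqI)
      fix x
      show "?l (Poly_Mapping.single 0 a * b) x = ?l (b * Poly_Mapping.single 0 a) x"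
        by (simp add: lookup_mult_finite lookup_single when_def minus_plus_eq_zero if_distrib[of "\<lambda>z. z * _"] if_distrib[of "\<lambda>z. _ * z"] mult.commute cong: if_cong)
    qed
  qed (simp_all add: simps)
qed

section \<open>The action of G on V and the bimodule V \<otimes> kG\<close>

context quadratic_action
begin

lemma generator_inj: "quadratic_generator scale R' u = quadratic_generator scale R' v \<Longrightarrow> u = v"
proof -
  assume a: "quadratic_generator scale R' u = quadratic_generator scale R' v"
  have "cl (V.gen u) = cl (V.gen (u - v)) \<oplus>\<^bsub>S\<^esub> cl (V.gen v)"
    using V.gen_add[of "u - v" v] by (simp add: cl_add[symmetric])
  then have "cl (V.gen (u - v)) = \<zero>\<^bsub>S\<^esub>"
    using a S.S.add.r_cancel_one[of "cl (V.gen v)" "cl (V.gen (u - v))"] by (simp add: generator_eq)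
  then show "u = v" using cl_gen_eq_0 by fastforce
qed

abbreviation "\<rho> \<equiv> generator_action scale R' act"

text \<open>The definite description is proper: g preserves S_1, and V \<rightarrow> S_1 is
  injective because J starts in degree 2. Linearity and the action laws are then inherited from
  S.\<close>

lemma generator_action: "quadratic_generator scale R' (\<rho> g v) = act g (quadratic_generator scale R' v)"
proof -
  have "cl (V.gen v) \<in> component S 1" unfolding S_comp by (intro imageI V.gen_comp1) simp
  then obtain w where w: "act g (cl (V.gen v)) = cl (V.gen w)" using act_comp S_comp_1 by blast
  show ?thesis unfolding generator_action_def
  proof (rule theI[of _ w])
    show "quadratic_generator scale R' w = act g (quadratic_generator scale R' v)" using w by (simp add: generator_eq)
    show "x = w" if "quadratic_generator scale R' x = act g (quadratic_generator scale R' v)" for x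
      by (rule generator_inj) (use that w in \<open>simp add: generator_eq\<close>)
  qed
qed

lemma generator_linear:
  "quadratic_generator scale R' (u + v) = quadratic_generator scale R' u \<oplus>\<^bsub>S\<^esub> quadratic_generator scale R' v"
  "quadratic_generator scale R' (scale c v) = c \<odot>\<^bsub>S\<^esub> quadratic_generator scale R' v"
  "quadratic_generator scale R' v \<in> carrier S"
  using V.gen_add[of u v] by (simp_all add: generator_eq cl_add gen_scale cl_smult[symmetric] V.T_smult_eq)

lemma group_bimod: "bimod (group_bimodule scale \<rho>) (Poly_Mapping.single 0)"
proof (rule group_bimodule_bimod)
  show "\<rho> g (u + v) = \<rho> g u + \<rho> g v" for g u v
    by (rule generator_inj) (simp add: generator_action generator_linear ring_hom_add[OF act_hom])
  show "\<rho> g (scale c v) = scale c (\<rho> g v)" for g c v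
    by (rule generator_inj) (simp add: generator_action generator_linear act_smult)
  show "\<rho> 0 v = v" for v by (rule generator_inj) (simp add: generator_action generator_linear act_0)
  show "\<rho> (g + h) v = \<rho> g (\<rho> h v)" for g h v
    by (rule generator_inj) (simp add: generator_action generator_linear act_plus)
qed

end

theorem theorem5p4:
  fixes scale :: "'k::field \<Rightarrow> 'v::ab_group_add \<Rightarrow> 'v"
    and Basis :: "'v set"
    and act :: "'g::{group_add,finite} \<Rightarrow> _ \<Rightarrow> _"
  assumes V: "finite_dimensional_vector_space scale Basis"
    and R': "R' \<subseteq> component (tensor_algebra_field scale) 2"
      "subbimodule (tensor_algebra_field scale) R'"
    and S: "S = quadratic_algebra scale R'"
    and koszul: "koszul scale R'"
    and act: "graded_action act S"
    and T: "T = group_tensor_algebra scale (generator_action scale R' act)"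
    and P: "P \<subseteq> filtration T 2" "subbimodule T P"
    and R: "R = hom_part T 2 ` P"
    and skew: "graded_algebra_iso (quotient_algebra T (genideal T R))
      (skew_group_algebra S act) \<noteq> {}"
  shows "PBW_type T P \<longleftrightarrow>
    P \<inter> filtration T 1 = {\<zero>\<^bsub>T\<^esub>} \<and>
    (\<exists>\<alpha> \<beta>. \<alpha> \<in> bimodule_hom T R (component T 1) \<and>
      \<beta> \<in> bimodule_hom T R (component T 0) \<and>
      P = {x \<ominus>\<^bsub>T\<^esub> \<alpha> x \<ominus>\<^bsub>T\<^esub> \<beta> x | x. x \<in> R} \<and>
      (let U = component T 1;
           W = tensor_sub T R U \<inter> tensor_sub T U R;
           dif = (\<lambda>\<phi> z. tensor_hom T R U \<phi> id z \<ominus>\<^bsub>T\<^esub> tensor_hom T U R id \<phi> z) in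
        dif \<alpha> ` W \<subseteq> R \<and>
        (\<forall>z \<in> W. \<alpha> (dif \<alpha> z) = \<ominus>\<^bsub>T\<^esub> dif \<beta> z) \<and>
        (\<forall>z \<in> W. \<beta> (dif \<alpha> z) = \<zero>\<^bsub>T\<^esub>)))"
proof -
  let ?\<rho> = "generator_action scale R' act"
  interpret quadratic_action scale Basis R' act
    using V R' act unfolding S
    by (intro quadratic_action.intro quadratic.intro quadratic_axioms.intro quadratic_action_axioms.intro)
  have T_eq: "T = tensor_algebra (Poly_Mapping.single 0) (group_bimodule scale ?\<rho>)"
    by (simp add: T group_tensor_algebra_def)
  interpret G: bimod "group_bimodule scale ?\<rho>" "Poly_Mapping.single 0" by (rule group_bimod)
  interpret GP: filtered_bimodule "tensor_algebra (Poly_Mapping.single 0) (group_bimodule scale ?\<rho>)" P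
    by (intro filtered_bimodule.intro filtered_quotient.intro G.T_galg filtered_quotient_axioms.intro filtered_bimodule_axioms.intro)
      (use P in \<open>simp_all add: T_eq\<close>)
  let ?A = "quotient_algebra T (genideal T R)"
  let ?B = "skew_group_algebra (quadratic_algebra scale R') act"
  obtain \<theta> where "\<theta> \<in> graded_algebra_iso ?A ?B" using skew unfolding S by blast
  then have \<theta>: "\<theta> \<in> ring_hom ?A ?B" "inj_on \<theta> (carrier ?A)"
    "\<And>c x. x \<in> carrier ?A \<Longrightarrow> \<theta> (c \<odot>\<^bsub>?A\<^esub> x) = c \<odot>\<^bsub>?B\<^esub> \<theta> x"
    "\<And>n. \<theta> ` component ?A n = component ?B n"
    by (auto simp: graded_algebra_iso_def ring_iso_def bij_betw_def)
  \<comment> \<open>The projection to T/\<langle>R\<rangle> followed by the given isomorphism;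
    injectivity of \<theta> makes \<langle>R\<rangle> its kernel.\<close>
  define q where "q t = \<theta> (genideal T R +>\<^bsub>T\<^esub> t)" for t
  have I: "genideal T R = GP.IR" "T = G.T" by (simp_all add: R T_eq)
  have A: "?A = quotient_algebra G.T GP.IR" using I by simp
  have cl: "GP.IR +>\<^bsub>G.T\<^esub> t \<in> carrier ?A" if "t \<in> carrier G.T" for t
    unfolding A G.T.quotient_carrier using that by blast
  have q: "q t = \<theta> (GP.IR +>\<^bsub>G.T\<^esub> t)" for t unfolding q_def I(1) unfolding I(2) by (rule refl)
  have q_zero: "q t = (\<lambda>x. \<zero>\<^bsub>quadratic_algebra scale R'\<^esub>) \<longleftrightarrow> t \<in> GP.IR" if t: "t \<in> carrier G.T" for t
  proof -
    \<comment> \<open>This follows from 0 = 0 + 0, cancelled pointwise in S.\<close>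
    have "\<theta> \<zero>\<^bsub>?A\<^esub> = \<zero>\<^bsub>?B\<^esub>"
    proof -
      have "\<zero>\<^bsub>?A\<^esub> = \<zero>\<^bsub>?A\<^esub> \<oplus>\<^bsub>?A\<^esub> \<zero>\<^bsub>?A\<^esub>" "\<zero>\<^bsub>?A\<^esub> \<in> carrier ?A"
        unfolding A using ring.ring_simprules(2,8)[OF G.T.quotient_ring[OF GP.IR_ideal]] by auto
      then have "\<theta> \<zero>\<^bsub>?A\<^esub> = \<theta> \<zero>\<^bsub>?A\<^esub> \<oplus>\<^bsub>?B\<^esub> \<theta> \<zero>\<^bsub>?A\<^esub>" "\<theta> \<zero>\<^bsub>?A\<^esub> \<in> carrier ?B"
        using ring_hom_add[OF \<theta>(1)] ring_hom_closed[OF \<theta>(1)] by metis+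
      then have "\<theta> \<zero>\<^bsub>?A\<^esub> x = \<zero>\<^bsub>quadratic_algebra scale R'\<^esub>" for x
        using S.S.add.r_cancel_one'[of "\<theta> \<zero>\<^bsub>?A\<^esub> x" "\<theta> \<zero>\<^bsub>?A\<^esub> x"]
        by (simp add: skew_group_algebra_def fun_eq_iff)
      then show ?thesis by (simp add: skew_group_algebra_def fun_eq_iff)
    qed
    moreover have "\<zero>\<^bsub>?A\<^esub> = GP.IR +>\<^bsub>G.T\<^esub> \<zero>\<^bsub>G.T\<^esub>"
      unfolding A G.T.quotient_zero by (rule G.T.rcos_zero[OF GP.IR_ideal, symmetric])
    ultimately have "q t = \<zero>\<^bsub>?B\<^esub> \<longleftrightarrow> GP.IR +>\<^bsub>G.T\<^esub> t = GP.IR +>\<^bsub>G.T\<^esub> \<zero>\<^bsub>G.T\<^esub>"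
      using inj_on_eq_iff[OF \<theta>(2) cl[OF t] cl[OF G.T.zero_closed]] q by metis
    also have "\<dots> \<longleftrightarrow> t \<in> GP.IR" using G.T.rcos_eq_iff[OF GP.IR_ideal t G.T.zero_closed] t by (simp add: G.T.minus_eq)
    finally show ?thesis by (simp add: skew_group_algebra_def)
  qed
  interpret skew_quotient scale Basis R' act "group_bimodule scale ?\<rho>" "Poly_Mapping.single 0" P q
  proof (intro skew_quotient.intro quadratic_action_axioms G.bimod_axioms GP.filtered_bimodule_axioms skew_quotient_axioms.intro)
    show "koszul scale R'" by (rule koszul)
    show "q t x \<in> carrier (quadratic_algebra scale R')" if "t \<in> carrier G.T" for t x
      using ring_hom_closed[OF \<theta>(1) cl[OF that]] by (simp add: q skew_group_algebra_def)
    show "q (s \<oplus>\<^bsub>G.T\<^esub> t) x = q s x \<oplus>\<^bsub>quadratic_algebra scale R'\<^esub> q t x" if "s \<in> carrier G.T" "t \<in> carrier G.T" for s t x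
      using ring_hom_add[OF \<theta>(1) cl[OF that(1)] cl[OF that(2)]]
      by (simp add: q A G.T.quotient_add[OF GP.IR_ideal that] skew_group_algebra_def)
    show "q (s \<otimes>\<^bsub>G.T\<^esub> t) x = (\<Oplus>\<^bsub>quadratic_algebra scale R'\<^esub>g\<in>UNIV. q s g \<otimes>\<^bsub>quadratic_algebra scale R'\<^esub> act g (q t (- g + x)))"
      if "s \<in> carrier G.T" "t \<in> carrier G.T" for s t x
      using ring_hom_mult[OF \<theta>(1) cl[OF that(1)] cl[OF that(2)]]
      by (simp add: q A G.T.quotient_mult[OF GP.IR_ideal that] skew_group_algebra_def)
    show "q \<one>\<^bsub>G.T\<^esub> x = (if x = 0 then \<one>\<^bsub>quadratic_algebra scale R'\<^esub> else \<zero>\<^bsub>quadratic_algebra scale R'\<^esub>)" for x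
      using ring_hom_one[OF \<theta>(1)] by (simp add: q A G.T.quotient_one skew_group_algebra_def)
    show "q (c \<odot>\<^bsub>G.T\<^esub> t) x = c \<odot>\<^bsub>quadratic_algebra scale R'\<^esub> q t x" if "t \<in> carrier G.T" for c t x
      using \<theta>(3)[OF cl[OF that], of c] by (simp add: q A G.T.quotient_smult[OF GP.IR_ideal that] skew_group_algebra_def)
    show "q ` component G.T n = {f. \<forall>x. f x \<in> component (quadratic_algebra scale R') n}" for n
      using \<theta>(4)[of n] by (simp add: q A G.T.quotient_component skew_group_algebra_def image_image)
    show "(\<forall>x. q t x = \<zero>\<^bsub>quadratic_algebra scale R'\<^esub>) \<longleftrightarrow> t \<in> GP.IR" if "t \<in> carrier G.T" for t
      using q_zero[OF that] by (simp add: fun_eq_iff)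
  qed
  obtain TL TR where "pbw G.T P Basis E TL TR" using ex_pbw by blast
  from pbw.PBW_criterion[OF this] show ?thesis unfolding I(2) R .
qed

end
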